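(* Let $P\subset\mathbb{R}^n$ be a Delzant polytope and let $\xi$ be a Higgs tensor on $P$. Let $$\mathcal A(\xi)=\left\{u=u_P+h\ \text{symplectic potential}: r(\xi\,D^2u\,\bar\xi\,D^2u)<1\right\}.$$ The real moment map equation $$\left(\left(\mathbb{1}-\xi\,D^2u\,\bar\xi\,D^2u\right)^{1/2}(D^2u)^{-1}\right)^{ab}{}_{,ab}=-C$$ for $u\in\mathcal A(\xi)$ is the Euler–Lagrange equation (with respect to variations $u+t\varphi$, $\varphi\in C^\infty(P)$) of the toric HK-energy $$\widehat{\mathcal F}(u,\xi)=\int_{\partial P}u\,d\sigma-\int_PC\,u\,d\mu-\int_P\log\det(D^2u)\,d\mu+\int_P\rho(\xi\,D^2u\,\bar\xi\,D^2u)\,d\mu.$$ Moreover $\widehat{\mathcal F}(\cdot,\xi)$ is convex along linear paths in $\mathcal A(\xi)$.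
   Context: $P=\{y\in\mathbb{R}^n:\ell^r(y)\ge0\ \forall r\}$ is a Delzant polytope with interior $P^\circ$, where the $\ell^r$ are the affine-linear functions defining the facets $S_r$, normalized to have primitive integral inward normals. $d\mu$ is Lebesgue measure. $d\sigma$ is Donaldson's boundary measure, equal on each facet $S_r$ to the $(n-1)$-dimensional Lebesgue measure times $|\nabla\ell^r|^{-1}$. The constant $C$ is four times the average scalar curvature, $C=4\hat s=\sigma(\partial P)/\mu(P)$. Indices after a comma are partial derivatives, and repeated indices are summed. A symplectic potential is $u=u_P+h$ with $u_P=\sum_r\ell^r\log\ell^r$, $h\in C^\infty(P)$ (smooth up to the boundary), $D^2u$ positive definite on $P^\circ$, and $\det D^2u=(\delta\prod_r\ell^r)^{-1}$ for a strictly positive $\delta\in C^0(P)$. A Higgs tensor is a smooth complex-symmetric-matrix-valued function $\xi$ on $P^\circ$ such that $D^2u_P\,\xi\,D^2u_P$ extends smoothly to $P$; then $\xi\,D^2u\,\bar\xi\,D^2u$ extends smoothly to $P$. $r$ denotes the spectral radius (the bound holds at all points of $P$). For $u\in\mathcal A(\xi)$ the matrix $\xi\,D^2u\,\bar\xi\,D^2u$ has real eigenvalues in $[0,1)$ and is diagonalizable on $P^\circ$; the square root is the one with positive eigenvalues. With $f(x)=1-(1-x)^{1/2}+\log(1+(1-x)^{1/2})$, $\rho(\xi\,D^2u\,\bar\xi\,D^2u)=\mathrm{Tr}\,f(\xi\,D^2u\,\bar\xi\,D^2u)$, the sum of $f$ over the eigenvalues. Convexity along linear paths means: if $u_t=(1-t)u_0+tu_1\in\mathcal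 A(\xi)$ for all $t\in[0,1]$, then $t\mapsto\widehat{\mathcal F}(u_t,\xi)$ is convex. *)

theory Defs
  imports "HOL-Analysis.Analysis"
begin

definition partial :: "'n \<Rightarrow> (real^'n \<Rightarrow> 'b::real_normed_vector) \<Rightarrow> real^'n \<Rightarrow> 'b" where
  "partial i f y = vector_derivative (\<lambda>t. f (y + t *\<^sub>R axis i 1)) (at 0)"

definition hessian :: "(real^'n \<Rightarrow> real) \<Rightarrow> real^'n \<Rightarrow> real^'n^'n" where
  "hessian u y = (\<chi> a b. partial b (partial a u) y)"

text \<open>Used only for open \<open>U\<close>.\<close>

primrec Ck_on :: "nat \<Rightarrow> (real^'n) set \<Rightarrow> (real^'n \<Rightarrow> 'b::real_normed_vector) \<Rightarrow> bool" where
  "Ck_on 0 U f \<longleftrightarrow> continuous_on U f"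
| "Ck_on (Suc k) U f \<longleftrightarrow> (\<forall>y\<in>U. f differentiable (at y)) \<and> (\<forall>i. Ck_on k U (partial i f))"

definition smooth_on :: "(real^'n) set \<Rightarrow> (real^'n \<Rightarrow> 'b::real_normed_vector) \<Rightarrow> bool" where
  "smooth_on U f \<longleftrightarrow> (\<forall>k. Ck_on k U f)"

text \<open>\<open>f\<close>, regarded as a function on \<open>D\<close>, is the restriction of a function that is smooth on a
  neighbourhood of \<open>P\<close>. For \<open>D = P\<close> this is \<open>f \<in> C\<^sup>\<infinity>(P)\<close>, smoothness up to the boundary; for
  \<open>D = interior P\<close> it says that a function given on the interior extends smoothly to \<open>P\<close>.\<close>

definition extends_smoothly ::
    "(real^'n) set \<Rightarrow> (real^'n) set \<Rightarrow> (real^'n \<Rightarrow> 'b::real_normed_vector) \<Rightarrow> bool" where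
  "extends_smoothly D P f \<longleftrightarrow>
     (\<exists>U g. open U \<and> P \<subseteq> U \<and> smooth_on U g \<and> (\<forall>y\<in>D. g y = f y))"

definition eigenvalue :: "complex^'n^'n \<Rightarrow> complex \<Rightarrow> bool" where
  "eigenvalue A x \<longleftrightarrow> (\<exists>v. v \<noteq> 0 \<and> A *v v = x *s v)"

definition spectral_radius :: "complex^'n^'n \<Rightarrow> real" where
  "spectral_radius A = Max (cmod ` {x. eigenvalue A x})"

text \<open>\<open>matrix_sqrt A\<close> is only meaningful if \<open>A\<close> has positive eigenvalues; the square root with
  positive eigenvalues is then unique.\<close>

definition matrix_sqrt :: "complex^'n^'n \<Rightarrow> complex^'n^'n" where
  "matrix_sqrt A = (THE B. B ** B = A \<and> (\<forall>x. eigenvalue B x \<longrightarrow> x \<in> \<real> \<and> 0 < Re x))"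

text \<open>\<open>f(A)\<close> for a diagonalizable matrix \<open>A\<close> with real eigenvalues: it acts on each eigenspace
  of \<open>A\<close> as the scalar \<open>f(x)\<close>, \<open>x\<close> being the eigenvalue.\<close>

definition matrix_fun :: "(real \<Rightarrow> real) \<Rightarrow> complex^'n^'n \<Rightarrow> complex^'n^'n" where
  "matrix_fun f A =
     (THE B. \<forall>x v. A *v v = x *s v \<longrightarrow> B *v v = complex_of_real (f (Re x)) *s v)"

text \<open>A polytope is given by the inward normals \<open>\<nu> r\<close> and the constants \<open>c r\<close> of its defining
  functions \<open>\<ell>\<^sup>r(y) = \<nu> r \<bullet> y + c r\<close>, where \<open>r\<close> ranges over a finite type.\<close>

definition ell :: "('r \<Rightarrow> real^'n) \<Rightarrow> ('r \<Rightarrow> real) \<Rightarrow> 'r \<Rightarrow> real^'n \<Rightarrow> real" where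
  "ell \<nu> c r y = \<nu> r \<bullet> y + c r"

definition poly_set :: "('r \<Rightarrow> real^'n) \<Rightarrow> ('r \<Rightarrow> real) \<Rightarrow> (real^'n) set" where
  "poly_set \<nu> c = {y. \<forall>r. ell \<nu> c r y \<ge> 0}"

definition facet :: "('r \<Rightarrow> real^'n) \<Rightarrow> ('r \<Rightarrow> real) \<Rightarrow> 'r \<Rightarrow> (real^'n) set" where
  "facet \<nu> c r = {y \<in> poly_set \<nu> c. ell \<nu> c r y = 0}"

definition integral_vec :: "real^'n \<Rightarrow> bool" where
  "integral_vec v \<longleftrightarrow> (\<forall>i. v $ i \<in> \<int>)"

definition primitive_vec :: "real^'n \<Rightarrow> bool" where
  "primitive_vec v \<longleftrightarrow> integral_vec v \<and>
     (\<forall>(k::int) w. integral_vec w \<and> v = of_int k *\<^sub>R w \<longrightarrow> \<bar>k\<bar> = 1)"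

text \<open>The last condition says that the normals of the facets through a vertex \<open>v\<close> form a
  \<open>\<int>\<close>-basis of \<open>\<int>\<^sup>n\<close>.\<close>

definition delzant :: "('r::finite \<Rightarrow> real^'n) \<Rightarrow> ('r \<Rightarrow> real) \<Rightarrow> bool" where
  "delzant \<nu> c \<longleftrightarrow>
     polytope (poly_set \<nu> c) \<and> interior (poly_set \<nu> c) \<noteq> {} \<and>
     (\<forall>r. facet \<nu> c r facet_of poly_set \<nu> c) \<and> inj (facet \<nu> c) \<and>
     (\<forall>r. primitive_vec (\<nu> r)) \<and>
     (\<forall>v. v extreme_point_of poly_set \<nu> c \<longrightarrow>
        (\<forall>w. integral_vec w \<longrightarrow>
          (\<exists>!k::'r \<Rightarrow> int. (\<forall>r. ell \<nu> c r v \<noteq> 0 \<longrightarrow> k r = 0) \<and>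
             w = (\<Sum>r\<in>UNIV. of_int (k r) *\<^sub>R \<nu> r))))"

text \<open>Lebesgue measure on the hyperplane \<open>{y. a \<bullet> y + b = 0}\<close>, as a measure on the ambient space:
  the image of a product of copies of one-dimensional Lebesgue measure under orthonormal
  coordinates, just as \<^const>\<open>lborel\<close> is constructed from the standard basis. It does not
  depend on the chosen orthonormal basis of the space of vectors orthogonal to \<open>a\<close>.\<close>

definition hyperplane_measure :: "'a::euclidean_space \<Rightarrow> real \<Rightarrow> 'a measure" where
  "hyperplane_measure a b =
     (let B = (SOME B. pairwise orthogonal B \<and> (\<forall>v\<in>B. norm v = 1) \<and> span B = {v. a \<bullet> v = 0})
      in distr (\<Pi>\<^sub>M v\<in>B. lborel) borel
           (\<lambda>x. - (b / (a \<bullet> a)) *\<^sub>R a + (\<Sum>v\<in>B. x v *\<^sub>R v)))"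

text \<open>The integral \<open>\<integral>\<^bsub>\<partial>P\<^esub> g d\<sigma>\<close>; different facets meet in sets of measure zero.\<close>

definition boundary_integral ::
    "('r::finite \<Rightarrow> real^'n) \<Rightarrow> ('r \<Rightarrow> real) \<Rightarrow> (real^'n \<Rightarrow> real) \<Rightarrow> real" where
  "boundary_integral \<nu> c g =
     (\<Sum>r\<in>UNIV. (LINT y:facet \<nu> c r|hyperplane_measure (\<nu> r) (c r). g y) / norm (\<nu> r))"

definition C_const :: "('r::finite \<Rightarrow> real^'n) \<Rightarrow> ('r \<Rightarrow> real) \<Rightarrow> real" where
  "C_const \<nu> c = boundary_integral \<nu> c (\<lambda>_. 1) / measure lebesgue (poly_set \<nu> c)"

text \<open>Potentials and Higgs tensors are total functions, of which only the values on \<open>P\<close> and on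
  its interior, respectively, matter. Since \<open>0 * ln 0 = 0\<close>, \<open>u\<^sub>P\<close> is continuous on \<open>P\<close>.\<close>

definition guillemin :: "('r::finite \<Rightarrow> real^'n) \<Rightarrow> ('r \<Rightarrow> real) \<Rightarrow> real^'n \<Rightarrow> real" where
  "guillemin \<nu> c y = (\<Sum>r\<in>UNIV. ell \<nu> c r y * ln (ell \<nu> c r y))"

definition symplectic_potential ::
    "('r::finite \<Rightarrow> real^'n) \<Rightarrow> ('r \<Rightarrow> real) \<Rightarrow> (real^'n \<Rightarrow> real) \<Rightarrow> bool" where
  "symplectic_potential \<nu> c u \<longleftrightarrow>
     (let P = poly_set \<nu> c in
       (\<exists>h. extends_smoothly P P h \<and> (\<forall>y\<in>P. u y = guillemin \<nu> c y + h y)) \<and>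
       (\<forall>y\<in>interior P. \<forall>v. v \<noteq> 0 \<longrightarrow> v \<bullet> (hessian u y *v v) > 0) \<and>
       (\<exists>\<delta>. continuous_on P \<delta> \<and> (\<forall>y\<in>P. \<delta> y > 0) \<and>
         (\<forall>y\<in>interior P. det (hessian u y) = inverse (\<delta> y * (\<Prod>r\<in>UNIV. ell \<nu> c r y)))))"

abbreviation complex_mat :: "real^'n^'n \<Rightarrow> complex^'n^'n" where
  "complex_mat A \<equiv> map_matrix complex_of_real A"

definition higgs_tensor ::
    "('r::finite \<Rightarrow> real^'n) \<Rightarrow> ('r \<Rightarrow> real) \<Rightarrow> (real^'n \<Rightarrow> complex^'n^'n) \<Rightarrow> bool" where
  "higgs_tensor \<nu> c \<xi> \<longleftrightarrow>
     (let P = poly_set \<nu> c; G = (\<lambda>y. complex_mat (hessian (guillemin \<nu> c) y)) in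
       smooth_on (interior P) \<xi> \<and>
       (\<forall>y\<in>interior P. transpose (\<xi> y) = \<xi> y) \<and>
       extends_smoothly (interior P) P (\<lambda>y. G y ** \<xi> y ** G y))"

definition higgs_mat ::
    "(real^'n \<Rightarrow> complex^'n^'n) \<Rightarrow> (real^'n \<Rightarrow> real) \<Rightarrow> real^'n \<Rightarrow> complex^'n^'n" where
  "higgs_mat \<xi> u y =
     \<xi> y ** complex_mat (hessian u y) ** map_matrix cnj (\<xi> y) ** complex_mat (hessian u y)"

text \<open>The spectral radius is bounded at every point of \<open>P\<close>, including the boundary, where
  \<^const>\<open>higgs_mat\<close> takes its value by continuous extension from the interior.\<close>

definition admissible ::
    "('r::finite \<Rightarrow> real^'n) \<Rightarrow> ('r \<Rightarrow> real) \<Rightarrow> (real^'n \<Rightarrow> complex^'n^'n) \<Rightarrow> (real^'n \<Rightarrow> real) set" where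
  "admissible \<nu> c \<xi> = {u. symplectic_potential \<nu> c u \<and>
     (\<forall>y\<in>poly_set \<nu> c.
        spectral_radius (Lim (at y within interior (poly_set \<nu> c)) (higgs_mat \<xi> u)) < 1)}"

definition moment_map_equation ::
    "('r::finite \<Rightarrow> real^'n) \<Rightarrow> ('r \<Rightarrow> real) \<Rightarrow> (real^'n \<Rightarrow> complex^'n^'n) \<Rightarrow> (real^'n \<Rightarrow> real) \<Rightarrow> bool" where
  "moment_map_equation \<nu> c \<xi> u \<longleftrightarrow>
     (\<forall>y\<in>interior (poly_set \<nu> c).
        (\<Sum>a\<in>UNIV. \<Sum>b\<in>UNIV. partial b (partial a
           (\<lambda>z. (matrix_sqrt (mat 1 - higgs_mat \<xi> u z)
                  ** complex_mat (matrix_inv (hessian u z))) $ a $ b)) y)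
        = - complex_of_real (C_const \<nu> c))"

definition hk_fun :: "real \<Rightarrow> real" where
  "hk_fun x = 1 - sqrt (1 - x) + ln (1 + sqrt (1 - x))"

definition rho :: "complex^'n^'n \<Rightarrow> real" where
  "rho A = Re (trace (matrix_fun hk_fun A))"

text \<open>The integrands over \<open>P\<close> are only meaningful on the interior; the boundary is a null set.\<close>

definition hk_energy ::
    "('r::finite \<Rightarrow> real^'n) \<Rightarrow> ('r \<Rightarrow> real) \<Rightarrow> (real^'n \<Rightarrow> complex^'n^'n) \<Rightarrow> (real^'n \<Rightarrow> real) \<Rightarrow> real" where
  "hk_energy \<nu> c \<xi> u =
     boundary_integral \<nu> c u
     - (LINT y:poly_set \<nu> c|lebesgue. C_const \<nu> c * u y)
     - (LINT y:poly_set \<nu> c|lebesgue. ln (det (hessian u y)))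
     + (LINT y:poly_set \<nu> c|lebesgue. rho (higgs_mat \<xi> u y))"

end

theory Submission
  imports Defs "HOL-Computational_Algebra.Fundamental_Theorem_Algebra"
begin

text \<open>The functional is treated pointwise. At a point, \<open>- log det G + \<rho>(\<xi> G \<xi>\<^sup>* G)\<close> is a function of the
  Hessian \<open>G\<close>, and a Takagi factorization of \<open>\<xi>\<close> relative to \<open>G\<close> diagonalizes everything in sight. Its
  differential is \<open>E \<mapsto> - Re tr (H E)\<close> with \<open>H = (1 - \<xi> G \<xi>\<^sup>* G)\<^sup>1\<^sup>/\<^sup>2 G\<^sup>-\<^sup>1\<close> Hermitian, and monotonicity of
  \<open>G \<mapsto> H\<close> along lines gives convexity. Hence the first variation of the energy is
  \<open>\<integral>\<^bsub>\<partial>P\<^esub> \<phi> d\<sigma> - C \<integral> \<phi> d\<mu> - \<integral> K\<^sup>a\<^sup>b \<phi>\<^sub>,\<^sub>a\<^sub>b d\<mu>\<close> with \<open>K = Re H\<close>. Near the facet \<open>\<ell>\<^sup>r = 0\<close> the matrix \<open>K\<close>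
  degenerates like \<open>\<nu>\<^sup>r \<sqdot> K \<nu>\<^sup>r = \<ell>\<^sup>r + O((\<ell>\<^sup>r)\<^sup>2)\<close>. Integrating by parts against a product of cutoffs in
  \<open>\<ell>\<^sup>r / \<epsilon>\<close> and letting \<open>\<epsilon> \<rightarrow> 0\<close>, only the second derivatives of a single cutoff survive, and they
  produce exactly the boundary integral. Since \<open>H\<close> is Hermitian, its imaginary part does not contribute
  to \<open>H\<^sup>a\<^sup>b\<^sub>,\<^sub>a\<^sub>b\<close>.\<close>

text \<open>The eigenvalues of \<open>\<xi> G \<xi>\<^sup>* G\<close> need not be differentiable in
  \<open>G\<close>, so \<open>\<rho>\<close> is rewritten without them: with \<open>R\<close> the
  square root of \<open>1 - \<xi> G \<xi>\<^sup>* G\<close> it equals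
  \<open>n - tr R + log det (1 + R)\<close>, and \<open>R\<close> is differentiated through the
  linear equation that its increments satisfy. The main obstacle is the boundary, where the Hessian
  of \<open>u\<^sub>P\<close> blows up. The Delzant condition gives charts at the vertices in which
  this Hessian is an explicitly invertible singular part plus a regular one; its inverse, and the
  inverse applied to \<open>\<nu>\<^sup>r\<close> and divided by \<open>\<ell>\<^sup>r\<close>,
  therefore extend continuously to \<open>P\<close>. The unit weight of the boundary integral is
  this leading coefficient times the total rise of the cutoff profile. Convexity also serves
  analysis: it dominates the difference quotients of the integrand by those at two fixed parameters
  and by a tangent slope, which justifies differentiation under the integral.\<close>

section \<open>Calculus of iterated partial derivatives\<close>

lemma partial_has_derivative:
  assumes "(f has_derivative f') (at y)"
  shows "partial i f y = f' (axis i 1)"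
proof -
  have "((\<lambda>t::real. y + t *\<^sub>R axis i 1) has_derivative (\<lambda>t. t *\<^sub>R axis i 1)) (at 0)"
    by (auto intro!: derivative_eq_intros)
  moreover have "(f has_derivative f') (at (y + 0 *\<^sub>R axis i 1))"
    using assms by simp
  ultimately have "((\<lambda>t. f (y + t *\<^sub>R axis i 1)) has_derivative (\<lambda>t. f' (t *\<^sub>R axis i 1))) (at 0)"
    by (rule has_derivative_compose)
  moreover have "(\<lambda>t. f' (t *\<^sub>R axis i 1)) = (\<lambda>t. t *\<^sub>R f' (axis i 1))"
    using linear_scale[OF has_derivative_linear[OF assms]] by auto
  ultimately have "((\<lambda>t. f (y + t *\<^sub>R axis i 1)) has_vector_derivative f' (axis i 1)) (at 0)"
    by (simp add: has_vector_derivative_def)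
  then show ?thesis
    unfolding partial_def by (rule vector_derivative_at)
qed

lemma partial_cong_open:
  assumes "open U" "y \<in> U" "\<And>z. z \<in> U \<Longrightarrow> f z = g z"
  shows "partial i f y = partial i g y"
proof -
  have "((\<lambda>t::real. y + t *\<^sub>R axis i 1) \<longlongrightarrow> y + 0 *\<^sub>R axis i 1) (nhds 0)"
    by (intro tendsto_intros filterlim_ident)
  then have "\<forall>\<^sub>F t::real in nhds 0. y + t *\<^sub>R axis i 1 \<in> U"
    using assms(1,2) topological_tendstoD by fastforce
  then have "\<forall>\<^sub>F t::real in nhds 0. f (y + t *\<^sub>R axis i 1) = g (y + t *\<^sub>R axis i 1)"
    by eventually_elim (use assms(3) in auto)
  then show ?thesis
    unfolding partial_def by (intro vector_derivative_cong_eq) auto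
qed

lemma differentiable_cong_open:
  assumes "open U" "y \<in> U" "\<And>z. z \<in> U \<Longrightarrow> f z = g z" "f differentiable (at y)"
  shows "g differentiable (at y)"
proof -
  obtain f' where "(f has_derivative f') (at y)"
    using assms(4) differentiable_def by blast
  then have "(g has_derivative f') (at y)"
    using has_derivative_transform_within_open assms(1-3) by blast
  then show ?thesis
    by (rule differentiableI)
qed

lemma Ck_on_cong:
  assumes "open U" "\<And>z. z \<in> U \<Longrightarrow> f z = g z" "Ck_on k U f"
  shows "Ck_on k U g"
  using assms(2,3)
proof (induction k arbitrary: f g)
  case 0
  then show ?case using continuous_on_eq by (metis Ck_on.simps(1))
next
  case (Suc k)
  have "\<And>y. y \<in> U \<Longrightarrow> g differentiable (at y)"
    using Suc.prems differentiable_cong_open[OF assms(1)] by (metis Ck_on.simps(2))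
  moreover have "Ck_on k U (partial i g)" for i
  proof (rule Suc.IH)
    show "partial i f z = partial i g z" if "z \<in> U" for z
      using partial_cong_open[OF assms(1) that Suc.prems(1)] by auto
    show "Ck_on k U (partial i f)"
      using Suc.prems by simp
  qed
  ultimately show ?case by simp
qed

lemma Ck_on_SucD: "Ck_on (Suc k) U f \<Longrightarrow> Ck_on k U f"
proof (induction k arbitrary: f)
  case 0
  then show ?case
    by (auto intro: continuous_at_imp_continuous_on differentiable_imp_continuous_within)
next
  case (Suc k)
  then show ?case by auto
qed

lemma Ck_on_le: "Ck_on k U f \<Longrightarrow> j \<le> k \<Longrightarrow> Ck_on j U f"
  by (induction k) (auto simp del: Ck_on.simps simp: le_Suc_eq dest: Ck_on_SucD)

lemma Ck_on_subset: "Ck_on k U f \<Longrightarrow> V \<subseteq> U \<Longrightarrow> Ck_on k V f"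
  by (induction k arbitrary: f) (auto intro: continuous_on_subset)

lemma Ck_on_continuous: "Ck_on k U f \<Longrightarrow> continuous_on U f"
  using Ck_on_le[of k U f 0] by simp

lemma partial_const [simp]: "partial i (\<lambda>_. c) = (\<lambda>_. 0)"
  by (auto simp: partial_def)

lemma Ck_on_const: "Ck_on k U (\<lambda>_. c)"
  by (induction k arbitrary: c) auto

lemma differentiable_bounded_linear:
  assumes "bounded_linear L" "f differentiable F"
  shows "(\<lambda>z. L (f z)) differentiable F"
  using assms(2) bounded_linear.has_derivative[OF assms(1)]
  unfolding differentiable_def by blast

lemma partial_bounded_linear:
  assumes "bounded_linear L" "f differentiable (at y)"
  shows "partial i (\<lambda>z. L (f z)) y = L (partial i f y)"
proof -
  obtain f' where f': "(f has_derivative f') (at y)"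
    using assms(2) differentiable_def by blast
  show ?thesis
    using partial_has_derivative[OF f'] partial_has_derivative[OF bounded_linear.has_derivative[OF assms(1) f']]
    by simp
qed

lemma Ck_on_bounded_linear:
  assumes "bounded_linear L" "open U" "Ck_on k U f"
  shows "Ck_on k U (\<lambda>z. L (f z))"
  using assms(3)
proof (induction k arbitrary: f)
  case 0
  then show ?case
    using bounded_linear.continuous_on[OF assms(1)] by simp
next
  case (Suc k)
  have "Ck_on k U (partial i (\<lambda>z. L (f z)))" for i
  proof (rule Ck_on_cong[OF assms(2)])
    show "Ck_on k U (\<lambda>z. L (partial i f z))"
      using Suc by simp
    show "L (partial i f z) = partial i (\<lambda>z. L (f z)) z" if "z \<in> U" for z
      using Suc.prems that by (simp add: partial_bounded_linear[OF assms(1)])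
  qed
  moreover have "(\<lambda>z. L (f z)) differentiable (at y)" if "y \<in> U" for y
    using Suc.prems that by (simp add: differentiable_bounded_linear[OF assms(1)])
  ultimately show ?case by simp
qed

lemma partial_add:
  assumes "f differentiable (at y)" "g differentiable (at y)"
  shows "partial i (\<lambda>z. f z + g z) y = partial i f y + partial i g y"
proof -
  obtain f' g' where fg: "(f has_derivative f') (at y)" "(g has_derivative g') (at y)"
    using assms unfolding differentiable_def by blast
  show ?thesis
    using partial_has_derivative[OF has_derivative_add[OF fg]]
      partial_has_derivative[OF fg(1)] partial_has_derivative[OF fg(2)] by simp
qed

lemma Ck_on_add:
  assumes "open U" "Ck_on k U f" "Ck_on k U g"
  shows "Ck_on k U (\<lambda>z. f z + g z)"
  using assms(2,3)
proof (induction k arbitrary: f g)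
  case 0
  then show ?case by (auto intro: continuous_intros)
next
  case (Suc k)
  have "Ck_on k U (partial i (\<lambda>z. f z + g z))" for i
    by (rule Ck_on_cong[OF assms(1), of "\<lambda>z. partial i f z + partial i g z"])
      (use Suc in \<open>simp_all add: partial_add\<close>)
  then show ?case
    using Suc.prems by (auto intro: derivative_intros)
qed

lemma partial_bounded_bilinear:
  assumes "bounded_bilinear p" "f differentiable (at y)" "g differentiable (at y)"
  shows "partial i (\<lambda>z. p (f z) (g z)) y = p (f y) (partial i g y) + p (partial i f y) (g y)"
proof -
  obtain f' g' where fg: "(f has_derivative f') (at y)" "(g has_derivative g') (at y)"
    using assms unfolding differentiable_def by blast
  show ?thesis
    using partial_has_derivative[OF bounded_bilinear.FDERIV[OF assms(1) fg]]
      partial_has_derivative[OF fg(1)] partial_has_derivative[OF fg(2)]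
    by simp
qed

lemma differentiable_bounded_bilinear:
  assumes "bounded_bilinear p" "f differentiable (at y)" "g differentiable (at y)"
  shows "(\<lambda>z. p (f z) (g z)) differentiable (at y)"
  using bounded_bilinear.FDERIV[OF assms(1)] assms(2,3)
  unfolding differentiable_def by blast

lemma Ck_on_bounded_bilinear:
  assumes "bounded_bilinear p" "open U" "Ck_on k U f" "Ck_on k U g"
  shows "Ck_on k U (\<lambda>z. p (f z) (g z))"
  using assms(3,4)
proof (induction k arbitrary: f g)
  case 0
  then show ?case using bounded_bilinear.continuous_on[OF assms(1)] by auto
next
  case (Suc k)
  have "Ck_on k U (partial i (\<lambda>z. p (f z) (g z)))" for i
  proof (rule Ck_on_cong[OF assms(2), of "\<lambda>z. p (f z) (partial i g z) + p (partial i f z) (g z)"])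
    show "Ck_on k U (\<lambda>z. p (f z) (partial i g z) + p (partial i f z) (g z))"
      using Suc.prems by (intro Ck_on_add[OF assms(2)] Suc.IH) (auto simp del: Ck_on.simps dest: Ck_on_SucD, simp_all)
  qed (use Suc.prems in \<open>simp add: partial_bounded_bilinear[OF assms(1)]\<close>)
  then show ?case
    using Suc.prems by (simp add: differentiable_bounded_bilinear[OF assms(1)])
qed

lemmas Ck_on_mult = Ck_on_bounded_bilinear[OF bounded_bilinear_mult]
  and Ck_on_scaleR = Ck_on_bounded_bilinear[OF bounded_bilinear_scaleR]
  and partial_mult = partial_bounded_bilinear[OF bounded_bilinear_mult]

lemma Ck_on_minus: "open U \<Longrightarrow> Ck_on k U f \<Longrightarrow> Ck_on k U (\<lambda>z. - f z)"
  by (rule Ck_on_bounded_linear) (auto intro: bounded_linear_minus bounded_linear_ident)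

lemma Ck_on_diff: "open U \<Longrightarrow> Ck_on k U f \<Longrightarrow> Ck_on k U g \<Longrightarrow> Ck_on k U (\<lambda>z. f z - g z)"
  using Ck_on_add[of U k f "\<lambda>z. - g z"] Ck_on_minus by auto

lemma Ck_on_sum:
  assumes "open U" "\<And>i. i \<in> I \<Longrightarrow> Ck_on k U (f i)"
  shows "Ck_on k U (\<lambda>z. \<Sum>i\<in>I. f i z)"
  using assms(2) by (induction I rule: infinite_finite_induct) (auto intro: Ck_on_const Ck_on_add assms(1))

lemma partial_sum:
  assumes "\<And>i. i \<in> I \<Longrightarrow> f i differentiable (at y)"
  shows "partial j (\<lambda>z. \<Sum>i\<in>I. f i z) y = (\<Sum>i\<in>I. partial j (f i) y)"
  using assms
proof (induction I rule: infinite_finite_induct)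
  case (insert x F)
  have "(\<lambda>z. \<Sum>i\<in>F. f i z) differentiable (at y)"
    by (cases "finite F") (use insert.prems in \<open>auto intro!: differentiable_sum\<close>)
  then show ?case
    using insert by (simp add: partial_add)
qed auto

lemma Ck_on_nth: "open U \<Longrightarrow> Ck_on k U f \<Longrightarrow> Ck_on k U (\<lambda>z. f z $ i)"
  by (rule Ck_on_bounded_linear[OF bounded_linear_vec_nth])

lemma vec_eq_sum_axis: "(v::'a::{comm_monoid_add}^'n) = (\<Sum>i\<in>UNIV. axis i (v $ i))"
proof (rule vec_eq_iff[THEN iffD2], rule allI)
  fix j
  have "(\<Sum>i\<in>UNIV. axis i (v $ i)) $ j = (\<Sum>i\<in>UNIV. if j = i then v $ i else 0)"
    unfolding sum_component by (intro sum.cong) (auto simp: axis_def)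
  then show "v $ j = (\<Sum>i\<in>UNIV. axis i (v $ i)) $ j"
    by simp
qed

lemma bounded_linear_axis: "bounded_linear (\<lambda>x::'a::real_normed_vector. axis i x :: 'a^'n)"
proof (rule bounded_linear_intro[where K = 1])
  show "norm (axis i x :: 'a^'n) \<le> norm x * 1" for x :: 'a
  proof -
    have "norm (axis i x :: 'a^'n) \<le> (\<Sum>j\<in>UNIV. norm ((axis i x :: 'a^'n) $ j))"
      unfolding norm_vec_def by (intro L2_set_le_sum) auto
    also have "\<dots> = (\<Sum>j\<in>UNIV. if i = j then norm x else 0)"
      by (intro sum.cong) (auto simp: axis_def)
    finally show ?thesis
      by simp
  qed
qed (auto simp: axis_def vec_eq_iff)

lemma Ck_on_vec:
  fixes F :: "real^'n \<Rightarrow> 'a::real_normed_vector^'m"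
  assumes "open U" "\<And>i. Ck_on k U (\<lambda>z. F z $ i)"
  shows "Ck_on k U F"
proof -
  have "Ck_on k U (\<lambda>z. \<Sum>i\<in>UNIV. axis i (F z $ i))"
    by (intro Ck_on_sum assms Ck_on_bounded_linear[OF bounded_linear_axis])
  then show ?thesis
    by (simp flip: vec_eq_sum_axis)
qed

lemma Ck_on_bounded_linear_id: 
  assumes "bounded_linear f"
  shows "Ck_on k U f"
proof (cases k)
  case 0
  then show ?thesis
    using assms by (simp add: linear_continuous_on)
next
  case (Suc j)
  have "partial i f = (\<lambda>_. f (axis i 1))" for i
    using partial_has_derivative[OF bounded_linear_imp_has_derivative[OF assms]] by auto
  then show ?thesis
    using Suc assms by (simp add: Ck_on_const bounded_linear_imp_differentiable)
qed

text \<open>Differentiation returns a product of \<open>inverse f\<close> with itself and a partial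
  derivative of \<open>f\<close>, so an induction on the order closes.\<close>

lemma Ck_on_inverse:
  fixes f :: "real^'n \<Rightarrow> real"
  assumes "open U" "Ck_on k U f" "\<And>z. z \<in> U \<Longrightarrow> f z \<noteq> 0"
  shows "Ck_on k U (\<lambda>z. inverse (f z))"
  using assms(2)
proof (induction k)
  case 0
  then show ?case using assms(3) by (auto intro: continuous_intros)
next
  case (Suc k)
  have "Ck_on k U (partial i (\<lambda>z. inverse (f z)))" for i
  proof (rule Ck_on_cong[OF assms(1), of "\<lambda>z. - (inverse (f z) * partial i f z * inverse (f z))"])
    show "Ck_on k U (\<lambda>z. - (inverse (f z) * partial i f z * inverse (f z)))"
      using Suc Ck_on_SucD[of k U] by (intro Ck_on_mult Ck_on_minus assms(1)) auto
    fix z assume z: "z \<in> U"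
    then obtain f' where f': "(f has_derivative f') (at z)"
      using Suc.prems unfolding Ck_on.simps differentiable_def by blast
    show "- (inverse (f z) * partial i f z * inverse (f z)) = partial i (\<lambda>z. inverse (f z)) z"
      using partial_has_derivative[OF Deriv.has_derivative_inverse[OF assms(3)[OF z] f']]
        partial_has_derivative[OF f'] by simp
  qed
  then show ?case
    using Suc.prems assms(3) by auto
qed

section \<open>Regularity of solutions of linear equations with parameters\<close>

text \<open>Implicit linear equations \<open>M(y) X(y) = F(y)\<close>. The estimate only uses continuity of \<open>M\<close>, so
  that it also applies to \<open>(R(y) + R(y\<^sub>0)) \<cdot> (R(y) - R(y\<^sub>0))\<close> for a square root \<open>R\<close>.\<close>

lemma bilinear_solve_estimate:
  fixes p :: "'m::real_normed_vector \<Rightarrow> 'x::euclidean_space \<Rightarrow> 'x"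
  assumes p: "bounded_bilinear p" and inj: "\<And>x. p M0 x = 0 \<Longrightarrow> x = 0"
  obtains g B e where "linear g" "\<And>x. g (p M0 x) = x" "\<And>x. p M0 (g x) = x" "B > 0" "e > 0"
    "\<And>M x. norm (M - M0) < e \<Longrightarrow> norm x \<le> B * norm (p M x)"
proof -
  interpret p: bounded_bilinear p by fact
  have lin: "linear (p M0)"
    by (simp add: linear_iff p.add_right p.scaleR_right)
  have "inj (p M0)"
    using linear_injective_0[OF lin] inj by blast
  then obtain g where g: "linear g" "\<And>x. g (p M0 x) = x" "\<And>x. p M0 (g x) = x"
    using linear_injective_isomorphism[OF lin] by blast
  obtain B where B: "B > 0" "\<And>x. norm (g x) \<le> B * norm x"
    using linear_bounded_pos[OF g(1)] by blast
  obtain K where K: "K > 0" "\<And>a b. norm (p a b) \<le> norm a * norm b * K"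
    using p.pos_bounded by blast
  show ?thesis
  \<comment> \<open>For \<open>M\<close> this close to \<open>M0\<close> the perturbation term is at
    most half of \<open>norm x\<close>; absorbing it on the left doubles the constant
    \<open>B\<close> of the inverse.\<close>
  proof (rule that[OF g, of "2 * B" "1 / (2 * B * K)"])
    fix M x assume M: "norm (M - M0) < 1 / (2 * B * K)"
    have "p M x = p M0 x + p (M - M0) x"
      by (simp add: p.diff_left)
    then have "norm (p M0 x) \<le> norm (p M x) + norm (p (M - M0) x)"
      using norm_triangle_ineq4[of "p M x" "p (M - M0) x"] by simp
    also have "\<dots> \<le> norm (p M x) + (1 / (2 * B * K)) * norm x * K"
      using K(2)[of "M - M0" x] M K(1)
      by (smt (verit) mult_right_mono norm_ge_zero)
    finally have "norm (p M0 x) \<le> norm (p M x) + norm x / (2 * B)"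
      using K(1) by (simp add: field_simps)
    moreover have "norm x \<le> B * norm (p M0 x)"
      using B(2)[of "p M0 x"] g(2) by simp
    ultimately have "norm x \<le> B * (norm (p M x) + norm x / (2 * B))"
      using B(1) by (meson le_less_trans mult_le_cancel_left_pos order_trans)
    then show "norm x \<le> 2 * B * norm (p M x)"
      using B(1) by (simp add: field_simps)
  qed (use B K in auto)
qed

text \<open>Since \<open>D\<close> vanishes at \<open>x0\<close>, the solve estimate makes
  \<open>D x\<close> of first order, and the variation of \<open>M\<close> multiplies it by a null
  factor. Continuity of \<open>M\<close> at \<open>x0\<close> is then enough, which breaks the
  circle when \<open>M\<close> itself contains the function to be differentiated.\<close>

lemma bilinear_solve_has_derivative0:
  fixes p :: "'m::real_normed_vector \<Rightarrow> 'x::euclidean_space \<Rightarrow> 'x"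
  assumes p: "bounded_bilinear p" and inj: "\<And>x. p (M x0) x = 0 \<Longrightarrow> x = 0"
    and M: "continuous (at x0 within S) M"
    and E: "(E has_derivative E') (at x0 within S)" "E x0 = 0" and "D x0 = 0"
    and eq: "\<forall>\<^sub>F x in at x0 within S. p (M x) (D x) = E x"
  obtains D' where "(D has_derivative D') (at x0 within S)" "\<And>h. p (M x0) (D' h) = E' h"
proof -
  interpret p: bounded_bilinear p by fact
  obtain g B e where g: "linear g" "\<And>x. g (p (M x0) x) = x" "\<And>x. p (M x0) (g x) = x" "B > 0" "e > 0"
    "\<And>M' x. norm (M' - M x0) < e \<Longrightarrow> norm x \<le> B * norm (p M' x)"
    using bilinear_solve_estimate[OF p inj] by blast
  have bg: "bounded_linear g"
    using g(1) by (simp add: linear_conv_bounded_linear)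
  have Mlim: "((\<lambda>x. M x - M x0) \<longlongrightarrow> 0) (at x0 within S)"
    using M by (simp add: continuous_within LIM_zero)
  have small: "\<forall>\<^sub>F x in at x0 within S. norm (M x - M x0) < e"
    using tendstoD[OF Mlim, of e] g(5) by (simp add: dist_norm)
  have ne: "\<forall>\<^sub>F x in at x0 within S. x \<noteq> x0"
    by (simp add: eventually_at_filter)
  obtain K where K: "K > 0" "\<And>a b. norm (p a b) \<le> norm a * norm b * K"
    using p.pos_bounded by blast
  obtain L where L: "\<And>x. norm (E' x) \<le> norm x * L"
    using bounded_linear.bounded[OF has_derivative_bounded_linear[OF E(1)]] by blast
  let ?N = "\<lambda>x. norm (E x - E' (x - x0)) / norm (x - x0)"
  have Elim: "(?N \<longlongrightarrow> 0) (at x0 within S)"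
    using E unfolding has_derivative_iff_norm by simp
  have "((\<lambda>x. norm (D x - D x0 - g (E' (x - x0))) / norm (x - x0)) \<longlongrightarrow> 0) (at x0 within S)"
  \<comment> \<open>The remainder is \<open>g\<close> applied to the linearization error of
    \<open>E\<close> minus the change of \<open>M\<close> acting on \<open>D x\<close>; both are
    small compared with \<open>norm (x - x0)\<close>.\<close>
  proof (rule Lim_null_comparison)
    show "\<forall>\<^sub>F x in at x0 within S. norm (norm (D x - D x0 - g (E' (x - x0))) / norm (x - x0))
        \<le> B * (?N x + norm (M x - M x0) * (B * (?N x + L)) * K)"
      using small eq ne
    proof eventually_elim
      fix x assume x: "norm (M x - M x0) < e" "p (M x) (D x) = E x" "x \<noteq> x0"
      define d where "d = norm (x - x0)"
      have d: "d > 0" using x(3) by (simp add: d_def)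
      have Ex: "norm (E x) \<le> norm (E x - E' (x - x0)) + d * L"
        using norm_triangle_ineq[of "E x - E' (x - x0)" "E' (x - x0)"] L[of "x - x0"]
        by (simp add: d_def)
      have Dx: "norm (D x) \<le> B * (norm (E x - E' (x - x0)) + d * L)"
        using g(6)[OF x(1), of "D x"] x(2) Ex g(4)
        by (metis mult_le_cancel_left_pos order_trans)
      have "p (M x0) (D x) = E x - p (M x - M x0) (D x)"
        using x(2) by (simp add: p.diff_left)
      then have gD: "g (E x - p (M x - M x0) (D x)) = D x"
        using g(2)[of "D x"] by simp
      have "g ((E x - E' (x - x0)) - p (M x - M x0) (D x)) =
          g (E x - p (M x - M x0) (D x)) - g (E' (x - x0))"
        by (subst linear_diff[OF g(1), symmetric]) (simp add: algebra_simps)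
      then have "D x - g (E' (x - x0)) = g ((E x - E' (x - x0)) - p (M x - M x0) (D x))"
        unfolding gD by simp
      moreover have "norm (g z) \<le> B * norm z" for z
        using g(3) g(6)[of "M x0" "g z"] g(5) by simp
      ultimately have "norm (D x - g (E' (x - x0)))
          \<le> B * norm ((E x - E' (x - x0)) - p (M x - M x0) (D x))"
        by simp
      also have "\<dots> \<le> B * (norm (E x - E' (x - x0)) + norm (M x - M x0) * norm (D x) * K)"
        using g(4) norm_triangle_ineq4[of "E x - E' (x - x0)" "p (M x - M x0) (D x)"]
          K(2)[of "M x - M x0" "D x"]
        by (intro mult_left_mono) auto
      also have "\<dots> \<le> B * (norm (E x - E' (x - x0)) +
          norm (M x - M x0) * (B * (norm (E x - E' (x - x0)) + d * L)) * K)"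
        using g(4) K(1) Dx by (intro mult_left_mono add_left_mono mult_right_mono) auto
      finally have "norm (D x - g (E' (x - x0))) / d \<le> B * (norm (E x - E' (x - x0)) +
          norm (M x - M x0) * (B * (norm (E x - E' (x - x0)) + d * L)) * K) / d"
        using d by (simp add: divide_right_mono)
      also have "\<dots> = B * (?N x + norm (M x - M x0) * (B * (?N x + L)) * K)"
        using d by (simp add: d_def field_simps)
      finally have "norm (D x - g (E' (x - x0))) / d
        \<le> B * (?N x + norm (M x - M x0) * (B * (?N x + L)) * K)" .
      then show "norm (norm (D x - D x0 - g (E' (x - x0))) / norm (x - x0))
        \<le> B * (?N x + norm (M x - M x0) * (B * (?N x + L)) * K)"
        by (simp add: d_def \<open>D x0 = 0\<close>)
    qed
    have "((\<lambda>x. B * (?N x + norm (M x - M x0) * (B * (?N x + L)) * K)) \<longlongrightarrow>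
        B * (0 + norm (0::'m) * (B * (0 + L)) * K)) (at x0 within S)"
      by (intro tendsto_intros Elim Mlim)
    then show "((\<lambda>x. B * (?N x + norm (M x - M x0) * (B * (?N x + L)) * K)) \<longlongrightarrow> 0) (at x0 within S)"
      by simp
  qed
  moreover have "bounded_linear (\<lambda>h. g (E' h))"
    using bounded_linear_compose[OF bg has_derivative_bounded_linear[OF E(1)]] .
  ultimately have "(D has_derivative (\<lambda>h. g (E' h))) (at x0 within S)"
    unfolding has_derivative_iff_norm by simp
  then show ?thesis
    by (rule that) (simp add: g(3))
qed

text \<open>The estimate is applied to \<open>X x - X0\<close>, whose image under
  \<open>p (M x)\<close> is \<open>E x - p (M x) X0\<close> and tends to zero.\<close>

lemma bilinear_solve_tendsto:
  fixes p :: "'m::real_normed_vector \<Rightarrow> 'x::euclidean_space \<Rightarrow> 'x"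
  assumes p: "bounded_bilinear p" and inj: "\<And>x. p M0 x = 0 \<Longrightarrow> x = 0"
    and M: "(M \<longlongrightarrow> M0) F" and E: "(E \<longlongrightarrow> p M0 X0) F"
    and eq: "\<forall>\<^sub>F x in F. p (M x) (X x) = E x"
  shows "(X \<longlongrightarrow> X0) F"
proof -
  interpret p: bounded_bilinear p by fact
  obtain B e where g: "B > 0" "e > 0"
    "\<And>M' x. norm (M' - M0) < e \<Longrightarrow> norm x \<le> B * norm (p M' x)"
    by (rule bilinear_solve_estimate[OF p inj]) blast+
  have "((\<lambda>x. X x - X0) \<longlongrightarrow> 0) F"
  proof (rule Lim_null_comparison)
    have "\<forall>\<^sub>F x in F. norm (M x - M0) < e"
      using tendstoD[OF M, of e] g(2) by (simp add: dist_norm)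
    then show "\<forall>\<^sub>F x in F. norm (X x - X0) \<le> B * norm (E x - p (M x) X0)"
      using eq
    proof eventually_elim
      case (elim x)
      then show ?case
        using g(3)[of "M x" "X x - X0"] by (simp add: p.diff_right)
    qed
    have "((\<lambda>x. B * norm (E x - p (M x) X0)) \<longlongrightarrow> B * norm (p M0 X0 - p M0 X0)) F"
      by (intro tendsto_intros E p.tendsto M)
    then show "((\<lambda>x. B * norm (E x - p (M x) X0)) \<longlongrightarrow> 0) F"
      by simp
  qed
  then show ?thesis
    using LIM_zero_iff by blast
qed

lemma bilinear_solve_continuous_on:
  fixes p :: "'m::real_normed_vector \<Rightarrow> 'x::euclidean_space \<Rightarrow> 'x"
  assumes p: "bounded_bilinear p" and inj: "\<And>y x. y \<in> S \<Longrightarrow> p (M y) x = 0 \<Longrightarrow> x = 0"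
    and "continuous_on S M" "continuous_on S E"
    and eq: "\<And>y. y \<in> S \<Longrightarrow> p (M y) (X y) = E y"
  shows "continuous_on S X"
  unfolding continuous_on_def
proof
  fix y assume y: "y \<in> S"
  show "(X \<longlongrightarrow> X y) (at y within S)"
  proof (rule bilinear_solve_tendsto[OF p inj[OF y]])
    show "(M \<longlongrightarrow> M y) (at y within S)" "(E \<longlongrightarrow> p (M y) (X y)) (at y within S)"
      using assms(3,4) y eq by (auto simp: continuous_on_def)
    show "\<forall>\<^sub>F x in at y within S. p (M x) (X x) = E x"
      using eq by (simp add: eventually_at_filter)
  qed auto
qed

lemma bilinear_solve_has_derivative:
  fixes p :: "'m::real_normed_vector \<Rightarrow> 'x::euclidean_space \<Rightarrow> 'x"
  assumes p: "bounded_bilinear p" and inj: "\<And>x. p (M x0) x = 0 \<Longrightarrow> x = 0"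
    and M: "(M has_derivative M') (at x0 within S)"
    and F: "(F has_derivative F') (at x0 within S)"
    and eq: "\<forall>\<^sub>F x in at x0 within S. p (M x) (X x) = F x" "p (M x0) (X x0) = F x0"
  obtains X' where "(X has_derivative X') (at x0 within S)"
    "\<And>h. p (M x0) (X' h) + p (M' h) (X x0) = F' h"
proof -
  interpret p: bounded_bilinear p by fact
  have "((\<lambda>x. F x - p (M x) (X x0)) has_derivative (\<lambda>h. F' h - p (M' h) (X x0))) (at x0 within S)"
    by (intro has_derivative_diff F bounded_linear.has_derivative[OF p.bounded_linear_left M])
  moreover
  have 1: "F x0 - p (M x0) (X x0) = 0" "X x0 - X x0 = 0"
    using eq by auto
  moreover have 2: "continuous (at x0 within S) M"
    using has_derivative_continuous[OF M] .
  moreover have 3: "\<forall>\<^sub>F x in at x0 within S. p (M x) (X x - X x0) = F x - p (M x) (X x0)"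
      using eq(1) by eventually_elim (simp add: p.diff_right)
  ultimately obtain D' where D': "((\<lambda>x. X x - X x0) has_derivative D') (at x0 within S)"
    "\<And>h. p (M x0) (D' h) = F' h - p (M' h) (X x0)"
    using bilinear_solve_has_derivative0[where D="\<lambda>x. X x - X x0" and E="\<lambda>x. F x - p (M x) (X x0)"
      and M=M and ?x0.0=x0 and S=S and E'="\<lambda>h. F' h - p (M' h) (X x0)", OF p inj] by blast
  have "((\<lambda>x. (X x - X x0) + X x0) has_derivative (\<lambda>h. D' h + 0)) (at x0 within S)"
    by (intro has_derivative_add D' has_derivative_const)
  then show ?thesis
    using D'(2) by (intro that[of D']) auto
qed

text \<open>A partial derivative of \<open>X\<close> solves an equation with the same coefficient
  \<open>M\<close>, the right-hand side involving only \<open>X\<close> and first derivatives of the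
  data. Hence the induction has to generalize over \<open>F\<close> and \<open>X\<close>.\<close>

lemma bilinear_solve_Ck_on:
  fixes p :: "'m::real_normed_vector \<Rightarrow> 'x::euclidean_space \<Rightarrow> 'x"
  assumes p: "bounded_bilinear p" and inj: "\<And>y x. y \<in> U \<Longrightarrow> p (M y) x = 0 \<Longrightarrow> x = 0" and "open U"
    and "Ck_on k U M" "Ck_on k U F"
    and eq: "\<And>y. y \<in> U \<Longrightarrow> p (M y) (X y) = F y"
  shows "Ck_on k U X"
  using assms(4-6)
proof (induction k arbitrary: F X)
  case 0
  then show ?case
    using bilinear_solve_continuous_on[of p U M F X] p inj by simp
next
  case (Suc k)
  interpret p: bounded_bilinear p by fact
  have X: "Ck_on k U X"
    using Suc.IH[of F X] Suc.prems Ck_on_SucD[of k U M] Ck_on_SucD[of k U F] by blast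
  have main: "X differentiable (at y) \<and>
      (\<forall>i. p (M y) (partial i X y) = partial i F y - p (partial i M y) (X y))" if y: "y \<in> U" for y
  proof -
    obtain M' F' where M': "(M has_derivative M') (at y)" and F': "(F has_derivative F') (at y)"
      using Suc.prems y by (metis Ck_on.simps(2) differentiable_def)
    have "\<forall>\<^sub>F x in at y. p (M x) (X x) = F x"
      using eventually_at_in_open'[OF \<open>open U\<close> y] by eventually_elim (use Suc.prems(3) in auto)
    then obtain X' where X': "(X has_derivative X') (at y)" "\<And>h. p (M y) (X' h) + p (M' h) (X y) = F' h"
      using bilinear_solve_has_derivative[OF p inj[OF y] M' F'] Suc.prems(3)[OF y] by blast
    show ?thesis
      using X'(2) partial_has_derivative[OF X'(1)] partial_has_derivative[OF M'] partial_has_derivative[OF F']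
        differentiableI[OF X'(1)] by (simp add: algebra_simps)
  qed
  have "Ck_on k U (partial i X)" for i
  proof (rule Suc.IH[of "\<lambda>y. partial i F y - p (partial i M y) (X y)"])
    show "Ck_on k U (\<lambda>y. partial i F y - p (partial i M y) (X y))"
      using Suc.prems X by (intro Ck_on_diff Ck_on_bounded_bilinear[OF p] \<open>open U\<close>) auto
  qed (use Ck_on_SucD[OF Suc.prems(1)] main in \<open>auto simp del: Ck_on.simps\<close>)
  then show ?case
    using main by auto
qed

section \<open>Conjugate transposes and diagonal matrices\<close>

definition hconj :: "complex^'n^'m \<Rightarrow> complex^'m^'n" where
  "hconj A = transpose (map_matrix cnj A)"

definition dg :: "('n \<Rightarrow> complex) \<Rightarrow> complex^'n^'n" where
  "dg d = (\<chi> i j. if i = j then d i else 0)"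

lemma map_matrix_cnj_mult: "map_matrix cnj (A ** B) = map_matrix cnj A ** map_matrix cnj B"
  by (simp add: vec_eq_iff matrix_matrix_mult_def)

lemma map_matrix_cnj_cnj [simp]: "map_matrix cnj (map_matrix cnj A) = A"
  by (simp add: vec_eq_iff)

lemma map_matrix_cnj_one [simp]: "map_matrix cnj (mat 1) = mat 1"
  by (simp add: vec_eq_iff mat_def)

lemma map_matrix_cnj_of_real [simp]: "map_matrix cnj (complex_mat A) = complex_mat A"
  by (simp add: vec_eq_iff)

lemma map_matrix_cnj_transpose: "map_matrix cnj (transpose A) = transpose (map_matrix cnj A)"
  by (simp add: vec_eq_iff transpose_def)

lemma hconj_mult: "hconj (A ** B) = hconj B ** hconj A"
  by (simp add: hconj_def map_matrix_cnj_mult matrix_transpose_mul)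

lemma hconj_hconj [simp]: "hconj (hconj A) = A"
  by (simp add: hconj_def map_matrix_cnj_transpose)

lemma hconj_one [simp]: "hconj (mat 1) = mat 1"
  by (simp add: hconj_def)

lemma cnj_hconj: "map_matrix cnj (hconj A) = transpose A"
  by (simp add: hconj_def map_matrix_cnj_transpose)

lemma complex_mat_mult: "complex_mat (A ** B) = complex_mat A ** complex_mat B"
  by (simp add: vec_eq_iff matrix_matrix_mult_def)

lemma complex_mat_one [simp]: "complex_mat (mat 1) = mat 1"
  by (simp add: vec_eq_iff mat_def)

lemma complex_mat_transpose: "complex_mat (transpose A) = transpose (complex_mat A)"
  by (simp add: vec_eq_iff transpose_def)

lemma hconj_complex_mat: "hconj (complex_mat A) = complex_mat (transpose A)"
  by (simp add: hconj_def complex_mat_transpose)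

lemma dg_mult: "dg a ** dg b = dg (\<lambda>i. a i * b i)"
  by (simp add: vec_eq_iff matrix_matrix_mult_def dg_def if_distrib[of "\<lambda>x. x * _"] cong: if_cong)

lemma dg_mult_nth: "(dg a ** M) $ i $ j = a i * M $ i $ j"
  by (simp add: matrix_matrix_mult_def dg_def if_distrib[of "\<lambda>x. x * _"] cong: if_cong)

lemma mult_dg_nth: "(M ** dg a) $ i $ j = M $ i $ j * a j"
  by (simp add: matrix_matrix_mult_def dg_def if_distrib[of "\<lambda>x. _ * x"] cong: if_cong)

lemma dg_one: "dg (\<lambda>_. 1) = mat 1"
  by (simp add: vec_eq_iff dg_def mat_def)

lemma dg_diff: "dg a - dg b = dg (\<lambda>i. a i - b i)"
  by (simp add: vec_eq_iff dg_def)

lemma dg_add: "dg a + dg b = dg (\<lambda>i. a i + b i)"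
  by (simp add: vec_eq_iff dg_def)

lemma hconj_dg: "hconj (dg a) = dg (\<lambda>i. cnj (a i))"
  by (auto simp add: vec_eq_iff dg_def hconj_def transpose_def)

lemma cnj_dg: "map_matrix cnj (dg a) = dg (\<lambda>i. cnj (a i))"
  by (auto simp add: vec_eq_iff dg_def)

lemma transpose_dg [simp]: "transpose (dg a) = dg a"
  by (auto simp add: vec_eq_iff dg_def transpose_def)

lemma trace_dg: "trace (dg a) = (\<Sum>i\<in>UNIV. a i)"
  by (simp add: trace_def dg_def)

lemma det_dg: "det (dg a) = (\<Prod>i\<in>UNIV. a i)"
  by (subst det_diagonal) (auto simp: dg_def)

lemma matrix_add_rdistrib: "(A + B) ** (C::'a::semiring_1^'k^'n) = A ** C + B ** C"
  by (simp add: vec_eq_iff matrix_matrix_mult_def distrib_right sum.distrib)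

lemma mult_axis_nth: "((A::'a::semiring_1^'n^'m) *v axis i 1) $ a = A $ a $ i"
  by (simp add: matrix_vector_mult_def axis_def if_distrib[of "\<lambda>x. _ * x"] cong: if_cong)

lemma matrix_eq_on_basis:
  fixes A B :: "'a::field^'n^'m" and V :: "'a^'k^'n"
  assumes "V ** W = mat 1" "\<And>i. A *v (V *v axis i 1) = B *v (V *v axis i 1)"
  shows "A = B"
proof -
  have "(A ** V) $ a $ i = (B ** V) $ a $ i" for a i
    using arg_cong[OF assms(2)[of i], of "\<lambda>v. v $ a"] unfolding matrix_vector_mul_assoc mult_axis_nth .
  then have "A ** V = B ** V"
    by (simp add: vec_eq_iff)
  then show ?thesis
    using assms(1) by (metis matrix_mul_assoc matrix_mul_rid)
qed

lemma bounded_bilinear_matrix_mult_real: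
  "bounded_bilinear ((**) :: real^'n^'m \<Rightarrow> real^'k^'n \<Rightarrow> real^'k^'m)"
  unfolding bilinear_conv_bounded_bilinear[symmetric] bilinear_def
  by (auto simp: linear_iff matrix_add_ldistrib matrix_add_rdistrib)
    (auto simp: vec_eq_iff matrix_matrix_mult_def sum_distrib_left algebra_simps)

lemma bounded_bilinear_matrix_mult_complex:
  "bounded_bilinear ((**) :: complex^'n^'m \<Rightarrow> complex^'k^'n \<Rightarrow> complex^'k^'m)"
  unfolding bilinear_conv_bounded_bilinear[symmetric] bilinear_def
  by (auto simp: linear_iff matrix_add_ldistrib matrix_add_rdistrib)
    (auto simp: vec_eq_iff matrix_matrix_mult_def scaleR_sum_right algebra_simps)

subsection \<open>Matrices diagonalized by a given basis\<close>

locale diagonalization =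
  fixes V W :: "complex^'n^'n"
  assumes VW: "V ** W = mat 1" and WV: "W ** V = mat 1"
begin

text \<open>For a fixed eigenbasis, the columns of \<open>V\<close>, these matrices form a
  commutative algebra on which products, traces and functions act entrywise.\<close>

definition D :: "('n \<Rightarrow> complex) \<Rightarrow> complex^'n^'n" where
  "D d = V ** dg d ** W"

lemma D_mult: "D a ** D b = D (\<lambda>i. a i * b i)"
proof -
  have "D a ** D b = V ** dg a ** (W ** V) ** dg b ** W"
    by (simp add: D_def matrix_mul_assoc)
  also have "\<dots> = V ** (dg a ** dg b) ** W"
    by (simp add: WV matrix_mul_assoc)
  finally show ?thesis
    by (simp add: D_def dg_mult)
qed

lemma D_one: "D (\<lambda>_. 1) = mat 1"
  by (simp add: D_def dg_one VW)

lemma D_add: "D a + D b = D (\<lambda>i. a i + b i)"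
  by (simp add: D_def matrix_add_ldistrib matrix_add_rdistrib flip: dg_add)

lemma D_diff: "D a - D b = D (\<lambda>i. a i - b i)"
  using D_add[of "\<lambda>i. a i - b i" b] by (simp add: diff_eq_eq)

lemma trace_D: "trace (D a) = (\<Sum>i\<in>UNIV. a i)"
proof -
  have "trace (D a) = trace (dg a ** (W ** V))"
    unfolding D_def by (metis matrix_mul_assoc trace_mul_sym)
  then show ?thesis
    by (simp add: WV trace_dg)
qed

lemma det_D: "det (D a) = (\<Prod>i\<in>UNIV. a i)"
proof -
  have "det V * det W = 1"
    using det_mul[of V W] VW by simp
  then show ?thesis
    by (simp add: D_def det_mul det_dg)
qed

lemma D_axis: "D d *v (V *v axis i 1) = d i *s (V *v axis i 1)"
proof -
  have "D d *v (V *v axis i 1) = (V ** dg d ** (W ** V)) *v axis i 1"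
    by (simp add: D_def matrix_vector_mul_assoc matrix_mul_assoc)
  also have "\<dots> = V *v (dg d *v axis i 1)"
    by (simp add: WV matrix_vector_mul_assoc)
  also have "dg d *v axis i 1 = d i *s axis i 1"
    by (auto simp: vec_eq_iff mult_axis_nth dg_def) (auto simp: axis_def)
  finally show ?thesis
    by (simp add: vector_scalar_commute)
qed

lemma V_axis_nonzero: "V *v axis i 1 \<noteq> 0"
proof
  assume "V *v axis i 1 = 0"
  then have "(W ** V) *v axis i 1 = 0"
    by (simp flip: matrix_vector_mul_assoc)
  then show False
    by (simp add: WV axis_eq_0_iff)
qed

text \<open>The product form covers repeated eigenvalues: the coordinates of an eigenvector vanish
  except where \<open>d i\<close> is its eigenvalue, and no choice of index is made.\<close>

lemma eigenvector_D:
  assumes "D d *v v = x *s v"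
  shows "(x - d i) * (W *v v) $ i = 0"
proof -
  have "W *v (D d *v v) = (W ** V ** dg d) *v (W *v v)"
    by (simp add: D_def matrix_vector_mul_assoc matrix_mul_assoc)
  then have "dg d *v (W *v v) = x *s (W *v v)"
    using assms by (simp add: WV vector_scalar_commute)
  moreover have "(dg d *v u) $ i = d i * u $ i" for u
    by (simp add: matrix_vector_mult_def dg_def if_distrib[of "\<lambda>x. x * _"] cong: if_cong)
  ultimately have "d i * (W *v v) $ i = x * (W *v v) $ i"
    by (metis vector_smult_component)
  then show ?thesis
    by (metis diff_self left_diff_distrib)
qed

lemma eigenvalue_D: "eigenvalue (D d) x \<longleftrightarrow> x \<in> range d"
proof
  assume "eigenvalue (D d) x"
  then obtain v where v: "v \<noteq> 0" "D d *v v = x *s v"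
    by (auto simp: eigenvalue_def)
  have "W *v v \<noteq> 0"
  proof
    assume "W *v v = 0"
    then have "(V ** W) *v v = 0"
      by (simp flip: matrix_vector_mul_assoc)
    then show False
      using v by (simp add: VW)
  qed
  then obtain i where "(W *v v) $ i \<noteq> 0"
    by (auto simp: vec_eq_iff)
  then show "x \<in> range d"
    using eigenvector_D[OF v(2), of i] by auto
qed (use D_axis V_axis_nonzero in \<open>auto simp: eigenvalue_def\<close>)

text \<open>The candidate acts correctly on every eigenvector, also for repeated eigenvalues,
  because such a vector only has coordinates where \<open>d i\<close> is the eigenvalue. Uniqueness
  holds because the columns of \<open>V\<close> are eigenvectors and span.\<close>

lemma matrix_fun_D: "matrix_fun f (D d) = D (\<lambda>i. complex_of_real (f (Re (d i))))"
  unfolding matrix_fun_def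
proof (rule the_equality)
  show "\<forall>x v. D d *v v = x *s v \<longrightarrow>
      D (\<lambda>i. complex_of_real (f (Re (d i)))) *v v = complex_of_real (f (Re x)) *s v"
  proof (intro allI impI)
    fix x v assume v: "D d *v v = x *s v"
    define e where "e = (\<lambda>i. complex_of_real (f (Re (d i))))"
    have "(dg e *v (W *v v)) $ i = (complex_of_real (f (Re x)) *s (W *v v)) $ i" for i
      using eigenvector_D[OF v, of i]
      by (auto simp: matrix_vector_mult_def dg_def e_def if_distrib[of "\<lambda>x. x * _"] cong: if_cong)
    then have "dg e *v (W *v v) = complex_of_real (f (Re x)) *s (W *v v)"
      by (simp add: vec_eq_iff)
    then have "V *v (dg e *v (W *v v)) = complex_of_real (f (Re x)) *s ((V ** W) *v v)"
      by (simp add: vector_scalar_commute matrix_vector_mul_assoc)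
    then show "D (\<lambda>i. complex_of_real (f (Re (d i)))) *v v = complex_of_real (f (Re x)) *s v"
      by (simp add: D_def VW matrix_vector_mul_assoc matrix_mul_assoc flip: e_def)
  qed
  fix B assume B: "\<forall>x v. D d *v v = x *s v \<longrightarrow> B *v v = complex_of_real (f (Re x)) *s v"
  show "B = D (\<lambda>i. complex_of_real (f (Re (d i))))"
    by (rule matrix_eq_on_basis[OF VW]) (use B D_axis in auto)
qed

text \<open>For uniqueness let \<open>B\<close> be another root and \<open>v\<close> a column of
  \<open>V\<close>, so that \<open>B\<close> applied twice to \<open>v\<close> gives
  \<open>s * s\<close> times \<open>v\<close>. Then \<open>z = B *v v - s *s v\<close> satisfies
  \<open>B *v z = (- s) *s z\<close>; as \<open>- s\<close> is not a permitted eigenvalue,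
  \<open>z = 0\<close>.\<close>

lemma matrix_sqrt_D:
  assumes "\<And>i. d i > 0"
  shows "matrix_sqrt (D (\<lambda>i. complex_of_real (d i))) = D (\<lambda>i. complex_of_real (sqrt (d i)))"
  unfolding matrix_sqrt_def
proof (rule the_equality)
  let ?A = "D (\<lambda>i. complex_of_real (d i))"
  have sq: "complex_of_real (sqrt (d i)) * complex_of_real (sqrt (d i)) = complex_of_real (d i)" for i
    using assms[of i] by (simp flip: of_real_mult)
  show "D (\<lambda>i. complex_of_real (sqrt (d i))) ** D (\<lambda>i. complex_of_real (sqrt (d i))) = ?A \<and>
      (\<forall>x. eigenvalue (D (\<lambda>i. complex_of_real (sqrt (d i)))) x \<longrightarrow> x \<in> \<real> \<and> 0 < Re x)"
    using assms by (auto simp: D_mult sq eigenvalue_D)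
  fix B assume B: "B ** B = ?A \<and> (\<forall>x. eigenvalue B x \<longrightarrow> x \<in> \<real> \<and> 0 < Re x)"
  show "B = D (\<lambda>i. complex_of_real (sqrt (d i)))"
  proof (rule matrix_eq_on_basis[OF VW])
    fix i
    define v s z where "v = V *v axis i 1" and "s = complex_of_real (sqrt (d i))" and "z = B *v v - s *s v"
    have "B *v (B *v v) = (s * s) *s v"
      using B D_axis[of "\<lambda>i. complex_of_real (d i)" i] by (simp add: matrix_vector_mul_assoc[of B B] sq s_def v_def)
    then have "B *v z = (- s) *s z"
      by (simp add: z_def matrix_vector_mult_diff_distrib vector_scalar_commute vec_eq_iff algebra_simps)
    moreover have "\<not> 0 < Re (- s)"
      using assms[of i] by (simp add: s_def)
    ultimately have "z = 0"
      using B unfolding eigenvalue_def by blast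
    then show "B *v (V *v axis i 1) = D (\<lambda>i. complex_of_real (sqrt (d i))) *v (V *v axis i 1)"
      by (simp add: D_axis z_def v_def s_def)
  qed
qed

end

subsection \<open>Takagi factorization relative to a real inner product\<close>

definition real_posdef :: "real^'n^'n \<Rightarrow> bool" where
  "real_posdef G \<longleftrightarrow> transpose G = G \<and> (\<forall>v. v \<noteq> 0 \<longrightarrow> v \<bullet> (G *v v) > 0)"

text \<open>The columns of \<open>V\<close> are orthonormal for the Hermitian form of
  \<open>G\<close>, while \<open>\<xi>\<close> is diagonalized with \<open>transpose V\<close> in
  place of \<open>hconj V\<close>: it transforms as a symmetric bilinear form. The
  \<open>\<sigma> i\<close> are the singular values of \<open>\<xi>\<close> relative to
  \<open>G\<close>.\<close>

definition frame :: "real^'n^'n \<Rightarrow> complex^'n^'n \<Rightarrow> complex^'n^'n \<Rightarrow> ('n \<Rightarrow> real) \<Rightarrow> bool" where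
  "frame G \<xi> V \<sigma> \<longleftrightarrow> hconj V ** complex_mat G ** V = mat 1 \<and>
     \<xi> = V ** dg (\<lambda>i. complex_of_real (\<sigma> i)) ** transpose V \<and> (\<forall>i. 0 \<le> \<sigma> i)"

context
  fixes G :: "real^'n^'n" and \<xi> :: "complex^'n^'n"
  assumes G: "real_posdef G" and \<xi>: "transpose \<xi> = \<xi>"
begin

private definition cv :: "complex^'n \<Rightarrow> complex^'n" where "cv v = (\<chi> i. cnj (v $ i))"
private definition bl :: "complex^'n \<Rightarrow> complex^'n \<Rightarrow> complex" where "bl x y = (\<Sum>a\<in>UNIV. x $ a * y $ a)"
private definition hip where "hip v w = bl (cv v) (complex_mat G *v w)"
text \<open>An antilinear map whose square is multiplication by \<open>\<xi> G cnj \<xi> G\<close>.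
  The columns of the frame will be vectors with \<open>\<tau> v = \<sigma> v\<close> and
  \<open>\<sigma>\<close> nonnegative. The symmetry of \<open>\<xi>\<close> is used as the symmetry
  of the form \<open>\<beta>\<close>, antilinear in both arguments.\<close>

private definition \<tau> where "\<tau> w = \<xi> *v (complex_mat G *v cv w)"
private definition \<beta> where "\<beta> v w = hip v (\<tau> w)"

private lemma bl_transpose: "bl x (A *v y) = bl y (transpose A *v x)"
proof -
  have "bl x (A *v y) = (\<Sum>a\<in>UNIV. \<Sum>b\<in>UNIV. x $ a * A $ a $ b * y $ b)"
    by (simp add: bl_def matrix_vector_mult_def sum_distrib_left mult.assoc)
  also have "\<dots> = (\<Sum>b\<in>UNIV. \<Sum>a\<in>UNIV. x $ a * A $ a $ b * y $ b)"
    by (rule sum.swap)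
  also have "\<dots> = bl y (transpose A *v x)"
    by (simp add: bl_def matrix_vector_mult_def transpose_def sum_distrib_left mult_ac)
  finally show ?thesis .
qed

private lemma bl_simps: "bl (x + x') y = bl x y + bl x' y" "bl x (y + y') = bl x y + bl x y'"
  "bl (c *s x) y = c * bl x y" "bl x (c *s y) = c * bl x y" "bl x (y - y') = bl x y - bl x y'" "bl x 0 = 0"
  by (simp_all add: bl_def algebra_simps sum.distrib sum_distrib_left sum_subtractf)

private lemma cv_simps: "cv (x + y) = cv x + cv y" "cv (c *s x) = cnj c *s cv x" "cv (cv x) = x" "cv 0 = 0"
  by (simp_all add: cv_def vec_eq_iff)

private lemma hip_simps: "hip (x + x') y = hip x y + hip x' y" "hip x (y + y') = hip x y + hip x y'"
  "hip (c *s x) y = cnj c * hip x y" "hip x (c *s y) = c * hip x y" "hip x (y - y') = hip x y - hip x y'"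
  "hip x 0 = 0"
  by (simp_all add: hip_def cv_simps bl_simps matrix_vector_right_distrib vector_scalar_commute
      matrix_vector_mult_diff_distrib)

private lemma hip_cnj: "hip w v = cnj (hip v w)"
proof -
  have "cnj (hip v w) = bl v (complex_mat G *v cv w)"
    by (simp add: hip_def bl_def cv_def matrix_vector_mult_def)
  also have "\<dots> = hip w v"
    using G by (subst bl_transpose) (simp add: hip_def real_posdef_def flip: complex_mat_transpose)
  finally show ?thesis ..
qed

private lemma \<beta>_eq: "\<beta> v w = bl (cv v) ((complex_mat G ** \<xi> ** complex_mat G) *v cv w)"
  by (simp add: \<beta>_def hip_def \<tau>_def matrix_vector_mul_assoc matrix_mul_assoc)

private lemma \<beta>_sym: "\<beta> v w = \<beta> w v"
proof -
  have "transpose (complex_mat G ** \<xi> ** complex_mat G) = complex_mat G ** \<xi> ** complex_mat G"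
    using G \<xi> by (simp add: matrix_transpose_mul matrix_mul_assoc real_posdef_def flip: complex_mat_transpose)
  then show ?thesis
    unfolding \<beta>_eq by (subst bl_transpose) simp
qed

private lemma \<beta>_simps: "\<beta> (x + x') y = \<beta> x y + \<beta> x' y" "\<beta> x (y + y') = \<beta> x y + \<beta> x y'"
  "\<beta> (c *s x) y = cnj c * \<beta> x y" "\<beta> x (c *s y) = cnj c * \<beta> x y"
  by (simp_all add: \<beta>_eq cv_simps bl_simps matrix_vector_right_distrib vector_scalar_commute)

private lemma hip_pos: "v \<noteq> 0 \<Longrightarrow> Re (hip v v) > 0"
proof -
  assume v: "v \<noteq> 0"
  define x y :: "real^'n" where "x = (\<chi> i. Re (v $ i))" and "y = (\<chi> i. Im (v $ i))"
  have "Re (hip v v) = x \<bullet> (G *v x) + y \<bullet> (G *v y)"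
    by (simp add: hip_def bl_def cv_def matrix_vector_mult_def inner_vec_def x_def y_def sum.distrib
        sum_distrib_left algebra_simps)
  moreover have "x \<noteq> 0 \<or> y \<noteq> 0"
    using v by (auto simp: x_def y_def vec_eq_iff complex_eq_iff)
  moreover have "z \<bullet> (G *v z) \<ge> 0" for z
    using G by (cases "z = 0") (auto simp: real_posdef_def less_imp_le)
  ultimately show ?thesis
    using G by (metis add_nonneg_pos add_pos_nonneg real_posdef_def)
qed

private lemma hip_self: "hip v v = complex_of_real (Re (hip v v))"
  using hip_cnj[of v v] by (metis Reals_cnj_iff of_real_Re)

text \<open>The orthogonal complement of the vectors found so far is invariant under
  \<open>\<tau>\<close>. A vector maximizing the quotient of \<open>Re (\<beta> w w)\<close> and
  \<open>Re (hip w w)\<close> on it satisfies \<open>\<tau> u = s u\<close>, because stationarity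
  makes \<open>\<tau> u - s u\<close> orthogonal to itself.\<close>

private lemma takagi_step:
  fixes I :: "'n set"
  assumes W: "\<And>i. i \<in> I \<Longrightarrow> \<tau> (v i) = complex_of_real (\<sigma> i) *s v i" and "k \<notin> I"
  obtains w s where "s \<ge> 0" "\<tau> w = complex_of_real s *s w" "hip w w = 1" "\<And>i. i \<in> I \<Longrightarrow> hip (v i) w = 0"
proof -
  define WW where "WW = {w. \<forall>i\<in>I. hip (v i) w = 0}"
  have \<tau>W: "\<tau> w \<in> WW" if "w \<in> WW" for w
  proof -
    have "hip (v i) (\<tau> w) = 0" if "i \<in> I" for i
    proof -
      have "hip (v i) (\<tau> w) = hip w (\<tau> (v i))"
        using \<beta>_sym by (simp add: \<beta>_def)
      also have "\<dots> = complex_of_real (\<sigma> i) * cnj (hip (v i) w)"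
        using W that hip_cnj[of w "v i"] by (simp add: hip_simps)
      finally show ?thesis
        using that \<open>w \<in> WW\<close> by (simp add: WW_def)
    qed
    then show ?thesis by (simp add: WW_def)
  qed
  define M :: "complex^'n^'n" where "M = (\<chi> i. if i \<in> I then transpose (complex_mat G) *v cv (v i) else 0)"
  have M: "(M *v w) $ i = (if i \<in> I then hip (v i) w else 0)" for w i
  proof -
    have "(M *v w) $ i = bl (M $ i) w"
      by (simp add: bl_def matrix_vector_mult_def)
    moreover have "bl (transpose (complex_mat G) *v cv (v i)) w = hip (v i) w"
      by (simp add: hip_def bl_transpose[of "cv (v i)"]) (simp add: bl_def mult.commute)
    ultimately show ?thesis by (simp add: M_def bl_def)
  qed
  have "det M = 0"
    by (rule det_zero_row(1)[of k]) (use \<open>k \<notin> I\<close> in \<open>auto simp: row_def M_def vec_eq_iff\<close>)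
  then obtain w0 where w0: "w0 \<noteq> 0" "M *v w0 = 0"
    using invertible_det_nz[of M] matrix_left_invertible_ker[of M] invertible_left_inverse[of M] by blast
  have w0W: "w0 \<in> WW"
    using M[of w0] w0(2) by (auto simp: WW_def) (metis zero_index)
  have WWs: "c *s w \<in> WW" if "w \<in> WW" for c w
    using that by (simp add: WW_def hip_simps)
  have WWr: "r *\<^sub>R w \<in> WW" if "w \<in> WW" for r w
  proof -
    have "r *\<^sub>R w = complex_of_real r *s w"
      by (simp add: vec_eq_iff) (simp add: scaleR_conv_of_real)
    then show ?thesis using WWs that by simp
  qed
  have cont_hip: "continuous_on UNIV (\<lambda>w. hip w' w)" for w'
    unfolding hip_def bl_def matrix_vector_mult_def by (intro continuous_intros)
  have cont_hh: "continuous_on UNIV (\<lambda>w. Re (hip w w))" and cont_\<beta>: "continuous_on UNIV (\<lambda>w. Re (\<beta> w w))"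
    unfolding \<beta>_eq hip_def bl_def cv_def matrix_vector_mult_def by (auto intro!: continuous_intros)
  define S where "S = WW \<inter> sphere 0 1"
  have "closed WW"
  proof -
    have "WW = (\<Inter>i\<in>I. {w. hip (v i) w = 0})"
      by (auto simp: WW_def)
    moreover have "closed {w. hip (v i) w = 0}" for i
      using continuous_closed_vimage[of "{0}" "hip (v i)"] cont_hip[of "v i"]
      by (simp add: vimage_def continuous_on_eq_continuous_at)
    ultimately show ?thesis by auto
  qed
  then have "compact S"
    unfolding S_def using compact_Int_closed[of "sphere 0 1" WW] by (simp add: Int_commute)
  moreover have "S \<noteq> {}"
    using WWr[OF w0W, of "1 / norm w0"] w0 by (auto simp: S_def)
  moreover have "continuous_on S (\<lambda>w. Re (\<beta> w w) / Re (hip w w))"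
  proof (intro continuous_on_divide continuous_on_subset[OF cont_\<beta>] continuous_on_subset[OF cont_hh])
    show "\<forall>w\<in>S. Re (hip w w) \<noteq> 0"
    proof
      fix w assume "w \<in> S"
      then have "w \<noteq> 0" by (auto simp: S_def)
      then show "Re (hip w w) \<noteq> 0"
        using hip_pos[of w] by simp
    qed
  qed auto
  ultimately obtain u where u: "u \<in> S" "\<And>w. w \<in> S \<Longrightarrow> Re (\<beta> w w) / Re (hip w w) \<le> Re (\<beta> u u) / Re (hip u u)"
    using continuous_attains_sup[of S] by blast
  define s where "s = Re (\<beta> u u) / Re (hip u u)"
  have u0: "u \<noteq> 0" "u \<in> WW"
    using u(1) by (auto simp: S_def)
  have scale: "Re (\<beta> (r *\<^sub>R w) (r *\<^sub>R w)) = r\<^sup>2 * Re (\<beta> w w)" "Re (hip (r *\<^sub>R w) (r *\<^sub>R w)) = r\<^sup>2 * Re (hip w w)"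
    for r w
  proof -
    have eq: "r *\<^sub>R w = complex_of_real r *s w"
      by (simp add: vec_eq_iff) (simp add: scaleR_conv_of_real)
    show "Re (\<beta> (r *\<^sub>R w) (r *\<^sub>R w)) = r\<^sup>2 * Re (\<beta> w w)" "Re (hip (r *\<^sub>R w) (r *\<^sub>R w)) = r\<^sup>2 * Re (hip w w)"
      unfolding eq by (simp_all add: \<beta>_simps hip_simps power2_eq_square)
  qed
  have max: "Re (\<beta> w w) \<le> s * Re (hip w w)" if "w \<in> WW" for w
  proof (cases "w = 0")
    case True
    then show ?thesis by (simp add: \<beta>_eq hip_def cv_simps bl_simps)
  next
    case False
    let ?w = "(1 / norm w) *\<^sub>R w"
    have "?w \<in> S"
      using WWr[OF that] False by (auto simp: S_def)
    then have "Re (\<beta> ?w ?w) / Re (hip ?w ?w) \<le> s"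
      using u(2) by (simp add: s_def)
    then have "Re (\<beta> w w) / Re (hip w w) \<le> s"
      using False unfolding scale by simp
    then show ?thesis
      using hip_pos[OF False] by (simp add: field_simps)
  qed
  have \<beta>u: "Re (\<beta> u u) = s * Re (hip u u)"
    using hip_pos[OF u0(1)] by (simp add: s_def)
  \<comment> \<open>Multiplication by the imaginary unit reverses the sign of
    \<open>\<beta> u u\<close> and preserves \<open>hip u u\<close>, so the maximum cannot be
    negative.\<close>
  have "s \<ge> 0"
  proof -
    have "Re (\<beta> (\<i> *s u) (\<i> *s u)) \<le> s * Re (hip (\<i> *s u) (\<i> *s u))"
      using max WWs u0 by blast
    then have "- (s * Re (hip u u)) \<le> s * Re (hip u u)"
      using \<beta>u by (simp add: \<beta>_simps hip_simps)
    then show ?thesis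
      using hip_pos[OF u0(1)] by (smt (verit) mult_neg_pos)
  qed
  define z where "z = \<tau> u - complex_of_real s *s u"
  have zW: "z \<in> WW"
    using \<tau>W[OF u0(2)] u0(2) by (auto simp: z_def WW_def hip_simps)
  \<comment> \<open>Stationarity of the maximizer in the direction \<open>w\<close>; it will be
    applied to \<open>w = z\<close>.\<close>
  have orth: "Re (\<beta> u w) = s * Re (hip u w)" if w: "w \<in> WW" for w
  proof -
    define b q where "b = 2 * (Re (\<beta> u w) - s * Re (hip u w))" and "q = Re (\<beta> w w) - s * Re (hip w w)"
    have ineq: "t * b + t\<^sup>2 * q \<le> 0" for t
    proof -
      have "u + t *\<^sub>R w \<in> WW"
        using u0(2) WWr[OF w, of t] by (simp add: WW_def hip_simps)
      from max[OF this] have "Re (\<beta> (u + complex_of_real t *s w) (u + complex_of_real t *s w))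
          \<le> s * Re (hip (u + complex_of_real t *s w) (u + complex_of_real t *s w))"
      proof -
        have "t *\<^sub>R w = complex_of_real t *s w"
          by (simp add: vec_eq_iff) (simp add: scaleR_conv_of_real)
        then show ?thesis using max[OF \<open>u + t *\<^sub>R w \<in> WW\<close>] by simp
      qed
      moreover have "Re (hip w u) = Re (hip u w)"
        by (subst hip_cnj) simp
      ultimately show ?thesis
        using \<beta>u \<beta>_sym[of w u]
        by (simp add: \<beta>_simps hip_simps b_def q_def power2_eq_square algebra_simps)
    qed
    have "b = 0"
    proof (rule ccontr)
      assume b: "b \<noteq> 0"
      \<comment> \<open>With this \<open>t\<close> the linear term outweighs the quadratic one,
        whatever the sign of \<open>q\<close>.\<close>
      define t where "t = b / (1 + \<bar>q\<bar>)"
      have "1 + \<bar>q\<bar> \<noteq> 0"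
        by linarith
      then have bt: "b = t * (1 + \<bar>q\<bar>)"
        by (simp add: t_def)
      have "t * b + t\<^sup>2 * q = t\<^sup>2 * ((1 + \<bar>q\<bar>) + q)"
        by (subst bt) (simp add: algebra_simps power2_eq_square)
      moreover have "t\<^sup>2 * ((1 + \<bar>q\<bar>) + q) > 0"
        using b bt by (intro mult_pos_pos) (auto simp: add_pos_nonneg)
      ultimately show False
        using ineq[of t] by simp
    qed
    then show ?thesis by (simp add: b_def)
  qed
  have "Re (hip z z) = Re (hip z (\<tau> u)) - s * Re (hip z u)"
    by (simp add: z_def hip_simps)
  also have "\<dots> = Re (\<beta> u z) - s * Re (hip u z)"
    using \<beta>_sym[of z u] hip_cnj[of z u] by (simp add: \<beta>_def)
  finally have "z = 0"
    using orth[OF zW] hip_pos[of z] by fastforce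
  then have \<tau>u: "\<tau> u = complex_of_real s *s u"
    by (simp add: z_def)
  define c where "c = complex_of_real (1 / sqrt (Re (hip u u)))"
  have cc: "cnj c = c" "c * c * hip u u = 1"
  proof -
    define r where "r = Re (hip u u)"
    have "hip u u = complex_of_real r" "r > 0"
      using hip_self[of u] hip_pos[OF u0(1)] by (auto simp: r_def)
    then have "c * c * hip u u = complex_of_real (1 / sqrt r * (1 / sqrt r) * r)"
      unfolding c_def r_def[symmetric] by (simp only: of_real_mult)
    also have "1 / sqrt r * (1 / sqrt r) * r = 1"
      using \<open>r > 0\<close> by simp
    finally show "c * c * hip u u = 1" by simp
  qed (simp add: c_def)
  show ?thesis
  proof (rule that[of s "c *s u"])
    show "\<tau> (c *s u) = complex_of_real s *s (c *s u)"
    proof -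
      have "\<tau> (c *s u) = cnj c *s \<tau> u"
        by (simp add: \<tau>_def cv_simps vector_scalar_commute)
      then show ?thesis
        by (simp add: \<tau>u cc vec_eq_iff mult_ac)
    qed
    show "hip (c *s u) (c *s u) = 1"
      using cc by (simp add: hip_simps mult_ac)
    show "hip (v i) (c *s u) = 0" if "i \<in> I" for i
      using u0(2) that by (simp add: WW_def hip_simps)
  qed (use \<open>s \<ge> 0\<close> in auto)
qed

private lemma takagi_basis:
  "\<exists>v \<sigma>. (\<forall>i\<in>I. \<sigma> i \<ge> 0 \<and> \<tau> (v i) = complex_of_real (\<sigma> i) *s v i) \<and>
     (\<forall>i\<in>I. \<forall>j\<in>I. hip (v i) (v j) = (if i = j then 1 else 0))" for I :: "'n set"
  using finite[of I]
proof (induction I rule: finite_induct)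
  case (insert k I)
  obtain v \<sigma> where "\<forall>i\<in>I. \<sigma> i \<ge> 0 \<and> \<tau> (v i) = complex_of_real (\<sigma> i) *s v i"
    "\<forall>i\<in>I. \<forall>j\<in>I. hip (v i) (v j) = (if i = j then 1 else 0)"
    using insert.IH by (elim exE conjE)
  then have v: "\<And>i. i \<in> I \<Longrightarrow> \<sigma> i \<ge> 0" "\<And>i. i \<in> I \<Longrightarrow> \<tau> (v i) = complex_of_real (\<sigma> i) *s v i"
    "\<And>i j. i \<in> I \<Longrightarrow> j \<in> I \<Longrightarrow> hip (v i) (v j) = (if i = j then 1 else 0)"
    by simp_all
  obtain w s where w: "s \<ge> 0" "\<tau> w = complex_of_real s *s w" "hip w w = 1" "\<And>i. i \<in> I \<Longrightarrow> hip (v i) w = 0"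
    by (rule takagi_step[of I v \<sigma> k]) (use v(2) insert.hyps in auto)
  have "hip w (v i) = 0" if "i \<in> I" for i
    using w(4)[OF that] hip_cnj[of w "v i"] by simp
  then show ?case
    using v w insert.hyps
    by (intro exI[of _ "v(k := w)"] exI[of _ "\<sigma>(k := s)"]) (simp split: if_splits)
qed auto

text \<open>The basis vectors are the columns of \<open>V\<close>. Their \<open>\<beta>\<close>
  pairings say that \<open>G \<xi> G\<close> becomes diagonal after multiplication by
  \<open>hconj V\<close> and \<open>map_matrix cnj V\<close>; the orthonormality relation then
  inverts both sides and recovers \<open>\<xi>\<close>.\<close>

lemma takagi: "\<exists>V \<sigma>. frame G \<xi> V \<sigma>"
proof -
  obtain v :: "'n \<Rightarrow> complex^'n" and \<sigma> :: "'n \<Rightarrow> real"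
    where v: "\<And>i. \<sigma> i \<ge> 0" "\<And>i. \<tau> (v i) = complex_of_real (\<sigma> i) *s v i"
    "\<And>i j. hip (v i) (v j) = (if i = j then 1 else 0)"
  proof -
    from takagi_basis[of UNIV] show thesis
    proof (elim exE conjE)
      fix v :: "'n \<Rightarrow> complex^'n" and \<sigma> :: "'n \<Rightarrow> real"
      assume "\<forall>i\<in>UNIV. \<sigma> i \<ge> 0 \<and> \<tau> (v i) = complex_of_real (\<sigma> i) *s v i"
        "\<forall>i\<in>UNIV. \<forall>j\<in>UNIV. hip (v i) (v j) = (if i = j then 1 else 0)"
      then show thesis
        by (intro that[of \<sigma> v]) simp_all
    qed
  qed
  define V :: "complex^'n^'n" where "V = (\<chi> a i. v i $ a)"
  have hip_nth: "hip (v i) (v j) = (hconj V ** complex_mat G ** V) $ i $ j" for i j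
    by (simp add: hip_def bl_def cv_def V_def hconj_def transpose_def matrix_mul_assoc[symmetric])
      (simp add: matrix_matrix_mult_def matrix_vector_mult_def)
  have \<beta>_nth: "\<beta> (v i) (v j) = (hconj V ** (complex_mat G ** \<xi> ** complex_mat G) ** map_matrix cnj V) $ i $ j" for i j
    unfolding \<beta>_eq matrix_mul_assoc[symmetric, of "hconj V"]
    by (simp add: bl_def cv_def V_def hconj_def transpose_def matrix_matrix_mult_def[of "\<chi> i j. cnj (v i $ j)"])
      (simp add: matrix_matrix_mult_def matrix_vector_mult_def)
  have 1: "hconj V ** complex_mat G ** V = mat 1"
    using v(3) by (simp add: vec_eq_iff hip_nth[symmetric] mat_def)
  have 2: "hconj V ** (complex_mat G ** \<xi> ** complex_mat G) ** map_matrix cnj V = dg (\<lambda>i. complex_of_real (\<sigma> i))"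
  proof -
    have "\<beta> (v i) (v j) = complex_of_real (\<sigma> j) * (if i = j then 1 else 0)" for i j
      by (simp only: \<beta>_def v hip_simps)
    then show ?thesis
      by (simp add: vec_eq_iff \<beta>_nth[symmetric] dg_def)
  qed
  have 3: "V ** hconj V ** complex_mat G = mat 1"
    using 1 matrix_left_right_inverse[of "hconj V ** complex_mat G" V] by (simp add: matrix_mul_assoc)
  have "transpose (V ** hconj V ** complex_mat G) = mat 1"
    by (simp add: 3)
  then have 4: "complex_mat G ** map_matrix cnj V ** transpose V = mat 1"
    using G by (simp add: matrix_transpose_mul matrix_mul_assoc hconj_def real_posdef_def flip: complex_mat_transpose)
  have "V ** dg (\<lambda>i. complex_of_real (\<sigma> i)) ** transpose V =
      (V ** hconj V ** complex_mat G) ** \<xi> ** (complex_mat G ** map_matrix cnj V ** transpose V)"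
    unfolding 2[symmetric] by (simp add: matrix_mul_assoc)
  then have "\<xi> = V ** dg (\<lambda>i. complex_of_real (\<sigma> i)) ** transpose V"
    using 3 4 by simp
  then show ?thesis
    using 1 v(1) unfolding frame_def by blast
qed

end

section \<open>The integrand as a function of the Hessian\<close>

definition hm :: "real^'n^'n \<Rightarrow> complex^'n^'n \<Rightarrow> complex^'n^'n" where
  "hm G \<xi> = \<xi> ** complex_mat G ** map_matrix cnj \<xi> ** complex_mat G"

definition rt :: "real^'n^'n \<Rightarrow> complex^'n^'n \<Rightarrow> complex^'n^'n" where
  "rt G \<xi> = matrix_sqrt (mat 1 - hm G \<xi>)"

definition Hm :: "real^'n^'n \<Rightarrow> complex^'n^'n \<Rightarrow> complex^'n^'n" where
  "Hm G \<xi> = rt G \<xi> ** complex_mat (matrix_inv G)"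

definition phi :: "real^'n^'n \<Rightarrow> complex^'n^'n \<Rightarrow> real" where
  "phi G \<xi> = - ln (det G) + rho (hm G \<xi>)"

text \<open>The pointwise content of admissibility for a Hessian \<open>G\<close> and a value
  \<open>\<xi>\<close> of the Higgs tensor.\<close>

definition good :: "real^'n^'n \<Rightarrow> complex^'n^'n \<Rightarrow> bool" where
  "good G \<xi> \<longleftrightarrow> real_posdef G \<and> transpose \<xi> = \<xi> \<and> (\<forall>x. eigenvalue (hm G \<xi>) x \<longrightarrow> cmod x < 1)"

lemma real_posdef_invertible: "real_posdef G \<Longrightarrow> invertible (G::real^'n^'n)"
  unfolding invertible_left_inverse matrix_left_invertible_ker real_posdef_def
  by (metis inner_zero_right less_irrefl)

lemma invertible_inv_mult: "invertible G \<Longrightarrow> matrix_inv G ** G = mat 1" "invertible G \<Longrightarrow> G ** matrix_inv G = mat 1"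
  for G :: "real^'n^'n"
  unfolding matrix_inv_def invertible_def by (auto dest!: someI_ex)

locale nframe =
  fixes G :: "real^'n^'n" and \<xi> V :: "complex^'n^'n" and \<sigma> :: "'n \<Rightarrow> real"
  assumes pd: "real_posdef G" and fr: "frame G \<xi> V \<sigma>"
begin

text \<open>The inverse of \<open>V\<close>, by the normalization in \<open>frame\<close>.\<close>

definition W where "W = hconj V ** complex_mat G"

lemma Gsym: "transpose G = G"
  using pd by (simp add: real_posdef_def)

lemma VGV: "hconj V ** complex_mat G ** V = mat 1"
  using fr by (simp add: frame_def)

sublocale diagonalization V W
proof
  show "W ** V = mat 1" using VGV by (simp add: W_def)
  then show "V ** W = mat 1" by (rule matrix_left_right_inverse[THEN iffD1])
qed

lemma VtGV: "transpose V ** complex_mat G ** map_matrix cnj V = mat 1"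
  using arg_cong[OF VGV, of "map_matrix cnj"] by (simp add: map_matrix_cnj_mult cnj_hconj)

lemma invG: "invertible G"
  using pd by (rule real_posdef_invertible)

lemma ginv: "complex_mat (matrix_inv G) = V ** hconj V"
proof -
  have "complex_mat (matrix_inv G) = V ** hconj V ** complex_mat G ** complex_mat (matrix_inv G)"
    using VW by (simp add: W_def matrix_mul_assoc)
  also have "\<dots> = V ** hconj V ** complex_mat (G ** matrix_inv G)"
    by (simp add: complex_mat_mult matrix_mul_assoc)
  finally show ?thesis
    by (simp add: invertible_inv_mult[OF invG])
qed

lemma hconj_W: "hconj W = complex_mat G ** V"
  using Gsym by (simp add: W_def hconj_mult hconj_complex_mat)

lemma G_W: "complex_mat G = hconj W ** W"
proof -
  have "hconj W ** W = complex_mat G ** (V ** W)"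
    by (simp add: hconj_W matrix_mul_assoc)
  then show ?thesis by (simp add: VW)
qed

lemma \<xi>_eq: "\<xi> = V ** dg (\<lambda>i. complex_of_real (\<sigma> i)) ** transpose V"
  using fr by (simp add: frame_def)

lemma \<sigma>_nonneg: "0 \<le> \<sigma> i"
  using fr by (simp add: frame_def)

lemma \<xi>G\<xi>_eq: "\<xi> ** complex_mat G ** map_matrix cnj \<xi> =
    V ** dg (\<lambda>i. complex_of_real ((\<sigma> i)\<^sup>2)) ** hconj V"
proof -
  have "\<xi> ** complex_mat G ** map_matrix cnj \<xi> =
    V ** dg (\<lambda>i. complex_of_real (\<sigma> i)) ** (transpose V ** complex_mat G ** map_matrix cnj V)
      ** dg (\<lambda>i. complex_of_real (\<sigma> i)) ** hconj V"
    unfolding \<xi>_eq by (simp add: map_matrix_cnj_mult cnj_dg matrix_mul_assoc hconj_def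
        flip: map_matrix_cnj_transpose)
  also have "\<dots> = V ** (dg (\<lambda>i. complex_of_real (\<sigma> i)) ** dg (\<lambda>i. complex_of_real (\<sigma> i))) ** hconj V"
    by (simp add: VtGV matrix_mul_assoc)
  finally show ?thesis
    by (simp add: dg_mult power2_eq_square)
qed

lemma hm_eq: "hm G \<xi> = D (\<lambda>i. complex_of_real ((\<sigma> i)\<^sup>2))"
  unfolding D_def by (simp add: hm_def \<xi>G\<xi>_eq W_def matrix_mul_assoc)

lemma eigenvalue_hm: "eigenvalue (hm G \<xi>) x \<longleftrightarrow> (\<exists>i. x = complex_of_real ((\<sigma> i)\<^sup>2))"
  by (auto simp: hm_eq eigenvalue_D)

text \<open>Determinants in \<open>VGV\<close> give that \<open>det G\<close> times the squared
  modulus of \<open>det V\<close> is one.\<close>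

lemma det_G: "det G > 0"
proof -
  have "det (hconj V) * complex_of_real (det G) * det V = 1"
  proof -
    have "det (complex_mat G) = complex_of_real (det G)"
      by (simp add: det_def)
    then show ?thesis
      using arg_cong[OF VGV, of det] by (simp add: det_mul)
  qed
  moreover have "det (hconj V) = cnj (det V)"
    by (simp add: hconj_def) (simp add: det_def)
  ultimately have "complex_of_real (det G) * (cnj (det V) * det V) = 1"
    by (simp add: mult_ac)
  moreover have "cnj (det V) * det V = complex_of_real ((cmod (det V))\<^sup>2)"
    by (metis complex_norm_square mult.commute)
  ultimately have "complex_of_real (det G * (cmod (det V))\<^sup>2) = complex_of_real 1"
    by simp
  then have "det G * (cmod (det V))\<^sup>2 = 1"
    using of_real_eq_iff by blast
  then show ?thesis
    by (metis mult_eq_0_iff not_less_iff_gr_or_eq zero_le_power2 zero_less_mult_iff zero_less_one not_le)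
qed

text \<open>The inverse of \<open>G\<close> is \<open>V ** hconj V\<close>, so its diagonal holds
  the squared norms of the rows of \<open>V\<close>. This bounds frames uniformly while
  \<open>G\<close> varies, although they are chosen without any continuity.\<close>

lemma V_entry: "(cmod (V $ a $ i))\<^sup>2 \<le> matrix_inv G $ a $ a"
proof -
  have "complex_of_real (matrix_inv G $ a $ a) = (V ** hconj V) $ a $ a"
    using ginv by (metis nth_map_matrix)
  also have "\<dots> = (\<Sum>i\<in>UNIV. V $ a $ i * cnj (V $ a $ i))"
    by (simp add: matrix_matrix_mult_def hconj_def transpose_def)
  also have "\<dots> = complex_of_real (\<Sum>i\<in>UNIV. (cmod (V $ a $ i))\<^sup>2)"
    by (simp only: complex_norm_square[symmetric] of_real_sum)
  finally have "matrix_inv G $ a $ a = (\<Sum>i\<in>UNIV. (cmod (V $ a $ i))\<^sup>2)"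
    using of_real_eq_iff by blast
  then show ?thesis
    using member_le_sum[of i UNIV "\<lambda>i. (cmod (V $ a $ i))\<^sup>2"] by simp
qed

end

lemma good_frame:
  assumes "good G \<xi>"
  obtains V \<sigma> where "nframe G \<xi> V \<sigma>" "\<And>i. \<sigma> i < 1"
proof -
  obtain V \<sigma> where F: "frame G \<xi> V \<sigma>"
    using takagi[of G \<xi>] assms by (auto simp: good_def)
  then interpret nframe G \<xi> V \<sigma>
    using assms by unfold_locales (auto simp: good_def)
  have "\<sigma> i < 1" for i
  proof -
    have "cmod (complex_of_real ((\<sigma> i)\<^sup>2)) < 1"
      using assms eigenvalue_hm unfolding good_def by blast
    then have "(\<sigma> i)\<^sup>2 < 1\<^sup>2" by (simp del: of_real_power)
    then show ?thesis by (rule power2_less_imp_less) simp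
  qed
  then show ?thesis
    using that nframe_axioms by blast
qed

locale hframe = nframe G \<xi> V \<sigma>
  for G :: "real^'n^'n" and \<xi> V :: "complex^'n^'n" and \<sigma> :: "'n \<Rightarrow> real" +
  assumes lt: "\<And>i. \<sigma> i < 1"
begin

definition s where "s i = sqrt (1 - (\<sigma> i)\<^sup>2)"

lemma \<sigma>2: "(\<sigma> i)\<^sup>2 < 1"
  using lt[of i] \<sigma>_nonneg[of i] by (simp add: power_less_one_iff abs_square_less_1)

lemma s_bounds: "0 < s i" "s i \<le> 1" "(s i)\<^sup>2 = 1 - (\<sigma> i)\<^sup>2"
  using \<sigma>2[of i] by (auto simp: s_def)

lemma one_hm: "mat 1 - hm G \<xi> = D (\<lambda>i. complex_of_real (1 - (\<sigma> i)\<^sup>2))"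
  by (simp add: hm_eq D_diff flip: D_one)

lemma rt_eq: "rt G \<xi> = D (\<lambda>i. complex_of_real (s i))"
  unfolding rt_def one_hm s_def using \<sigma>2 by (intro matrix_sqrt_D) simp

lemma rt_sq: "rt G \<xi> ** rt G \<xi> = mat 1 - hm G \<xi>"
  using s_bounds(3) by (simp add: rt_eq one_hm D_mult power2_eq_square flip: of_real_mult)

lemma Hm_eq: "Hm G \<xi> = V ** dg (\<lambda>i. complex_of_real (s i)) ** hconj V"
proof -
  have "Hm G \<xi> = V ** dg (\<lambda>i. complex_of_real (s i)) ** (W ** V) ** hconj V"
    by (simp add: Hm_def rt_eq ginv D_def matrix_mul_assoc)
  then show ?thesis by (simp add: WV)
qed

lemma hconj_Hm: "hconj (Hm G \<xi>) = Hm G \<xi>"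
  by (simp add: Hm_eq hconj_mult hconj_dg matrix_mul_assoc)

lemma rho_eq: "rho (hm G \<xi>) = (\<Sum>i\<in>UNIV. hk_fun ((\<sigma> i)\<^sup>2))"
  by (simp add: rho_def hm_eq matrix_fun_D trace_D del: of_real_power)

text \<open>Each summand is \<open>1 - s + ln (1 + s)\<close> with \<open>s\<close> between 0 and 1.
  The bound does not depend on the point, so the \<open>rho\<close> integral of the energy
  converges.\<close>

lemma rho_bound: "\<bar>rho (hm G \<xi>)\<bar> \<le> 2 * real CARD('n)"
proof -
  have "\<bar>hk_fun ((\<sigma> i)\<^sup>2)\<bar> \<le> 2" for i
  proof -
    have "ln (1 + s i) \<le> s i" "0 \<le> ln (1 + s i)"
      using s_bounds[of i] by (auto intro: ln_add_one_self_le_self)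
    then show ?thesis
      using s_bounds[of i] by (simp add: hk_fun_def flip: s_def)
  qed
  then have "\<bar>\<Sum>i\<in>UNIV. hk_fun ((\<sigma> i)\<^sup>2)\<bar> \<le> (\<Sum>i\<in>(UNIV::'n set). 2)"
    by (intro order_trans[OF sum_abs] sum_mono)
  then show ?thesis by (simp add: rho_eq)
qed

lemma det_one_rt: "det (mat 1 + rt G \<xi>) = complex_of_real (\<Prod>i\<in>UNIV. 1 + s i)"
  by (simp add: rt_eq D_add det_D flip: D_one)

text \<open>Trace and determinant of the root replace the sum over eigenvalues, so that the
  derivative can be taken without following individual eigenvalues.\<close>

lemma phi_eq: "phi G \<xi> = CARD('n) - ln (det G) - Re (trace (rt G \<xi>)) + ln (Re (det (mat 1 + rt G \<xi>)))"
proof -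
  have "ln (\<Prod>i\<in>UNIV. 1 + s i) = (\<Sum>i\<in>UNIV. ln (1 + s i))"
  proof (rule ln_prod)
    show "1 + s i \<noteq> 0" for i
      using s_bounds(1)[of i] by linarith
  qed simp
  then show ?thesis
    unfolding phi_def rho_eq det_one_rt Re_complex_of_real
    by (simp add: rt_eq trace_D hk_fun_def sum.distrib sum_subtractf flip: s_def)
qed

text \<open>Reduces inequalities between real parts of matrices that are diagonal in one frame to
  inequalities between their diagonal entries.\<close>

lemma hermitian_quad:
  fixes a :: "real^'n" and d :: "'n \<Rightarrow> real"
  defines "c \<equiv> (\<lambda>i. \<Sum>k\<in>UNIV. complex_of_real (a $ k) * V $ k $ i)"
  shows "(\<Sum>k\<in>UNIV. \<Sum>l\<in>UNIV. a $ k * Re ((V ** dg (\<lambda>i. complex_of_real (d i)) ** hconj V) $ k $ l) * a $ l)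
    = (\<Sum>i\<in>UNIV. d i * (cmod (c i))\<^sup>2)"
proof -
  have "complex_of_real (\<Sum>i\<in>UNIV. d i * (cmod (c i))\<^sup>2) = (\<Sum>i\<in>UNIV. of_real (d i) * (c i * cnj (c i)))"
    by (simp only: of_real_sum of_real_mult complex_norm_square)
  also have "\<dots> = (\<Sum>i\<in>UNIV. \<Sum>k\<in>UNIV. \<Sum>l\<in>UNIV. of_real (a $ k) * (V $ k $ i * of_real (d i) * cnj (V $ l $ i)) * of_real (a $ l))"
  proof (rule sum.cong[OF refl])
    fix i
    have "c i * cnj (c i) = (\<Sum>k\<in>UNIV. \<Sum>l\<in>UNIV.
        (of_real (a $ k) * V $ k $ i) * (of_real (a $ l) * cnj (V $ l $ i)))"
      unfolding c_def cnj_sum complex_cnj_mult complex_cnj_complex_of_real by (rule sum_product)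
    then show "complex_of_real (d i) * (c i * cnj (c i)) = (\<Sum>k\<in>UNIV. \<Sum>l\<in>UNIV.
        of_real (a $ k) * (V $ k $ i * of_real (d i) * cnj (V $ l $ i)) * of_real (a $ l))"
      by (simp only: sum_distrib_left) (simp add: mult_ac)
  qed
  also have "\<dots> = (\<Sum>k\<in>UNIV. \<Sum>i\<in>UNIV. \<Sum>l\<in>UNIV. of_real (a $ k) * (V $ k $ i * of_real (d i) * cnj (V $ l $ i)) * of_real (a $ l))"
    by (rule sum.swap)
  also have "\<dots> = (\<Sum>k\<in>UNIV. \<Sum>l\<in>UNIV. \<Sum>i\<in>UNIV. of_real (a $ k) * (V $ k $ i * of_real (d i) * cnj (V $ l $ i)) * of_real (a $ l))"
    by (intro sum.cong refl sum.swap)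
  also have "\<dots> = (\<Sum>k\<in>UNIV. \<Sum>l\<in>UNIV. of_real (a $ k) * (V ** dg (\<lambda>i. complex_of_real (d i)) ** hconj V) $ k $ l * of_real (a $ l))"
    unfolding matrix_matrix_mult_def[of "V ** _"]
    by (simp add: mult_dg_nth hconj_def transpose_def sum_distrib_left sum_distrib_right)
  finally have "Re (complex_of_real (\<Sum>i\<in>UNIV. d i * (cmod (c i))\<^sup>2)) = Re \<dots>"
    by simp
  then show ?thesis by (simp add: Re_complex_of_real)
qed

end

lemma good_hframe:
  assumes "good G \<xi>"
  obtains V \<sigma> where "hframe G \<xi> V \<sigma>"
  using good_frame[OF assms] by (metis hframe.intro hframe_axioms.intro)

section \<open>Monotonicity of the differential\<close>

lemma trace_frame_product:
  "trace (V ** dg (\<lambda>i. complex_of_real (d i)) ** hconj V ** (hconj W ** W)) =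
    complex_of_real (\<Sum>j\<in>UNIV. \<Sum>i\<in>UNIV. d i * (cmod ((W ** V) $ j $ i))\<^sup>2)"
proof -
  have "trace (V ** dg (\<lambda>i. complex_of_real (d i)) ** hconj V ** (hconj W ** W)) =
      trace (W ** V ** dg (\<lambda>i. complex_of_real (d i)) ** hconj (W ** V))"
    using trace_mul_sym[of "V ** dg (\<lambda>i. complex_of_real (d i)) ** hconj V ** hconj W" W]
    by (simp add: hconj_mult matrix_mul_assoc)
  also have "\<dots> = (\<Sum>j\<in>UNIV. \<Sum>i\<in>UNIV. of_real (d i) * ((W ** V) $ j $ i * cnj ((W ** V) $ j $ i)))"
    unfolding trace_def matrix_matrix_mult_def[of "W ** V ** _"]
    by (simp add: mult_dg_nth) (simp add: hconj_def transpose_def mult_ac)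
  also have "\<dots> = (\<Sum>j\<in>UNIV. \<Sum>i\<in>UNIV. of_real (d i) * of_real ((cmod ((W ** V) $ j $ i))\<^sup>2))"
    by (simp only: complex_norm_square)
  finally show ?thesis by simp
qed

text \<open>With \<open>X\<close> and \<open>Z\<close> the moduli, the claim follows from
  \<open>(X - Z) * (s * X - t * Z) \<ge> 0\<close>. The relation \<open>X * a = b * Z\<close> ties
  the order of \<open>X\<close> and \<open>Z\<close> to that of \<open>b\<close> and
  \<open>a\<close>; as \<open>s\<close> and \<open>t\<close> decrease in \<open>a\<close> and
  \<open>b\<close>, both factors have the same sign.\<close>

lemma monotone_term:
  fixes x z :: complex and a b s t :: real
  assumes "x * of_real a = of_real b * z" "0 \<le> a" "a < 1" "0 \<le> b" "b < 1"
    and s: "s = sqrt (1 - a\<^sup>2)" and t: "t = sqrt (1 - b\<^sup>2)"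
  shows "(s + t) * Re (x * z) \<le> s * (cmod x)\<^sup>2 + t * (cmod z)\<^sup>2"
proof -
  define X Z where "X = cmod x" and "Z = cmod z"
  have XZ: "X \<ge> 0" "Z \<ge> 0" "X * a = b * Z"
    using arg_cong[OF assms(1), of cmod] assms(2,4) by (auto simp: X_def Z_def norm_mult)
  have "a\<^sup>2 < 1" "b\<^sup>2 < 1"
    using assms(2-5) by (auto simp: abs_square_less_1)
  then have st: "s \<ge> 0" "t \<ge> 0"
    by (auto simp: s t)
  have "(X - Z) * (s * X - t * Z) \<ge> 0"
  proof (cases "a = 0 \<or> b = 0")
    case True
    then consider "a = 0" "b = 0" | "a = 0" "Z = 0" | "b = 0" "X = 0"
      using XZ(3) by auto
    then show ?thesis
    proof cases
      case 1
      then have "s = 1" "t = 1" by (auto simp: s t)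
      then show ?thesis by (simp flip: power2_eq_square)
    next
      case 2
      then show ?thesis using XZ st by simp
    next
      case 3
      then show ?thesis using XZ st by simp
    qed
  next
    case False
    then have ab: "a > 0" "b > 0" using assms(2,4) by auto
    show ?thesis
    proof (cases "a \<le> b")
      case True
      then have "s \<ge> t" using ab by (auto simp: s t intro: power_mono)
      moreover have "Z \<le> X"
      proof -
        have "b * Z \<le> b * X" using XZ True by (metis mult.commute mult_left_mono)
        then show ?thesis using ab by simp
      qed
      ultimately have "t * Z \<le> s * X" using XZ st by (intro mult_mono) auto
      then show ?thesis using \<open>Z \<le> X\<close> by simp
    next
      case False
      then have "s \<le> t" using ab by (auto simp: s t intro: power_mono)
      moreover have "X \<le> Z"
      proof -
        have "a * X \<le> a * Z" using XZ False by (metis mult.commute mult_left_mono less_imp_le not_le)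
        then show ?thesis using ab by simp
      qed
      ultimately have "s * X \<le> t * Z" using XZ st by (intro mult_mono) auto
      then show ?thesis using \<open>X \<le> Z\<close> by (simp add: mult_nonpos_nonpos)
    qed
  qed
  moreover have "Re (x * z) \<le> X * Z"
    using complex_Re_le_cmod[of "x * z"] by (simp add: X_def Z_def norm_mult)
  then have "(s + t) * Re (x * z) \<le> (s + t) * (X * Z)"
    using st by (intro mult_left_mono) auto
  ultimately show ?thesis
    by (simp add: X_def Z_def power2_eq_square algebra_simps)
qed

text \<open>The transition matrices \<open>X\<close> and \<open>Z\<close> between the two frames are
  inverse to each other. Writing the same \<open>\<xi>\<close> in both frames relates entry
  \<open>(j, i)\<close> of \<open>X\<close> to entry \<open>(i, j)\<close> of \<open>Z\<close> as
  \<open>monotone_term\<close> requires, and the four traces become sums over such pairs.\<close>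

lemma Hm_monotone:
  assumes "good G \<xi>" "good G' \<xi>"
  shows "Re (trace ((Hm G \<xi> - Hm G' \<xi>) ** (complex_mat G - complex_mat G'))) \<le> 0"
proof -
  obtain V \<sigma> where "hframe G \<xi> V \<sigma>"
    using good_hframe[OF assms(1)] .
  then interpret A: hframe G \<xi> V \<sigma> .
  obtain V' \<sigma>' where "hframe G' \<xi> V' \<sigma>'"
    using good_hframe[OF assms(2)] .
  then interpret B: hframe G' \<xi> V' \<sigma>' .
  define X Z where "X = B.W ** V" and "Z = A.W ** V'"
  have XZ: "X ** Z = mat 1" "Z ** X = mat 1"
  proof -
    have "X ** Z = B.W ** (V ** A.W) ** V'" "Z ** X = A.W ** (V' ** B.W) ** V"
      by (simp_all add: X_def Z_def matrix_mul_assoc)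
    then show "X ** Z = mat 1" "Z ** X = mat 1"
      by (simp_all add: A.VW B.VW A.WV B.WV)
  qed
  have rel: "X $ j $ i * of_real (\<sigma> i) = of_real (\<sigma>' j) * Z $ i $ j" for i j
  proof -
    have "B.W ** V ** dg (\<lambda>i. complex_of_real (\<sigma> i)) ** transpose (A.W ** V)
        = B.W ** \<xi> ** transpose A.W"
      by (subst A.\<xi>_eq) (simp add: matrix_transpose_mul matrix_mul_assoc)
    also have "\<dots> = (B.W ** V') ** dg (\<lambda>i. complex_of_real (\<sigma>' i)) ** transpose (A.W ** V')"
      by (subst B.\<xi>_eq) (simp add: matrix_transpose_mul matrix_mul_assoc)
    finally have "X ** dg (\<lambda>i. complex_of_real (\<sigma> i)) = dg (\<lambda>i. complex_of_real (\<sigma>' i)) ** transpose Z"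
      by (simp add: A.WV B.WV X_def Z_def)
    then have "(X ** dg (\<lambda>i. complex_of_real (\<sigma> i))) $ j $ i = (dg (\<lambda>i. complex_of_real (\<sigma>' i)) ** transpose Z) $ j $ i"
      by simp
    then show ?thesis
      by (simp add: mult_dg_nth dg_mult_nth transpose_def)
  qed
  have t1: "trace (Hm G \<xi> ** complex_mat G) = of_real (\<Sum>i\<in>UNIV. A.s i)"
  proof -
    have "Hm G \<xi> ** complex_mat G = A.D (\<lambda>i. complex_of_real (A.s i))"
      unfolding A.D_def by (simp add: A.Hm_eq A.W_def matrix_mul_assoc)
    then show ?thesis by (simp add: A.trace_D)
  qed
  have t2: "trace (Hm G' \<xi> ** complex_mat G') = of_real (\<Sum>i\<in>UNIV. B.s i)"
  proof -
    have "Hm G' \<xi> ** complex_mat G' = B.D (\<lambda>i. complex_of_real (B.s i))"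
      unfolding B.D_def by (simp add: B.Hm_eq B.W_def matrix_mul_assoc)
    then show ?thesis by (simp add: B.trace_D)
  qed
  have t3: "trace (Hm G \<xi> ** complex_mat G') = of_real (\<Sum>j\<in>UNIV. \<Sum>i\<in>UNIV. A.s i * (cmod (X $ j $ i))\<^sup>2)"
    by (simp only: A.Hm_eq B.G_W trace_frame_product X_def)
  have t4: "trace (Hm G' \<xi> ** complex_mat G) = of_real (\<Sum>i\<in>UNIV. \<Sum>j\<in>UNIV. B.s j * (cmod (Z $ i $ j))\<^sup>2)"
    by (simp only: B.Hm_eq A.G_W trace_frame_product Z_def)
  \<comment> \<open>The diagonals of \<open>X ** Z = mat 1\<close> and \<open>Z ** X = mat 1\<close>
    turn the single sums of \<open>s\<close> into double sums over pairs of entries, to match the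
    cross traces.\<close>
  have one1: "Re (\<Sum>i\<in>UNIV. X $ j $ i * Z $ i $ j) = 1" for j
    using arg_cong[OF XZ(1), of "\<lambda>M. M $ j $ j"] by (simp add: matrix_matrix_mult_def mat_def)
  have one2: "Re (\<Sum>j\<in>UNIV. Z $ i $ j * X $ j $ i) = 1" for i
    using arg_cong[OF XZ(2), of "\<lambda>M. M $ i $ i"] by (simp add: matrix_matrix_mult_def mat_def)
  have "(\<Sum>i\<in>UNIV. A.s i) + (\<Sum>j\<in>UNIV. B.s j) =
      (\<Sum>i\<in>UNIV. A.s i * Re (\<Sum>j\<in>UNIV. Z $ i $ j * X $ j $ i)) + (\<Sum>j\<in>UNIV. B.s j * Re (\<Sum>i\<in>UNIV. X $ j $ i * Z $ i $ j))"
    by (simp only: one1 one2 mult_1_right)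
  also have "\<dots> = (\<Sum>i\<in>UNIV. \<Sum>j\<in>UNIV. A.s i * Re (X $ j $ i * Z $ i $ j)) + (\<Sum>j\<in>UNIV. \<Sum>i\<in>UNIV. B.s j * Re (X $ j $ i * Z $ i $ j))"
    by (simp only: Re_sum sum_distrib_left mult.commute[of "Z $ _ $ _"])
  also have "(\<Sum>i\<in>UNIV. \<Sum>j\<in>UNIV. A.s i * Re (X $ j $ i * Z $ i $ j)) = (\<Sum>j\<in>UNIV. \<Sum>i\<in>UNIV. A.s i * Re (X $ j $ i * Z $ i $ j))"
    by (rule sum.swap)
  also have "\<dots> + (\<Sum>j\<in>UNIV. \<Sum>i\<in>UNIV. B.s j * Re (X $ j $ i * Z $ i $ j)) =
      (\<Sum>j\<in>UNIV. \<Sum>i\<in>UNIV. (A.s i + B.s j) * Re (X $ j $ i * Z $ i $ j))"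
    by (simp only: sum.distrib[symmetric] distrib_right)
  also have "\<dots> \<le> (\<Sum>j\<in>UNIV. \<Sum>i\<in>UNIV. A.s i * (cmod (X $ j $ i))\<^sup>2 + B.s j * (cmod (Z $ i $ j))\<^sup>2)"
    by (intro sum_mono monotone_term[OF rel] A.\<sigma>_nonneg B.\<sigma>_nonneg A.lt B.lt A.s_def B.s_def)
  also have "\<dots> = (\<Sum>j\<in>UNIV. \<Sum>i\<in>UNIV. A.s i * (cmod (X $ j $ i))\<^sup>2) + (\<Sum>j\<in>UNIV. \<Sum>i\<in>UNIV. B.s j * (cmod (Z $ i $ j))\<^sup>2)"
    by (simp only: sum.distrib)
  also have "(\<Sum>j\<in>UNIV. \<Sum>i\<in>UNIV. B.s j * (cmod (Z $ i $ j))\<^sup>2) = (\<Sum>i\<in>UNIV. \<Sum>j\<in>UNIV. B.s j * (cmod (Z $ i $ j))\<^sup>2)"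
    by (rule sum.swap)
  finally have "(\<Sum>i\<in>UNIV. A.s i) + (\<Sum>j\<in>UNIV. B.s j) \<le>
    (\<Sum>j\<in>UNIV. \<Sum>i\<in>UNIV. A.s i * (cmod (X $ j $ i))\<^sup>2) + (\<Sum>i\<in>UNIV. \<Sum>j\<in>UNIV. B.s j * (cmod (Z $ i $ j))\<^sup>2)" .
  moreover have "trace ((Hm G \<xi> - Hm G' \<xi>) ** (complex_mat G - complex_mat G')) =
      trace (Hm G \<xi> ** complex_mat G) - trace (Hm G \<xi> ** complex_mat G')
      - (trace (Hm G' \<xi> ** complex_mat G) - trace (Hm G' \<xi> ** complex_mat G'))"
    by (simp add: bounded_bilinear.diff_left[OF bounded_bilinear_matrix_mult_complex]
        bounded_bilinear.diff_right[OF bounded_bilinear_matrix_mult_complex] trace_sub)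
  ultimately show ?thesis
    unfolding t1 t2 t3 t4 by simp
qed

section \<open>Continuity of the square root\<close>

lemma matrix_norm_mono:
  fixes A :: "'a::real_normed_vector^'n^'m" and B :: "'b::real_normed_vector^'n^'m"
  assumes "\<And>i j. norm (A $ i $ j) \<le> c * norm (B $ i $ j)" "c \<ge> 0"
  shows "norm A \<le> c * norm B"
proof -
  have row: "norm (A $ i) \<le> c * norm (B $ i)" for i
    unfolding norm_vec_def L2_set_right_distrib[OF assms(2)]
    using assms by (intro L2_set_mono) auto
  show ?thesis
    unfolding norm_vec_def[of A] norm_vec_def[of B] L2_set_right_distrib[OF assms(2)]
    using row by (intro L2_set_mono) auto
qed

lemma matrix_norm_le_entries:
  fixes A :: "'a::real_normed_vector^'n^'m"
  assumes "\<And>i j. norm (A $ i $ j) \<le> c"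
  shows "norm A \<le> real CARD('m) * (real CARD('n) * c)"
proof -
  have row: "norm (A $ i) \<le> real CARD('n) * c" for i
  proof -
    have "norm (A $ i) \<le> (\<Sum>j\<in>UNIV. norm (A $ i $ j))"
      unfolding norm_vec_def by (intro L2_set_le_sum) auto
    also have "\<dots> \<le> (\<Sum>j\<in>(UNIV::'n set). c)"
      using assms by (intro sum_mono) auto
    finally show ?thesis by simp
  qed
  have "norm A \<le> (\<Sum>i\<in>UNIV. norm (A $ i))"
    unfolding norm_vec_def[of A] by (intro L2_set_le_sum) auto
  also have "\<dots> \<le> (\<Sum>i\<in>(UNIV::'m set). real CARD('n) * c)"
    using row by (intro sum_mono) auto
  finally show ?thesis by simp
qed

lemma norm_complex_mat: "norm (complex_mat G) \<le> norm G"
  using matrix_norm_mono[of "complex_mat G" 1 G] by simp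

lemma norm_hconj: "norm (hconj (A::complex^'n^'n)) \<le> real CARD('n) * (real CARD('n) * norm A)"
proof (rule matrix_norm_le_entries)
  fix i j
  have "norm (hconj A $ i $ j) = norm (A $ j $ i)"
    by (simp add: hconj_def transpose_def)
  also have "\<dots> \<le> norm (A $ j)" by (rule Finite_Cartesian_Product.norm_nth_le)
  also have "\<dots> \<le> norm A" by (rule Finite_Cartesian_Product.norm_nth_le)
  finally show "norm (hconj A $ i $ j) \<le> norm A" .
qed

text \<open>In the eigenbases of the two roots, the map from \<open>X\<close> to
  \<open>R1 ** X + X ** R\<close> multiplies entry \<open>(i, j)\<close> by the sum of two positive
  eigenvalues, at least the smallest one of the fixed root. The varying frame enters only through
  the norms of \<open>V1\<close> and its inverse.\<close>

lemma (in hframe) sylvester_bound: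
  "\<exists>K\<ge>0. \<forall>(G1::real^'n^'n) \<xi>1 V1 \<sigma>1 X. hframe G1 \<xi>1 V1 \<sigma>1 \<longrightarrow>
     norm X \<le> K * (norm V1 * norm (nframe.W G1 V1)) * norm (rt G1 \<xi>1 ** X + X ** rt G \<xi>)"
proof -
  obtain K where K: "K > 0" "\<And>(A::complex^'n^'n) (B::complex^'n^'n). norm (A ** B) \<le> norm A * norm B * K"
    using bounded_bilinear.pos_bounded[OF bounded_bilinear_matrix_mult_complex] by blast
  have K3: "norm (A ** B ** C) \<le> norm A * norm C * K\<^sup>2 * norm B"
    for A :: "complex^'n^'n" and B :: "complex^'n^'n" and C :: "complex^'n^'n"
  proof -
    have "norm (A ** B ** C) \<le> norm (A ** B) * norm C * K" by (rule K(2))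
    also have "\<dots> \<le> (norm A * norm B * K) * norm C * K"
      using K by (intro mult_right_mono) auto
    finally show ?thesis by (simp add: power2_eq_square mult_ac)
  qed
  define m where "m = Min (range s)"
  have m: "m > 0" "\<And>j. m \<le> s j"
    using s_bounds(1) by (auto simp: m_def)
  have main: "norm X \<le> K\<^sup>2 * K\<^sup>2 * (norm V1 * norm (nframe.W G1 V1) * norm V * norm W) / m
          * norm (rt G1 \<xi>1 ** X + X ** rt G \<xi>)"
    if F: "hframe G1 \<xi>1 V1 \<sigma>1" for G1 \<xi>1 V1 \<sigma>1 and X :: "complex^'n^'n"
  proof -
    interpret A: hframe G1 \<xi>1 V1 \<sigma>1 by fact
    define E X' where "E = rt G1 \<xi>1 ** X + X ** rt G \<xi>" and "X' = A.W ** X ** V"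
    have 1: "A.W ** rt G1 \<xi>1 = dg (\<lambda>i. complex_of_real (A.s i)) ** A.W"
      by (simp add: A.rt_eq A.D_def matrix_mul_assoc A.WV)
    have 2: "rt G \<xi> ** V = V ** dg (\<lambda>i. complex_of_real (s i))"
      by (simp add: rt_eq D_def WV flip: matrix_mul_assoc)
    have "A.W ** E ** V = A.W ** rt G1 \<xi>1 ** X ** V + A.W ** X ** (rt G \<xi> ** V)"
      by (simp add: E_def matrix_add_ldistrib matrix_add_rdistrib matrix_mul_assoc)
    also have "\<dots> = dg (\<lambda>i. complex_of_real (A.s i)) ** X' + X' ** dg (\<lambda>i. complex_of_real (s i))"
      unfolding 1 2 by (simp add: X'_def matrix_mul_assoc)
    finally have E': "(A.W ** E ** V) $ i $ j = of_real (A.s i + s j) * X' $ i $ j" for i j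
      by (simp add: dg_mult_nth mult_dg_nth algebra_simps)
    have "norm X' \<le> 1 / m * norm (A.W ** E ** V)"
    proof (rule matrix_norm_mono)
      fix i j
      have "m \<le> A.s i + s j"
        using m(2)[of j] A.s_bounds(1)[of i] by simp
      then have "m * norm (X' $ i $ j) \<le> norm ((A.W ** E ** V) $ i $ j)"
        using m(1) unfolding E' norm_mult norm_of_real by (intro mult_right_mono) auto
      then show "norm (X' $ i $ j) \<le> 1 / m * norm ((A.W ** E ** V) $ i $ j)"
        using m(1) by (simp add: field_simps)
    qed (use m in auto)
    also have "\<dots> \<le> 1 / m * (norm A.W * norm V * K\<^sup>2 * norm E)"
      using m(1) K3[of A.W E V] by (intro mult_left_mono) simp_all
    finally have X': "norm X' \<le> 1 / m * (norm A.W * norm V * K\<^sup>2 * norm E)" .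
    have "X = (V1 ** A.W) ** X ** (V ** W)"
      by (simp add: A.VW VW)
    also have "\<dots> = V1 ** X' ** W"
      by (simp add: X'_def matrix_mul_assoc)
    finally have "norm X \<le> norm V1 * norm W * K\<^sup>2 * norm X'"
      using K3[of V1 X' W] by simp
    also have "\<dots> \<le> norm V1 * norm W * K\<^sup>2 * (1 / m * (norm A.W * norm V * K\<^sup>2 * norm E))"
      using X' by (intro mult_left_mono) auto
    finally show ?thesis
      by (simp add: E_def mult_ac)
  qed

  show ?thesis
  proof (intro exI[of _ "K\<^sup>2 * K\<^sup>2 * (norm V * norm W) / m"] conjI allI impI)
    show "0 \<le> K\<^sup>2 * K\<^sup>2 * (norm V * norm W) / m"
      using m(1) by auto
  qed (use main in \<open>simp add: mult_ac\<close>)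
qed

lemma sylvester_inj:
  assumes "good (G::real^'n^'n) \<xi>" "rt G \<xi> ** X + X ** rt G \<xi> = 0"
  shows "X = 0"
proof -
  obtain V \<sigma> where F: "hframe G \<xi> V \<sigma>"
    using good_hframe[OF assms(1)] .
  interpret hframe G \<xi> V \<sigma> by fact
  have "\<exists>K. norm X \<le> K * (norm V * norm W) * norm (rt G \<xi> ** X + X ** rt G \<xi>)"
    using sylvester_bound F by blast
  then show ?thesis
    using assms(2) by simp
qed

lemma matrix_inv_tendsto:
  fixes Gf :: "'b \<Rightarrow> real^'n^'n"
  assumes "(Gf \<longlongrightarrow> G0) F" "invertible G0" "\<forall>\<^sub>F x in F. invertible (Gf x)"
  shows "((\<lambda>x. matrix_inv (Gf x)) \<longlongrightarrow> matrix_inv G0) F"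
proof (rule bilinear_solve_tendsto[OF bounded_bilinear_matrix_mult_real _ assms(1)])
  show "x = 0" if "G0 ** x = 0" for x :: "real^'n^'n"
  proof -
    have "x = (matrix_inv G0 ** G0) ** x"
      by (simp add: invertible_inv_mult[OF assms(2)])
    also have "\<dots> = matrix_inv G0 ** (G0 ** x)"
      by (simp add: matrix_mul_assoc)
    finally show ?thesis
      unfolding that by (simp add: vec_eq_iff matrix_matrix_mult_def)
  qed
  show "((\<lambda>_. mat 1) \<longlongrightarrow> G0 ** matrix_inv G0) F"
    by (simp add: invertible_inv_mult[OF assms(2)])
  show "\<forall>\<^sub>F x in F. Gf x ** matrix_inv (Gf x) = mat 1"
    using assms(3) by eventually_elim (simp add: invertible_inv_mult)
qed

lemma bounded_linear_complex_mat: "bounded_linear (complex_mat :: real^'n^'n \<Rightarrow> complex^'n^'n)"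
  by (simp add: linear_conv_bounded_linear[symmetric] linear_iff vec_eq_iff) (simp add: scaleR_conv_of_real)

lemma bounded_linear_map_matrix_cnj: "bounded_linear (map_matrix cnj :: complex^'n^'m \<Rightarrow> complex^'n^'m)"
  by (simp add: linear_conv_bounded_linear[symmetric] linear_iff vec_eq_iff)

lemmas tendsto_matrix_mult_complex = bounded_bilinear.tendsto[OF bounded_bilinear_matrix_mult_complex]
  and tendsto_complex_mat = bounded_linear.tendsto[OF bounded_linear_complex_mat]
  and tendsto_map_matrix_cnj = bounded_linear.tendsto[OF bounded_linear_map_matrix_cnj]

lemma hm_tendsto:
  assumes "(Gf \<longlongrightarrow> G0) F" "(\<xi>f \<longlongrightarrow> \<xi>0) F"
  shows "((\<lambda>x. hm (Gf x) (\<xi>f x)) \<longlongrightarrow> hm G0 \<xi>0) F"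
  unfolding hm_def
  by (intro tendsto_matrix_mult_complex tendsto_complex_mat tendsto_map_matrix_cnj assms)

text \<open>The difference of two roots solves a Sylvester equation whose right-hand side is a
  difference of values of \<open>hm\<close>. The Sylvester bound stays uniform because
  \<open>V_entry\<close> controls the frames near the limit, continuous or not.\<close>

lemma rt_tendsto:
  fixes Gf :: "'b \<Rightarrow> real^'n^'n"
  assumes Gf: "(Gf \<longlongrightarrow> G0) F" and \<xi>f: "(\<xi>f \<longlongrightarrow> \<xi>0) F" and good0: "good G0 \<xi>0"
    and good: "\<forall>\<^sub>F x in F. good (Gf x) (\<xi>f x)"
  shows "((\<lambda>x. rt (Gf x) (\<xi>f x)) \<longlongrightarrow> rt G0 \<xi>0) F"
proof -
  obtain V0 \<sigma>0 where F0: "hframe G0 \<xi>0 V0 \<sigma>0"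
    using good_hframe[OF good0] .
  interpret A: hframe G0 \<xi>0 V0 \<sigma>0 by fact
  obtain K where K: "K \<ge> 0" "\<And>(G::real^'n^'n) \<xi> V \<sigma> X. hframe G \<xi> V \<sigma> \<Longrightarrow>
       norm X \<le> K * (norm V * norm (nframe.W G V)) * norm (rt G \<xi> ** X + X ** rt G0 \<xi>0)"
    using A.sylvester_bound by blast
  obtain Km where Km: "Km > 0" "\<And>(A::complex^'n^'n) (B::complex^'n^'n). norm (A ** B) \<le> norm A * norm B * Km"
    using bounded_bilinear.pos_bounded[OF bounded_bilinear_matrix_mult_complex] by blast
  have inv: "((\<lambda>x. matrix_inv (Gf x)) \<longlongrightarrow> matrix_inv G0) F"
    using good by (intro matrix_inv_tendsto[OF Gf A.invG])
      (auto elim!: eventually_mono simp: good_def real_posdef_invertible)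
  define b1 b2 where "b1 = norm (matrix_inv G0) + 1" and "b2 = norm G0 + 1"
  have ev: "\<forall>\<^sub>F x in F. norm (matrix_inv (Gf x)) < b1" "\<forall>\<^sub>F x in F. norm (Gf x) < b2"
    using order_tendstoD(2)[OF tendsto_norm[OF inv]] order_tendstoD(2)[OF tendsto_norm[OF Gf]]
    by (auto simp: b1_def b2_def)
  define n where "n = real CARD('n)"
  \<comment> \<open>Entries of \<open>V\<close> are at most the square root of a bound
    \<open>b1\<close> for the inverse; \<open>b1 + 1\<close> dominates that root. The dimension
    factors pass from entries to norms.\<close>
  define cV where "cV = n * (n * (b1 + 1))"
  define cW where "cW = n * (n * cV) * b2 * Km"
  have b: "b1 > 0" "b2 > 0" "n > 0" "cV > 0" "cW > 0"
  proof -
    show "b1 > 0" "b2 > 0"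
      unfolding b1_def b2_def by (intro add_nonneg_pos; simp)+
    show "n > 0"
      by (simp add: n_def)
    show "cV > 0"
      unfolding cV_def using \<open>b1 > 0\<close> \<open>n > 0\<close> by (intro mult_pos_pos) auto
    then show "cW > 0"
      unfolding cW_def using \<open>b2 > 0\<close> \<open>n > 0\<close> Km by (intro mult_pos_pos) auto
  qed
  have "((\<lambda>x. rt (Gf x) (\<xi>f x) - rt G0 \<xi>0) \<longlongrightarrow> 0) F"
  proof (rule Lim_null_comparison)
    show "\<forall>\<^sub>F x in F. norm (rt (Gf x) (\<xi>f x) - rt G0 \<xi>0) \<le>
        K * (cV * cW) * norm (hm G0 \<xi>0 - hm (Gf x) (\<xi>f x))"
      using good ev
    proof eventually_elim
      fix x
      assume good: "good (Gf x) (\<xi>f x)" and b1: "norm (matrix_inv (Gf x)) < b1" and b2: "norm (Gf x) < b2"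
      obtain V \<sigma> where F: "hframe (Gf x) (\<xi>f x) V \<sigma>"
        using good_hframe[OF good] .
      interpret B: hframe "Gf x" "\<xi>f x" V \<sigma> by fact
      have V: "norm V \<le> cV"
        unfolding cV_def n_def
      proof (rule matrix_norm_le_entries)
        fix a i
        have "(cmod (V $ a $ i))\<^sup>2 \<le> norm (matrix_inv (Gf x) $ a $ a)"
          using B.V_entry[of a i] by simp
        also have "\<dots> \<le> norm (matrix_inv (Gf x))"
          by (meson Finite_Cartesian_Product.norm_nth_le order_trans)
        also have "\<dots> \<le> (b1 + 1)\<^sup>2"
        proof -
          have "(b1 + 1)\<^sup>2 = b1\<^sup>2 + 1 + 2 * b1"
            by (simp add: power2_sum)
          then show ?thesis
            using b1 b(1) zero_le_power2[of b1] by linarith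
        qed
        finally have "(cmod (V $ a $ i))\<^sup>2 \<le> (b1 + 1)\<^sup>2" .
        then show "norm (V $ a $ i) \<le> b1 + 1"
          using b by (simp add: power2_le_iff_abs_le)
      qed
      have "norm B.W \<le> norm (hconj V) * norm (complex_mat (Gf x)) * Km"
        unfolding B.W_def by (rule Km)
      also have "\<dots> \<le> (n * (n * cV)) * b2 * Km"
      proof (intro mult_right_mono mult_mono)
        show "norm (hconj V) \<le> n * (n * cV)"
          using norm_hconj[of V] V b unfolding n_def
          by (meson mult_left_mono of_nat_0_le_iff order_trans)
        show "norm (complex_mat (Gf x)) \<le> b2"
          using norm_complex_mat[of "Gf x"] b2 by simp
      qed (use b Km in auto)
      finally have W: "norm B.W \<le> cW" by (simp add: cW_def)
      let ?X = "rt (Gf x) (\<xi>f x) - rt G0 \<xi>0"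
      have E: "rt (Gf x) (\<xi>f x) ** ?X + ?X ** rt G0 \<xi>0 = hm G0 \<xi>0 - hm (Gf x) (\<xi>f x)"
        using A.rt_sq B.rt_sq
        by (simp add: bounded_bilinear.diff_left[OF bounded_bilinear_matrix_mult_complex]
          bounded_bilinear.diff_right[OF bounded_bilinear_matrix_mult_complex])
      have "norm ?X \<le> K * (norm V * norm B.W) * norm (hm G0 \<xi>0 - hm (Gf x) (\<xi>f x))"
        using K(2)[OF F, of ?X] unfolding E .
      also have "\<dots> \<le> K * (cV * cW) * norm (hm G0 \<xi>0 - hm (Gf x) (\<xi>f x))"
        using K(1) V W b by (intro mult_right_mono mult_left_mono mult_mono) auto
      finally show "norm ?X \<le> K * (cV * cW) * norm (hm G0 \<xi>0 - hm (Gf x) (\<xi>f x))" .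
    qed
    have "((\<lambda>x. K * (cV * cW) * norm (hm G0 \<xi>0 - hm (Gf x) (\<xi>f x)))
        \<longlongrightarrow> K * (cV * cW) * norm (hm G0 \<xi>0 - hm G0 \<xi>0)) F"
      by (intro tendsto_intros hm_tendsto Gf \<xi>f)
    then show "((\<lambda>x. K * (cV * cW) * norm (hm G0 \<xi>0 - hm (Gf x) (\<xi>f x))) \<longlongrightarrow> 0) F"
      by simp
  qed
  then show ?thesis
    using LIM_zero_iff by blast
qed

section \<open>Derivative of the integrand and its convexity along lines\<close>

text \<open>For the derivative of the Leibniz expansion at the identity matrix: after one factor has
  been differentiated, a permutation other than the identity still leaves an off-diagonal
  zero.\<close>

lemma permutes_moves_another:
  assumes "p permutes (UNIV::'n set)" "p \<noteq> id"
  shows "\<exists>j. j \<noteq> i \<and> p j \<noteq> j"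
proof -
  obtain k where k: "p k \<noteq> k"
    using assms(2) by (auto simp: fun_eq_iff)
  show ?thesis
  proof (cases "k = i")
    case True
    have "p (p k) \<noteq> p k"
      using k permutes_inj[OF assms(1)] by (auto simp: inj_def)
    then show ?thesis using True k by (intro exI[of _ "p k"]) auto
  qed (use k in auto)
qed

lemma det_has_derivative_one:
  fixes M :: "'a::real_normed_vector \<Rightarrow> 'f::real_normed_field^'n^'n"
  assumes M: "(M has_derivative M') (at x within S)" and one: "M x = mat 1"
  shows "((\<lambda>z. det (M z)) has_derivative (\<lambda>h. trace (M' h))) (at x within S)"
proof -
  have nth: "((\<lambda>z. M z $ i $ j) has_derivative (\<lambda>h. M' h $ i $ j)) (at x within S)" for i j
    using bounded_linear.has_derivative[OF bounded_linear_vec_nth bounded_linear.has_derivative[OF bounded_linear_vec_nth M]] .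
  have "((\<lambda>z. det (M z)) has_derivative
     (\<lambda>h. \<Sum>p | p permutes UNIV. of_int (sign p) *
        (\<Sum>i\<in>UNIV. M' h $ i $ p i * (\<Prod>j\<in>UNIV - {i}. M x $ j $ p j)))) (at x within S)"
    unfolding det_def by (intro has_derivative_sum has_derivative_mult_right has_derivative_prod nth)
  moreover have "(\<Sum>p | p permutes UNIV. of_int (sign p) *
        (\<Sum>i\<in>UNIV. M' h $ i $ p i * (\<Prod>j\<in>UNIV - {i}. M x $ j $ p j))) = trace (M' h)" for h
  proof -
    have "(\<Sum>p | p permutes UNIV. of_int (sign p) *
        (\<Sum>i\<in>UNIV. M' h $ i $ p i * (\<Prod>j\<in>UNIV - {i}. M x $ j $ p j))) =
      (\<Sum>p | p permutes (UNIV::'n set). if p = id then trace (M' h) else 0)"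
    proof (intro sum.cong refl)
      fix p :: "'n \<Rightarrow> 'n" assume p: "p \<in> {p. p permutes UNIV}"
      show "of_int (sign p) * (\<Sum>i\<in>UNIV. M' h $ i $ p i * (\<Prod>j\<in>UNIV - {i}. M x $ j $ p j)) =
          (if p = id then trace (M' h) else 0)"
      proof (cases "p = id")
        case True
        then show ?thesis by (simp add: one mat_def trace_def)
      next
        case False
        have "(\<Prod>j\<in>UNIV - {i}. M x $ j $ p j) = 0" for i
        proof -
          obtain j where "j \<noteq> i" "p j \<noteq> j"
            using permutes_moves_another[of p i] p False by blast
          then show ?thesis
            by (intro prod_zero) (auto simp: one mat_def intro!: bexI[of _ j])
        qed
        then have "(\<Sum>i\<in>UNIV. M' h $ i $ p i * (\<Prod>j\<in>UNIV - {i}. M x $ j $ p j)) = 0"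
          by (intro sum.neutral ballI) (simp only: mult_zero_right)
        then show ?thesis using False by simp
      qed
    qed
    also have "\<dots> = trace (M' h)"
      by (simp add: finite_permutations permutes_id)
    finally show ?thesis .
  qed
  ultimately show ?thesis by simp
qed

text \<open>Jacobi's formula; left multiplication by \<open>N\<close> moves the base point to the
  identity matrix.\<close>

lemma det_has_derivative:
  fixes M :: "'a::real_normed_vector \<Rightarrow> 'f::real_normed_field^'n^'n"
  assumes bb: "bounded_bilinear ((**) :: 'f^'n^'n \<Rightarrow> 'f^'n^'n \<Rightarrow> 'f^'n^'n)"
    and M: "(M has_derivative M') (at x within S)" and N: "N ** M x = mat 1"
  shows "((\<lambda>z. det (M z)) has_derivative (\<lambda>h. det (M x) * trace (N ** M' h))) (at x within S)"
proof -
  have "((\<lambda>z. N ** M z) has_derivative (\<lambda>h. N ** M' h)) (at x within S)"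
    using bounded_linear.has_derivative[OF bounded_bilinear.bounded_linear_right[OF bb] M] .
  then have "((\<lambda>z. det (M x) * det (N ** M z)) has_derivative (\<lambda>h. det (M x) * trace (N ** M' h))) (at x within S)"
    by (intro has_derivative_mult_right det_has_derivative_one N)
  moreover have "det (M x) * det (N ** M z) = det (M z)" for z
  proof -
    have "det N * det (M x) = 1"
      using arg_cong[OF N, of det] by (simp add: det_mul)
    then have "det (M x) * det N = 1" by (simp add: mult.commute)
    then show ?thesis
      by (simp add: det_mul flip: mult.assoc)
  qed
  ultimately show ?thesis by simp
qed

lemma trace_cnj: "trace (map_matrix cnj A) = cnj (trace A)"
  by (simp add: trace_def)

lemma bounded_linear_Re_trace: "bounded_linear (\<lambda>A::complex^'n^'n. Re (trace A))"
  by (simp add: linear_conv_bounded_linear[symmetric] linear_iff trace_def sum.distrib sum_distrib_left)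

text \<open>The coefficient is a pair so that the two factors may differ: increments of a root lead
  to the roots at two different points, derivatives to the same root twice.\<close>

lemma bounded_bilinear_sylvester:
  "bounded_bilinear (\<lambda>(A::(complex^'n^'n) \<times> (complex^'n^'n)) X. fst A ** X + X ** snd A)"
proof -
  note bb = bounded_bilinear_matrix_mult_complex
  show ?thesis
    unfolding bilinear_conv_bounded_bilinear[symmetric] bilinear_def linear_iff
    by (auto simp: bounded_bilinear.add_left[OF bb] bounded_bilinear.add_right[OF bb]
        bounded_bilinear.scaleR_left[OF bb] bounded_bilinear.scaleR_right[OF bb] scaleR_add_right)
qed

text \<open>Multiplying \<open>R R' + R' R = - A'\<close> by \<open>(1 + R)\<^sup>-\<^sup>1\<close> and taking traces removes \<open>R'\<close> from the
  derivative of \<open>- tr R + log det (1 + R)\<close>.\<close>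

lemma phi_has_derivative:
  fixes G0 E :: "real^'n^'n"
  assumes good: "\<And>t. t \<in> S \<Longrightarrow> good (G0 + t *\<^sub>R E) \<xi>" and t0: "t0 \<in> S"
  shows "((\<lambda>t. phi (G0 + t *\<^sub>R E) \<xi>) has_real_derivative
    - Re (trace (Hm (G0 + t0 *\<^sub>R E) \<xi> ** complex_mat E))) (at t0 within S)"
proof -
  define Gt where "Gt t = G0 + t *\<^sub>R E" for t
  define R where "R t = rt (Gt t) \<xi>" for t
  define Ec Gc where "Ec = complex_mat E" and "Gc = complex_mat (Gt t0)"
  obtain V \<sigma> where F0: "hframe (Gt t0) \<xi> V \<sigma>"
    using good_hframe[OF good[OF t0]] unfolding Gt_def .
  interpret A: hframe "Gt t0" \<xi> V \<sigma> by fact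
  have Gt: "(Gt has_vector_derivative E) (at t0 within S)"
    unfolding Gt_def by (auto intro!: derivative_eq_intros simp: has_vector_derivative_def)
  have Gct: "((\<lambda>t. complex_mat (Gt t)) has_vector_derivative Ec) (at t0 within S)"
    unfolding Ec_def by (rule bounded_linear.has_vector_derivative[OF bounded_linear_complex_mat Gt])
  define A' where "A' = \<xi> ** Gc ** map_matrix cnj \<xi> ** Ec + \<xi> ** Ec ** map_matrix cnj \<xi> ** Gc"
  have hm': "((\<lambda>t. hm (Gt t) \<xi>) has_vector_derivative A') (at t0 within S)"
  proof -
    note bb = bounded_bilinear_matrix_mult_complex
    have "((\<lambda>t. \<xi> ** complex_mat (Gt t) ** map_matrix cnj \<xi>) has_vector_derivative
        \<xi> ** Ec ** map_matrix cnj \<xi>) (at t0 within S)"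
      by (intro bounded_linear.has_vector_derivative[OF bounded_bilinear.bounded_linear_left[OF bb]]
          bounded_linear.has_vector_derivative[OF bounded_bilinear.bounded_linear_right[OF bb]] Gct)
    from bounded_bilinear.has_vector_derivative[OF bb this Gct] show ?thesis
      by (simp add: hm_def A'_def Gc_def)
  qed
  have goodS: "\<forall>\<^sub>F t in at t0 within S. good (Gt t) \<xi>"
    using good by (simp add: eventually_at_filter Gt_def)
  have Rcont: "(R \<longlongrightarrow> R t0) (at t0 within S)"
    unfolding R_def using Gt good[OF t0] goodS
    by (intro rt_tendsto) (auto simp: Gt_def intro!: tendsto_eq_intros)
  have inj: "X = 0" if "fst (R t0, R t0) ** X + X ** snd (R t0, R t0) = 0" for X
    using sylvester_inj[of "Gt t0" \<xi> X] good[OF t0] that by (simp add: R_def Gt_def)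
  have 1: "continuous (at t0 within S) (\<lambda>t. (R t, R t0))"
    using Rcont by (auto simp: continuous_within intro!: tendsto_intros)
  have 2: "((\<lambda>t. hm (Gt t0) \<xi> - hm (Gt t) \<xi>) has_derivative (\<lambda>h. - (h *\<^sub>R A'))) (at t0 within S)"
    using hm' unfolding has_vector_derivative_def by (auto intro!: derivative_eq_intros)
  have 3: "\<forall>\<^sub>F t in at t0 within S. fst (R t, R t0) ** (R t - R t0) + (R t - R t0) ** snd (R t, R t0) =
      hm (Gt t0) \<xi> - hm (Gt t) \<xi>"
    using goodS
  proof eventually_elim
    case (elim t)
    obtain V' \<sigma>' where "hframe (Gt t) \<xi> V' \<sigma>'"
      using good_hframe[OF elim] .
    then interpret B: hframe "Gt t" \<xi> V' \<sigma>' .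
    show ?case
      using A.rt_sq B.rt_sq
      by (simp add: R_def bounded_bilinear.diff_left[OF bounded_bilinear_matrix_mult_complex]
          bounded_bilinear.diff_right[OF bounded_bilinear_matrix_mult_complex])
  qed
  obtain R' where R': "((\<lambda>t. R t - R t0) has_derivative R') (at t0 within S)"
    "\<And>h. fst (R t0, R t0) ** R' h + R' h ** snd (R t0, R t0) = - (h *\<^sub>R A')"
  proof (rule bilinear_solve_has_derivative0[where p="\<lambda>A X. fst A ** X + X ** snd A" and M="\<lambda>t. (R t, R t0)"
        and ?x0.0=t0 and S=S and D="\<lambda>t. R t - R t0" and E="\<lambda>t. hm (Gt t0) \<xi> - hm (Gt t) \<xi>"
        and E'="\<lambda>h. - (h *\<^sub>R A')", OF bounded_bilinear_sylvester inj 1 2 _ _ 3])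
    fix D' assume D': "((\<lambda>t. R t - R t0) has_derivative D') (at t0 within S)"
      "\<And>h. fst (R t0, R t0) ** D' h + D' h ** snd (R t0, R t0) = - (h *\<^sub>R A')"
    show thesis
      by (rule that[OF D'])
  qed simp_all
  define R1 where "R1 = R' 1"
  have R'lin: "R' = (\<lambda>h. h *\<^sub>R R1)"
  proof
    show "R' h = h *\<^sub>R R1" for h
      using linear_scale[OF has_derivative_linear[OF R'(1)], of h 1]
      by (simp only: R1_def real_scaleR_def mult_1_right)
  qed
  have Rt: "(R has_derivative (\<lambda>h. h *\<^sub>R R1)) (at t0 within S)"
    using has_derivative_add[OF R'(1) has_derivative_const[of "R t0"]] R'lin by simp
  have R1: "R t0 ** R1 + R1 ** R t0 = - A'"
    using R'(2)[of 1] by (simp add: R1_def)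
  \<comment> \<open>The inverse of \<open>1 + R\<close> at \<open>t0\<close>; being diagonal in the
    same frame, it commutes with \<open>R t0\<close>.\<close>
  define T where "T = A.D (\<lambda>i. complex_of_real (1 / (1 + A.s i)))"
  have R0: "R t0 = A.D (\<lambda>i. complex_of_real (A.s i))"
    by (simp add: R_def A.rt_eq)
  have s1: "1 + A.s i > 0" for i
    using A.s_bounds(1)[of i] by simp
  have TR: "T ** (mat 1 + R t0) = mat 1"
  proof -
    have "complex_of_real (1 / (1 + A.s i)) * (1 + complex_of_real (A.s i)) = 1" for i
    proof -
      have "complex_of_real (1 / (1 + A.s i)) * (1 + complex_of_real (A.s i)) =
          complex_of_real (1 / (1 + A.s i) * (1 + A.s i))"
        by (simp only: of_real_mult of_real_add of_real_1)
      also have "1 / (1 + A.s i) * (1 + A.s i) = 1"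
        using s1[of i] by simp
      finally show ?thesis by simp
    qed
    then show ?thesis
      by (simp only: R0 A.D_add T_def A.D_mult A.D_one[symmetric])
  qed
  have TRcomm: "T ** R t0 = R t0 ** T"
    by (simp add: T_def R0 A.D_mult mult.commute)
  define d where "d = (\<Prod>i\<in>UNIV. 1 + A.s i)"
  have d: "d > 0"
    unfolding d_def using s1 by (intro prod_pos) auto
  have det1: "det (mat 1 + R t0) = complex_of_real d"
    using A.det_one_rt by (simp add: R_def d_def)
  have D1: "((\<lambda>t. ln (det (Gt t))) has_derivative (\<lambda>h. h * trace (matrix_inv (Gt t0) ** E))) (at t0 within S)"
  proof -
    have "((\<lambda>t. det (Gt t)) has_derivative (\<lambda>h. det (Gt t0) * trace (matrix_inv (Gt t0) ** (h *\<^sub>R E)))) (at t0 within S)"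
      using Gt unfolding has_vector_derivative_def
      by (intro det_has_derivative bounded_bilinear_matrix_mult_real) (auto simp: invertible_inv_mult[OF A.invG])
    from has_derivative_ln[OF _ this] A.det_G show ?thesis
      by (simp add: bounded_bilinear.scaleR_right[OF bounded_bilinear_matrix_mult_real] trace_def
          sum_distrib_left[symmetric] field_simps)
  qed
  have D2: "((\<lambda>t. Re (trace (R t))) has_derivative (\<lambda>h. h * Re (trace R1))) (at t0 within S)"
    using bounded_linear.has_derivative[OF bounded_linear_Re_trace Rt]
    by (simp add: trace_def sum_distrib_left)
  have D3: "((\<lambda>t. ln (Re (det (mat 1 + R t)))) has_derivative (\<lambda>h. h * Re (trace (T ** R1)))) (at t0 within S)"
  proof -
    have "((\<lambda>t. mat 1 + R t) has_derivative (\<lambda>h. h *\<^sub>R R1)) (at t0 within S)"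
      using has_derivative_add[OF has_derivative_const[of "mat 1"] Rt] by simp
    from det_has_derivative[OF bounded_bilinear_matrix_mult_complex this TR]
    have "((\<lambda>t. Re (det (mat 1 + R t))) has_derivative
        (\<lambda>h. Re (det (mat 1 + R t0) * trace (T ** (h *\<^sub>R R1))))) (at t0 within S)"
      by (rule bounded_linear.has_derivative[OF bounded_linear_Re])
    from has_derivative_ln[OF _ this] d show ?thesis
      by (simp add: det1 bounded_bilinear.scaleR_right[OF bounded_bilinear_matrix_mult_complex] trace_def
          sum_distrib_left[symmetric] field_simps)
  qed
  have main: "((\<lambda>t. real CARD('n) - ln (det (Gt t)) - Re (trace (R t)) + ln (Re (det (mat 1 + R t))))
      has_derivative (\<lambda>h. 0 - h * trace (matrix_inv (Gt t0) ** E) - h * Re (trace R1) + h * Re (trace (T ** R1))))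
      (at t0 within S)"
    by (intro has_derivative_add has_derivative_diff has_derivative_const D1 D2 D3)
  have val: "- trace (matrix_inv (Gt t0) ** E) - Re (trace R1) + Re (trace (T ** R1)) = - Re (trace (Hm (Gt t0) \<xi> ** Ec))"
  proof -
    let ?c = "\<lambda>i. complex_of_real (1 - A.s i)"
    have "R1 = T ** (mat 1 + R t0) ** R1" by (simp add: TR)
    also have "\<dots> = T ** R1 + T ** R t0 ** R1"
      by (simp add: matrix_add_ldistrib matrix_add_rdistrib)
    finally have e1: "trace R1 = trace (T ** R1) + trace (T ** R t0 ** R1)"
      by (metis trace_add)
    have "trace (T ** R1 ** R t0) = trace (R t0 ** (T ** R1))"
      by (rule trace_mul_sym)
    also have "\<dots> = trace (T ** R t0 ** R1)"
      by (simp add: matrix_mul_assoc TRcomm)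
    finally have "trace (T ** (R t0 ** R1 + R1 ** R t0)) = 2 * trace (T ** R t0 ** R1)"
      by (simp add: matrix_add_ldistrib matrix_mul_assoc trace_add)
    moreover have "trace (T ** (R t0 ** R1 + R1 ** R t0)) = - trace (T ** A')"
      unfolding R1 by (simp add: bounded_bilinear.minus_right[OF bounded_bilinear_matrix_mult_complex] trace_def sum_negf)
    ultimately have e2: "trace (T ** A') = - (2 * trace (T ** R t0 ** R1))"
      by (metis minus_minus)
    \<comment> \<open>The scalar identity behind the formula for \<open>Hm\<close>:
      \<open>1 - s\<^sup>2\<close> divided by \<open>1 + s\<close> is \<open>1 - s\<close>. It makes
      \<open>T\<close> times \<open>\<xi> G cnj \<xi>\<close> equal to the inverse of
      \<open>G\<close> minus \<open>Hm\<close>.\<close>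
    have c1: "complex_of_real (1 / (1 + A.s i)) * complex_of_real ((\<sigma> i)\<^sup>2) = ?c i" for i
    proof -
      have "(\<sigma> i)\<^sup>2 = (1 - A.s i) * (1 + A.s i)"
        using A.s_bounds(3)[of i] by (simp add: algebra_simps power2_eq_square)
      then have "1 / (1 + A.s i) * (\<sigma> i)\<^sup>2 = 1 - A.s i"
        using s1[of i] by (simp add: field_simps)
      then show ?thesis by (simp only: of_real_mult[symmetric])
    qed
    have TA1: "T ** (\<xi> ** Gc ** map_matrix cnj \<xi>) = V ** dg ?c ** hconj V"
    proof -
      have "T ** (\<xi> ** Gc ** map_matrix cnj \<xi>) =
          V ** dg (\<lambda>i. complex_of_real (1 / (1 + A.s i))) ** (A.W ** V) ** dg (\<lambda>i. complex_of_real ((\<sigma> i)\<^sup>2)) ** hconj V"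
        unfolding Gc_def A.\<xi>G\<xi>_eq T_def A.D_def by (simp only: matrix_mul_assoc)
      also have "\<dots> = V ** (dg (\<lambda>i. complex_of_real (1 / (1 + A.s i))) ** dg (\<lambda>i. complex_of_real ((\<sigma> i)\<^sup>2))) ** hconj V"
        by (simp only: A.WV matrix_mul_assoc matrix_mul_rid)
      finally show ?thesis by (simp only: dg_mult c1)
    qed
    have t1: "trace (T ** (\<xi> ** Gc ** map_matrix cnj \<xi> ** Ec)) = trace (V ** dg ?c ** hconj V ** Ec)"
      by (simp only: matrix_mul_assoc TA1[unfolded matrix_mul_assoc])
    \<comment> \<open>Cyclic permutation collects the diagonal factors in front of
      \<open>transpose V ** Ec ** map_matrix cnj V\<close>. As \<open>E\<close> is real, this is the
      conjugate of the matrix occurring in \<open>t1\<close>; in the real part the two terms of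
      \<open>A'\<close> contribute equally.\<close>
    have t2: "trace (T ** (\<xi> ** Ec ** map_matrix cnj \<xi> ** Gc)) = cnj (trace (V ** dg ?c ** hconj V ** Ec))"
    proof -
      let ?\<tau> = "\<lambda>i. complex_of_real (1 / (1 + A.s i))" and ?\<sigma> = "\<lambda>i. complex_of_real (\<sigma> i)"
      have cx: "map_matrix cnj \<xi> = map_matrix cnj V ** dg ?\<sigma> ** hconj V"
        by (subst A.\<xi>_eq) (simp add: map_matrix_cnj_mult cnj_dg hconj_def map_matrix_cnj_transpose)
      have "T ** (\<xi> ** Ec ** map_matrix cnj \<xi> ** Gc) =
          V ** dg ?\<tau> ** (A.W ** V) ** dg ?\<sigma> ** transpose V ** Ec ** map_matrix cnj V ** dg ?\<sigma> ** (hconj V ** Gc)"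
        unfolding cx T_def A.D_def by (subst (1) A.\<xi>_eq) (simp only: matrix_mul_assoc)
      also have "\<dots> = V ** (dg ?\<tau> ** dg ?\<sigma> ** transpose V ** Ec ** map_matrix cnj V ** dg ?\<sigma> ** A.W)"
      proof -
        have "hconj V ** Gc = A.W"
          by (simp only: A.W_def Gc_def)
        then show ?thesis
          by (simp only: A.WV matrix_mul_assoc matrix_mul_rid)
      qed
      finally have "trace (T ** (\<xi> ** Ec ** map_matrix cnj \<xi> ** Gc)) =
          trace ((dg ?\<tau> ** dg ?\<sigma> ** transpose V ** Ec ** map_matrix cnj V ** dg ?\<sigma> ** A.W) ** V)"
        by (simp only: trace_mul_sym[of V])
      also have "(dg ?\<tau> ** dg ?\<sigma> ** transpose V ** Ec ** map_matrix cnj V ** dg ?\<sigma> ** A.W) ** V =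
          (dg ?\<tau> ** dg ?\<sigma> ** transpose V ** Ec ** map_matrix cnj V) ** dg ?\<sigma>"
        by (simp only: A.WV matrix_mul_rid flip: matrix_mul_assoc)
      also have "trace \<dots> = trace (dg ?\<sigma> ** (dg ?\<tau> ** dg ?\<sigma> ** transpose V ** Ec ** map_matrix cnj V))"
        by (rule trace_mul_sym)
      also have "dg ?\<sigma> ** (dg ?\<tau> ** dg ?\<sigma> ** transpose V ** Ec ** map_matrix cnj V) =
          dg (\<lambda>i. ?\<sigma> i * (?\<tau> i * ?\<sigma> i)) ** (transpose V ** Ec ** map_matrix cnj V)"
        by (simp only: dg_mult[symmetric] matrix_mul_assoc)
      also have "(\<lambda>i. ?\<sigma> i * (?\<tau> i * ?\<sigma> i)) = ?c"
        using c1 by (simp add: power2_eq_square mult_ac fun_eq_iff)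
      also have "dg ?c ** (transpose V ** Ec ** map_matrix cnj V) = map_matrix cnj (dg ?c ** hconj V ** Ec ** V)"
        by (simp add: map_matrix_cnj_mult cnj_dg cnj_hconj Ec_def matrix_mul_assoc)
      also have "trace \<dots> = cnj (trace ((dg ?c ** hconj V ** Ec) ** V))"
        by (simp only: trace_cnj)
      also have "trace ((dg ?c ** hconj V ** Ec) ** V) = trace (V ** (dg ?c ** hconj V ** Ec))"
        by (rule trace_mul_sym)
      finally show ?thesis by (simp only: matrix_mul_assoc)
    qed
    have "trace (T ** A') = trace (V ** dg ?c ** hconj V ** Ec) + cnj (trace (V ** dg ?c ** hconj V ** Ec))"
      unfolding A'_def by (simp only: matrix_add_ldistrib trace_add t1 t2)
    then have e3: "Re (trace (T ** A')) = 2 * Re (trace (V ** dg ?c ** hconj V ** Ec))"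
      by simp
    have "V ** dg ?c ** hconj V = complex_mat (matrix_inv (Gt t0)) - Hm (Gt t0) \<xi>"
    proof -
      have "V ** dg ?c ** hconj V = V ** (dg (\<lambda>_. 1) - dg (\<lambda>i. complex_of_real (A.s i))) ** hconj V"
        by (simp add: dg_diff)
      then show ?thesis
        by (simp add: A.ginv A.Hm_eq dg_one bounded_bilinear.diff_left[OF bounded_bilinear_matrix_mult_complex]
          bounded_bilinear.diff_right[OF bounded_bilinear_matrix_mult_complex])
    qed
    then have "trace (V ** dg ?c ** hconj V ** Ec) = trace (complex_mat (matrix_inv (Gt t0)) ** Ec) - trace (Hm (Gt t0) \<xi> ** Ec)"
      by (simp add: bounded_bilinear.diff_left[OF bounded_bilinear_matrix_mult_complex] trace_sub)
    moreover have "trace (complex_mat (matrix_inv (Gt t0)) ** Ec) = complex_of_real (trace (matrix_inv (Gt t0) ** E))"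
      unfolding Ec_def complex_mat_mult[symmetric] by (simp add: trace_def)
    ultimately have "Re (trace (T ** A')) = 2 * (trace (matrix_inv (Gt t0) ** E) - Re (trace (Hm (Gt t0) \<xi> ** Ec)))"
      using e3 by simp
    then show ?thesis
      using e1 e2 by simp
  qed
  have eq: "phi (Gt t) \<xi> = real CARD('n) - ln (det (Gt t)) - Re (trace (R t)) + ln (Re (det (mat 1 + R t)))"
    if t: "t \<in> S" for t
  proof -
    obtain V' \<sigma>' where "hframe (Gt t) \<xi> V' \<sigma>'"
      using good_hframe[OF good[OF t]] unfolding Gt_def .
    then interpret B: hframe "Gt t" \<xi> V' \<sigma>' .
    show ?thesis by (simp add: B.phi_eq R_def)
  qed
  have "((\<lambda>t. phi (Gt t) \<xi>) has_derivative
      (\<lambda>h. 0 - h * trace (matrix_inv (Gt t0) ** E) - h * Re (trace R1) + h * Re (trace (T ** R1)))) (at t0 within S)"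
    by (rule has_derivative_transform[OF t0 _ main]) (use eq in auto)
  moreover have "(\<lambda>h. 0 - h * trace (matrix_inv (Gt t0) ** E) - h * Re (trace R1) + h * Re (trace (T ** R1))) =
      (*) (- Re (trace (Hm (Gt t0) \<xi> ** Ec)))"
    unfolding val[symmetric] by (auto simp: algebra_simps)
  ultimately show ?thesis
    by (simp add: has_field_derivative_def Gt_def Ec_def)
qed

text \<open>By \<open>Hm_monotone\<close> the derivative along the line is nondecreasing; the mean
  value theorem on either side of \<open>x\<close> then gives the supporting line.\<close>

lemma phi_tangent:
  fixes G0 E :: "real^'n^'n"
  assumes good: "\<And>t. t \<in> {a..b} \<Longrightarrow> good (G0 + t *\<^sub>R E) \<xi>" and xy: "x \<in> {a..b}" "y \<in> {a..b}"
  shows "phi (G0 + y *\<^sub>R E) \<xi> \<ge> phi (G0 + x *\<^sub>R E) \<xi> - (y - x) * Re (trace (Hm (G0 + x *\<^sub>R E) \<xi> ** complex_mat E))"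
proof -
  define f where "f t = phi (G0 + t *\<^sub>R E) \<xi>" for t
  define g where "g t = - Re (trace (Hm (G0 + t *\<^sub>R E) \<xi> ** complex_mat E))" for t
  have der: "(f has_real_derivative g t) (at t within {a..b})" if "t \<in> {a..b}" for t
    unfolding f_def g_def using phi_has_derivative[of "{a..b}" G0 E \<xi> t] good that by blast
  have mono: "g s \<le> g t" if "s \<in> {a..b}" "t \<in> {a..b}" "s \<le> t" for s t
  proof -
    let ?M = "(Hm (G0 + s *\<^sub>R E) \<xi> - Hm (G0 + t *\<^sub>R E) \<xi>) ** complex_mat E"
    have "complex_mat (G0 + s *\<^sub>R E) - complex_mat (G0 + t *\<^sub>R E) = (s - t) *\<^sub>R complex_mat E"
      by (simp add: vec_eq_iff) (simp add: scaleR_conv_of_real algebra_simps)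
    then have "Re (trace ((s - t) *\<^sub>R ?M)) \<le> 0"
      using Hm_monotone[OF good[OF that(1)] good[OF that(2)]]
      by (simp add: bounded_bilinear.scaleR_right[OF bounded_bilinear_matrix_mult_complex])
    moreover have "Re (trace ((s - t) *\<^sub>R ?M)) = (s - t) * Re (trace ?M)"
      by (simp add: trace_def sum_distrib_left)
    moreover have "Re (trace ?M) = g t - g s"
      by (simp add: g_def bounded_bilinear.diff_left[OF bounded_bilinear_matrix_mult_complex] trace_sub)
    ultimately have *: "(s - t) * (g t - g s) \<le> 0" by simp
    show ?thesis
    proof (cases "s = t")
      case False
      then have "s - t < 0" using that by simp
      then show ?thesis using * by (simp add: mult_le_0_iff)
    qed simp
  qed
  have "f y \<ge> f x + (y - x) * g x"
  proof (cases x y rule: linorder_cases)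
    case equal
    then show ?thesis by simp
  next
    case less
    have "(f has_derivative (*) (g t)) (at t within {x..y})" if "x \<le> t" "t \<le> y" for t
      using der[of t] that xy by (auto simp: has_field_derivative_def intro: has_derivative_subset)
    from mvt_very_simple[OF less_imp_le[OF less] this] obtain t where t: "t \<in> {x..y}" "f y - f x = g t * (y - x)"
      by auto
    have "g x * (y - x) \<le> g t * (y - x)"
      using mono[of x t] t(1) xy less by (intro mult_right_mono) auto
    then show ?thesis using t(2) by (simp add: algebra_simps)
  next
    case greater
    have "(f has_derivative (*) (g t)) (at t within {y..x})" if "y \<le> t" "t \<le> x" for t
      using der[of t] that xy by (auto simp: has_field_derivative_def intro: has_derivative_subset)
    from mvt_very_simple[OF less_imp_le[OF greater] this] obtain t where t: "t \<in> {y..x}" "f x - f y = g t * (x - y)"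
      by auto
    have "g t * (x - y) \<le> g x * (x - y)"
      using mono[of t x] t(1) xy greater by (intro mult_right_mono) auto
    then show ?thesis using t(2) by (simp add: algebra_simps)
  qed
  then show ?thesis by (simp add: f_def g_def)
qed

text \<open>The supporting line at the intermediate point is evaluated at both ends; in the weighted
  sum the slope terms cancel.\<close>

lemma phi_convex:
  fixes G0 E :: "real^'n^'n"
  assumes good: "\<And>t. t \<in> {a..b} \<Longrightarrow> good (G0 + t *\<^sub>R E) \<xi>"
  shows "convex_on {a..b} (\<lambda>t. phi (G0 + t *\<^sub>R E) \<xi>)"
proof (rule convex_onI)
  fix t x y :: real
  assume t: "0 < t" "t < 1" and xy: "x \<in> {a..b}" "y \<in> {a..b}"
  define z g f where "z = (1 - t) *\<^sub>R x + t *\<^sub>R y" and "g = Re (trace (Hm (G0 + z *\<^sub>R E) \<xi> ** complex_mat E))"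
    and "f = (\<lambda>t. phi (G0 + t *\<^sub>R E) \<xi>)"
  have z: "z \<in> {a..b}"
    using convexD_alt[of "{a..b}" x y t] xy t by (simp add: z_def)
  have "f x \<ge> f z - (x - z) * g" "f y \<ge> f z - (y - z) * g"
    using phi_tangent[OF good z] xy by (auto simp: f_def g_def)
  then have "(1 - t) * f x + t * f y \<ge> (1 - t) * (f z - (x - z) * g) + t * (f z - (y - z) * g)"
    using t by (intro add_mono mult_left_mono) auto
  moreover have "(1 - t) * (f z - (x - z) * g) + t * (f z - (y - z) * g) = f z"
    by (simp add: z_def algebra_simps)
  ultimately show "f ((1 - t) *\<^sub>R x + t *\<^sub>R y) \<le> (1 - t) * f x + t * f y"
    by (simp add: z_def)
qed simp

subsection \<open>Orthogonal invariance of Lebesgue measure\<close>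

text \<open>The library's change of variables formula requires a well-ordered index type. A finite index
  type is in bijection with one.\<close>

typedef 'a wo = "UNIV :: 'a set" morphisms unwo wo
  by auto

definition wo_rank :: "'a::finite wo \<Rightarrow> nat" where
  "wo_rank x = (SOME f. inj f) (unwo x)"

lemma inj_wo_rank: "inj wo_rank"
proof -
  have "\<exists>f :: 'a::finite \<Rightarrow> nat. inj f"
    using finite_imp_inj_to_nat_seg[of "UNIV::'a set"] by auto
  then have "inj (SOME f :: 'a::finite \<Rightarrow> nat. inj f)"
    by (rule someI_ex)
  then show ?thesis
    unfolding wo_rank_def by (intro injI) (metis injD unwo_inject)
qed

instance wo :: (finite) finite
proof
  have "UNIV = wo ` (UNIV :: 'a set)"
    by (metis surj_def unwo_inverse)
  then show "finite (UNIV :: 'a wo set)"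
    by (metis finite finite_imageI)
qed

instantiation wo :: (finite) wellorder
begin

definition less_eq_wo :: "'a wo \<Rightarrow> 'a wo \<Rightarrow> bool" where
  "less_eq_wo x y \<longleftrightarrow> wo_rank x \<le> wo_rank y"

definition less_wo :: "'a wo \<Rightarrow> 'a wo \<Rightarrow> bool" where
  "less_wo x y \<longleftrightarrow> wo_rank x < wo_rank y"

instance
proof
  fix P :: "'a wo \<Rightarrow> bool" and a
  assume "\<And>x. (\<And>y. y < x \<Longrightarrow> P y) \<Longrightarrow> P x"
  then show "P a"
    unfolding less_wo_def by (induction a rule: measure_induct_rule[of wo_rank]) blast
qed (auto simp: less_eq_wo_def less_wo_def dest: injD[OF inj_wo_rank])

end

lemma prod_Basis_vec:
  fixes f :: "real^'n \<Rightarrow> 'c::comm_monoid_mult"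
  shows "(\<Prod>b\<in>Basis. f b) = (\<Prod>i\<in>UNIV. f (axis i 1))"
proof -
  have 1: "(Basis :: (real^'n) set) = (\<lambda>i. axis i 1) ` UNIV"
    by (auto simp: Basis_vec_def)
  have 2: "inj (\<lambda>i. axis i (1::real) :: real^'n)"
    by (auto simp: inj_def axis_eq_axis)
  show ?thesis
    unfolding 1 by (subst prod.reindex[OF 2]) simp
qed

definition reindex :: "('m \<Rightarrow> 'n) \<Rightarrow> real^'n \<Rightarrow> real^'m" where
  "reindex g x = (\<chi> i. x $ g i)"

lemma reindex_linear: "linear (reindex g)"
  by (simp add: linear_iff reindex_def vec_eq_iff)

lemma reindex_measurable [measurable]: "reindex g \<in> borel_measurable borel"
  by (simp add: borel_measurable_continuous_onI linear_continuous_on linear_conv_bounded_linear reindex_linear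
      flip: linear_conv_bounded_linear)

lemma lborel_reindex:
  fixes g :: "'m::finite \<Rightarrow> 'n::finite"
  assumes "bij g"
  shows "distr lborel borel (reindex g) = lborel"
proof (rule lborel_eqI[symmetric])
  fix l u :: "real^'m" assume lu: "\<And>b. b \<in> Basis \<Longrightarrow> l \<bullet> b \<le> u \<bullet> b"
  define l' u' where "l' = reindex (inv g) l" and "u' = reindex (inv g) u"
  have le: "l $ i \<le> u $ i" for i
    using lu[of "axis i 1"] by (simp add: inner_axis axis_in_Basis_iff)
  have "reindex g -` box l u = box l' u'"
  proof -
    have "(\<forall>i. l $ i < x $ g i \<and> x $ g i < u $ i) \<longleftrightarrow> (\<forall>j. l $ inv g j < x $ j \<and> x $ j < u $ inv g j)" for x :: "real^'n"
      using assms by (metis bij_inv_eq_iff)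
    then show ?thesis
      by (auto simp: mem_box_cart reindex_def l'_def u'_def)
  qed
  then have "emeasure (distr lborel borel (reindex g)) (box l u) = emeasure lborel (box l' u')"
    by (simp add: emeasure_distr)
  also have "\<dots> = (\<Prod>b\<in>Basis. (u' - l') \<bullet> b)"
  proof (rule emeasure_lborel_box)
    show "l' \<bullet> b \<le> u' \<bullet> b" if "b \<in> Basis" for b
      using that le by (auto simp: Basis_vec_def inner_axis l'_def u'_def reindex_def)
  qed
  also have "(\<Prod>b\<in>Basis. (u' - l') \<bullet> b) = (\<Prod>j\<in>UNIV. u $ inv g j - l $ inv g j)"
    by (simp add: prod_Basis_vec inner_axis l'_def u'_def reindex_def)
  also have "\<dots> = (\<Prod>i\<in>UNIV. u $ i - l $ i)"
    using assms by (intro prod.reindex_bij_betw) (simp add: bij_imp_bij_inv)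
  also have "\<dots> = (\<Prod>b\<in>Basis. (u - l) \<bullet> b)"
    by (simp add: prod_Basis_vec inner_axis)
  finally show "emeasure (distr lborel borel (reindex g)) (box l u) = (\<Prod>b\<in>Basis. (u - l) \<bullet> b)" .
qed simp

lemma orthogonal_transformation_measurable:
  "orthogonal_transformation (T :: 'a::euclidean_space \<Rightarrow> 'a) \<Longrightarrow> T \<in> borel_measurable borel"
  by (simp add: borel_measurable_continuous_onI linear_continuous_on linear_conv_bounded_linear
      orthogonal_transformation_linear flip: linear_conv_bounded_linear)

lemma lborel_orthogonal_wo:
  fixes T :: "real^'n::{finite,wellorder} \<Rightarrow> real^'n::_"
  assumes T: "orthogonal_transformation T"
  shows "distr lborel borel T = lborel"
proof (rule lborel_eqI[symmetric])
  fix l u :: "real^'n::{finite,wellorder}" assume lu: "\<And>b. b \<in> Basis \<Longrightarrow> l \<bullet> b \<le> u \<bullet> b"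
  have T': "orthogonal_transformation (inv T)"
    by (rule orthogonal_transformation_inv[OF T])
  have "T -` box l u = inv T ` box l u"
    using orthogonal_transformation_bij[OF T] by (simp add: bij_vimage_eq_inv_image)
  moreover have "emeasure lborel (inv T ` box l u) = emeasure lborel (box l u)"
  proof -
    have m: "inv T ` box l u \<in> sets borel"
      using \<open>T -` box l u = inv T ` box l u\<close> measurable_sets_borel[OF orthogonal_transformation_measurable[OF T], of "box l u"]
      by simp
    have "measure lebesgue (inv T ` box l u) = measure lebesgue (box l u)" "inv T ` box l u \<in> lmeasurable"
      using measure_orthogonal_image[OF T'] measurable_orthogonal_image[OF T'] by auto
    then have "emeasure lebesgue (inv T ` box l u) = emeasure lebesgue (box l u)"
      using lmeasurable_box[of l u] by (metis emeasure_eq_measure2 fmeasurableD2)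
    then show ?thesis
      using m by (simp add: emeasure_completion)
  qed
  ultimately show "emeasure (distr lborel borel T) (box l u) = (\<Prod>b\<in>Basis. (u - l) \<bullet> b)"
    using lu by (simp add: emeasure_distr orthogonal_transformation_measurable[OF T])
qed simp

text \<open>Conjugation with a relabelling of coordinates carries \<open>T\<close> to the
  well-ordered index type; the relabelling preserves inner products and Lebesgue measure.\<close>

lemma lborel_orthogonal:
  fixes T :: "real^'n \<Rightarrow> real^'n"
  assumes T: "orthogonal_transformation T"
  shows "distr lborel borel T = lborel"
proof -
  have bij: "bij (wo :: 'n \<Rightarrow> 'n wo)" "bij (unwo :: 'n wo \<Rightarrow> 'n)"
    by (auto intro!: bijI' simp: wo_inject unwo_inject) (metis wo_inverse unwo_inverse UNIV_I)+
  define r r' where "r = reindex (unwo :: 'n wo \<Rightarrow> 'n)" and "r' = reindex (wo :: 'n \<Rightarrow> 'n wo)"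
  have rr: "r' (r x) = x" "r (r' y) = y" for x y
    by (simp_all add: r_def r'_def reindex_def vec_eq_iff wo_inverse unwo_inverse)
  have inner: "r' x \<bullet> r' y = x \<bullet> y" for x y
    unfolding inner_vec_def r'_def reindex_def
    using sum.reindex_bij_betw[OF bij(1), of "\<lambda>i. x $ i * y $ i"] by simp
  then have inner': "r x \<bullet> r y = x \<bullet> y" for x y
    by (metis rr(1))
  have "orthogonal_transformation (r \<circ> T \<circ> r')"
    unfolding orthogonal_transformation_def
  proof (intro conjI allI)
    show "linear (r \<circ> T \<circ> r')"
      using T unfolding r_def r'_def orthogonal_transformation_def
      by (intro linear_compose reindex_linear) auto
    show "(r \<circ> T \<circ> r') v \<bullet> (r \<circ> T \<circ> r') w = v \<bullet> w" for v w
      using T by (simp add: orthogonal_transformation_def inner inner')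
  qed
  then have "distr lborel borel (r \<circ> T \<circ> r') = lborel"
    by (rule lborel_orthogonal_wo)
  then have "distr (distr lborel borel (r \<circ> T \<circ> r')) borel r' = distr lborel borel r'"
    by simp
  moreover have [measurable]: "T \<in> borel_measurable borel" "r \<in> borel_measurable borel" "r' \<in> borel_measurable borel"
    using orthogonal_transformation_measurable[OF T] by (auto simp: r_def r'_def)
  have "distr (distr lborel borel (r \<circ> T \<circ> r')) borel r' = distr (distr lborel borel r') borel T"
    by (simp add: distr_distr comp_def rr)
  ultimately show ?thesis
    unfolding r'_def using lborel_reindex[OF bij(1)] by simp
qed

text \<open>A bijection of the standard basis with \<open>B\<close> extends to an orthogonal map
  \<open>T\<close>, which turns a box relative to \<open>B\<close> into a standard box. A product
  measure is determined by its values on boxes.\<close>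

lemma lborel_orthonormal_coordinates:
  fixes B :: "(real^'n) set"
  assumes B: "pairwise orthogonal B" "\<And>v. v \<in> B \<Longrightarrow> norm v = 1" "span B = UNIV"
  shows "finite B"
    and "distr (\<Pi>\<^sub>M v\<in>B. lborel) borel (\<lambda>x. \<Sum>v\<in>B. x v *\<^sub>R v) = lborel"
proof -
  have "0 \<notin> B"
    using B(2) by force
  then have indep: "independent B"
    using B(1) pairwise_orthogonal_independent by blast
  then show fin: "finite B"
    using independent_imp_finite by blast
  have orth: "v \<bullet> w = (if v = w then 1 else 0)" if "v \<in> B" "w \<in> B" for v w
    using B(1) B(2)[OF that(1)] that by (auto simp: pairwise_def orthogonal_def norm_eq_1)
  have "card B = DIM(real^'n)"
  proof -
    have "card B = dim (span B)"
      by (simp only: dim_span dim_eq_card_independent[OF indep])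
    then show ?thesis
      by (simp only: B(3) dim_UNIV)
  qed
  then obtain \<beta> where \<beta>: "bij_betw \<beta> (Basis :: (real^'n) set) B"
    using finite_same_card_bij[OF finite_Basis fin] by metis
  define T where "T y = (\<Sum>b\<in>Basis. (y \<bullet> b) *\<^sub>R \<beta> b)" for y :: "real^'n"
  have T\<beta>: "T y \<bullet> \<beta> b = y \<bullet> b" if "b \<in> Basis" for y b
  proof -
    have "T y \<bullet> \<beta> b = (\<Sum>c\<in>Basis. (y \<bullet> c) * (if c = b then 1 else 0))"
      unfolding T_def inner_sum_left
    proof (intro sum.cong refl)
      fix c assume c: "c \<in> (Basis :: (real^'n) set)"
      have "\<beta> c \<bullet> \<beta> b = (if c = b then 1 else 0)"
        using orth[of "\<beta> c" "\<beta> b"] bij_betwE[OF \<beta>] c that \<beta> unfolding bij_betw_def inj_on_def by auto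
      then show "(y \<bullet> c) *\<^sub>R \<beta> c \<bullet> \<beta> b = y \<bullet> c * (if c = b then 1 else 0)"
        by simp
    qed
    also have "\<dots> = y \<bullet> b"
      using that by (simp add: if_distrib[of "\<lambda>x. _ * x"] cong: if_cong)
    finally show ?thesis .
  qed
  have T: "orthogonal_transformation T"
    unfolding orthogonal_transformation_def
  proof (intro conjI allI)
    show "linear T"
      by (simp add: linear_iff T_def inner_add_left scaleR_add_left sum.distrib scaleR_sum_right)
    show "T v \<bullet> T w = v \<bullet> w" for v w
      unfolding T_def[of w] inner_sum_right inner_scaleR_right
      by (simp add: T\<beta> euclidean_inner[of v w] mult.commute)
  qed
  interpret P: product_sigma_finite "\<lambda>_::real^'n. lborel :: real measure"
    by standard
  have coords: "distr lborel (\<Pi>\<^sub>M v\<in>B. lborel) (\<lambda>y. \<lambda>v\<in>B. y \<bullet> v) = (\<Pi>\<^sub>M v\<in>B. lborel)"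
  proof (rule P.PiM_eqI[OF fin])
    fix A :: "real^'n \<Rightarrow> real set" assume A: "\<And>v. v \<in> B \<Longrightarrow> A v \<in> sets lborel"
    have [measurable]: "(\<lambda>y. \<lambda>v\<in>B. y \<bullet> v) \<in> lborel \<rightarrow>\<^sub>M (\<Pi>\<^sub>M v\<in>B. (lborel :: real measure))"
      by measurable
    have [measurable]: "Pi\<^sub>E B A \<in> sets (\<Pi>\<^sub>M v\<in>B. lborel)"
      using A by (intro sets_PiM_I_finite fin) auto
    let ?A = "\<lambda>b. A (\<beta> b)"
    have AB: "?A b \<in> sets lborel" if "b \<in> Basis" for b
      using A bij_betwE[OF \<beta>] that by auto
    have [measurable]: "T \<in> borel_measurable borel"
      by (rule orthogonal_transformation_measurable[OF T])
    have "emeasure (distr lborel (\<Pi>\<^sub>M v\<in>B. lborel) (\<lambda>y. \<lambda>v\<in>B. y \<bullet> v)) (Pi\<^sub>E B A) =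
        emeasure lborel ((\<lambda>y. \<lambda>v\<in>B. y \<bullet> v) -` Pi\<^sub>E B A)"
      by (subst emeasure_distr) auto
    also have "\<dots> = emeasure (distr lborel borel T) ((\<lambda>y. \<lambda>v\<in>B. y \<bullet> v) -` Pi\<^sub>E B A)"
      by (simp add: lborel_orthogonal[OF T])
    also have "\<dots> = emeasure lborel (T -` ((\<lambda>y. \<lambda>v\<in>B. y \<bullet> v) -` Pi\<^sub>E B A))"
    proof -
      have "(\<lambda>y. \<lambda>v\<in>B. y \<bullet> v) -` Pi\<^sub>E B A \<in> sets borel"
        using measurable_sets[of "\<lambda>y. \<lambda>v\<in>B. y \<bullet> v" lborel "\<Pi>\<^sub>M v\<in>B. (lborel :: real measure)" "Pi\<^sub>E B A"] by simp
      then show ?thesis by (simp add: emeasure_distr)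
    qed
    also have "T -` ((\<lambda>y. \<lambda>v\<in>B. y \<bullet> v) -` Pi\<^sub>E B A) = {y. \<forall>b\<in>Basis. y \<bullet> b \<in> ?A b}"
    proof -
      have "(\<forall>v\<in>B. T y \<bullet> v \<in> A v) \<longleftrightarrow> (\<forall>b\<in>Basis. y \<bullet> b \<in> ?A b)" for y
        using \<beta> T\<beta> by (force simp: bij_betw_def)
      then show ?thesis by (auto simp: PiE_iff)
    qed
    also have "emeasure lborel {y::real^'n. \<forall>b\<in>Basis. y \<bullet> b \<in> ?A b} = emeasure (\<Pi>\<^sub>M b\<in>Basis. lborel) (Pi\<^sub>E Basis ?A)"
    proof -
      have m: "{y::real^'n. \<forall>b\<in>Basis. y \<bullet> b \<in> ?A b} \<in> sets borel"
      proof -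
        have "{y::real^'n. \<forall>b\<in>Basis. y \<bullet> b \<in> ?A b} = (\<Inter>b\<in>Basis. (\<lambda>y. y \<bullet> b) -` ?A b)"
          by auto
        also have "\<dots> \<in> sets borel"
          using AB by (intro sets.finite_INT) (auto intro!: measurable_sets_borel[of _ borel])
        finally show ?thesis .
      qed
      have "(\<lambda>f. \<Sum>b\<in>Basis. f b *\<^sub>R b) -` {y::real^'n. \<forall>b\<in>Basis. y \<bullet> b \<in> ?A b} \<inter> space (\<Pi>\<^sub>M b\<in>Basis. lborel) = Pi\<^sub>E Basis ?A"
        by (auto simp: space_PiM PiE_iff inner_sum_left inner_Basis if_distrib[of "\<lambda>x. _ * x"] cong: if_cong)
      then show ?thesis
        by (subst (1) lborel_eq) (simp add: emeasure_distr m)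
    qed
    also have "\<dots> = (\<Prod>b\<in>Basis. emeasure lborel (?A b))"
      using AB by (intro P.emeasure_PiM) auto
    also have "\<dots> = (\<Prod>v\<in>B. emeasure lborel (A v))"
      by (rule prod.reindex_bij_betw[OF \<beta>])
    finally show "emeasure (distr lborel (\<Pi>\<^sub>M v\<in>B. lborel) (\<lambda>y. \<lambda>v\<in>B. y \<bullet> v)) (Pi\<^sub>E B A) = (\<Prod>v\<in>B. emeasure lborel (A v))" .
  qed simp
  have expand: "(\<Sum>v\<in>B. (y \<bullet> v) *\<^sub>R v) = y" for y
  proof -
    have "y \<in> span B" using B(3) by simp
    then obtain c where c: "y = (\<Sum>v\<in>B. c v *\<^sub>R v)"
      using fin by (auto simp: span_finite)
    have "y \<bullet> w = c w" if "w \<in> B" for w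
    proof -
      have "y \<bullet> w = (\<Sum>v\<in>B. c v * (if v = w then 1 else 0))"
        unfolding c inner_sum_left using that orth by (intro sum.cong) auto
      then show ?thesis
        using fin that by (simp add: if_distrib[of "\<lambda>x. _ * x"] cong: if_cong)
    qed
    then show ?thesis
      by (subst (2) c) (intro sum.cong, auto)
  qed
  have "distr (distr lborel (\<Pi>\<^sub>M v\<in>B. lborel) (\<lambda>y. \<lambda>v\<in>B. y \<bullet> v)) borel (\<lambda>x. \<Sum>v\<in>B. x v *\<^sub>R v) =
      distr lborel borel (\<lambda>y::real^'n. y)"
  proof (subst distr_distr)
    show "distr lborel borel ((\<lambda>x. \<Sum>v\<in>B. x v *\<^sub>R v) \<circ> (\<lambda>y. \<lambda>v\<in>B. y \<bullet> v)) = distr lborel borel (\<lambda>y. y)"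
      by (simp add: comp_def expand cong: sum.cong)
  qed measurable
  then show "distr (\<Pi>\<^sub>M v\<in>B. lborel) borel (\<lambda>x. \<Sum>v\<in>B. x v *\<^sub>R v) = (lborel :: (real^'n) measure)"
    unfolding coords by (simp add: distr_id2)
qed

subsection \<open>Slicing along a hyperplane\<close>

locale hyperplane =
  fixes a :: "real^'n" and b :: real
  assumes a: "a \<noteq> 0"
begin

text \<open>The very choice made inside \<open>hyperplane_measure\<close>, so that the two
  descriptions agree by unfolding.\<close>

definition B :: "(real^'n) set" where
  "B = (SOME B. pairwise orthogonal B \<and> (\<forall>v\<in>B. norm v = 1) \<and> span B = {v. a \<bullet> v = 0})"

definition Q :: "(real^'n \<Rightarrow> real) measure" where "Q = (\<Pi>\<^sub>M v\<in>B. lborel)"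

definition pt :: "(real^'n \<Rightarrow> real) \<Rightarrow> real^'n" where
  "pt x = - (b / (a \<bullet> a)) *\<^sub>R a + (\<Sum>v\<in>B. x v *\<^sub>R v)"

text \<open>Coordinates adapted to a layer of width \<open>e\<close>: the affine function takes the
  value \<open>e * fst p\<close>, and \<open>snd p\<close> holds the tangential coordinates.\<close>

definition slice :: "real \<Rightarrow> real \<times> (real^'n \<Rightarrow> real) \<Rightarrow> real^'n" where
  "slice e p = pt (snd p) + (e * fst p / (a \<bullet> a)) *\<^sub>R a"

lemma hyperplane_measure_eq: "hyperplane_measure a b = distr Q borel pt"
  unfolding hyperplane_measure_def Let_def B_def Q_def pt_def ..

lemma aa: "a \<bullet> a > 0"
  using a by simp

lemma B: "pairwise orthogonal B" "\<And>v. v \<in> B \<Longrightarrow> norm v = 1" "span B = {v. a \<bullet> v = 0}"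
proof -
  have "subspace {v. a \<bullet> v = 0}"
    by (rule subspace_hyperplane)
  then obtain B' where "pairwise orthogonal B'" "\<And>v. v \<in> B' \<Longrightarrow> norm v = 1" "span B' = {v. a \<bullet> v = 0}"
    using orthonormal_basis_subspace by metis
  then have "\<exists>B. pairwise orthogonal B \<and> (\<forall>v\<in>B. norm v = 1) \<and> span B = {v. a \<bullet> v = 0}"
    by blast
  then have "pairwise orthogonal B \<and> (\<forall>v\<in>B. norm v = 1) \<and> span B = {v. a \<bullet> v = 0}"
    unfolding B_def by (rule someI_ex)
  then show "pairwise orthogonal B" "\<And>v. v \<in> B \<Longrightarrow> norm v = 1" "span B = {v. a \<bullet> v = 0}"
    by blast+
qed

lemma aB: "v \<in> B \<Longrightarrow> a \<bullet> v = 0"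
  using B(3) span_superset by blast

definition nn :: "real^'n" where "nn = a /\<^sub>R norm a"

lemma nn_B: "nn \<notin> B"
  using aB[of nn] a by (auto simp: nn_def)

lemma basis: "pairwise orthogonal (insert nn B)" "\<And>v. v \<in> insert nn B \<Longrightarrow> norm v = 1" "span (insert nn B) = UNIV"
proof -
  have "orthogonal nn v" "orthogonal v nn" if "v \<in> B" for v
    using aB[OF that] by (simp_all add: orthogonal_def nn_def inner_commute)
  then show "pairwise orthogonal (insert nn B)"
    using B(1) by (auto simp: pairwise_insert)
  show "norm v = 1" if "v \<in> insert nn B" for v
    using that B(2) a by (auto simp: nn_def)
  have "y \<in> span (insert nn B)" for y
  proof -
    have "y - ((y \<bullet> a) / (a \<bullet> a)) *\<^sub>R a \<in> span B"
      using aa unfolding B(3) by (simp add: inner_diff_right inner_commute)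
    then have "y - ((y \<bullet> a) / (a \<bullet> a)) *\<^sub>R a \<in> span (insert nn B)"
      using span_mono[of B "insert nn B"] by blast
    moreover have "a = norm a *\<^sub>R nn"
      using a by (simp add: nn_def)
    then have "((y \<bullet> a) / (a \<bullet> a)) *\<^sub>R a \<in> span (insert nn B)"
      by (metis insertI1 span_base span_scale)
    ultimately show ?thesis
      using span_add by fastforce
  qed
  then show "span (insert nn B) = UNIV" by blast
qed

lemma finB: "finite B"
  using lborel_orthonormal_coordinates(1)[OF basis] by simp

sublocale P: product_sigma_finite "\<lambda>_::real^'n. lborel :: real measure"
  by standard

lemma sigma_finite_Q: "sigma_finite_measure Q"
  unfolding Q_def by (rule P.sigma_finite[OF finB])

sublocale Q: sigma_finite_measure Q
  by (rule sigma_finite_Q)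

sublocale LQ: pair_sigma_finite "lborel :: real measure" Q
  by standard

lemma pt_measurable [measurable]: "pt \<in> borel_measurable Q"
  unfolding pt_def Q_def using finB by measurable

lemma slice_measurable [measurable]: "slice e \<in> borel_measurable (lborel \<Otimes>\<^sub>M Q)"
  unfolding slice_def by measurable

lemma pt_ell: "a \<bullet> pt x + b = 0"
  using aa aB by (simp add: pt_def inner_add_right inner_diff_right inner_sum_right)

lemma slice_ell: "a \<bullet> slice e p + b = e * fst p"
  using aa pt_ell[of "snd p"] by (simp add: slice_def inner_add_right)

text \<open>Fubini in the orthonormal basis \<open>insert nn B\<close>. Arc length along the unit
  normal is \<open>e / norm a\<close> times the layer coordinate, and this Jacobian is the source of
  the factor \<open>1 / norm (\<nu> r)\<close> in the boundary measure.\<close>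

lemma slice_distr:
  assumes e: "e > 0"
  shows "distr (lborel \<Otimes>\<^sub>M Q) borel (slice e) = density lborel (\<lambda>_. ennreal (norm a / e))"
proof (rule measure_eqI)
  fix A assume "A \<in> sets (distr (lborel \<Otimes>\<^sub>M Q) borel (slice e))"
  then have A[measurable]: "A \<in> sets borel" by simp
  define h where "h \<tau> = (\<integral>\<^sup>+x. indicator A (\<tau> *\<^sub>R nn + (\<Sum>v\<in>B. x v *\<^sub>R v)) \<partial>Q)" for \<tau>
  have sm[measurable]: "(\<lambda>x. \<Sum>v\<in>B. x v *\<^sub>R v) \<in> borel_measurable Q"
    unfolding Q_def using finB by measurable
  have [measurable]: "h \<in> borel_measurable borel"
    unfolding h_def by measurable
  have ins: "(\<lambda>x. \<Sum>v\<in>insert nn B. x v *\<^sub>R v) \<in> borel_measurable (\<Pi>\<^sub>M v\<in>insert nn B. lborel)"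
    using finB by measurable
  have "emeasure lborel A = emeasure (distr (\<Pi>\<^sub>M v\<in>insert nn B. lborel) borel (\<lambda>x. \<Sum>v\<in>insert nn B. x v *\<^sub>R v)) A"
    using lborel_orthonormal_coordinates(2)[OF basis] by simp
  also have "\<dots> = (\<integral>\<^sup>+x. indicator A (\<Sum>v\<in>insert nn B. x v *\<^sub>R v) \<partial>(\<Pi>\<^sub>M v\<in>insert nn B. lborel))"
    using ins by (subst nn_integral_indicator[symmetric], simp, subst nn_integral_distr) auto
  also have "\<dots> = (\<integral>\<^sup>+\<tau>. \<integral>\<^sup>+x. indicator A (\<Sum>v\<in>insert nn B. (x(nn := \<tau>)) v *\<^sub>R v) \<partial>(\<Pi>\<^sub>M v\<in>B. lborel) \<partial>lborel)"
    using ins by (intro P.product_nn_integral_insert_rev finB nn_B) auto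
  also have "\<dots> = (\<integral>\<^sup>+\<tau>. h \<tau> \<partial>lborel)"
  proof -
    have "(\<Sum>v\<in>insert nn B. (x(nn := \<tau>)) v *\<^sub>R v) = \<tau> *\<^sub>R nn + (\<Sum>v\<in>B. x v *\<^sub>R v)" for x \<tau>
    proof -
      have "(\<Sum>v\<in>B. (x(nn := \<tau>)) v *\<^sub>R v) = (\<Sum>v\<in>B. x v *\<^sub>R v)"
        using nn_B by (intro sum.cong) auto
      then show ?thesis using finB nn_B by simp
    qed
    then show ?thesis by (simp add: h_def Q_def)
  qed
  also have "\<dots> = ennreal (e / norm a) * (\<integral>\<^sup>+s. h (- (b / norm a) + e / norm a * s) \<partial>lborel)"
    using a e by (subst nn_integral_real_affine[of h "e / norm a" "- (b / norm a)"]) auto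
  also have "(\<integral>\<^sup>+s. h (- (b / norm a) + e / norm a * s) \<partial>lborel) = (\<integral>\<^sup>+s. \<integral>\<^sup>+x. indicator A (slice e (s, x)) \<partial>Q \<partial>lborel)"
  proof -
    have "(- (b / norm a) + e / norm a * s) *\<^sub>R nn + (\<Sum>v\<in>B. x v *\<^sub>R v) = slice e (s, x)" for s x
    proof -
      have "a \<bullet> a = norm a * norm a"
        by (simp add: power2_norm_eq_inner flip: power2_eq_square)
      then have "(- (b / norm a) + e / norm a * s) *\<^sub>R nn = - (b / (a \<bullet> a)) *\<^sub>R a + (e * s / (a \<bullet> a)) *\<^sub>R a"
        using a by (simp add: nn_def field_simps scaleR_add_left[symmetric] del: scaleR_add_left)
      then show ?thesis by (simp add: slice_def pt_def)
    qed
    then show ?thesis by (simp add: h_def)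
  qed
  also have "\<dots> = (\<integral>\<^sup>+p. indicator A (slice e p) \<partial>(lborel \<Otimes>\<^sub>M Q))"
    by (rule Q.nn_integral_fst) measurable
  also have "\<dots> = emeasure (distr (lborel \<Otimes>\<^sub>M Q) borel (slice e)) A"
    by (subst nn_integral_indicator[symmetric], simp, subst nn_integral_distr) auto
  finally have eq: "emeasure lborel A = ennreal (e / norm a) * emeasure (distr (lborel \<Otimes>\<^sub>M Q) borel (slice e)) A" .
  have "emeasure (density lborel (\<lambda>_. ennreal (norm a / e))) A = ennreal (norm a / e) * emeasure lborel A"
    by (simp add: emeasure_density nn_integral_cmult)
  also have "\<dots> = (ennreal (norm a / e) * ennreal (e / norm a)) * emeasure (distr (lborel \<Otimes>\<^sub>M Q) borel (slice e)) A"
    unfolding eq by (simp add: mult.assoc)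
  also have "ennreal (norm a / e) * ennreal (e / norm a) = 1"
    using a e by (simp add: ennreal_mult[symmetric])
  finally show "emeasure (distr (lborel \<Otimes>\<^sub>M Q) borel (slice e)) A = emeasure (density lborel (\<lambda>_. ennreal (norm a / e))) A"
    by simp
qed simp

lemma slice_integral:
  fixes F :: "real^'n \<Rightarrow> real"
  assumes e: "e > 0" and [measurable]: "F \<in> borel_measurable borel"
  shows "(LINT y|lborel. F y) = e / norm a * (LINT p|(lborel \<Otimes>\<^sub>M Q). F (slice e p))"
    and "integrable lborel F \<longleftrightarrow> integrable (lborel \<Otimes>\<^sub>M Q) (\<lambda>p. F (slice e p))"
proof -
  have c: "norm a / e > 0" using a e by simp
  have "(LINT p|(lborel \<Otimes>\<^sub>M Q). F (slice e p)) = (LINT y|(distr (lborel \<Otimes>\<^sub>M Q) borel (slice e)). F y)"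
    by (subst integral_distr) auto
  also have "\<dots> = norm a / e * (LINT y|lborel. F y)"
    unfolding slice_distr[OF e] using c by (subst integral_density) auto
  finally show "(LINT y|lborel. F y) = e / norm a * (LINT p|(lborel \<Otimes>\<^sub>M Q). F (slice e p))"
    using a e by simp
  have "integrable (lborel \<Otimes>\<^sub>M Q) (\<lambda>p. F (slice e p)) \<longleftrightarrow> integrable (distr (lborel \<Otimes>\<^sub>M Q) borel (slice e)) F"
    by (subst integrable_distr_eq) auto
  also have "\<dots> \<longleftrightarrow> integrable lborel (\<lambda>x. (norm a / e) *\<^sub>R F x)"
    unfolding slice_distr[OF e] using c by (intro integrable_density) auto
  also have "\<dots> \<longleftrightarrow> integrable lborel F"
  proof
    assume "integrable lborel (\<lambda>x. (norm a / e) *\<^sub>R F x)"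
    from integrable_scaleR_right[OF this, of "e / norm a"] show "integrable lborel F"
      using a e by simp
  qed (rule integrable_scaleR_right)
  finally show "integrable lborel F \<longleftrightarrow> integrable (lborel \<Otimes>\<^sub>M Q) (\<lambda>p. F (slice e p))" ..
qed

lemma slice_coordinate: "v \<in> B \<Longrightarrow> \<bar>snd p v\<bar> \<le> norm (slice e p)"
proof -
  assume v: "v \<in> B"
  have "slice e p \<bullet> v = (\<Sum>w\<in>B. snd p w * (if w = v then 1 else 0))"
  proof -
    have "w \<bullet> v = (if w = v then 1 else 0)" if "w \<in> B" for w
      using B(1) B(2)[OF v] that v by (auto simp: pairwise_def orthogonal_def norm_eq_1)
    then show ?thesis
      using aB[OF v] by (simp add: slice_def pt_def inner_add_left inner_diff_left inner_sum_left)
  qed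
  then have "slice e p \<bullet> v = snd p v"
    using finB v by (simp add: if_distrib[of "\<lambda>x. _ * x"] cong: if_cong)
  then show ?thesis
    using Cauchy_Schwarz_ineq2[of "slice e p" v] B(2)[OF v] by simp
qed

text \<open>A set of finite measure containing the tangential coordinates of all points of norm at
  most \<open>R\<close>; it supplies dominating functions.\<close>

definition cubeQ :: "real \<Rightarrow> (real^'n \<Rightarrow> real) set" where
  "cubeQ R = Pi\<^sub>E B (\<lambda>_. {-R..R})"

lemma cubeQ_sets [measurable]: "cubeQ R \<in> sets Q"
  unfolding cubeQ_def Q_def by (intro sets_PiM_I_finite finB) auto

lemma emeasure_cubeQ: "emeasure Q (cubeQ R) < \<infinity>"
  unfolding cubeQ_def Q_def by (subst P.emeasure_PiM[OF finB]) (auto simp: ennreal_prod_eq_top less_top[symmetric] emeasure_lborel_Icc_eq power_eq_top_ennreal)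

lemma in_cubeQ: "x \<in> space Q \<Longrightarrow> norm (slice e (s, x)) \<le> R \<Longrightarrow> x \<in> cubeQ R"
proof -
  assume x: "x \<in> space Q" "norm (slice e (s, x)) \<le> R"
  have "x v \<in> {-R..R}" if "v \<in> B" for v
    using slice_coordinate[OF that, of "(s, x)" e] x(2) by auto
  then show ?thesis
    using x(1) by (auto simp: cubeQ_def Q_def space_PiM PiE_iff)
qed

lemma integrable_slab:
  fixes h :: "real \<Rightarrow> real"
  assumes h: "integrable lborel h"
  shows "integrable (lborel \<Otimes>\<^sub>M Q) (\<lambda>p. h (fst p) * indicator (cubeQ R) (snd p))"
proof -
  have int: "integrable Q (indicator (cubeQ R) :: _ \<Rightarrow> real)"
    using emeasure_cubeQ by (intro integrable_real_indicator) auto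
  have [measurable]: "h \<in> borel_measurable borel"
    using borel_measurable_integrable[OF h] by simp
  show ?thesis
  proof (rule LQ.Fubini_integrable)
    have "(\<lambda>x. LINT y|Q. norm (h (fst (x, y)) * indicator (cubeQ R) (snd (x, y)))) =
        (\<lambda>x. norm (h x) * (LINT y|Q. indicator (cubeQ R) y))"
      by (simp add: abs_mult)
    then show "integrable lborel (\<lambda>x. LINT y|Q. norm (h (fst (x, y)) * indicator (cubeQ R) (snd (x, y))))"
      using h by simp
    show "AE x in lborel. integrable Q (\<lambda>y. h (fst (x, y)) * indicator (cubeQ R) (snd (x, y)))"
      using int by simp
  qed measurable
qed

end

context hyperplane
begin

lemma product_integral:
  fixes h :: "real \<Rightarrow> real" and k :: "(real^'n \<Rightarrow> real) \<Rightarrow> real"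
  assumes h: "integrable lborel h" and k: "integrable Q k"
  shows "integrable (lborel \<Otimes>\<^sub>M Q) (\<lambda>p. h (fst p) * k (snd p))"
    and "(LINT p|(lborel \<Otimes>\<^sub>M Q). h (fst p) * k (snd p)) = (LINT s|lborel. h s) * (LINT x|Q. k x)"
proof -
  have [measurable]: "h \<in> borel_measurable borel" "k \<in> borel_measurable Q"
    using borel_measurable_integrable[OF h] borel_measurable_integrable[OF k] by simp_all
  show int: "integrable (lborel \<Otimes>\<^sub>M Q) (\<lambda>p. h (fst p) * k (snd p))"
  proof (rule LQ.Fubini_integrable)
    have "(\<lambda>x. LINT y|Q. norm (h (fst (x, y)) * k (snd (x, y)))) = (\<lambda>x. norm (h x) * (LINT y|Q. norm (k y)))"
      by (simp add: abs_mult)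
    then show "integrable lborel (\<lambda>x. LINT y|Q. norm (h (fst (x, y)) * k (snd (x, y))))"
      using h by simp
    show "AE x in lborel. integrable Q (\<lambda>y. h (fst (x, y)) * k (snd (x, y)))"
      using k by simp
  qed measurable
  show "(LINT p|(lborel \<Otimes>\<^sub>M Q). h (fst p) * k (snd p)) = (LINT s|lborel. h s) * (LINT x|Q. k x)"
    using LQ.integral_fst'[OF int] by simp
qed

text \<open>Rescaling turns the shrinking layers into the fixed slab
  \<open>0 \<le> fst p \<le> 2\<close>, where dominated convergence applies. The factor
  \<open>1 / e k\<close> cancels against the Jacobian up to \<open>1 / norm a\<close>.\<close>

lemma layer_limit:
  fixes F :: "nat \<Rightarrow> real^'n \<Rightarrow> real" and F0 :: "real \<times> (real^'n \<Rightarrow> real) \<Rightarrow> real" and e :: "nat \<Rightarrow> real"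
  assumes e: "\<And>k. e k > 0"
    and F[measurable]: "\<And>k. F k \<in> borel_measurable borel"
    and bound: "\<And>k y. \<bar>F k y\<bar> \<le> C"
    and supp: "\<And>k y. F k y \<noteq> 0 \<Longrightarrow> norm y \<le> R \<and> 0 \<le> a \<bullet> y + b \<and> a \<bullet> y + b \<le> 2 * e k"
    and lim: "AE p in lborel \<Otimes>\<^sub>M Q. (\<lambda>k. F k (slice (e k) p)) \<longlonglongrightarrow> F0 p"
    and F0[measurable]: "F0 \<in> borel_measurable (lborel \<Otimes>\<^sub>M Q)"
  shows "(\<lambda>k. (1 / e k) * (LINT y|lborel. F k y)) \<longlonglongrightarrow> 1 / norm a * (LINT p|(lborel \<Otimes>\<^sub>M Q). F0 p)"
proof -
  let ?w = "\<lambda>p. C * indicator {0..2::real} (fst p) * indicator (cubeQ R) (snd p)"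
  have "(\<lambda>k. LINT p|(lborel \<Otimes>\<^sub>M Q). F k (slice (e k) p)) \<longlonglongrightarrow> (LINT p|(lborel \<Otimes>\<^sub>M Q). F0 p)"
  proof (rule integral_dominated_convergence)
    show "integrable (lborel \<Otimes>\<^sub>M Q) ?w"
      using emeasure_cubeQ by (intro product_integral) (auto intro!: integrable_real_indicator simp: emeasure_lborel_Icc_eq)
    show "AE p in lborel \<Otimes>\<^sub>M Q. norm (F k (slice (e k) p)) \<le> ?w p" for k
    proof (rule AE_I2)
      fix p :: "real \<times> (real^'n \<Rightarrow> real)" assume p: "p \<in> space (lborel \<Otimes>\<^sub>M Q)"
      show "norm (F k (slice (e k) p)) \<le> ?w p"
      proof (cases "F k (slice (e k) p) = 0")
        case True
        then show ?thesis using bound[of k 0] by simp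
      next
        case False
        have "0 \<le> e k * fst p" "e k * fst p \<le> 2 * e k" "norm (slice (e k) p) \<le> R"
          using supp[OF False] slice_ell[of "e k" p] by auto
        then have "fst p \<in> {0..2}"
          using e[of k] by (auto simp: zero_le_mult_iff mult.commute)
        moreover have "snd p \<in> cubeQ R"
          using in_cubeQ[of "snd p" "e k" "fst p" R] p \<open>norm (slice (e k) p) \<le> R\<close>
          by (auto simp: space_pair_measure)
        ultimately show ?thesis using bound[of k] by simp
      qed
    qed
  qed (use lim in measurable)
  then have "(\<lambda>k. 1 / norm a * (LINT p|(lborel \<Otimes>\<^sub>M Q). F k (slice (e k) p))) \<longlonglongrightarrow>
      1 / norm a * (LINT p|(lborel \<Otimes>\<^sub>M Q). F0 p)"
    by (intro tendsto_intros)
  moreover have "(1 / e k) * (LINT y|lborel. F k y) = 1 / norm a * (LINT p|(lborel \<Otimes>\<^sub>M Q). F k (slice (e k) p))" for k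
    using e[of k] by (subst slice_integral(1)[OF e[of k] F]) simp
  ultimately show ?thesis by simp
qed

text \<open>On the hyperplane only the part \<open>w\<close> of \<open>a'\<close> orthogonal to
  \<open>a\<close> matters. If \<open>w = 0\<close>, the function is a nonzero constant; otherwise
  its zeros lie in a transversal hyperplane, a null set. So almost every point of a facet lies on no
  other facet hyperplane.\<close>

lemma AE_off_hyperplane:
  assumes "\<not> (\<exists>k. a' = k *\<^sub>R a \<and> b' = k * b)"
  shows "AE p in (lborel :: real measure) \<Otimes>\<^sub>M Q. a' \<bullet> pt (snd p) + b' \<noteq> 0"
proof -
  define k w where "k = (a' \<bullet> a) / (a \<bullet> a)" and "w = a' - k *\<^sub>R a"
  have wa: "w \<bullet> a = 0"
    using aa by (simp add: w_def k_def inner_diff_left)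
  have eq: "a' \<bullet> pt (snd p) + b' = w \<bullet> slice 1 p + (b' - k * b)" for p :: "real \<times> (real^'n \<Rightarrow> real)"
  proof -
    have "w \<bullet> slice 1 p = w \<bullet> pt (snd p)"
      by (simp add: slice_def inner_add_right wa)
    also have "\<dots> = a' \<bullet> pt (snd p) - k * (a \<bullet> pt (snd p))"
      by (simp add: w_def inner_diff_left)
    also have "a \<bullet> pt (snd p) = - b"
      using pt_ell[of "snd p"] by simp
    finally show ?thesis by simp
  qed
  show ?thesis
  proof (cases "w = 0")
    case True
    then have "a' = k *\<^sub>R a" by (simp add: w_def)
    then have "b' - k * b \<noteq> 0" using assms by auto
    then show ?thesis
      unfolding eq True by simp
  next
    case False
    have "negligible {y. w \<bullet> y = - (b' - k * b)}"
      using False by (simp add: negligible_hyperplane)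
    then have "AE y in lebesgue. w \<bullet> y + (b' - k * b) \<noteq> 0"
      by (auto simp: negligible_iff_null_sets eq_neg_iff_add_eq_0 dest!: AE_not_in)
    then have "AE y in lborel. w \<bullet> y + (b' - k * b) \<noteq> 0"
      by (simp add: AE_completion_iff)
    then have "AE y in distr (lborel \<Otimes>\<^sub>M Q) borel (slice 1). w \<bullet> y + (b' - k * b) \<noteq> 0"
      unfolding slice_distr[OF zero_less_one] by (subst AE_density) auto
    then show ?thesis
      by (subst (asm) AE_distr_iff) (auto simp: eq)
  qed
qed

lemma slice_0: "slice 0 p = pt (snd p)"
  by (simp add: slice_def)

lemma hyperplane_integrable:
  fixes g :: "real^'n \<Rightarrow> real"
  assumes [measurable]: "(\<lambda>y. indicator S y * g y) \<in> borel_measurable borel"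
    and "\<And>y. y \<in> S \<Longrightarrow> norm y \<le> R" "\<And>y. y \<in> S \<Longrightarrow> \<bar>g y\<bar> \<le> C"
  shows "integrable Q (\<lambda>x. indicator S (pt x) * g (pt x))"
    and "set_integrable (hyperplane_measure a b) S g"
    and "(LINT y:S|hyperplane_measure a b. g y) = (LINT x|Q. indicator S (pt x) * g (pt x))"
proof -
  have m: "(\<lambda>x. indicator S (pt x) * g (pt x)) \<in> borel_measurable Q"
    using measurable_compose[OF pt_measurable assms(1)] by simp
  show 1: "integrable Q (\<lambda>x. indicator S (pt x) * g (pt x))"
  proof (rule Bochner_Integration.integrable_bound[OF _ m])
    show "integrable Q (\<lambda>x. \<bar>C\<bar> * indicator (cubeQ R) x)"
      using emeasure_cubeQ by (auto intro!: integrable_real_indicator)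
    show "AE x in Q. norm (indicator S (pt x) * g (pt x)) \<le> norm (\<bar>C\<bar> * indicator (cubeQ R) x)"
    proof (rule AE_I2)
      fix x assume x: "x \<in> space Q"
      show "norm (indicator S (pt x) * g (pt x)) \<le> norm (\<bar>C\<bar> * indicator (cubeQ R) x)"
      proof (cases "pt x \<in> S")
        case True
        then have "x \<in> cubeQ R"
          using in_cubeQ[OF x, of 0 0 R] assms(2) by (simp add: slice_0)
        then show ?thesis
          using True assms(3)[OF True] by simp
      qed simp
    qed
  qed
  show "set_integrable (hyperplane_measure a b) S g"
    unfolding set_integrable_def hyperplane_measure_eq using 1 by (subst integrable_distr_eq) auto
  show "(LINT y:S|hyperplane_measure a b. g y) = (LINT x|Q. indicator S (pt x) * g (pt x))"
    unfolding set_lebesgue_integral_def hyperplane_measure_eq by (subst integral_distr) auto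
qed

end

section \<open>Integrability of logarithms\<close>

lemma abs_x_ln_x_le: "0 \<le> x \<Longrightarrow> x \<le> 1 \<Longrightarrow> \<bar>x * ln x\<bar> \<le> 2 * sqrt x" for x :: real
proof (cases "x = 0")
  case False
  assume x: "0 \<le> x" "x \<le> 1"
  then have x: "0 < x" "x \<le> 1" using False by auto
  have "ln (1 / sqrt x) \<le> 1 / sqrt x - 1"
    using x by (intro ln_le_minus_one) auto
  moreover have "ln (1 / sqrt x) = - (ln x / 2)"
    using x by (simp add: ln_div ln_sqrt)
  ultimately have "- ln x \<le> 2 / sqrt x" by simp
  then have "x * (- ln x) \<le> x * (2 / sqrt x)"
    using x by (intro mult_left_mono) auto
  also have "x * (2 / sqrt x) = 2 * sqrt x"
    using x by (simp add: field_simps)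
  finally show ?thesis
    using x by (simp add: abs_mult)
qed simp

lemma continuous_on_x_ln_x: "continuous_on {0..} (\<lambda>x::real. x * ln x)"
  unfolding continuous_on_def
proof
  fix x :: real assume "x \<in> {0..}"
  then consider "x = 0" | "x > 0" by fastforce
  then show "((\<lambda>x. x * ln x) \<longlongrightarrow> x * ln x) (at x within {0..})"
  proof cases
    case 1
    have "((\<lambda>x::real. x * ln x) \<longlongrightarrow> 0) (at 0 within {0..})"
    proof (rule Lim_null_comparison)
      have "\<forall>\<^sub>F x::real in at 0 within {0..}. x \<in> {0..} \<and> x < 1"
        using eventually_at_ball'[of 1 0 "{0::real..}"] by (auto elim!: eventually_mono simp: dist_real_def)
      then show "\<forall>\<^sub>F x::real in at 0 within {0..}. norm (x * ln x) \<le> 2 * sqrt x"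
        by eventually_elim (use abs_x_ln_x_le in auto)
      show "((\<lambda>x. 2 * sqrt x) \<longlongrightarrow> 0) (at 0 within {0::real..})"
        by (auto intro!: tendsto_eq_intros)
    qed
    then show ?thesis using 1 by simp
  next
    case 2
    then have "isCont (\<lambda>x. x * ln x) x" by (intro continuous_intros) auto
    then show ?thesis
      using continuous_at_imp_continuous_at_within unfolding continuous_within by blast
  qed
qed

text \<open>Shifting by \<open>ln M\<close> gives a nonnegative function on the half-open interval,
  with an antiderivative that is continuous up to 0 because \<open>0 * ln 0 = 0\<close>; no improper
  limit has to be taken.\<close>

lemma integrable_ln:
  fixes M :: real
  assumes "M \<ge> 1"
  shows "integrable lborel (\<lambda>s::real. indicator {0..M} s * \<bar>ln s\<bar>)"
proof -
  let ?f = "\<lambda>s::real. ln M - ln s"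
  have cont: "continuous_on {0..M} (\<lambda>s. s * ln M - (s * ln s - s))"
    by (intro continuous_intros continuous_on_subset[OF continuous_on_x_ln_x]) auto
  have "(?f has_integral ((M * ln M - (M * ln M - M)) - (0 * ln M - (0 * ln 0 - 0)))) {0..M}"
  proof (rule fundamental_theorem_of_calculus_interior)
    fix x assume x: "x \<in> {0<..<M}"
    then have "((\<lambda>s. s * ln M - (s * ln s - s)) has_real_derivative ?f x) (at x)"
      by (auto intro!: derivative_eq_intros)
    then show "((\<lambda>s. s * ln M - (s * ln s - s)) has_vector_derivative ?f x) (at x)"
      by (simp add: has_real_derivative_iff_has_vector_derivative)
  qed (use assms cont in auto)
  then have "?f absolutely_integrable_on {0<..M}"
  proof -
    assume "(?f has_integral ((M * ln M - (M * ln M - M)) - (0 * ln M - (0 * ln 0 - 0)))) {0..M}"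
    then have "?f integrable_on {0..M}" by blast
    then have "?f integrable_on {0<..M}"
      by (rule integrable_spike_set) (auto intro: negligible_subset[of "{0}"])
    then show ?thesis
      using assms by (intro nonnegative_absolutely_integrable_1) auto
  qed
  then have "integrable lebesgue (\<lambda>s. indicator {0<..M} s * ?f s)"
    by (simp add: set_integrable_def)
  then have "integrable lborel (\<lambda>s. indicator {0<..M} s * ?f s)"
    by (subst (asm) integrable_completion) auto
  moreover have "integrable lborel (\<lambda>s. indicator {0<..M} s * \<bar>ln M\<bar>)"
    using assms by (auto intro!: integrable_real_indicator simp: emeasure_lborel_Ioc)
  ultimately have "integrable lborel (\<lambda>s. indicator {0<..M} s * ?f s + indicator {0<..M} s * \<bar>ln M\<bar>)"
    by (rule Bochner_Integration.integrable_add)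
  then show ?thesis
  proof (rule Bochner_Integration.integrable_bound)
    show "AE s in lborel. norm (indicator {0..M} s * \<bar>ln s\<bar>) \<le> norm (indicator {0<..M} s * ?f s + indicator {0<..M} s * \<bar>ln M\<bar>)"
    proof (rule AE_I2)
      fix s :: real
      show "norm (indicator {0..M} s * \<bar>ln s\<bar>) \<le> norm (indicator {0<..M} s * ?f s + indicator {0<..M} s * \<bar>ln M\<bar>)"
      proof (cases "0 < s \<and> s \<le> M")
        case True
        then have "ln s \<le> ln M" "0 \<le> ln M"
          using assms by auto
        then have "\<bar>ln s\<bar> \<le> \<bar>ln M - ln s + \<bar>ln M\<bar>\<bar>"
          by linarith
        then show ?thesis using True by simp
      next
        case False
        then consider "s = 0" | "s \<notin> {0..M}" by fastforce
        then show ?thesis by cases auto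
      qed
    qed
  qed measurable
qed

context hyperplane
begin

text \<open>In slice coordinates of width 1 the integrand is the logarithm of the first coordinate,
  supported in a bounded slab.\<close>

lemma integrable_ln_ell:
  assumes [measurable]: "S \<in> sets borel" and S: "\<And>y. y \<in> S \<Longrightarrow> norm y \<le> R" "\<And>y. y \<in> S \<Longrightarrow> a \<bullet> y + b > 0"
  shows "integrable lborel (\<lambda>y. indicator S y * ln (a \<bullet> y + b))"
proof -
  define M where "M = max 1 (norm a * R + \<bar>b\<bar>)"
  have "integrable (lborel \<Otimes>\<^sub>M Q) (\<lambda>p. (indicator {0..M} (fst p) * \<bar>ln (fst p)\<bar>) * indicator (cubeQ R) (snd p))"
    by (intro integrable_slab integrable_ln) (simp add: M_def)
  then have "integrable (lborel \<Otimes>\<^sub>M Q) (\<lambda>p. indicator S (slice 1 p) * ln (a \<bullet> slice 1 p + b))"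
  proof (rule Bochner_Integration.integrable_bound)
    show "AE p in lborel \<Otimes>\<^sub>M Q. norm (indicator S (slice 1 p) * ln (a \<bullet> slice 1 p + b))
        \<le> norm ((indicator {0..M} (fst p) * \<bar>ln (fst p)\<bar>) * indicator (cubeQ R) (snd p) :: real)"
    proof (rule AE_I2)
      fix p :: "real \<times> (real^'n \<Rightarrow> real)" assume p: "p \<in> space (lborel \<Otimes>\<^sub>M Q)"
      show "norm (indicator S (slice 1 p) * ln (a \<bullet> slice 1 p + b))
        \<le> norm ((indicator {0..M} (fst p) * \<bar>ln (fst p)\<bar>) * indicator (cubeQ R) (snd p) :: real)"
      proof (cases "slice 1 p \<in> S")
        case True
        have "a \<bullet> slice 1 p \<le> norm a * R"
          using norm_cauchy_schwarz[of a "slice 1 p"] mult_left_mono[OF S(1)[OF True], of "norm a"] by simp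
        then have "fst p \<in> {0..M}"
          using S(2)[OF True] slice_ell[of 1 p] by (auto simp: M_def)
        moreover have "snd p \<in> cubeQ R"
          using in_cubeQ[of "snd p" 1 "fst p" R] p S(1)[OF True] by (auto simp: space_pair_measure)
        ultimately show ?thesis
          using slice_ell[of 1 p] True by simp
      qed simp
    qed
  qed measurable
  then show ?thesis
    by (subst slice_integral(2)[OF zero_less_one]) auto
qed

end

subsection \<open>Hessians\<close>

lemma line_derivative:
  fixes f :: "real^'n \<Rightarrow> real"
  assumes "f differentiable (at (x + r *\<^sub>R axis i 1))"
  shows "((\<lambda>r. f (x + r *\<^sub>R axis i 1)) has_real_derivative partial i f (x + r *\<^sub>R axis i 1)) (at r)"
proof -
  obtain f' where f': "(f has_derivative f') (at (x + r *\<^sub>R axis i 1))"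
    using assms unfolding differentiable_def by blast
  have "((\<lambda>r. x + r *\<^sub>R axis i 1) has_derivative (\<lambda>h. h *\<^sub>R axis i 1)) (at r)"
    by (auto intro!: derivative_eq_intros)
  from has_derivative_compose[OF this f']
  have "((\<lambda>r. f (x + r *\<^sub>R axis i 1)) has_derivative (\<lambda>h. f' (h *\<^sub>R axis i 1))) (at r)" .
  moreover have "(\<lambda>h. f' (h *\<^sub>R axis i 1)) = (*) (partial i f (x + r *\<^sub>R axis i 1))"
    using linear_scale[OF has_derivative_linear[OF f']] partial_has_derivative[OF f', of i]
    by (auto simp: mult.commute)
  ultimately show ?thesis
    by (simp add: has_field_derivative_def)
qed

text \<open>The mean value theorem is used first in direction \<open>a\<close>, for the difference
  of two parallel restrictions, then in direction \<open>b\<close>. The left-hand side is symmetric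
  in \<open>a\<close> and \<open>b\<close>, which makes mixed partial derivatives commute.\<close>

lemma mixed_difference:
  fixes f :: "real^'n \<Rightarrow> real"
  assumes "Ck_on 2 U f" and U: "\<And>z. dist y z \<le> 2 * s \<Longrightarrow> z \<in> U" and s: "s > 0"
  shows "\<exists>z. dist y z \<le> 2 * s \<and>
    f (y + s *\<^sub>R axis a 1 + s *\<^sub>R axis b 1) - f (y + s *\<^sub>R axis a 1) - f (y + s *\<^sub>R axis b 1) + f y
      = s\<^sup>2 * partial b (partial a f) z"
proof -
  have d1: "f differentiable (at z)" and d2: "partial i f differentiable (at z)" if "z \<in> U" for z i
    using assms(1) that by (auto simp: numeral_2_eq_2)
  have near: "y + p *\<^sub>R axis a 1 + q *\<^sub>R axis b 1 \<in> U" if "0 \<le> p" "p \<le> s" "0 \<le> q" "q \<le> s" for p q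
  proof (rule U)
    have "norm (p *\<^sub>R axis a 1 + q *\<^sub>R axis b 1 :: real^'n) \<le> p + q"
      using norm_triangle_ineq[of "p *\<^sub>R axis a 1 :: real^'n" "q *\<^sub>R axis b 1"] that by simp
    moreover have "dist y (y + p *\<^sub>R axis a 1 + q *\<^sub>R axis b 1) = norm (p *\<^sub>R axis a 1 + q *\<^sub>R axis b 1 :: real^'n)"
      by (simp add: dist_norm norm_minus_commute add.commute)
    ultimately show "dist y (y + p *\<^sub>R axis a 1 + q *\<^sub>R axis b 1) \<le> 2 * s"
      using that by simp
  qed
  have near_a: "y + p *\<^sub>R axis a 1 \<in> U" if "0 \<le> p" "p \<le> s" for p
    using near[of p 0] that s by simp
  define g where "g r = f ((y + s *\<^sub>R axis b 1) + r *\<^sub>R axis a 1) - f (y + r *\<^sub>R axis a 1)" for r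
  have "\<exists>r>0. r < s \<and> g s - g 0 = (s - 0) * (partial a f ((y + s *\<^sub>R axis b 1) + r *\<^sub>R axis a 1) - partial a f (y + r *\<^sub>R axis a 1))"
  proof (rule MVT2[OF s])
    fix r assume r: "0 \<le> r" "r \<le> s"
    have "(y + s *\<^sub>R axis b 1) + r *\<^sub>R axis a 1 \<in> U"
      using near[of r s] r s by (simp add: add_ac)
    then show "(g has_real_derivative partial a f ((y + s *\<^sub>R axis b 1) + r *\<^sub>R axis a 1) - partial a f (y + r *\<^sub>R axis a 1)) (at r)"
      unfolding g_def using r near_a by (intro DERIV_diff line_derivative d1) auto
  qed
  then obtain r where r: "0 < r" "r < s"
    "g s - g 0 = s * (partial a f ((y + s *\<^sub>R axis b 1) + r *\<^sub>R axis a 1) - partial a f (y + r *\<^sub>R axis a 1))"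
    by auto
  have "\<exists>q>0. q < s \<and> partial a f ((y + r *\<^sub>R axis a 1) + s *\<^sub>R axis b 1) - partial a f ((y + r *\<^sub>R axis a 1) + 0 *\<^sub>R axis b 1)
      = (s - 0) * partial b (partial a f) ((y + r *\<^sub>R axis a 1) + q *\<^sub>R axis b 1)"
  proof (rule MVT2[OF s])
    fix q assume q: "0 \<le> q" "q \<le> s"
    then show "((\<lambda>q. partial a f ((y + r *\<^sub>R axis a 1) + q *\<^sub>R axis b 1)) has_real_derivative
        partial b (partial a f) ((y + r *\<^sub>R axis a 1) + q *\<^sub>R axis b 1)) (at q)"
      using near[of r q] r by (intro line_derivative d2) auto
  qed
  then obtain q where q: "0 < q" "q < s"
    "partial a f ((y + r *\<^sub>R axis a 1) + s *\<^sub>R axis b 1) - partial a f (y + r *\<^sub>R axis a 1)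
      = s * partial b (partial a f) ((y + r *\<^sub>R axis a 1) + q *\<^sub>R axis b 1)"
    by auto
  define z where "z = y + r *\<^sub>R axis a 1 + q *\<^sub>R axis b 1"
  have "dist y z \<le> 2 * s"
  proof -
    have "norm (r *\<^sub>R axis a 1 + q *\<^sub>R axis b 1 :: real^'n) \<le> r + q"
      using norm_triangle_ineq[of "r *\<^sub>R axis a 1 :: real^'n" "q *\<^sub>R axis b 1"] r q by simp
    moreover have "dist y z = norm (r *\<^sub>R axis a 1 + q *\<^sub>R axis b 1 :: real^'n)"
      by (simp add: z_def dist_norm norm_minus_commute add.commute)
    ultimately show ?thesis using r q by simp
  qed
  moreover have "g s - g 0 = s\<^sup>2 * partial b (partial a f) z"
    using r(3) q(3) by (simp add: z_def power2_eq_square add_ac)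
  ultimately show ?thesis
    by (intro exI[of _ z]) (simp add: g_def algebra_simps)
qed

lemma partial_commute:
  fixes f :: "real^'n \<Rightarrow> real"
  assumes U: "open U" "y \<in> U" and f: "Ck_on 2 U f"
  shows "partial b (partial a f) y = partial a (partial b f) y"
proof (rule ccontr)
  let ?A = "partial b (partial a f)" and ?B = "partial a (partial b f)"
  assume ne: "?A y \<noteq> ?B y"
  define e where "e = \<bar>?A y - ?B y\<bar> / 2"
  have e: "e > 0" using ne by (simp add: e_def)
  have cont: "continuous_on U ?A" "continuous_on U ?B"
    using f by (auto simp: numeral_2_eq_2)
  obtain d0 where d0: "d0 > 0" "ball y d0 \<subseteq> U"
    using U open_contains_ball by blast
  obtain d1 where d1: "d1 > 0" "\<And>z. z \<in> U \<Longrightarrow> dist z y < d1 \<Longrightarrow> dist (?A z) (?A y) < e"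
    using cont(1) U(2) e unfolding continuous_on_iff by blast
  obtain d2 where d2: "d2 > 0" "\<And>z. z \<in> U \<Longrightarrow> dist z y < d2 \<Longrightarrow> dist (?B z) (?B y) < e"
    using cont(2) U(2) e unfolding continuous_on_iff by blast
  define s where "s = min d0 (min d1 d2) / 4"
  have s: "s > 0" "2 * s < d0" "2 * s < d1" "2 * s < d2"
    using d0(1) d1(1) d2(1) by (auto simp: s_def)
  have inU: "z \<in> U" if "dist y z \<le> 2 * s" for z
    using that s d0(2) by (auto simp: subset_iff)
  obtain z where z: "dist y z \<le> 2 * s"
    "f (y + s *\<^sub>R axis a 1 + s *\<^sub>R axis b 1) - f (y + s *\<^sub>R axis a 1) - f (y + s *\<^sub>R axis b 1) + f y = s\<^sup>2 * ?A z"
    using mixed_difference[OF f inU s(1)] by blast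
  obtain w where w: "dist y w \<le> 2 * s"
    "f (y + s *\<^sub>R axis b 1 + s *\<^sub>R axis a 1) - f (y + s *\<^sub>R axis b 1) - f (y + s *\<^sub>R axis a 1) + f y = s\<^sup>2 * ?B w"
    using mixed_difference[OF f inU s(1)] by blast
  have swap: "y + s *\<^sub>R axis b 1 + s *\<^sub>R axis a 1 = y + s *\<^sub>R axis a 1 + s *\<^sub>R axis b 1"
    by simp
  have "s\<^sup>2 * ?A z = s\<^sup>2 * ?B w"
    using z(2) w(2) unfolding swap by linarith
  then have "?A z = ?B w"
    using s(1) by simp
  moreover have "dist (?A z) (?A y) < e" "dist (?B w) (?B y) < e"
    using d1(2)[of z] d2(2)[of w] inU z(1) w(1) s by (auto simp: dist_commute)
  ultimately show False
    unfolding e_def dist_real_def by (simp add: abs_if split: if_splits)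
qed

lemma hessian_symmetric:
  assumes "open U" "y \<in> U" "Ck_on 2 U f"
  shows "transpose (hessian f y) = hessian f y"
  using partial_commute[OF assms] by (simp add: hessian_def transpose_def vec_eq_iff)

lemma hessian_cong_open:
  assumes "open U" "y \<in> U" "\<And>z. z \<in> U \<Longrightarrow> f z = g z"
  shows "hessian f y = hessian g y"
proof -
  have "partial a f z = partial a g z" if "z \<in> U" for a z
    using partial_cong_open[OF assms(1) that assms(3)] .
  then have "partial b (partial a f) y = partial b (partial a g) y" for a b
    by (rule partial_cong_open[OF assms(1,2)])
  then show ?thesis
    by (simp add: hessian_def)
qed

lemma hessian_add:
  assumes U: "open U" "y \<in> U"
    and "\<And>z. z \<in> U \<Longrightarrow> f differentiable (at z)" "\<And>z a. z \<in> U \<Longrightarrow> partial a f differentiable (at z)"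
    and "\<And>z. z \<in> U \<Longrightarrow> g differentiable (at z)" "\<And>z a. z \<in> U \<Longrightarrow> partial a g differentiable (at z)"
  shows "hessian (\<lambda>z. f z + g z) y = hessian f y + hessian g y"
proof -
  have "partial b (partial a (\<lambda>z. f z + g z)) y = partial b (partial a f) y + partial b (partial a g) y" for a b
  proof -
    have "partial b (partial a (\<lambda>z. f z + g z)) y = partial b (\<lambda>z. partial a f z + partial a g z) y"
      using assms by (intro partial_cong_open[OF U] partial_add) auto
    also have "\<dots> = partial b (partial a f) y + partial b (partial a g) y"
      using assms by (intro partial_add) auto
    finally show ?thesis .
  qed
  then show ?thesis
    by (simp add: hessian_def vec_eq_iff)
qed

lemma Ck_on_hessian: "open U \<Longrightarrow> Ck_on (Suc (Suc k)) U f \<Longrightarrow> Ck_on k U (hessian f)"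
  by (intro Ck_on_vec) (simp_all add: hessian_def)

lemma smooth_hessian: "open U \<Longrightarrow> smooth_on U f \<Longrightarrow> Ck_on k U (hessian f)"
  using Ck_on_hessian unfolding smooth_on_def by blast

lemma smooth_on_imp_Ck: "smooth_on U f \<Longrightarrow> Ck_on k U f"
  by (simp add: smooth_on_def)

lemma smooth_differentiable:
  assumes "smooth_on U f" "z \<in> U"
  shows "f differentiable (at z)" "partial a f differentiable (at z)"
  using smooth_on_imp_Ck[OF assms(1), of 2] assms(2) by (auto simp: numeral_2_eq_2)

lemma smooth_on_subset: "smooth_on U f \<Longrightarrow> V \<subseteq> U \<Longrightarrow> smooth_on V f"
  unfolding smooth_on_def by (blast intro: Ck_on_subset)

lemma smooth_on_add: "open U \<Longrightarrow> smooth_on U f \<Longrightarrow> smooth_on U g \<Longrightarrow> smooth_on U (\<lambda>y. f y + g y)"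
  unfolding smooth_on_def by (blast intro: Ck_on_add)

lemma smooth_on_cmult: "open U \<Longrightarrow> smooth_on U f \<Longrightarrow> smooth_on U (\<lambda>y. (t::real) * f y)"
  unfolding smooth_on_def by (intro allI Ck_on_mult[of U _ "\<lambda>_. t" f] Ck_on_const) auto

lemma hessian_cmult:
  assumes U: "open U" "y \<in> U" and f: "smooth_on U (f :: real^'n \<Rightarrow> real)"
  shows "hessian (\<lambda>z. t * f z) y = t *\<^sub>R hessian f y"
proof -
  have "partial b (partial a (\<lambda>z. t * f z)) y = t * partial b (partial a f) y" for a b
  proof -
    have "partial b (partial a (\<lambda>z. t * f z)) y = partial b (\<lambda>z. t * partial a f z) y"
      using smooth_differentiable[OF f]
      by (intro partial_cong_open[OF U] partial_bounded_linear[OF bounded_linear_mult_right]) auto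
    also have "\<dots> = t * partial b (partial a f) y"
      using smooth_differentiable[OF f U(2)] by (intro partial_bounded_linear[OF bounded_linear_mult_right]) auto
    finally show ?thesis .
  qed
  then show ?thesis
    by (simp add: hessian_def vec_eq_iff)
qed

subsection \<open>Matrices\<close>

lemma psd_cauchy_schwarz:
  fixes K :: "real^'n^'n"
  assumes sym: "transpose K = K" and psd: "\<And>v. 0 \<le> v \<bullet> (K *v v)"
  shows "(a \<bullet> (K *v b))\<^sup>2 \<le> (a \<bullet> (K *v a)) * (b \<bullet> (K *v b))"
proof -
  define A B C where "A = a \<bullet> (K *v a)" and "B = b \<bullet> (K *v b)" and "C = a \<bullet> (K *v b)"
  have C': "b \<bullet> (K *v a) = C"
    using dot_lmul_matrix[of b K a] sym by (simp add: C_def inner_commute transpose_matrix_vector[symmetric])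
  have ineq: "0 \<le> A + 2 * t * C + t\<^sup>2 * B" for t
  proof -
    have "(a + t *\<^sub>R b) \<bullet> (K *v (a + t *\<^sub>R b)) = A + 2 * t * C + t\<^sup>2 * B"
      by (simp add: matrix_vector_right_distrib matrix_vector_mult_scaleR inner_add_left inner_add_right C'
          power2_eq_square algebra_simps flip: A_def B_def C_def)
    then show ?thesis using psd by metis
  qed
  have B: "B \<ge> 0" using psd by (simp add: B_def)
  have "C\<^sup>2 \<le> A * B"
  proof (cases "B = 0")
    case True
    \<comment> \<open>For \<open>B = 0\<close> the nonnegative expression is affine in
      \<open>t\<close>, so its slope vanishes; otherwise the parameter below gives it the value
      -1.\<close>
    have "C = 0"
    proof (rule ccontr)
      assume "C \<noteq> 0"
      then have "A + 2 * (- (A + 1) / (2 * C)) * C = - 1"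
        by (simp add: field_simps)
      then show False using ineq[of "- (A + 1) / (2 * C)"] True by simp
    qed
    then show ?thesis using True by simp
  next
    case False
    then have "B > 0" using B by simp
    have "A + 2 * (- C / B) * C + (- C / B)\<^sup>2 * B = A - C\<^sup>2 / B"
      using False by (simp add: power2_eq_square field_simps)
    then have "C\<^sup>2 / B \<le> A" using ineq[of "- C / B"] by simp
    then show ?thesis using \<open>B > 0\<close> by (simp add: field_simps)
  qed
  then show ?thesis by (simp add: A_def B_def C_def)
qed

lemma tendsto_det:
  fixes M :: "'b \<Rightarrow> 'a::{real_normed_field}^'n^'n"
  assumes "(M \<longlongrightarrow> M0) F"
  shows "((\<lambda>x. det (M x)) \<longlongrightarrow> det M0) F"
  unfolding det_def using assms by (intro tendsto_intros)

lemma continuous_on_det: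
  fixes M :: "'b::topological_space \<Rightarrow> 'a::{real_normed_field}^'n^'n"
  shows "continuous_on S M \<Longrightarrow> continuous_on S (\<lambda>x. det (M x))"
  unfolding continuous_on_def by (blast intro: tendsto_det)

lemma eigenvalue_iff_det: "eigenvalue A x \<longleftrightarrow> det (A - mat x) = 0"
proof -
  have eq: "(A - mat x) *v v = A *v v - x *s v" for v
    by (simp add: matrix_vector_mult_diff_rdistrib vec_eq_iff)
      (simp add: matrix_vector_mult_def mat_def if_distrib[of "\<lambda>x. x * _"] cong: if_cong)
  have "eigenvalue A x \<longleftrightarrow> \<not> (\<forall>v. (A - mat x) *v v = 0 \<longrightarrow> v = 0)"
    by (auto simp: eigenvalue_def eq)
  also have "\<dots> \<longleftrightarrow> \<not> invertible (A - mat x)"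
    by (simp add: invertible_left_inverse matrix_left_invertible_ker)
  also have "\<dots> \<longleftrightarrow> det (A - mat x) = 0"
    using invertible_det_nz by blast
  finally show ?thesis .
qed

text \<open>The spectral radius is a \<open>Max\<close>, so it needs a finite nonempty set.
  Eigenvalues are the zeros of the characteristic polynomial; that it is not constant is seen from
  its growth along the integers.\<close>

lemma eigenvalues_finite_nonempty:
  fixes A :: "complex^'n^'n"
  shows "finite {x. eigenvalue A x}" "{x. eigenvalue A x} \<noteq> {}"
proof -
  define p where "p = det (\<chi> i j. [:A $ i $ j:] - (if i = j then [:0, 1:] else 0) :: complex poly^'n^'n)"
  have p: "poly p x = det (A - mat x)" for x
    unfolding p_def det_def
    by (simp add: poly_sum poly_prod mat_def of_int_poly if_distrib[of "\<lambda>p. poly p x"] cong: if_cong)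
  have "\<not> constant (poly p)"
  proof
    assume "constant (poly p)"
    then have const: "poly p x = poly p 0" for x
      unfolding constant_def by blast
    \<comment> \<open>If the polynomial were constant, dividing its value at \<open>Suc k\<close> by
      the corresponding power would express \<open>det (A / Suc k - 1)\<close> as a null sequence,
      while these determinants tend to \<open>det (- 1)\<close>, which is not zero.\<close>
    have scale: "inverse (of_nat (Suc k)) ^ CARD('n) * poly p 0 = det ((1 / real (Suc k)) *\<^sub>R A - mat 1)" for k
    proof -
      define r where "r = complex_of_real (1 / real (Suc k))"
      have nz: "of_nat (Suc k) \<noteq> (0::complex)"
        by (simp only: of_nat_eq_0_iff)
      have r2: "r = inverse (of_nat (Suc k))"
        by (simp only: r_def of_real_divide of_real_inverse of_real_1 of_real_of_nat_eq divide_inverse mult_1)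
      have r: "r * of_nat (Suc k) = 1" "r = inverse (of_nat (Suc k))"
        using left_inverse[OF nz] r2 by (simp_all only:)
      have "det ((1 / real (Suc k)) *\<^sub>R A - mat 1) = det (\<chi> i. r *s ((A - mat (of_nat (Suc k))) $ i))"
      proof (rule arg_cong[of _ _ det], unfold vec_eq_iff, intro allI)
        fix i j
        have s: "(1 / real (Suc k)) *\<^sub>R z = r * z" for z
          by (simp only: r_def scaleR_conv_of_real)
        show "((1 / real (Suc k)) *\<^sub>R A - mat 1) $ i $ j = (\<chi> i. r *s ((A - mat (of_nat (Suc k))) $ i)) $ i $ j"
          using r(1) by (cases "i = j")
            (simp_all only: vector_minus_component vector_scaleR_component s vec_lambda_beta
              vector_smult_component mat_def right_diff_distrib if_True if_False mult_zero_right simp_thms)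
      qed
      also have "\<dots> = r ^ CARD('n) * det (A - mat (of_nat (Suc k)))"
        by (simp only: det_rows_mul prod_constant vec_nth_inverse)
      finally show ?thesis
        using p const r by metis
    qed
    have "(\<lambda>k. inverse (of_nat (Suc k)) ^ CARD('n) * poly p 0) \<longlonglongrightarrow> 0 ^ CARD('n) * poly p 0"
      by (intro tendsto_intros LIMSEQ_inverse_real_of_nat lim_inverse_n' filterlim_compose[OF lim_inverse_n filterlim_Suc])
    moreover have "(\<lambda>k. det ((1 / real (Suc k)) *\<^sub>R A - mat 1)) \<longlonglongrightarrow> det (0 *\<^sub>R A - mat 1)"
    proof (intro tendsto_det tendsto_intros)
      show "(\<lambda>k. 1 / real (Suc k)) \<longlonglongrightarrow> 0"
        using LIMSEQ_inverse_real_of_nat by (simp add: inverse_eq_divide)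
    qed
    ultimately have "det (0 *\<^sub>R A - mat 1) = 0 ^ CARD('n) * poly p 0"
      unfolding scale using LIMSEQ_unique by blast
    then have "det (- mat 1 :: complex^'n^'n) = 0" by simp
    then have "\<not> invertible (- mat 1 :: complex^'n^'n)"
      using invertible_det_nz by blast
    moreover have "(- mat 1 :: complex^'n^'n) ** (- mat 1) = mat 1"
      by (simp add: bounded_bilinear.minus_left[OF bounded_bilinear_matrix_mult_complex]
          bounded_bilinear.minus_right[OF bounded_bilinear_matrix_mult_complex])
    ultimately show False
      using invertible_def by blast
  qed
  then have "p \<noteq> 0" "\<exists>z. poly p z = 0"
    using fundamental_theorem_of_algebra by (auto simp: constant_def)
  then show "finite {x. eigenvalue A x}" "{x. eigenvalue A x} \<noteq> {}"
    using poly_roots_finite[of p] by (auto simp: eigenvalue_iff_det p)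
qed

lemma spectral_radius_less_iff: "spectral_radius A < 1 \<longleftrightarrow> (\<forall>x. eigenvalue A x \<longrightarrow> cmod x < 1)"
  unfolding spectral_radius_def using eigenvalues_finite_nonempty[of A] by (subst Max_less_iff) auto

definition outer :: "real^'n \<Rightarrow> real^'n^'n" where
  "outer v = (\<chi> i j. v $ i * v $ j)"

lemma outer_mult: "outer v *v x = (v \<bullet> x) *\<^sub>R v"
  by (simp add: outer_def vec_eq_iff matrix_vector_mult_def inner_vec_def sum_distrib_left mult_ac)

lemma transpose_outer [simp]: "transpose (outer v) = outer v"
  by (simp add: outer_def transpose_def vec_eq_iff mult.commute)

lemma transpose_sum: "transpose (\<Sum>i\<in>I. M i) = (\<Sum>i\<in>I. transpose (M i))"
  by (simp add: transpose_def vec_eq_iff)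

lemma transpose_scaleR: "transpose (r *\<^sub>R M) = r *\<^sub>R transpose (M :: real^'n^'m)"
  by (simp add: transpose_def vec_eq_iff)

lemma transpose_add: "transpose (A + B) = transpose A + transpose B"
  by (simp add: transpose_def vec_eq_iff)

lemma sum_matrix_mult: "(\<Sum>i\<in>I. M i) *v x = (\<Sum>i\<in>I. M i *v x)" for M :: "'i \<Rightarrow> real^'n^'m"
  by (induction I rule: infinite_finite_induct) (auto simp: matrix_vector_mult_add_rdistrib)

lemma scaleR_matrix_mult: "(r *\<^sub>R M) *v x = r *\<^sub>R (M *v x)" for M :: "real^'n^'m"
  by (simp add: scaleR_matrix_vector_assoc)

lemma bounded_bilinear_matrix_vector: "bounded_bilinear ((*v) :: real^'n^'m \<Rightarrow> real^'n \<Rightarrow> real^'m)"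
  unfolding bilinear_conv_bounded_bilinear[symmetric] bilinear_def
  by (auto simp: linear_iff matrix_vector_right_distrib matrix_vector_mult_add_rdistrib
      matrix_vector_mult_scaleR scaleR_matrix_mult)

lemma inner_matrix_transpose: "(A *v x) \<bullet> y = x \<bullet> (transpose A *v y)" for A :: "real^'n^'m"
  by (metis dot_lmul_matrix inner_commute transpose_transpose transpose_matrix_vector)

lemmas continuous_on_matrix_mult = bounded_bilinear.continuous_on[OF bounded_bilinear_matrix_mult_real]
  and continuous_on_matrix_mult_complex = bounded_bilinear.continuous_on[OF bounded_bilinear_matrix_mult_complex]
  and continuous_on_matrix_vector = bounded_bilinear.continuous_on[OF bounded_bilinear_matrix_vector]
  and continuous_on_complex_mat = bounded_linear.continuous_on[OF bounded_linear_complex_mat]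
  and continuous_on_map_matrix_cnj = bounded_linear.continuous_on[OF bounded_linear_map_matrix_cnj]
  and tendsto_matrix_vector = bounded_bilinear.tendsto[OF bounded_bilinear_matrix_vector]

lemma continuous_on_matrix_inv:
  fixes M :: "'b::topological_space \<Rightarrow> real^'n^'n"
  assumes "continuous_on S M" "\<And>x. x \<in> S \<Longrightarrow> invertible (M x)"
  shows "continuous_on S (\<lambda>x. matrix_inv (M x))"
  unfolding continuous_on_def
proof
  fix x assume "x \<in> S"
  then show "((\<lambda>x. matrix_inv (M x)) \<longlongrightarrow> matrix_inv (M x)) (at x within S)"
    using assms by (intro matrix_inv_tendsto) (auto simp: continuous_on_def eventually_at_filter)
qed

lemma invertible_iff_ker: "invertible A \<longleftrightarrow> (\<forall>x. A *v x = 0 \<longrightarrow> x = 0)" for A :: "real^'n^'n"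
  by (simp add: invertible_left_inverse matrix_left_invertible_ker)

lemma matrix_inv_unique: "A ** B = mat 1 \<Longrightarrow> matrix_inv B = A" for A B :: "real^'n^'n"
proof -
  assume AB: "A ** B = mat 1"
  then have inv: "invertible B"
    using invertible_left_inverse by blast
  have "matrix_inv B = (A ** B) ** matrix_inv B"
    by (simp add: AB)
  also have "\<dots> = A ** (B ** matrix_inv B)"
    by (simp add: matrix_mul_assoc)
  finally show ?thesis
    by (simp add: invertible_inv_mult[OF inv])
qed

text \<open>Points of \<open>X\<close> close to \<open>z\<close> are also close to \<open>y\<close>;
  passing to the limit at \<open>z\<close> transfers the estimate at \<open>y\<close> from values of
  \<open>f\<close> to those of the extension.\<close>

lemma continuous_extension_by_limits:
  fixes f :: "'a::metric_space \<Rightarrow> 'b::metric_space"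
  assumes X: "open X" "X \<subseteq> P" "P \<subseteq> closure X" and lim: "\<And>y. y \<in> P \<Longrightarrow> \<exists>l. (f \<longlongrightarrow> l) (at y within X)"
    and nontriv: "\<And>y. y \<in> P \<Longrightarrow> at y within X \<noteq> bot" and cont: "continuous_on X f"
  shows "\<exists>g. continuous_on P g \<and> (\<forall>y\<in>X. g y = f y)"
proof -
  define g where "g y = Lim (at y within X) f" for y
  have g: "(f \<longlongrightarrow> g y) (at y within X)" if "y \<in> P" for y
    using lim[OF that] nontriv[OF that] unfolding g_def by (metis tendsto_Lim)
  have "g y = f y" if "y \<in> X" for y
  proof -
    have "(f \<longlongrightarrow> f y) (at y within X)"
      using cont that by (simp add: continuous_on_def)
    then show ?thesis
      using g[of y] tendsto_unique nontriv that X(2) by (metis subsetD)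
  qed
  moreover have "continuous_on P g"
    unfolding continuous_on_iff
  proof (intro ballI allI impI)
    fix y and e :: real assume y: "y \<in> P" and e: "e > 0"
    obtain d where d: "d > 0" "\<And>z. z \<in> X \<Longrightarrow> 0 < dist z y \<Longrightarrow> dist z y < d \<Longrightarrow> dist (f z) (g y) < e / 2"
      using g[OF y] e unfolding Lim_within by (metis half_gt_zero)
    have "dist (g z) (g y) < e" if z: "z \<in> P" "dist z y < d" for z
    proof (cases "z = y")
      case True
      then show ?thesis using e by simp
    next
      case False
      have "\<forall>\<^sub>F x in at z within X. dist (f x) (g y) \<le> e / 2"
      proof -
        \<comment> \<open>The first entry keeps the approximating points within \<open>d\<close> of
          \<open>y\<close>, the second keeps them different from \<open>y\<close>, where the limit
          gives no information.\<close>
        define d' where "d' = min (d - dist z y) (dist z y)"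
        have "d' > 0" using False z by (simp add: d'_def)
        then have "\<forall>\<^sub>F x in at z within X. x \<in> X \<and> dist x z < d'"
          unfolding eventually_at by auto
        then show ?thesis
        proof eventually_elim
          case (elim x)
          have "dist x y < d"
            using dist_triangle[of x y z] elim by (simp add: d'_def)
          moreover have "0 < dist x y"
            using elim by (auto simp: d'_def dist_commute)
          ultimately show ?case using d(2)[of x] elim by simp
        qed
      qed
      then have "dist (g z) (g y) \<le> e / 2"
        using nontriv[OF z(1)] by (intro tendsto_upperbound[OF tendsto_dist[OF g[OF z(1)] tendsto_const]])
      then show ?thesis using e by simp
    qed
    then show "\<exists>d>0. \<forall>x'\<in>P. dist x' y < d \<longrightarrow> dist (g x') (g y) < e"
      using d(1) by blast
  qed
  ultimately show ?thesis by blast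
qed

subsection \<open>Delzant polytopes and the Guillemin metric\<close>

locale delz =
  fixes \<nu> :: "'r::finite \<Rightarrow> real^'n" and c :: "'r \<Rightarrow> real"
  assumes delzant: "delzant \<nu> c"
begin

abbreviation L where "L r y \<equiv> ell \<nu> c r y"
definition P where "P = poly_set \<nu> c"
abbreviation X where "X \<equiv> interior P"

lemma polytope_P: "polytope P" and X_nonempty: "X \<noteq> {}"
  and inj_facet: "inj (facet \<nu> c)"
  and primitive: "primitive_vec (\<nu> r)"
  and vertex_basis: "v extreme_point_of P \<Longrightarrow> integral_vec z \<Longrightarrow>
    \<exists>!k::'r \<Rightarrow> int. (\<forall>r. L r v \<noteq> 0 \<longrightarrow> k r = 0) \<and> z = (\<Sum>r\<in>UNIV. of_int (k r) *\<^sub>R \<nu> r)"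
  using delzant by (auto simp: delzant_def P_def)

lemma in_P: "y \<in> P \<longleftrightarrow> (\<forall>r. L r y \<ge> 0)"
  by (simp add: P_def poly_set_def)

lemma compact_P: "compact P" and convex_P: "convex P" and closed_P: "closed P" and bounded_P: "bounded P"
  using polytope_P by (auto intro: polytope_imp_compact polytope_imp_convex polytope_imp_closed polytope_imp_bounded)

lemma closure_X: "closure X = P"
  using convex_closure_interior[OF convex_P X_nonempty] closed_P by (simp add: closure_closed)

lemma X_subset: "X \<subseteq> P"
  by (rule interior_subset)

lemma nu_nonzero: "\<nu> r \<noteq> 0"
proof
  assume "\<nu> r = 0"
  then have "\<nu> r = of_int 2 *\<^sub>R (0::real^'n)" by simp
  moreover have "integral_vec (0::real^'n)"
    by (simp add: integral_vec_def)
  ultimately have "\<bar>2::int\<bar> = 1"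
    using primitive[of r] unfolding primitive_vec_def by blast
  then show False by simp
qed

lemma L_continuous: "continuous_on S (L r)"
  unfolding ell_def by (intro continuous_intros)

lemma L_move: "L r (y + z) = L r y + \<nu> r \<bullet> z"
  by (simp add: ell_def inner_add_right)

lemma interior_iff: "y \<in> X \<longleftrightarrow> (\<forall>r. L r y > 0)"
proof
  assume "\<forall>r. L r y > 0"
  moreover have "open {y. \<forall>r. L r y > 0}"
  proof -
    have "{y. \<forall>r. L r y > 0} = (\<Inter>r. {y. L r y > 0})" by auto
    moreover have "open {y. L r y > 0}" for r
      unfolding ell_def by (intro open_Collect_less continuous_intros)
    ultimately show ?thesis by auto
  qed
  moreover have "{y. \<forall>r. L r y > 0} \<subseteq> P"
    by (auto simp: in_P less_imp_le)
  ultimately show "y \<in> X"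
    using interior_maximal by blast
next
  assume y: "y \<in> X"
  show "\<forall>r. L r y > 0"
  proof
    fix r
    obtain e where e: "e > 0" "cball y e \<subseteq> P"
      using y mem_interior_cball by blast
    let ?z = "- (e / norm (\<nu> r)) *\<^sub>R \<nu> r"
    have "y + ?z \<in> cball y e"
      using e(1) nu_nonzero[of r] by (simp add: dist_norm)
    then have "0 \<le> L r (y + ?z)"
      using e(2) in_P by blast
    then have "0 \<le> L r y - e / norm (\<nu> r) * (\<nu> r \<bullet> \<nu> r)"
      unfolding L_move by simp
    moreover have "e / norm (\<nu> r) * (\<nu> r \<bullet> \<nu> r) > 0"
      using e(1) nu_nonzero[of r] by (intro mult_pos_pos) auto
    ultimately show "L r y > 0" by simp
  qed
qed

lemma nontrivial: "y \<in> P \<Longrightarrow> at y within X \<noteq> bot"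
proof -
  assume "y \<in> P"
  then have "y islimpt X"
    using closure_X X_nonempty open_interior
    by (metis UnE closure_def interior_limit_point interior_open mem_Collect_eq)
  then show ?thesis
    using trivial_limit_within by blast
qed

lemma dense_eq:
  assumes "continuous_on P f" "continuous_on P g" "\<And>y. y \<in> X \<Longrightarrow> f y = g y" "y \<in> P"
  shows "f y = (g y :: 'b::t2_space)"
proof -
  have "(f \<longlongrightarrow> f y) (at y within X)" "(g \<longlongrightarrow> g y) (at y within X)"
    using assms X_subset by (auto simp: continuous_on_def intro: tendsto_within_subset)
  moreover have "\<forall>\<^sub>F z in at y within X. f z = g z"
    using assms(3) by (simp add: eventually_at_filter)
  ultimately have "(g \<longlongrightarrow> f y) (at y within X)"
    using tendsto_cong by fast
  then show ?thesis
    using \<open>(g \<longlongrightarrow> g y) (at y within X)\<close> tendsto_unique nontrivial[OF assms(4)] by blast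
qed

text \<open>The facet equations satisfied at \<open>y\<close> cut out a face. It has an extreme
  point, and extreme points of a face are extreme points of the polytope.\<close>

lemma exists_vertex:
  assumes y: "y \<in> P"
  obtains v where "v extreme_point_of P" "\<And>r. L r y = 0 \<Longrightarrow> L r v = 0"
proof -
  define F where "F = P \<inter> {z. \<forall>r. L r y = 0 \<longrightarrow> L r z = 0}"
  have F_eq: "{z. \<forall>r. L r y = 0 \<longrightarrow> L r z = 0} = (\<Inter>r\<in>{r. L r y = 0}. {z. \<nu> r \<bullet> z = - c r})"
    by (auto simp: ell_def)
  have "compact F" "convex F"
    unfolding F_def F_eq using compact_P convex_P
    by (auto intro!: compact_Int_closed closed_INT closed_hyperplane convex_Int convex_INT convex_hyperplane)
  moreover have "F \<noteq> {}"
    using y by (auto simp: F_def)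
  ultimately obtain v where v: "v extreme_point_of F"
    using extreme_point_exists_convex by blast
  have "v extreme_point_of P"
    unfolding extreme_point_of_def
  proof (intro conjI ballI notI)
    show "v \<in> P" using v by (auto simp: extreme_point_of_def F_def)
    fix p q assume pq: "p \<in> P" "q \<in> P" "v \<in> open_segment p q"
    then obtain u where u: "0 < u" "u < 1" "v = (1 - u) *\<^sub>R p + u *\<^sub>R q"
      by (auto simp: in_segment)
    have "L r p = 0 \<and> L r q = 0" if r: "L r y = 0" for r
    proof -
      have "L r v = (1 - u) * L r p + u * L r q"
        by (simp add: u(3) ell_def inner_add_right algebra_simps)
      moreover have "L r v = 0"
        using v r by (auto simp: extreme_point_of_def F_def)
      moreover have "0 \<le> (1 - u) * L r p" "0 \<le> u * L r q"
        using pq in_P u by auto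
      ultimately have "(1 - u) * L r p = 0" "u * L r q = 0"
        by linarith+
      then show ?thesis using u by simp
    qed
    then have "p \<in> F" "q \<in> F"
      using pq by (auto simp: F_def)
    then show False
      using v pq(3) by (auto simp: extreme_point_of_def)
  qed
  moreover have "L r v = 0" if "L r y = 0" for r
    using v that by (auto simp: extreme_point_of_def F_def)
  ultimately show ?thesis
    using that by blast
qed

text \<open>The integer coefficients of the coordinate vectors in the lattice basis of normals
  assemble to the dual vectors. Duality is the uniqueness of the expansion of \<open>\<nu> r\<close>
  itself.\<close>

lemma vertex_dual_basis:
  assumes v: "v extreme_point_of P"
  defines "J \<equiv> {r. L r v = 0}"
  obtains \<kappa> where "\<And>r s. r \<in> J \<Longrightarrow> s \<in> J \<Longrightarrow> \<nu> r \<bullet> \<kappa> s = (if r = s then 1 else 0)"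
    "\<And>x. x = (\<Sum>s\<in>J. (x \<bullet> \<kappa> s) *\<^sub>R \<nu> s)"
proof -
  have "integral_vec (axis i 1 :: real^'n)" for i
    by (simp add: integral_vec_def axis_def)
  then have "\<forall>i. \<exists>k::'r \<Rightarrow> int. (\<forall>r. L r v \<noteq> 0 \<longrightarrow> k r = 0) \<and> (axis i 1 :: real^'n) = (\<Sum>r\<in>UNIV. of_int (k r) *\<^sub>R \<nu> r)"
    using vertex_basis[OF v] by blast
  then obtain k :: "'n \<Rightarrow> 'r \<Rightarrow> int" where k: "\<And>i r. L r v \<noteq> 0 \<Longrightarrow> k i r = 0"
    "\<And>i. (axis i 1 :: real^'n) = (\<Sum>r\<in>UNIV. of_int (k i r) *\<^sub>R \<nu> r)"
    by metis
  define \<kappa> :: "'r \<Rightarrow> real^'n" where "\<kappa> r = (\<chi> i. of_int (k i r))" for r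
  have \<kappa>0: "\<kappa> r = 0" if "r \<notin> J" for r
    using k(1) that by (simp add: \<kappa>_def J_def vec_eq_iff)
  have expand: "x = (\<Sum>s\<in>UNIV. (x \<bullet> \<kappa> s) *\<^sub>R \<nu> s)" for x
  proof -
    have "x = (\<Sum>i\<in>UNIV. (x $ i) *\<^sub>R axis i 1)"
      by (simp add: vec_eq_iff axis_def if_distrib[of "\<lambda>x. _ * x"] cong: if_cong)
    also have "\<dots> = (\<Sum>i\<in>UNIV. \<Sum>r\<in>UNIV. (x $ i * of_int (k i r)) *\<^sub>R \<nu> r)"
      by (simp add: k(2) scaleR_sum_right)
    also have "\<dots> = (\<Sum>r\<in>UNIV. \<Sum>i\<in>UNIV. (x $ i * of_int (k i r)) *\<^sub>R \<nu> r)"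
      by (rule sum.swap)
    also have "\<dots> = (\<Sum>r\<in>UNIV. (x \<bullet> \<kappa> r) *\<^sub>R \<nu> r)"
      by (simp add: \<kappa>_def inner_vec_def scaleR_sum_left)
    finally show ?thesis .
  qed
  have "x = (\<Sum>s\<in>J. (x \<bullet> \<kappa> s) *\<^sub>R \<nu> s)" for x
  proof -
    have "(\<Sum>s\<in>UNIV. (x \<bullet> \<kappa> s) *\<^sub>R \<nu> s) = (\<Sum>s\<in>J. (x \<bullet> \<kappa> s) *\<^sub>R \<nu> s)"
      using \<kappa>0 by (intro sum.mono_neutral_right) auto
    then show ?thesis using expand by metis
  qed
  moreover have "\<nu> r \<bullet> \<kappa> s = (if r = s then 1 else 0)" if "r \<in> J" "s \<in> J" for r s
  proof -
    have int: "integral_vec (\<nu> r)"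
      using primitive by (simp add: primitive_vec_def)
    \<comment> \<open>The coefficients of \<open>\<nu> r\<close> obtained by expanding its
      coordinates; the floor turns the integral entries into integers, as the uniqueness clause
      speaks of integer coefficients.\<close>
    define m where "m s = (\<Sum>i\<in>UNIV. \<lfloor>\<nu> r $ i\<rfloor> * k i s)" for s
    have m: "\<nu> r \<bullet> \<kappa> s = of_int (m s)" for s
      using int by (simp add: m_def \<kappa>_def inner_vec_def integral_vec_def)
    have 1: "(\<forall>s. L s v \<noteq> 0 \<longrightarrow> m s = 0) \<and> \<nu> r = (\<Sum>s\<in>UNIV. of_int (m s) *\<^sub>R \<nu> s)"
      using k(1) expand[of "\<nu> r"] by (simp add: m) (simp add: m_def)
    have 2: "(\<forall>s. L s v \<noteq> 0 \<longrightarrow> (if s = r then 1 else 0 :: int) = 0) \<and>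
        \<nu> r = (\<Sum>s\<in>UNIV. of_int (if s = r then 1 else 0) *\<^sub>R \<nu> s)"
      using that(1) by (auto simp: J_def if_distrib[of of_int] if_distrib[of "\<lambda>x. x *\<^sub>R _"] cong: if_cong)
    have "\<exists>\<^sub>\<le>\<^sub>1 k::'r \<Rightarrow> int. (\<forall>s. L s v \<noteq> 0 \<longrightarrow> k s = 0) \<and> \<nu> r = (\<Sum>s\<in>UNIV. of_int (k s) *\<^sub>R \<nu> s)"
      using vertex_basis[OF v int] unfolding ex1_iff_ex_Uniq by (rule conjunct2)
    then have "m = (\<lambda>s. if s = r then 1 else 0)"
      by (rule Uniq_D) (fact 1, fact 2)
    then show ?thesis using m by auto
  qed
  ultimately show ?thesis
    using that by blast
qed

text \<open>The closed form of the Hessian of \<open>guillemin\<close> on the interior.\<close>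

definition G0 :: "real^'n \<Rightarrow> real^'n^'n" where
  "G0 y = (\<Sum>r\<in>UNIV. (1 / L r y) *\<^sub>R outer (\<nu> r))"

lemma G0_mult: "G0 y *v x = (\<Sum>r\<in>UNIV. ((\<nu> r \<bullet> x) / L r y) *\<^sub>R \<nu> r)"
  by (simp add: G0_def sum_matrix_mult scaleR_matrix_mult outer_mult)

lemma guillemin_differentiable:
  assumes "y \<in> X"
  shows "guillemin \<nu> c differentiable (at y)"
    and "partial a (guillemin \<nu> c) y = (\<Sum>r\<in>UNIV. \<nu> r $ a * (ln (L r y) + 1))"
proof -
  have L: "L r y > 0" for r
    using assms interior_iff by blast
  have d: "(guillemin \<nu> c has_derivative (\<lambda>h. \<Sum>r\<in>UNIV. L r y * ((\<nu> r \<bullet> h) * inverse (L r y)) + (\<nu> r \<bullet> h) * ln (L r y))) (at y)"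
    unfolding guillemin_def ell_def using L
    by (intro has_derivative_sum has_derivative_mult has_derivative_ln)
      (auto simp: ell_def intro!: derivative_eq_intros)
  then show "guillemin \<nu> c differentiable (at y)"
    by (rule differentiableI)
  show "partial a (guillemin \<nu> c) y = (\<Sum>r\<in>UNIV. \<nu> r $ a * (ln (L r y) + 1))"
    unfolding partial_has_derivative[OF d]
    using L by (intro sum.cong) (auto simp: inner_axis algebra_simps less_imp_neq[THEN not_sym])
qed

lemma guillemin_hessian:
  assumes y: "y \<in> X"
  shows "partial a (guillemin \<nu> c) differentiable (at y)" and "hessian (guillemin \<nu> c) y = G0 y"
proof -
  have L: "L r y > 0" for r
    using assms interior_iff by blast
  let ?g = "\<lambda>a z. \<Sum>r\<in>UNIV. \<nu> r $ a * (ln (L r z) + 1)"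
  have d: "(?g a has_derivative (\<lambda>h. \<Sum>r\<in>UNIV. \<nu> r $ a * ((\<nu> r \<bullet> h) * inverse (L r y) + 0))) (at y)" for a
    unfolding ell_def using L
    by (intro has_derivative_sum has_derivative_mult_right has_derivative_add has_derivative_ln has_derivative_const)
      (auto simp: ell_def intro!: derivative_eq_intros)
  have eq: "?g a z = partial a (guillemin \<nu> c) z" if "z \<in> X" for a z
    using guillemin_differentiable(2)[OF that] by simp
  show "partial a (guillemin \<nu> c) differentiable (at y)"
    using differentiable_cong_open[OF open_interior y eq differentiableI[OF d]] .
  have "partial b (partial a (guillemin \<nu> c)) y = (\<Sum>r\<in>UNIV. \<nu> r $ a * (\<nu> r $ b / L r y))" for a b
  proof -
    have "partial b (partial a (guillemin \<nu> c)) y = partial b (?g a) y"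
      using eq by (intro partial_cong_open[OF open_interior y]) auto
    then show ?thesis
      unfolding partial_has_derivative[OF d] by (simp add: inner_axis divide_inverse)
  qed
  then show "hessian (guillemin \<nu> c) y = G0 y"
    by (simp add: hessian_def G0_def outer_def vec_eq_iff)
qed

end

section \<open>Boundary charts at vertices\<close>

text \<open>In the applications \<open>J\<close> is the set of facets through a vertex and
  \<open>\<kappa>\<close> the basis dual to their normals.\<close>

locale chart = delz +
  fixes J :: "'a set" and \<kappa> :: "'a \<Rightarrow> real^'b"
  assumes dual: "\<And>r s. r \<in> J \<Longrightarrow> s \<in> J \<Longrightarrow> \<nu> r \<bullet> \<kappa> s = (if r = s then 1 else 0)"
    and expand: "\<And>x. x = (\<Sum>s\<in>J. (x \<bullet> \<kappa> s) *\<^sub>R \<nu> s)"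
begin

definition U where "U = {y \<in> P. \<forall>r. r \<notin> J \<longrightarrow> L r y > 0}"
text \<open>On the interior \<open>Lam\<close> inverts the part of \<open>G0\<close> that becomes
  singular on the facets in \<open>J\<close>; \<open>S\<close> is the remaining part, regular on
  \<open>U\<close>. The product of \<open>Lam\<close> and \<open>G0\<close> is thus the regular
  matrix \<open>M0\<close>, and \<open>G0\<close> has the inverse
  \<open>matrix_inv (M0 y) ** Lam y\<close>, which makes sense on all of \<open>U\<close>.\<close>

definition Lam where "Lam y = (\<Sum>r\<in>J. L r y *\<^sub>R outer (\<kappa> r))"
definition S where "S y = (\<Sum>r\<in>-J. (1 / L r y) *\<^sub>R outer (\<nu> r))"
definition M0 where "M0 y = mat 1 + Lam y ** S y"

lemma X_U: "X \<subseteq> U"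
  using X_subset interior_iff by (auto simp: U_def)

lemma continuous_Lam: "continuous_on A Lam"
  unfolding Lam_def by (intro continuous_intros L_continuous)

lemma continuous_S: "continuous_on U S"
  unfolding S_def by (intro continuous_intros L_continuous) (auto simp: U_def)

lemma continuous_M0: "continuous_on U M0"
  unfolding M0_def by (intro continuous_intros continuous_on_matrix_mult continuous_Lam continuous_S)

lemma dual_expand: "x = (\<Sum>s\<in>J. (\<nu> s \<bullet> x) *\<^sub>R \<kappa> s)"
proof -
  have "z \<bullet> x = z \<bullet> (\<Sum>s\<in>J. (\<nu> s \<bullet> x) *\<^sub>R \<kappa> s)" for z
  proof -
    have "z \<bullet> x = (\<Sum>s\<in>J. (z \<bullet> \<kappa> s) *\<^sub>R \<nu> s) \<bullet> x"
      using expand[of z] by simp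
    then show ?thesis
      by (simp add: inner_sum_left inner_sum_right mult.commute)
  qed
  from this[of "x - (\<Sum>s\<in>J. (\<nu> s \<bullet> x) *\<^sub>R \<kappa> s)"]
  have "(x - (\<Sum>s\<in>J. (\<nu> s \<bullet> x) *\<^sub>R \<kappa> s)) \<bullet> (x - (\<Sum>s\<in>J. (\<nu> s \<bullet> x) *\<^sub>R \<kappa> s)) = 0"
    unfolding inner_diff_right[of _ x] by linarith
  then show ?thesis
    unfolding inner_eq_zero_iff by simp
qed

lemma Lam_mult: "Lam y *v x = (\<Sum>r\<in>J. (L r y * (\<kappa> r \<bullet> x)) *\<^sub>R \<kappa> r)"
  by (simp add: Lam_def sum_matrix_mult scaleR_matrix_mult outer_mult)

lemma S_mult: "S y *v x = (\<Sum>r\<in>-J. ((\<nu> r \<bullet> x) / L r y) *\<^sub>R \<nu> r)"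
  by (simp add: S_def sum_matrix_mult scaleR_matrix_mult outer_mult)

lemma M0_mult: "M0 y *v x = x + Lam y *v (S y *v x)"
  by (simp add: M0_def matrix_vector_mult_add_rdistrib matrix_vector_mul_assoc)

lemma Lam_nu: "r \<in> J \<Longrightarrow> Lam y *v \<nu> r = L r y *\<^sub>R \<kappa> r"
proof -
  assume r: "r \<in> J"
  have "Lam y *v \<nu> r = (\<Sum>s\<in>J. if s = r then L r y *\<^sub>R \<kappa> r else 0)"
    unfolding Lam_mult using dual[OF r] by (intro sum.cong) (auto simp: inner_commute)
  then show ?thesis using r by simp
qed

text \<open>With \<open>z = S y *v x\<close> and \<open>x = - (Lam y *v z)\<close>, the number
  \<open>x \<bullet> z\<close> is nonnegative by the first relation and nonpositive by the second.
  Its vanishing kills every term of \<open>S y *v x\<close>.\<close>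

lemma M0_inj:
  assumes y: "y \<in> U" and x: "M0 y *v x = 0"
  shows "x = 0"
proof -
  define z where "z = S y *v x"
  have xz: "x = - (Lam y *v z)"
    using x by (simp add: M0_mult z_def eq_neg_iff_add_eq_0)
  have L: "L r y \<ge> 0" "r \<notin> J \<Longrightarrow> L r y > 0" for r
    using y by (auto simp: U_def in_P)
  have "x \<bullet> z = (\<Sum>r\<in>-J. (\<nu> r \<bullet> x)\<^sup>2 / L r y)"
    by (simp add: z_def S_mult inner_sum_right power2_eq_square inner_commute)
  moreover have "x \<bullet> z = - (\<Sum>r\<in>J. L r y * (\<kappa> r \<bullet> z)\<^sup>2)"
    by (subst xz) (simp add: Lam_mult inner_sum_left power2_eq_square mult_ac)
  moreover have "(\<Sum>r\<in>J. L r y * (\<kappa> r \<bullet> z)\<^sup>2) \<ge> 0"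
    using L by (intro sum_nonneg) auto
  moreover have nn: "(\<nu> r \<bullet> x)\<^sup>2 / L r y \<ge> 0" if "r \<in> -J" for r
    using L that by auto
  ultimately have "(\<Sum>r\<in>-J. (\<nu> r \<bullet> x)\<^sup>2 / L r y) = 0"
    using sum_nonneg[of "-J" "\<lambda>r. (\<nu> r \<bullet> x)\<^sup>2 / L r y"] by auto
  then have "\<forall>r\<in>-J. (\<nu> r \<bullet> x)\<^sup>2 / L r y = 0"
    using nn by (subst (asm) sum_nonneg_eq_0_iff) auto
  then have "(\<nu> r \<bullet> x)\<^sup>2 / L r y = 0" if "r \<in> -J" for r
    using that by blast
  then have "\<nu> r \<bullet> x = 0" if "r \<in> -J" for r
    using that L(2)[of r] by fastforce
  then have "z = 0"
    by (simp add: z_def S_mult)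
  then show "x = 0" using xz by simp
qed

lemma invertible_M0: "y \<in> U \<Longrightarrow> invertible (M0 y)"
  using M0_inj by (simp add: invertible_iff_ker)

lemma Lam_G0:
  assumes y: "y \<in> X"
  shows "Lam y ** G0 y = M0 y"
proof -
  have L: "L r y > 0" for r
    using y interior_iff by blast
  have "(Lam y ** G0 y) *v x = M0 y *v x" for x
  proof -
    have split: "G0 y *v x = (\<Sum>r\<in>J. ((\<nu> r \<bullet> x) / L r y) *\<^sub>R \<nu> r) + S y *v x"
      using sum.union_disjoint[of J "-J" "\<lambda>r. ((\<nu> r \<bullet> x) / L r y) *\<^sub>R \<nu> r"]
      by (simp add: G0_mult S_mult Compl_partition)
    have "Lam y *v (\<Sum>r\<in>J. ((\<nu> r \<bullet> x) / L r y) *\<^sub>R \<nu> r) = (\<Sum>r\<in>J. ((\<nu> r \<bullet> x) / L r y) *\<^sub>R (Lam y *v \<nu> r))"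
      by (simp only: bounded_bilinear.sum_right[OF bounded_bilinear_matrix_vector] matrix_vector_mult_scaleR)
    also have "\<dots> = (\<Sum>r\<in>J. (\<nu> r \<bullet> x) *\<^sub>R \<kappa> r)"
      using L by (intro sum.cong) (auto simp: Lam_nu less_imp_neq[THEN not_sym])
    also have "\<dots> = x"
      using dual_expand[of x] by simp
    finally show ?thesis
      by (simp add: split M0_mult matrix_vector_right_distrib flip: matrix_vector_mul_assoc)
  qed
  then show ?thesis
    by (simp add: matrix_eq)
qed

text \<open>The independent spanning normals in \<open>J\<close> are as many as the dimension, so
  \<open>Lam\<close> is congruent to a diagonal matrix of the \<open>L r y\<close> through the dual
  vectors. The constant is a squared determinant; if it vanished, \<open>M0\<close> would be
  singular at an interior point.\<close>

lemma det_Lam: "\<exists>d\<noteq>0. \<forall>y. det (Lam y) = d * (\<Prod>r\<in>J. L r y)"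
proof -
  have inj: "inj_on \<nu> J"
    by (rule inj_onI) (metis dual zero_neq_one)
  have "independent (\<nu> ` J)"
  proof (rule independent_if_scalars_zero)
    fix f x assume f: "(\<Sum>x\<in>\<nu> ` J. f x *\<^sub>R x) = 0" and "x \<in> \<nu> ` J"
    then obtain s where s: "s \<in> J" "x = \<nu> s" by auto
    have "(\<Sum>r\<in>J. f (\<nu> r) *\<^sub>R \<nu> r) = 0"
      using f by (simp add: sum.reindex[OF inj])
    then have "(\<Sum>r\<in>J. f (\<nu> r) *\<^sub>R \<nu> r) \<bullet> \<kappa> s = 0" by simp
    then have "(\<Sum>r\<in>J. f (\<nu> r) * (if r = s then 1 else 0)) = 0"
      using dual s(1) by (simp add: inner_sum_left)
    then show "f x = 0"
      using s by (simp add: if_distrib[of "\<lambda>x. _ * x"] cong: if_cong)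
  qed simp
  moreover have "span (\<nu> ` J) = UNIV"
  proof -
    have "x \<in> span (\<nu> ` J)" for x
      by (subst expand) (intro span_sum span_scale span_base, auto)
    then show ?thesis by blast
  qed
  ultimately have "card (\<nu> ` J) = dim (UNIV :: (real^'b) set)"
    by (metis dim_span dim_eq_card_independent)
  then have "card J = CARD('b)"
    by (simp add: card_image[OF inj])
  then obtain \<beta> where \<beta>: "bij_betw \<beta> (UNIV :: 'b set) J"
    using finite_same_card_bij[of "UNIV :: 'b set" J] by auto
  define K :: "real^'b^'b" where "K = (\<chi> i. \<kappa> (\<beta> i))"
  define Dg where "Dg y = (\<chi> i j. if i = j then L (\<beta> i) y else 0)" for y
  have "Lam y = transpose K ** Dg y ** K" for y
  proof -
    have "(transpose K ** Dg y ** K) $ a $ b = (\<Sum>i\<in>UNIV. L (\<beta> i) y * (\<kappa> (\<beta> i) $ a * \<kappa> (\<beta> i) $ b))" for a b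
      by (simp add: matrix_matrix_mult_def transpose_def K_def Dg_def if_distrib[of "\<lambda>x. _ * x"] mult_ac cong: if_cong)
    moreover have "Lam y $ a $ b = (\<Sum>i\<in>UNIV. L (\<beta> i) y * (\<kappa> (\<beta> i) $ a * \<kappa> (\<beta> i) $ b))" for a b
      using sum.reindex_bij_betw[OF \<beta>, of "\<lambda>r. L r y * (\<kappa> r $ a * \<kappa> r $ b)"]
      by (simp add: Lam_def outer_def)
    ultimately show ?thesis by (simp add: vec_eq_iff)
  qed
  moreover have "det (Dg y) = (\<Prod>r\<in>J. L r y)" for y
  proof -
    have "det (Dg y) = (\<Prod>i\<in>UNIV. L (\<beta> i) y)"
      by (subst det_diagonal) (auto simp: Dg_def)
    then show ?thesis
      using prod.reindex_bij_betw[OF \<beta>, of "\<lambda>r. L r y"] by simp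
  qed
  ultimately have eq: "det (Lam y) = (det K)\<^sup>2 * (\<Prod>r\<in>J. L r y)" for y
    by (simp add: det_mul power2_eq_square)
  moreover have "(det K)\<^sup>2 \<noteq> 0"
  proof
    assume 0: "(det K)\<^sup>2 = 0"
    obtain y where y: "y \<in> X" using X_nonempty by blast
    have "det (Lam y) * det (G0 y) = det (M0 y)"
      using Lam_G0[OF y] det_mul by metis
    then have "det (M0 y) = 0"
      using eq[of y] 0 by simp
    then show False
      using invertible_M0[of y] X_U y invertible_det_nz by blast
  qed
  ultimately show ?thesis by blast
qed

lemma inv_G0:
  assumes y: "y \<in> X"
  shows "matrix_inv (G0 y) = matrix_inv (M0 y) ** Lam y" "invertible (G0 y)"
proof -
  have "(matrix_inv (M0 y) ** Lam y) ** G0 y = mat 1"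
    using Lam_G0[OF y] invertible_M0[of y] X_U y
    by (auto simp: matrix_mul_assoc[symmetric] invertible_inv_mult)
  then show "matrix_inv (G0 y) = matrix_inv (M0 y) ** Lam y" "invertible (G0 y)"
    using matrix_inv_unique invertible_left_inverse by blast+
qed

lemma continuous_inv_M0: "continuous_on U (\<lambda>y. matrix_inv (M0 y))"
  by (rule continuous_on_matrix_inv[OF continuous_M0 invertible_M0])

lemma inv_G0_limit:
  assumes y: "y \<in> U"
  shows "((\<lambda>z. matrix_inv (G0 z)) \<longlongrightarrow> matrix_inv (M0 y) ** Lam y) (at y within X)"
proof -
  have "continuous_on U (\<lambda>z. matrix_inv (M0 z) ** Lam z)"
    by (intro continuous_on_matrix_mult continuous_inv_M0 continuous_Lam)
  then have "((\<lambda>z. matrix_inv (M0 z) ** Lam z) \<longlongrightarrow> matrix_inv (M0 y) ** Lam y) (at y within X)"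
    using y X_U by (auto simp: continuous_on_def intro: tendsto_within_subset)
  moreover have "\<forall>\<^sub>F z in at y within X. matrix_inv (M0 z) ** Lam z = matrix_inv (G0 z)"
    using inv_G0(1) by (simp add: eventually_at_filter)
  ultimately show ?thesis
    using tendsto_cong by fast
qed

text \<open>\<open>Lam\<close> maps \<open>\<nu> r\<close> to \<open>L r\<close> times
  \<open>\<kappa> r\<close>, so the vanishing factor cancels.\<close>

lemma w_limit:
  assumes y: "y \<in> U" and r: "r \<in> J"
  shows "((\<lambda>z. (1 / L r z) *\<^sub>R (matrix_inv (G0 z) *v \<nu> r)) \<longlongrightarrow> matrix_inv (M0 y) *v \<kappa> r) (at y within X)"
proof -
  have "continuous_on U (\<lambda>z. matrix_inv (M0 z) *v \<kappa> r)"
    by (intro continuous_on_matrix_vector continuous_inv_M0 continuous_on_const)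
  then have "((\<lambda>z. matrix_inv (M0 z) *v \<kappa> r) \<longlongrightarrow> matrix_inv (M0 y) *v \<kappa> r) (at y within X)"
    using y X_U by (auto simp: continuous_on_def intro: tendsto_within_subset)
  moreover have "(1 / L r z) *\<^sub>R (matrix_inv (G0 z) *v \<nu> r) = matrix_inv (M0 z) *v \<kappa> r" if z: "z \<in> X" for z
  proof -
    have "L r z > 0" using z interior_iff by blast
    then show ?thesis
      using Lam_nu[OF r, of z]
      by (simp add: inv_G0(1)[OF z] matrix_vector_mult_scaleR flip: matrix_vector_mul_assoc)
  qed
  then have "\<forall>\<^sub>F z in at y within X. matrix_inv (M0 z) *v \<kappa> r = (1 / L r z) *\<^sub>R (matrix_inv (G0 z) *v \<nu> r)"
    by (simp add: eventually_at_filter)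
  ultimately show ?thesis
    using tendsto_cong by fast
qed

text \<open>On the facet the range of \<open>Lam\<close> is orthogonal to \<open>\<nu> r\<close>, so
  \<open>M0\<close> acts as the identity after pairing with \<open>\<nu> r\<close>, and duality
  gives 1.\<close>

lemma nu_w:
  assumes y: "y \<in> U" and r: "r \<in> J" and "L r y = 0"
  shows "\<nu> r \<bullet> (matrix_inv (M0 y) *v \<kappa> r) = 1"
proof -
  define w where "w = matrix_inv (M0 y) *v \<kappa> r"
  have "M0 y *v w = \<kappa> r"
    using invertible_M0[OF y] by (simp add: w_def matrix_vector_mul_assoc invertible_inv_mult)
  then have "\<nu> r \<bullet> (w + Lam y *v (S y *v w)) = 1"
    using dual[OF r r] by (simp add: M0_mult)
  moreover have "\<nu> r \<bullet> (Lam y *v z) = 0" for z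
  proof -
    have "\<nu> r \<bullet> (Lam y *v z) = (\<Sum>s\<in>J. L s y * (\<kappa> s \<bullet> z) * (if r = s then 1 else 0))"
      using dual[OF r] by (simp add: Lam_mult inner_sum_right)
    then show ?thesis
      using \<open>L r y = 0\<close> r by (simp add: if_distrib[of "\<lambda>x. _ * x"] cong: if_cong)
  qed
  ultimately show ?thesis
    by (simp add: inner_add_right flip: w_def)
qed

text \<open>The factors \<open>L r\<close> with \<open>r\<close> in \<open>J\<close> come from
  \<open>det (Lam z)\<close>; the others are nonzero throughout \<open>U\<close>.\<close>

lemma det_limit:
  assumes y: "y \<in> U"
  shows "\<exists>l\<noteq>0. ((\<lambda>z. (\<Prod>r\<in>UNIV. L r z) * det (G0 z)) \<longlongrightarrow> l) (at y within X)"
proof -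
  obtain d where d: "d \<noteq> 0" "\<And>y. det (Lam y) = d * (\<Prod>r\<in>J. L r y)"
    using det_Lam by blast
  let ?h = "\<lambda>z. (\<Prod>r\<in>-J. L r z) * det (M0 z) / d"
  have "continuous_on U ?h"
    using d(1) by (intro continuous_intros continuous_on_det continuous_M0 L_continuous) auto
  then have "(?h \<longlongrightarrow> ?h y) (at y within X)"
    using y X_U by (auto simp: continuous_on_def intro: tendsto_within_subset)
  moreover have "?h z = (\<Prod>r\<in>UNIV. L r z) * det (G0 z)" if z: "z \<in> X" for z
  proof -
    have "det (M0 z) = d * (\<Prod>r\<in>J. L r z) * det (G0 z)"
      using Lam_G0[OF z] d(2)[of z] by (metis det_mul)
    moreover have "(\<Prod>r\<in>UNIV. L r z) = (\<Prod>r\<in>J. L r z) * (\<Prod>r\<in>-J. L r z)"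
      using prod.union_disjoint[of J "-J" "\<lambda>r. L r z"] by (simp add: Compl_partition)
    ultimately show ?thesis using d(1) by simp
  qed
  then have "\<forall>\<^sub>F z in at y within X. ?h z = (\<Prod>r\<in>UNIV. L r z) * det (G0 z)"
    by (simp add: eventually_at_filter)
  ultimately have "((\<lambda>z. (\<Prod>r\<in>UNIV. L r z) * det (G0 z)) \<longlongrightarrow> ?h y) (at y within X)"
    using tendsto_cong by fast
  moreover have "?h y \<noteq> 0"
  proof -
    have "det (M0 y) \<noteq> 0"
      using invertible_M0[OF y] invertible_det_nz by blast
    moreover have "(\<Prod>r\<in>-J. L r y) \<noteq> 0"
      using y by (auto simp: U_def)
    ultimately show ?thesis using d(1) by simp
  qed
  ultimately show ?thesis by blast
qed

end

section \<open>Continuous extensions to the closed polytope\<close>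

context delz
begin

lemma exists_chart:
  assumes "y \<in> P"
  obtains J \<kappa> where "chart \<nu> c J \<kappa>" "y \<in> chart.U \<nu> c J"
proof -
  obtain v where v: "v extreme_point_of P" "\<And>r. L r y = 0 \<Longrightarrow> L r v = 0"
    using exists_vertex[OF assms] by blast
  define J where "J = {r. L r v = 0}"
  obtain \<kappa> where \<kappa>: "\<And>r s. r \<in> J \<Longrightarrow> s \<in> J \<Longrightarrow> \<nu> r \<bullet> \<kappa> s = (if r = s then 1 else 0)"
    "\<And>x. x = (\<Sum>s\<in>J. (x \<bullet> \<kappa> s) *\<^sub>R \<nu> s)"
    unfolding J_def by (rule vertex_dual_basis[OF v(1)]) blast
  have "chart \<nu> c J \<kappa>"
    by (intro chart.intro chart_axioms.intro delz_axioms) (use \<kappa> in auto)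
  moreover have "L r y > 0" if "r \<notin> J" for r
    using v(2)[of r] that assms by (auto simp: J_def in_P order_le_less)
  then have "y \<in> chart.U \<nu> c J"
    unfolding chart.U_def[OF \<open>chart \<nu> c J \<kappa>\<close>] using assms by auto
  ultimately show ?thesis using that by blast
qed

lemma G0_posdef: "y \<in> X \<Longrightarrow> real_posdef (G0 y)"
  unfolding real_posdef_def
proof (intro conjI allI impI)
  assume y: "y \<in> X"
  have L: "L r y > 0" for r
    using y interior_iff by blast
  show "transpose (G0 y) = G0 y"
    by (simp add: G0_def transpose_sum transpose_scaleR)
  fix v :: "real^'n" assume "v \<noteq> 0"
  obtain J \<kappa> where "chart \<nu> c J \<kappa>"
    using exists_chart X_subset y by blast
  then interpret chart \<nu> c J \<kappa> .
  have eq: "v \<bullet> (G0 y *v v) = (\<Sum>r\<in>UNIV. (\<nu> r \<bullet> v)\<^sup>2 / L r y)"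
    by (simp add: G0_mult inner_sum_right power2_eq_square inner_commute)
  have "\<exists>r. \<nu> r \<bullet> v \<noteq> 0"
  proof (rule ccontr)
    assume "\<not> (\<exists>r. \<nu> r \<bullet> v \<noteq> 0)"
    then have "v = 0" using dual_expand[of v] by simp
    then show False using \<open>v \<noteq> 0\<close> by simp
  qed
  then obtain r where "\<nu> r \<bullet> v \<noteq> 0" by blast
  then have "0 < (\<nu> r \<bullet> v)\<^sup>2 / L r y"
    using L by simp
  then show "0 < v \<bullet> (G0 y *v v)"
    unfolding eq using L by (intro sum_pos2[of UNIV r]) (auto simp: less_imp_le)
qed

lemma G0_continuous: "continuous_on X G0"
  unfolding G0_def using interior_iff
  by (intro continuous_intros L_continuous) (metis less_irrefl)

lemma G0_inv_continuous: "continuous_on X (\<lambda>y. matrix_inv (G0 y))"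
  by (intro continuous_on_matrix_inv G0_continuous real_posdef_invertible G0_posdef)

lemma X_extension:
  assumes "\<And>y. y \<in> P \<Longrightarrow> \<exists>l. (f \<longlongrightarrow> l) (at y within X)" "continuous_on X f"
  shows "\<exists>g. continuous_on P g \<and> (\<forall>y\<in>X. g y = (f y :: 'b::metric_space))"
  using continuous_extension_by_limits[of X P f] assms nontrivial X_subset closure_X by auto

text \<open>\<open>G0\<close> blows up at the boundary, but its inverse and \<open>G0\<^sup>-\<^sup>1 \<nu>\<^sup>r / \<ell>\<^sup>r\<close> extend continuously to \<open>P\<close>;
  \<open>Gam\<close> and \<open>ww r\<close> are these extensions.\<close>

definition Gam :: "real^'n \<Rightarrow> real^'n^'n" where
  "Gam = (SOME g. continuous_on P g \<and> (\<forall>y\<in>X. g y = matrix_inv (G0 y)))"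

lemma Gam: "continuous_on P Gam" "\<And>y. y \<in> X \<Longrightarrow> Gam y = matrix_inv (G0 y)"
proof -
  have "\<exists>g. continuous_on P g \<and> (\<forall>y\<in>X. g y = matrix_inv (G0 y))"
  proof (rule X_extension)
    fix y assume "y \<in> P"
    then obtain J \<kappa> where "chart \<nu> c J \<kappa>" "y \<in> chart.U \<nu> c J"
      using exists_chart by blast
    then show "\<exists>l. ((\<lambda>y. matrix_inv (G0 y)) \<longlongrightarrow> l) (at y within X)"
      using chart.inv_G0_limit by blast
  qed (rule G0_inv_continuous)
  then have "continuous_on P Gam \<and> (\<forall>y\<in>X. Gam y = matrix_inv (G0 y))"
    unfolding Gam_def by (rule someI_ex)
  then show "continuous_on P Gam" "\<And>y. y \<in> X \<Longrightarrow> Gam y = matrix_inv (G0 y)"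
    by auto
qed

definition ww :: "'r \<Rightarrow> real^'n \<Rightarrow> real^'n" where
  "ww r = (SOME g. continuous_on P g \<and> (\<forall>y\<in>X. g y = (1 / L r y) *\<^sub>R (matrix_inv (G0 y) *v \<nu> r)))"

lemma ww_limit:
  assumes "y \<in> P"
  shows "\<exists>l. ((\<lambda>z. (1 / L r z) *\<^sub>R (matrix_inv (G0 z) *v \<nu> r)) \<longlongrightarrow> l) (at y within X) \<and> (L r y = 0 \<longrightarrow> \<nu> r \<bullet> l = 1)"
proof (cases "L r y = 0")
  case True
  obtain J \<kappa> where "chart \<nu> c J \<kappa>" and y: "y \<in> chart.U \<nu> c J"
    using exists_chart[OF assms] by blast
  then interpret chart \<nu> c J \<kappa> by blast
  have "r \<in> J"
    using y True by (auto simp: U_def)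
  then show ?thesis
    using w_limit[OF y] nu_w[OF y _ True] by blast
next
  case False
  have "((\<lambda>z. matrix_inv (G0 z)) \<longlongrightarrow> Gam y) (at y within X)"
  proof -
    have "(Gam \<longlongrightarrow> Gam y) (at y within X)"
      using Gam(1) assms X_subset by (auto simp: continuous_on_def intro: tendsto_within_subset)
    moreover have "\<forall>\<^sub>F z in at y within X. Gam z = matrix_inv (G0 z)"
      using Gam(2) by (simp add: eventually_at_filter)
    ultimately show ?thesis using tendsto_cong by fast
  qed
  moreover have "(L r \<longlongrightarrow> L r y) (at y within X)"
    using L_continuous[of UNIV r] by (auto simp: continuous_on_def intro: tendsto_within_subset)
  ultimately have "((\<lambda>z. (1 / L r z) *\<^sub>R (matrix_inv (G0 z) *v \<nu> r)) \<longlongrightarrow> (1 / L r y) *\<^sub>R (Gam y *v \<nu> r)) (at y within X)"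
    using False by (intro tendsto_intros tendsto_matrix_vector)
  then show ?thesis using False by blast
qed

lemma ww: "continuous_on P (ww r)" "\<And>y. y \<in> X \<Longrightarrow> ww r y = (1 / L r y) *\<^sub>R (matrix_inv (G0 y) *v \<nu> r)"
proof -
  have "\<exists>g. continuous_on P g \<and> (\<forall>y\<in>X. g y = (1 / L r y) *\<^sub>R (matrix_inv (G0 y) *v \<nu> r))"
  proof (rule X_extension)
    show "continuous_on X (\<lambda>y. (1 / L r y) *\<^sub>R (matrix_inv (G0 y) *v \<nu> r))"
      using interior_iff
      by (intro continuous_intros continuous_on_matrix_vector G0_inv_continuous L_continuous) (metis less_irrefl)
  qed (use ww_limit in blast)
  then have "continuous_on P (ww r) \<and> (\<forall>y\<in>X. ww r y = (1 / L r y) *\<^sub>R (matrix_inv (G0 y) *v \<nu> r))"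
    unfolding ww_def by (rule someI_ex)
  then show "continuous_on P (ww r)" "\<And>y. y \<in> X \<Longrightarrow> ww r y = (1 / L r y) *\<^sub>R (matrix_inv (G0 y) *v \<nu> r)"
    by auto
qed

lemma nu_ww:
  assumes "y \<in> P" "L r y = 0"
  shows "\<nu> r \<bullet> ww r y = 1"
proof -
  obtain l where l: "((\<lambda>z. (1 / L r z) *\<^sub>R (matrix_inv (G0 z) *v \<nu> r)) \<longlongrightarrow> l) (at y within X)" "\<nu> r \<bullet> l = 1"
    using ww_limit[OF assms(1)] assms(2) by blast
  have "(ww r \<longlongrightarrow> ww r y) (at y within X)"
    using ww(1) assms X_subset by (auto simp: continuous_on_def intro: tendsto_within_subset)
  moreover have "\<forall>\<^sub>F z in at y within X. ww r z = (1 / L r z) *\<^sub>R (matrix_inv (G0 z) *v \<nu> r)"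
    using ww(2) by (simp add: eventually_at_filter)
  ultimately have "((\<lambda>z. (1 / L r z) *\<^sub>R (matrix_inv (G0 z) *v \<nu> r)) \<longlongrightarrow> ww r y) (at y within X)"
    using tendsto_cong by fast
  then have "ww r y = l"
    using l(1) tendsto_unique nontrivial[OF assms(1)] by blast
  then show ?thesis using l(2) by simp
qed

lemma Gam_nu: "y \<in> P \<Longrightarrow> Gam y *v \<nu> r = L r y *\<^sub>R ww r y"
proof (rule dense_eq[of "\<lambda>y. Gam y *v \<nu> r" "\<lambda>y. L r y *\<^sub>R ww r y"])
  show "continuous_on P (\<lambda>y. Gam y *v \<nu> r)" "continuous_on P (\<lambda>y. L r y *\<^sub>R ww r y)"
    by (intro continuous_intros continuous_on_matrix_vector Gam ww L_continuous)+
  show "Gam y *v \<nu> r = L r y *\<^sub>R ww r y" if "y \<in> X" for y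
    using Gam(2)[OF that] ww(2)[OF that] that interior_iff by (metis (no_types, lifting) less_irrefl
      nonzero_eq_divide_eq mult.commute scaleR_one scaleR_scaleR)
qed

lemma Gam_sym: "y \<in> P \<Longrightarrow> transpose (Gam y) = Gam y"
proof (rule dense_eq[of "\<lambda>y. transpose (Gam y)" Gam])
  have "bounded_linear (transpose :: real^'n^'n \<Rightarrow> real^'n^'n)"
    by (simp add: linear_conv_bounded_linear[symmetric] linear_iff transpose_add transpose_scaleR)
  then show "continuous_on P (\<lambda>y. transpose (Gam y))"
    using bounded_linear.continuous_on Gam(1) by blast
  show "continuous_on P Gam" by (rule Gam)
  show "transpose (Gam y) = Gam y" if y: "y \<in> X" for y
  proof -
    have "invertible (G0 y)" "transpose (G0 y) = G0 y"
      using G0_posdef[OF y] real_posdef_invertible by (auto simp: real_posdef_def)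
    then have "transpose (matrix_inv (G0 y)) ** G0 y = mat 1"
      by (metis invertible_inv_mult(2) matrix_transpose_mul transpose_mat)
    then show ?thesis
      using matrix_inv_unique Gam(2)[OF y] by metis
  qed
qed

lemma prod_L_pos: "y \<in> X \<Longrightarrow> (\<Prod>r\<in>UNIV. L r y) > 0"
  using interior_iff by (intro prod_pos) auto

text \<open>A frame for the zero tensor reduces the claim to \<open>det_G\<close>.\<close>

lemma det_posdef: "real_posdef G \<Longrightarrow> det (G :: real^'m^'m) > 0"
proof -
  assume G: "real_posdef G"
  have "transpose (mat 0 :: complex^'m^'m) = mat 0"
    by (rule transpose_mat)
  then obtain V \<sigma> where "frame G (mat 0) V \<sigma>"
    using takagi[OF G] by blast
  then interpret nframe G "mat 0" V \<sigma>
    using G by unfold_locales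
  show ?thesis by (rule det_G)
qed

lemma det_G0_limit:
  assumes "y \<in> P"
  shows "\<exists>l>0. ((\<lambda>z. (\<Prod>r\<in>UNIV. L r z) * det (G0 z)) \<longlongrightarrow> l) (at y within X)"
proof -
  obtain J \<kappa> where "chart \<nu> c J \<kappa>" "y \<in> chart.U \<nu> c J"
    using exists_chart[OF assms] by blast
  then obtain l where l: "l \<noteq> 0" "((\<lambda>z. (\<Prod>r\<in>UNIV. L r z) * det (G0 z)) \<longlongrightarrow> l) (at y within X)"
    using chart.det_limit by blast
  have "\<forall>\<^sub>F z in at y within X. 0 \<le> (\<Prod>r\<in>UNIV. L r z) * det (G0 z)"
  proof -
    have "0 \<le> (\<Prod>r\<in>UNIV. L r z) * det (G0 z)" if "z \<in> X" for z
      by (intro mult_nonneg_nonneg less_imp_le prod_L_pos det_posdef G0_posdef that)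
    then show ?thesis by (simp add: eventually_at_filter)
  qed
  then have "0 \<le> l"
    using tendsto_lowerbound[OF l(2)] nontrivial[OF assms] by blast
  then show ?thesis using l by (intro exI[of _ l]) auto
qed

end

subsection \<open>Regularity of the square root\<close>

lemma Ck_on_matrix_inv:
  fixes G :: "real^'n \<Rightarrow> real^'n^'n"
  assumes "open U" "Ck_on k U G" "\<And>y. y \<in> U \<Longrightarrow> invertible (G y)"
  shows "Ck_on k U (\<lambda>y. matrix_inv (G y))"
proof (rule bilinear_solve_Ck_on[OF bounded_bilinear_matrix_mult_real _ assms(1,2)])
  show "x = 0" if y: "y \<in> U" and x: "G y ** x = 0" for y and x :: "real^'n^'n"
  proof -
    have "x = matrix_inv (G y) ** (G y ** x)"
      using invertible_inv_mult(1)[OF assms(3)[OF y]] by (simp add: matrix_mul_assoc)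
    then show ?thesis
      unfolding x by (simp add: vec_eq_iff matrix_matrix_mult_def)
  qed
  show "Ck_on k U (\<lambda>_. mat 1)" by (rule Ck_on_const)
  show "G y ** matrix_inv (G y) = mat 1" if "y \<in> U" for y
    using invertible_inv_mult(2)[OF assms(3)[OF that]] .
qed

lemma Ck_on_hm:
  fixes G :: "real^'n \<Rightarrow> real^'n^'n"
  assumes "open U" "Ck_on k U G" "Ck_on k U \<xi>"
  shows "Ck_on k U (\<lambda>y. hm (G y) (\<xi> y))"
  unfolding hm_def
  by (intro Ck_on_bounded_bilinear[OF bounded_bilinear_matrix_mult_complex]
      Ck_on_bounded_linear[OF bounded_linear_complex_mat] Ck_on_bounded_linear[OF bounded_linear_map_matrix_cnj] assms)

lemma good_rt_sq: "good G \<xi> \<Longrightarrow> rt G \<xi> ** rt G \<xi> = mat 1 - hm G \<xi>"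
  using good_hframe hframe.rt_sq by blast

text \<open>Continuity starts the induction. The increment equation then gives differentiability,
  and the partial derivatives solve Sylvester equations whose coefficient \<open>R\<close> has the
  order already reached and whose right-hand sides are derivatives of \<open>hm\<close>.\<close>

lemma Ck_on_rt:
  fixes G :: "real^'n \<Rightarrow> real^'n^'n"
  assumes U: "open U" and "Ck_on k U G" "Ck_on k U \<xi>" and good: "\<And>y. y \<in> U \<Longrightarrow> good (G y) (\<xi> y)"
  shows "Ck_on k U (\<lambda>y. rt (G y) (\<xi> y))"
  using assms(2,3)
proof (induction k)
  case 0
  show ?case
    unfolding Ck_on.simps continuous_on_def
  proof
    fix y assume "y \<in> U"
    then show "((\<lambda>y. rt (G y) (\<xi> y)) \<longlongrightarrow> rt (G y) (\<xi> y)) (at y within U)"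
      using 0 good by (intro rt_tendsto) (auto simp: continuous_on_def eventually_at_filter)
  qed
next
  case (Suc k)
  define R where "R y = rt (G y) (\<xi> y)" for y
  define A where "A y = hm (G y) (\<xi> y)" for y
  have A: "Ck_on (Suc k) U A"
    unfolding A_def by (rule Ck_on_hm[OF U Suc.prems])
  have R: "Ck_on k U R"
    unfolding R_def using Suc.IH Suc.prems[THEN Ck_on_SucD] by blast
  have main: "R differentiable (at y) \<and> (\<forall>i. R y ** partial i R y + partial i R y ** R y = - partial i A y)" if y: "y \<in> U" for y
  proof -
    obtain A' where A': "(A has_derivative A') (at y)"
      using A y unfolding Ck_on.simps differentiable_def by blast
    have inj: "x = 0" if "fst (R y, R y) ** x + x ** snd (R y, R y) = 0" for x
      using sylvester_inj[OF good[OF y], of x] that by (simp add: R_def)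
    have "isCont R y"
      using Ck_on_continuous[OF R] U y continuous_on_eq_continuous_at by blast
    then have 1: "continuous (at y within UNIV) (\<lambda>z. (R z, R y))"
      by (auto intro!: continuous_intros)
    have 2: "((\<lambda>z. A y - A z) has_derivative (\<lambda>h. - A' h)) (at y within UNIV)"
      using has_derivative_diff[OF has_derivative_const[of "A y"] A'] by simp
    have 3: "\<forall>\<^sub>F z in at y within UNIV. fst (R z, R y) ** (R z - R y) + (R z - R y) ** snd (R z, R y) = A y - A z"
      using eventually_at_in_open'[OF U y]
    proof eventually_elim
      case (elim z)
      show ?case
        using good_rt_sq[OF good[OF y]] good_rt_sq[OF good[OF elim]]
        by (simp add: R_def A_def bounded_bilinear.diff_left[OF bounded_bilinear_matrix_mult_complex]
            bounded_bilinear.diff_right[OF bounded_bilinear_matrix_mult_complex])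
    qed
    have "\<exists>D'. ((\<lambda>z. R z - R y) has_derivative D') (at y) \<and> (\<forall>h. R y ** D' h + D' h ** R y = - A' h)"
    proof (rule bilinear_solve_has_derivative0[where p="\<lambda>A X. fst A ** X + X ** snd A" and M="\<lambda>z. (R z, R y)"
        and ?x0.0=y and S=UNIV and D="\<lambda>z. R z - R y" and E="\<lambda>z. A y - A z"
        and E'="\<lambda>h. - A' h", OF bounded_bilinear_sylvester inj 1 2 _ _ 3])
      fix D' assume D': "((\<lambda>z. R z - R y) has_derivative D') (at y)"
        "\<And>h. fst (R y, R y) ** D' h + D' h ** snd (R y, R y) = - A' h"
      show "\<exists>D'. ((\<lambda>z. R z - R y) has_derivative D') (at y) \<and> (\<forall>h. R y ** D' h + D' h ** R y = - A' h)"
        using D' by (intro exI[of _ D']) simp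
    qed simp_all
    then obtain D' where D': "((\<lambda>z. R z - R y) has_derivative D') (at y)" "\<And>h. R y ** D' h + D' h ** R y = - A' h"
      by blast
    have RD: "(R has_derivative D') (at y)"
      using has_derivative_add[OF D'(1) has_derivative_const[of "R y"]] by simp
    show ?thesis
      using differentiableI[OF RD] D'(2) partial_has_derivative[OF RD] partial_has_derivative[OF A'] by simp
  qed
  have "Ck_on k U (partial i R)" for i
  proof (rule bilinear_solve_Ck_on[OF bounded_bilinear_sylvester, where M="\<lambda>y. (R y, R y)" and F="\<lambda>y. - partial i A y"])
    show "x = 0" if "y \<in> U" "fst (R y, R y) ** x + x ** snd (R y, R y) = 0" for y x
      using sylvester_inj[OF good[OF that(1)], of x] that(2) by (simp add: R_def)
    have "bounded_linear (\<lambda>x::complex^'n^'n. (x, x))"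
      by (intro bounded_linear_Pair bounded_linear_ident)
    then show "Ck_on k U (\<lambda>y. (R y, R y))"
      using Ck_on_bounded_linear U R by blast
    show "Ck_on k U (\<lambda>y. - partial i A y)"
      using A by (intro Ck_on_minus U) simp
    show "fst (R y, R y) ** partial i R y + partial i R y ** snd (R y, R y) = - partial i A y" if "y \<in> U" for y
      using main[OF that] by simp
  qed (rule U)
  then have "Ck_on (Suc k) U R"
    using main by simp
  then show ?case by (simp only: R_def[abs_def])
qed

lemma Ck_on_Hm:
  fixes G :: "real^'n \<Rightarrow> real^'n^'n"
  assumes U: "open U" and G: "Ck_on k U G" and \<xi>: "Ck_on k U \<xi>" and good: "\<And>y. y \<in> U \<Longrightarrow> good (G y) (\<xi> y)"
  shows "Ck_on k U (\<lambda>y. Hm (G y) (\<xi> y))"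
  unfolding Hm_def using good
  by (intro Ck_on_bounded_bilinear[OF bounded_bilinear_matrix_mult_complex] Ck_on_rt
      Ck_on_bounded_linear[OF bounded_linear_complex_mat] Ck_on_matrix_inv assms)
    (auto simp: good_def real_posdef_invertible)

lemma continuous_on_phi:
  fixes G :: "real^'n \<Rightarrow> real^'n^'n"
  assumes U: "open U" and G: "continuous_on U G" and \<xi>: "continuous_on U \<xi>" and good: "\<And>y. y \<in> U \<Longrightarrow> good (G y) (\<xi> y)"
  shows "continuous_on U (\<lambda>y. phi (G y) (\<xi> y))"
proof -
  have R: "continuous_on U (\<lambda>y. rt (G y) (\<xi> y))"
    using Ck_on_rt[of U 0 G \<xi>] assms by simp
  have det1: "Re (det (mat 1 + rt (G y) (\<xi> y))) > 0" and pos: "det (G y) > 0"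
    and eq: "phi (G y) (\<xi> y) = real CARD('n) - ln (det (G y)) - Re (trace (rt (G y) (\<xi> y)))
      + ln (Re (det (mat 1 + rt (G y) (\<xi> y))))" if y: "y \<in> U" for y
  proof -
    obtain V \<sigma> where "hframe (G y) (\<xi> y) V \<sigma>"
      using good_hframe[OF good[OF y]] .
    then interpret hframe "G y" "\<xi> y" V \<sigma> .
    have "(\<Prod>i\<in>UNIV. 1 + s i) > 0"
      using s_bounds(1) by (intro prod_pos) (auto intro: add_pos_pos)
    then show "Re (det (mat 1 + rt (G y) (\<xi> y))) > 0"
      unfolding det_one_rt Re_complex_of_real .
    show "det (G y) > 0" by (rule det_G)
    show "phi (G y) (\<xi> y) = real CARD('n) - ln (det (G y)) - Re (trace (rt (G y) (\<xi> y)))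
      + ln (Re (det (mat 1 + rt (G y) (\<xi> y))))"
      by (rule phi_eq)
  qed
  have t1: "continuous_on U (\<lambda>y. Re (trace (rt (G y) (\<xi> y))))"
    by (rule bounded_linear.continuous_on[OF bounded_linear_Re_trace R])
  have t2: "continuous_on U (\<lambda>y. Re (det (mat 1 + rt (G y) (\<xi> y))))"
    by (intro continuous_on_Re continuous_on_det continuous_on_add continuous_on_const R)
  have nz: "\<forall>x\<in>U. det (G x) \<noteq> 0" "\<forall>x\<in>U. Re (det (mat 1 + rt (G x) (\<xi> x))) \<noteq> 0"
    using det1 pos by (metis less_irrefl)+
  have "continuous_on U (\<lambda>y. real CARD('n) - ln (det (G y)) - Re (trace (rt (G y) (\<xi> y)))
      + ln (Re (det (mat 1 + rt (G y) (\<xi> y)))))"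
    by (intro continuous_on_add continuous_on_diff continuous_on_const continuous_on_ln t1 t2
        continuous_on_det G nz)
  then show ?thesis
    by (rule continuous_on_eq) (simp add: eq)
qed

lemma rho_eq_phi: "rho (hm G \<xi>) = phi G \<xi> + ln (det G)"
  by (simp add: phi_def)

subsection \<open>Real part of the moment map integrand\<close>

definition reM :: "complex^'n^'m \<Rightarrow> real^'n^'m" where
  "reM A = (\<chi> i j. Re (A $ i $ j))"

lemma reM_quad: "a \<bullet> (reM A *v a) = (\<Sum>k\<in>UNIV. \<Sum>l\<in>UNIV. a $ k * Re (A $ k $ l) * a $ l)"
  by (simp add: reM_def inner_vec_def matrix_vector_mult_def sum_distrib_left mult_ac)

lemma reM_complex_mat [simp]: "reM (complex_mat G) = G"
  by (simp add: reM_def vec_eq_iff)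

lemma reM_sandwich: "reM (complex_mat G ** A ** complex_mat H) = G ** reM A ** H"
  by (simp add: reM_def vec_eq_iff matrix_matrix_mult_def sum_distrib_left sum_distrib_right Re_sum)

lemma bounded_linear_reM: "bounded_linear (reM :: complex^'n^'m \<Rightarrow> real^'n^'m)"
  by (simp add: linear_conv_bounded_linear[symmetric] linear_iff reM_def vec_eq_iff)

context hframe
begin

lemma reM_Hm_sym: "transpose (reM (Hm G \<xi>)) = reM (Hm G \<xi>)"
proof -
  have "Re (Hm G \<xi> $ j $ i) = Re (Hm G \<xi> $ i $ j)" for i j
    using arg_cong[OF hconj_Hm, of "\<lambda>M. Re (M $ i $ j)"] by (simp add: hconj_def transpose_def)
  then show ?thesis
    by (simp add: reM_def transpose_def vec_eq_iff)
qed

text \<open>Entrywise these are \<open>0 \<le> s\<close>, \<open>s \<le> 1\<close> and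
  \<open>1 - \<sigma>\<^sup>2 = s\<^sup>2 \<le> s\<close>. The last one yields the lower bound at a
  facet with an error quadratic in the defining function, without expanding the root.\<close>

lemma reM_Hm_bounds:
  shows "0 \<le> a \<bullet> (reM (Hm G \<xi>) *v a)" "a \<bullet> (reM (Hm G \<xi>) *v a) \<le> a \<bullet> (matrix_inv G *v a)"
    "a \<bullet> (matrix_inv G *v a) - a \<bullet> (reM (\<xi> ** complex_mat G ** map_matrix cnj \<xi>) *v a)
      \<le> a \<bullet> (reM (Hm G \<xi>) *v a)"
proof -
  define c where "c i = cmod (\<Sum>k\<in>UNIV. complex_of_real (a $ k) * V $ k $ i)" for i
  have 1: "a \<bullet> (reM (Hm G \<xi>) *v a) = (\<Sum>i\<in>UNIV. s i * (c i)\<^sup>2)"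
    unfolding reM_quad Hm_eq c_def by (rule hermitian_quad)
  have 2: "a \<bullet> (matrix_inv G *v a) = (\<Sum>i\<in>UNIV. 1 * (c i)\<^sup>2)"
  proof -
    have "complex_mat (matrix_inv G) = V ** dg (\<lambda>i. complex_of_real 1) ** hconj V"
      by (simp add: ginv dg_one)
    then have "a \<bullet> (reM (complex_mat (matrix_inv G)) *v a) = (\<Sum>i\<in>UNIV. 1 * (c i)\<^sup>2)"
      unfolding reM_quad c_def using hermitian_quad[of a "\<lambda>_. 1"] by simp
    then show ?thesis by simp
  qed
  have 3: "a \<bullet> (reM (\<xi> ** complex_mat G ** map_matrix cnj \<xi>) *v a) = (\<Sum>i\<in>UNIV. (\<sigma> i)\<^sup>2 * (c i)\<^sup>2)"
    unfolding reM_quad \<xi>G\<xi>_eq c_def by (rule hermitian_quad)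
  show "0 \<le> a \<bullet> (reM (Hm G \<xi>) *v a)"
    unfolding 1 using s_bounds(1) by (intro sum_nonneg mult_nonneg_nonneg) (auto simp: less_imp_le)
  show "a \<bullet> (reM (Hm G \<xi>) *v a) \<le> a \<bullet> (matrix_inv G *v a)"
    unfolding 1 2 using s_bounds(2) by (intro sum_mono mult_right_mono) auto
  have "(c i)\<^sup>2 - (\<sigma> i)\<^sup>2 * (c i)\<^sup>2 \<le> s i * (c i)\<^sup>2" for i
  proof -
    have "1 - (\<sigma> i)\<^sup>2 \<le> s i"
      using s_bounds[of i] by (metis less_imp_le mult_left_le power2_eq_square)
    then have "(1 - (\<sigma> i)\<^sup>2) * (c i)\<^sup>2 \<le> s i * (c i)\<^sup>2"
      by (intro mult_right_mono) auto
    then show ?thesis by (simp add: algebra_simps)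
  qed
  then show "a \<bullet> (matrix_inv G *v a) - a \<bullet> (reM (\<xi> ** complex_mat G ** map_matrix cnj \<xi>) *v a)
      \<le> a \<bullet> (reM (Hm G \<xi>) *v a)"
    unfolding 1 2 3 sum_subtractf[symmetric] by (intro sum_mono) simp
qed

end

subsection \<open>Admissible potentials\<close>

text \<open>For a closed failure condition over a compact parameter space: if it does not occur at
  parameter 0, it does not occur for small parameters.\<close>

lemma compact_fst_avoids_0:
  fixes K :: "(real \<times> 'b::topological_space) set"
  assumes "compact K" "\<And>b. (0, b) \<notin> K"
  shows "\<exists>e>0. \<forall>t b. \<bar>t\<bar> < e \<longrightarrow> (t, b) \<notin> K"
proof -
  have "compact (fst ` K)"
    by (intro compact_continuous_image continuous_intros assms)
  then have "open (- (fst ` K))"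
    using compact_imp_closed by blast
  moreover have "0 \<in> - (fst ` K)"
    using assms(2) by force
  ultimately obtain e where e: "e > 0" "ball 0 e \<subseteq> - (fst ` K)"
    using openE by blast
  have "(t, b) \<notin> K" if "\<bar>t\<bar> < e" for t b
  proof
    assume "(t, b) \<in> K"
    then have "t \<in> fst ` K" by force
    moreover have "t \<in> ball 0 e" using that by simp
    ultimately show False using e(2) by blast
  qed
  then show ?thesis using e(1) by blast
qed

locale higgs = delz \<nu> c for \<nu> :: "'r::finite \<Rightarrow> real^'n" and c +
  fixes \<xi> :: "real^'n \<Rightarrow> complex^'n^'n"
  assumes higgs: "higgs_tensor \<nu> c \<xi>"
begin

lemma xi_smooth: "smooth_on X \<xi>" and xi_sym: "y \<in> X \<Longrightarrow> transpose (\<xi> y) = \<xi> y"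
  using higgs by (auto simp: higgs_tensor_def Let_def P_def)

definition Th :: "real^'n \<Rightarrow> complex^'n^'n" where
  "Th = (SOME g. continuous_on P g \<and> (\<forall>y\<in>X. g y = complex_mat (G0 y) ** \<xi> y ** complex_mat (G0 y)))"

lemma Th: "continuous_on P Th" "\<And>y. y \<in> X \<Longrightarrow> Th y = complex_mat (G0 y) ** \<xi> y ** complex_mat (G0 y)"
proof -
  obtain U g where "open U" "P \<subseteq> U" "smooth_on U g"
    "\<And>y. y \<in> X \<Longrightarrow> g y = complex_mat (hessian (guillemin \<nu> c) y) ** \<xi> y ** complex_mat (hessian (guillemin \<nu> c) y)"
    using higgs unfolding higgs_tensor_def extends_smoothly_def Let_def P_def by auto
  moreover from this have "continuous_on P g"
    using smooth_on_imp_Ck[of U g 0] continuous_on_subset by auto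
  ultimately have "\<exists>g. continuous_on P g \<and> (\<forall>y\<in>X. g y = complex_mat (G0 y) ** \<xi> y ** complex_mat (G0 y))"
    using guillemin_hessian(2) by (intro exI[of _ g]) auto
  then have "continuous_on P Th \<and> (\<forall>y\<in>X. Th y = complex_mat (G0 y) ** \<xi> y ** complex_mat (G0 y))"
    unfolding Th_def by (rule someI_ex)
  then show "continuous_on P Th" "\<And>y. y \<in> X \<Longrightarrow> Th y = complex_mat (G0 y) ** \<xi> y ** complex_mat (G0 y)"
    by auto
qed

text \<open>For \<open>G = G0 + q\<close>, \<open>MM\<close> is \<open>G0\<^sup>-\<^sup>1 G\<close> and \<open>AA\<close> is \<open>\<xi> G \<xi>\<^sup>* G\<close>, both written through quantities that are
  continuous on \<open>P\<close>. Admissibility thereby becomes an open condition on the compact set \<open>P\<close>.\<close>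

definition MM :: "real^'n \<Rightarrow> real^'n^'n \<Rightarrow> real^'n^'n" where
  "MM y q = mat 1 + Gam y ** q"

definition AA :: "real^'n \<Rightarrow> real^'n^'n \<Rightarrow> complex^'n^'n" where
  "AA y q = complex_mat (Gam y) ** Th y ** complex_mat (MM y q) ** complex_mat (Gam y)
     ** map_matrix cnj (Th y) ** complex_mat (MM y q)"

lemma Gam_G0: "y \<in> X \<Longrightarrow> Gam y ** G0 y = mat 1" "y \<in> X \<Longrightarrow> G0 y ** Gam y = mat 1"
  using Gam(2) invertible_inv_mult[OF real_posdef_invertible[OF G0_posdef]] by auto

lemma xi_eq: "y \<in> X \<Longrightarrow> \<xi> y = complex_mat (Gam y) ** Th y ** complex_mat (Gam y)"
proof -
  assume y: "y \<in> X"
  have "complex_mat (Gam y) ** Th y ** complex_mat (Gam y) =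
      complex_mat (Gam y ** G0 y) ** \<xi> y ** complex_mat (G0 y ** Gam y)"
    by (simp add: Th(2)[OF y] complex_mat_mult matrix_mul_assoc)
  then show ?thesis by (simp add: Gam_G0[OF y])
qed

lemma G0_MM: "y \<in> X \<Longrightarrow> G0 y + q = G0 y ** MM y q"
  using Gam_G0(2)[of y] by (simp add: MM_def matrix_add_ldistrib matrix_mul_assoc)

lemma det_G0_MM: "y \<in> X \<Longrightarrow> det (G0 y + q) = det (G0 y) * det (MM y q)"
  by (simp add: G0_MM det_mul)

lemma xi_G: "y \<in> X \<Longrightarrow> \<xi> y ** complex_mat (G0 y + q) = complex_mat (Gam y) ** Th y ** complex_mat (MM y q)"
proof -
  assume y: "y \<in> X"
  have "\<xi> y ** complex_mat (G0 y + q) = complex_mat (Gam y) ** Th y ** complex_mat (Gam y ** G0 y) ** complex_mat (MM y q)"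
    by (simp add: xi_eq[OF y] G0_MM[OF y] complex_mat_mult matrix_mul_assoc)
  then show ?thesis by (simp add: Gam_G0[OF y])
qed

lemma hm_AA: "y \<in> X \<Longrightarrow> hm (G0 y + q) (\<xi> y) = AA y q"
proof -
  assume y: "y \<in> X"
  have "hm (G0 y + q) (\<xi> y) = (\<xi> y ** complex_mat (G0 y + q)) ** (map_matrix cnj (\<xi> y) ** complex_mat (G0 y + q))"
    by (simp add: hm_def matrix_mul_assoc)
  also have "map_matrix cnj (\<xi> y) ** complex_mat (G0 y + q) = map_matrix cnj (\<xi> y ** complex_mat (G0 y + q))"
    by (simp add: map_matrix_cnj_mult)
  finally show ?thesis
    unfolding xi_G[OF y] by (simp add: AA_def map_matrix_cnj_mult matrix_mul_assoc)
qed

lemma continuous_MM: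
  assumes "continuous_on A f" "f ` A \<subseteq> P" "continuous_on A q"
  shows "continuous_on A (\<lambda>x. MM (f x) (q x))"
  unfolding MM_def using assms
  by (intro continuous_intros continuous_on_matrix_mult continuous_on_compose2[OF Gam(1)]) auto

lemma continuous_AA:
  assumes "continuous_on A f" "f ` A \<subseteq> P" "continuous_on A q"
  shows "continuous_on A (\<lambda>x. AA (f x) (q x))"
  unfolding AA_def using assms
  by (intro continuous_on_matrix_mult_complex continuous_on_complex_mat continuous_on_map_matrix_cnj
      continuous_MM continuous_on_compose2[OF Gam(1)] continuous_on_compose2[OF Th(1)]) auto

text \<open>Admissibility of \<open>guillemin\<close> plus a smooth \<open>g\<close>, stated through
  \<open>Q = hessian g\<close>. The determinant clause stands for the existence of the function
  \<open>\<delta>\<close>, and the eigenvalue clause includes the boundary.\<close>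

definition admd :: "(real^'n \<Rightarrow> real^'n^'n) \<Rightarrow> bool" where
  "admd Q \<longleftrightarrow> (\<forall>y\<in>X. real_posdef (G0 y + Q y)) \<and> (\<forall>y\<in>P. det (MM y (Q y)) > 0) \<and>
     (\<forall>y\<in>P. \<forall>x. eigenvalue (AA y (Q y)) x \<longrightarrow> cmod x < 1)"

lemma admd_good: "admd Q \<Longrightarrow> y \<in> X \<Longrightarrow> good (G0 y + Q y) (\<xi> y)"
  using X_subset by (auto simp: admd_def good_def hm_AA xi_sym)

lemma potential_hessian:
  assumes U: "open U" "P \<subseteq> U" "smooth_on U g" and u: "\<And>y. y \<in> P \<Longrightarrow> u y = guillemin \<nu> c y + g y" and y: "y \<in> X"
  shows "hessian u y = G0 y + hessian g y"
proof -
  have "hessian u y = hessian (\<lambda>z. guillemin \<nu> c z + g z) y"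
    using X_subset u by (intro hessian_cong_open[OF open_interior y]) auto
  also have "\<dots> = hessian (guillemin \<nu> c) y + hessian g y"
  proof (rule hessian_add[OF open_interior y])
    show "g differentiable (at z)" "partial a g differentiable (at z)" if "z \<in> X" for z a
      using smooth_differentiable[OF U(3)] U(2) X_subset that by (meson subsetD)+
  qed (use guillemin_differentiable guillemin_hessian in auto)
  finally show ?thesis
    by (simp add: guillemin_hessian(2)[OF y])
qed

lemma smooth_hessian_P:
  assumes "open U" "P \<subseteq> U" "smooth_on U g"
  shows "continuous_on P (hessian g)" "\<And>y. y \<in> P \<Longrightarrow> transpose (hessian g y) = hessian g y"
proof -
  show "continuous_on P (hessian g)"
    using smooth_hessian[OF assms(1,3), of 0] assms(2) continuous_on_subset by auto
  show "transpose (hessian g y) = hessian g y" if "y \<in> P" for y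
    using hessian_symmetric[OF assms(1) _ smooth_on_imp_Ck[OF assms(3)]] assms(2) that by blast
qed

lemma tendsto_within_X: "continuous_on P f \<Longrightarrow> y \<in> P \<Longrightarrow> (f \<longlongrightarrow> f y) (at y within X)"
  using X_subset by (auto simp: continuous_on_def intro: tendsto_within_subset)

lemma tendsto_cong_X: "(\<And>z. z \<in> X \<Longrightarrow> f z = g z) \<Longrightarrow> (f \<longlongrightarrow> l) (at y within X) \<longleftrightarrow> (g \<longlongrightarrow> l) (at y within X)"
  by (intro tendsto_cong) (simp add: eventually_at_filter)

text \<open>Near a boundary point the product of all \<open>L r\<close> with the determinant of the
  Hessian tends to a positive constant times \<open>det (MM y (hessian g y))\<close>, so a positive
  continuous \<open>\<delta>\<close> exists exactly if this determinant is positive on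
  \<open>P\<close>. The limit of \<open>higgs_mat\<close> is \<open>AA\<close>.\<close>

lemma admissible_iff:
  assumes U: "open U" "P \<subseteq> U" "smooth_on U g" and u: "\<And>y. y \<in> P \<Longrightarrow> u y = guillemin \<nu> c y + g y"
  shows "u \<in> admissible \<nu> c \<xi> \<longleftrightarrow> admd (hessian g)"
proof -
  have hess: "hessian u y = G0 y + hessian g y" if "y \<in> X" for y
    by (rule potential_hessian[OF U _ that]) (rule u)
  note Q = smooth_hessian_P[OF U]
  have G_sym: "transpose (G0 y + hessian g y) = G0 y + hessian g y" if "y \<in> X" for y
    using G0_posdef[OF that] Q(2)[of y] X_subset that by (auto simp: transpose_add real_posdef_def)
  have pos: "(\<forall>y\<in>X. \<forall>v. v \<noteq> 0 \<longrightarrow> v \<bullet> (hessian u y *v v) > 0) \<longleftrightarrow> (\<forall>y\<in>X. real_posdef (G0 y + hessian g y))"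
    using G_sym by (auto simp: hess real_posdef_def)
  have detlim: "\<exists>l>0. ((\<lambda>z. (\<Prod>r\<in>UNIV. L r z) * det (hessian u z)) \<longlongrightarrow> l * det (MM y (hessian g y))) (at y within X)"
    if y: "y \<in> P" for y
  proof -
    obtain l where l: "l > 0" "((\<lambda>z. (\<Prod>r\<in>UNIV. L r z) * det (G0 z)) \<longlongrightarrow> l) (at y within X)"
      using det_G0_limit[OF y] by blast
    have "continuous_on P (\<lambda>z. det (MM z (hessian g z)))"
      by (intro continuous_on_det continuous_MM continuous_on_id Q) auto
    from tendsto_mult[OF l(2) tendsto_within_X[OF this y]]
    have "((\<lambda>z. (\<Prod>r\<in>UNIV. L r z) * det (hessian u z)) \<longlongrightarrow> l * det (MM y (hessian g y))) (at y within X)"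
      by (rule tendsto_cong_X[THEN iffD1, rotated]) (simp add: hess det_G0_MM)
    then show ?thesis using l(1) by blast
  qed
  have \<delta>: "(\<exists>\<delta>. continuous_on P \<delta> \<and> (\<forall>y\<in>P. \<delta> y > 0) \<and>
         (\<forall>y\<in>X. det (hessian u y) = inverse (\<delta> y * (\<Prod>r\<in>UNIV. L r y)))) \<longleftrightarrow> (\<forall>y\<in>P. det (MM y (hessian g y)) > 0)"
    if pd: "\<forall>y\<in>X. real_posdef (G0 y + hessian g y)"
  proof
    assume "\<exists>\<delta>. continuous_on P \<delta> \<and> (\<forall>y\<in>P. \<delta> y > 0) \<and>
         (\<forall>y\<in>X. det (hessian u y) = inverse (\<delta> y * (\<Prod>r\<in>UNIV. L r y)))"
    then obtain \<delta> where \<delta>: "continuous_on P \<delta>" "\<And>y. y \<in> P \<Longrightarrow> \<delta> y > 0"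
      "\<And>y. y \<in> X \<Longrightarrow> det (hessian u y) = inverse (\<delta> y * (\<Prod>r\<in>UNIV. L r y))"
      by blast
    show "\<forall>y\<in>P. det (MM y (hessian g y)) > 0"
    proof
      fix y assume y: "y \<in> P"
      obtain l where l: "l > 0" "((\<lambda>z. (\<Prod>r\<in>UNIV. L r z) * det (hessian u z)) \<longlongrightarrow> l * det (MM y (hessian g y))) (at y within X)"
        using detlim[OF y] by blast
      have dlim: "((\<lambda>z. inverse (\<delta> z)) \<longlongrightarrow> inverse (\<delta> y)) (at y within X)"
        using \<delta>(2)[OF y] by (intro tendsto_inverse tendsto_within_X \<delta>(1) y) simp
      have dinv: "inverse (\<delta> z) = (\<Prod>r\<in>UNIV. L r z) * det (hessian u z)" if "z \<in> X" for z
      proof -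
        have "p * inverse (d * p) = inverse d" if "p > 0" for p d :: real
          using that by simp
        then show ?thesis
          unfolding \<delta>(3)[OF that] using prod_L_pos[OF that] by metis
      qed
      from dlim have "((\<lambda>z. (\<Prod>r\<in>UNIV. L r z) * det (hessian u z)) \<longlongrightarrow> inverse (\<delta> y)) (at y within X)"
        by (rule tendsto_cong_X[THEN iffD1, rotated]) (rule dinv)
      then have "l * det (MM y (hessian g y)) = inverse (\<delta> y)"
        using l(2) tendsto_unique nontrivial[OF y] by blast
      moreover have "inverse (\<delta> y) > 0" using \<delta>(2)[OF y] by simp
      ultimately show "det (MM y (hessian g y)) > 0"
        using l(1) by (metis zero_less_mult_pos)
    qed
  next
    assume det: "\<forall>y\<in>P. det (MM y (hessian g y)) > 0"
    \<comment> \<open>The determinant identity forces this value of \<open>\<delta>\<close> on the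
      interior; positive limits extend it to \<open>P\<close>.\<close>
    define f where "f z = inverse ((\<Prod>r\<in>UNIV. L r z) * det (G0 z + hessian g z))" for z
    have f_lim: "\<exists>l>0. (f \<longlongrightarrow> l) (at y within X)" if y: "y \<in> P" for y
    proof -
      obtain l where l: "l > 0" "((\<lambda>z. (\<Prod>r\<in>UNIV. L r z) * det (hessian u z)) \<longlongrightarrow> l * det (MM y (hessian g y))) (at y within X)"
        using detlim[OF y] by blast
      have "l * det (MM y (hessian g y)) > 0" using l det y by simp
      moreover have "((\<lambda>z. inverse ((\<Prod>r\<in>UNIV. L r z) * det (hessian u z))) \<longlongrightarrow> inverse (l * det (MM y (hessian g y)))) (at y within X)"
        using calculation by (intro tendsto_inverse l(2)) (rule less_imp_neq[THEN not_sym])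
      then have "(f \<longlongrightarrow> inverse (l * det (MM y (hessian g y)))) (at y within X)"
        by (rule tendsto_cong_X[THEN iffD1, rotated]) (simp add: hess f_def)
      ultimately show ?thesis
        using positive_imp_inverse_positive by blast
    qed
    have f_pos: "(\<Prod>r\<in>UNIV. L r z) * det (G0 z + hessian g z) > 0" if "z \<in> X" for z
      using pd that by (intro mult_pos_pos prod_L_pos det_posdef) auto
    have "continuous_on X f"
      unfolding f_def
    proof (rule continuous_on_inverse)
      show "continuous_on X (\<lambda>z. (\<Prod>r\<in>UNIV. L r z) * det (G0 z + hessian g z))"
        using Q(1) X_subset
        by (intro continuous_intros L_continuous continuous_on_det G0_continuous)
          (auto intro: continuous_on_subset)
      show "\<forall>z\<in>X. (\<Prod>r\<in>UNIV. L r z) * det (G0 z + hessian g z) \<noteq> 0"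
        using f_pos by (metis less_irrefl)
    qed
    then obtain \<delta> where \<delta>: "continuous_on P \<delta>" "\<And>y. y \<in> X \<Longrightarrow> \<delta> y = f y"
      using X_extension[of f] f_lim by blast
    have "\<delta> y > 0" if y: "y \<in> P" for y
    proof -
      obtain l where l: "l > 0" "(f \<longlongrightarrow> l) (at y within X)"
        using f_lim[OF y] by blast
      have "(f \<longlongrightarrow> \<delta> y) (at y within X)"
        using tendsto_within_X[OF \<delta>(1) y] by (rule tendsto_cong_X[THEN iffD1, rotated]) (rule \<delta>(2))
      then have "\<delta> y = l"
        using l(2) tendsto_unique nontrivial[OF y] by blast
      then show ?thesis using l(1) by simp
    qed
    moreover have "det (hessian u y) = inverse (\<delta> y * (\<Prod>r\<in>UNIV. L r y))" if y: "y \<in> X" for y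
    proof -
      have "d = inverse (inverse (p * d) * p)" if "p > 0" for p d :: real
        using that by simp
      then show ?thesis
        unfolding \<delta>(2)[OF y] f_def hess[OF y] using prod_L_pos[OF y] by blast
    qed
    ultimately show "\<exists>\<delta>. continuous_on P \<delta> \<and> (\<forall>y\<in>P. \<delta> y > 0) \<and>
         (\<forall>y\<in>X. det (hessian u y) = inverse (\<delta> y * (\<Prod>r\<in>UNIV. L r y)))"
      using \<delta>(1) by blast
  qed
  have lim: "Lim (at y within X) (higgs_mat \<xi> u) = AA y (hessian g y)" if y: "y \<in> P" for y
  proof (rule tendsto_Lim[OF nontrivial[OF y]])
    have "continuous_on P (\<lambda>z. AA z (hessian g z))"
      by (intro continuous_AA continuous_on_id Q) auto
    from tendsto_within_X[OF this y]
    show "(higgs_mat \<xi> u \<longlongrightarrow> AA y (hessian g y)) (at y within X)"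
      by (rule tendsto_cong_X[THEN iffD1, rotated]) (simp add: hess higgs_mat_def flip: hm_AA hm_def)
  qed
  have ext: "\<exists>h. extends_smoothly P P h \<and> (\<forall>y\<in>P. u y = guillemin \<nu> c y + h y)"
    using U u unfolding extends_smoothly_def by blast
  show ?thesis
    unfolding admissible_def symplectic_potential_def Let_def admd_def P_def[symmetric] mem_Collect_eq
    using ext pos \<delta> by (auto simp: lim spectral_radius_less_iff)
qed

lemma admissible_potential:
  assumes "u \<in> admissible \<nu> c \<xi>"
  obtains U g where "open U" "P \<subseteq> U" "smooth_on U g" "\<And>y. y \<in> P \<Longrightarrow> u y = guillemin \<nu> c y + g y" "admd (hessian g)"
proof -
  obtain h where h: "extends_smoothly P P h" "\<And>y. y \<in> P \<Longrightarrow> u y = guillemin \<nu> c y + h y"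
    using assms by (auto simp: admissible_def symplectic_potential_def Let_def P_def)
  then obtain U g where U: "open U" "P \<subseteq> U" "smooth_on U g" "\<And>y. y \<in> P \<Longrightarrow> g y = h y"
    unfolding extends_smoothly_def by blast
  then have u: "u y = guillemin \<nu> c y + g y" if "y \<in> P" for y
    using h(2) that by simp
  have "u \<in> admissible \<nu> c \<xi> \<longleftrightarrow> admd (hessian g)"
    by (rule admissible_iff[OF U(1-3)]) (rule u)
  then show ?thesis
    using that[OF U(1-3)] u assms by blast
qed

lemma admd_inverse:
  assumes Q: "admd Q"
  shows "y \<in> P \<Longrightarrow> invertible (MM y (Q y))"
    and "y \<in> X \<Longrightarrow> matrix_inv (G0 y + Q y) = matrix_inv (MM y (Q y)) ** Gam y"
proof -
  show inv: "invertible (MM y (Q y))" if "y \<in> P" for y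
    using Q that by (auto simp: admd_def invertible_det_nz)
  assume y: "y \<in> X"
  have "(matrix_inv (MM y (Q y)) ** Gam y) ** (G0 y + Q y) = matrix_inv (MM y (Q y)) ** (Gam y ** G0 y) ** MM y (Q y)"
    by (simp add: G0_MM[OF y] matrix_mul_assoc)
  also have "\<dots> = mat 1"
    using inv[of y] X_subset y by (auto simp: Gam_G0[OF y] invertible_inv_mult)
  finally show "matrix_inv (G0 y + Q y) = matrix_inv (MM y (Q y)) ** Gam y"
    by (rule matrix_inv_unique)
qed

lemma continuous_inv_MM:
  assumes "admd Q" "continuous_on P Q"
  shows "continuous_on P (\<lambda>y. matrix_inv (MM y (Q y)))"
  using admd_inverse(1)[OF assms(1)] assms(2)
  by (intro continuous_on_matrix_inv continuous_MM continuous_on_id) auto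

lemma bounded_on_P:
  fixes f :: "real^'n \<Rightarrow> 'b::real_normed_vector"
  assumes "continuous_on P f"
  obtains B where "B > 0" "\<And>y. y \<in> P \<Longrightarrow> norm (f y) \<le> B"
  using compact_imp_bounded[OF compact_continuous_image[OF assms compact_P]] that
  unfolding bounded_pos by auto

lemma inverse_bounded:
  assumes "admd Q" "continuous_on P Q"
  obtains B where "B > 0" "\<And>y v. y \<in> X \<Longrightarrow> v \<bullet> (matrix_inv (G0 y + Q y) *v v) \<le> B * (norm v)\<^sup>2"
proof -
  have "continuous_on P (\<lambda>y. matrix_inv (MM y (Q y)) ** Gam y)"
    by (intro continuous_on_matrix_mult continuous_inv_MM assms Gam)
  then obtain B where B: "B > 0" "\<And>y. y \<in> P \<Longrightarrow> norm (matrix_inv (MM y (Q y)) ** Gam y) \<le> B"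
    using bounded_on_P by blast
  obtain K where K: "K > 0" "\<And>(A::real^'n^'n) (x::real^'n). norm (A *v x) \<le> norm A * norm x * K"
    using bounded_bilinear.pos_bounded[OF bounded_bilinear_matrix_vector] by blast
  have "v \<bullet> (matrix_inv (G0 y + Q y) *v v) \<le> (B * K) * (norm v)\<^sup>2" if y: "y \<in> X" for y v
  proof -
    have n: "norm (matrix_inv (G0 y + Q y)) \<le> B"
      using B(2)[of y] X_subset y by (auto simp: admd_inverse(2)[OF assms(1) y])
    have "v \<bullet> (matrix_inv (G0 y + Q y) *v v) \<le> norm v * norm (matrix_inv (G0 y + Q y) *v v)"
      by (rule norm_cauchy_schwarz)
    also have "\<dots> \<le> norm v * (norm (matrix_inv (G0 y + Q y)) * norm v * K)"
      by (intro mult_left_mono K) auto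
    also have "\<dots> \<le> norm v * (B * norm v * K)"
      using n K by (intro mult_left_mono mult_right_mono) auto
    finally show ?thesis
      by (simp add: power2_eq_square mult_ac)
  qed
  then show ?thesis
    using that[of "B * K"] B(1) K(1) by simp
qed

text \<open>The Hessian itself is unbounded near the boundary, but its inverse is bounded.
  Cauchy-Schwarz for the form of the Hessian, applied to \<open>v\<close> and the inverse applied to
  \<open>v\<close>, converts that bound into a uniform lower bound.\<close>

lemma posdef_lower_bound:
  assumes "admd Q" "continuous_on P Q"
  obtains b where "b > 0" "\<And>y v. y \<in> X \<Longrightarrow> b * (norm v)\<^sup>2 \<le> v \<bullet> ((G0 y + Q y) *v v)"
proof -
  obtain B where B: "B > 0" "\<And>y v. y \<in> X \<Longrightarrow> v \<bullet> (matrix_inv (G0 y + Q y) *v v) \<le> B * (norm v)\<^sup>2"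
    using inverse_bounded[OF assms] by blast
  have "1 / B * (norm v)\<^sup>2 \<le> v \<bullet> ((G0 y + Q y) *v v)" if y: "y \<in> X" for y v
  proof (cases "v = 0")
    case False
    let ?G = "G0 y + Q y"
    have pd: "real_posdef ?G"
      using assms(1) y by (simp add: admd_def)
    define z where "z = matrix_inv ?G *v v"
    have Gz: "?G *v z = v"
      using invertible_inv_mult[OF real_posdef_invertible[OF pd]]
      by (simp add: z_def matrix_vector_mul_assoc)
    have "(v \<bullet> (?G *v z))\<^sup>2 \<le> (v \<bullet> (?G *v v)) * (z \<bullet> (?G *v z))"
    proof (rule psd_cauchy_schwarz)
      show "transpose ?G = ?G" using pd by (simp add: real_posdef_def)
      show "0 \<le> w \<bullet> (?G *v w)" for w
        using pd by (cases "w = 0") (auto simp: real_posdef_def less_imp_le)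
    qed
    then have "((norm v)\<^sup>2)\<^sup>2 \<le> (v \<bullet> (?G *v v)) * (v \<bullet> z)"
      by (simp add: Gz power2_norm_eq_inner inner_commute)
    also have "\<dots> \<le> (v \<bullet> (?G *v v)) * (B * (norm v)\<^sup>2)"
    proof (intro mult_left_mono)
      show "v \<bullet> z \<le> B * (norm v)\<^sup>2"
        using B(2)[OF y] by (simp add: z_def)
      show "0 \<le> v \<bullet> (?G *v v)"
        using pd False by (simp add: real_posdef_def less_imp_le)
    qed
    finally have "(norm v)\<^sup>2 * (norm v)\<^sup>2 \<le> (v \<bullet> (?G *v v)) * B * (norm v)\<^sup>2"
      by (simp add: power2_eq_square mult_ac)
    then have "(norm v)\<^sup>2 \<le> (v \<bullet> (?G *v v)) * B"
      using False by (meson mult_le_cancel_right_pos zero_less_norm_iff zero_less_power)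
    then show ?thesis
      using B(1) by (simp add: field_simps)
  qed simp
  then show ?thesis
    using that[of "1 / B"] B(1) by simp
qed

text \<open>Failures of the determinant and eigenvalue conditions form compact sets over
  \<open>P\<close>, so they stay away from parameter 0. Positivity of the Hessian is a condition
  over the open interior only, and is preserved by means of the uniform lower bound.\<close>

lemma admd_perturb:
  assumes Q: "admd Q" "continuous_on P Q" "\<And>y. y \<in> P \<Longrightarrow> transpose (Q y) = Q y"
    and Q': "continuous_on P Q'" "\<And>y. y \<in> P \<Longrightarrow> transpose (Q' y) = Q' y"
  shows "\<exists>e>0. \<forall>t. \<bar>t\<bar> < e \<longrightarrow> admd (\<lambda>y. Q y + t *\<^sub>R Q' y)"
proof -
  define q where "q t y = Q y + t *\<^sub>R Q' y" for t y
  have q_cont: "continuous_on A (\<lambda>p. q (f p) (h p))"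
    if "continuous_on A f" "continuous_on A h" "h ` A \<subseteq> P" for A f and h :: "'z::topological_space \<Rightarrow> _"
    unfolding q_def using that
    by (intro continuous_intros continuous_on_compose2[OF Q(2)] continuous_on_compose2[OF Q'(1)]) auto
  define T where "T = {-1..1::real} \<times> P"
  have T: "compact T" "closed T"
    using compact_P by (auto simp: T_def intro: compact_Times compact_imp_closed)
  have "\<exists>e>0. \<forall>t b. \<bar>t\<bar> < e \<longrightarrow> (t, b) \<notin> T \<inter> (\<lambda>p. det (MM (snd p) (q (fst p) (snd p)))) -` {..0}"
  proof (rule compact_fst_avoids_0)
    have "closed (T \<inter> (\<lambda>p. det (MM (snd p) (q (fst p) (snd p)))) -` {..0})"
      by (intro continuous_closed_preimage continuous_on_det continuous_MM q_cont continuous_intros T)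
        (auto simp: T_def)
    from compact_Int_closed[OF T(1) this]
    show "compact (T \<inter> (\<lambda>p. det (MM (snd p) (q (fst p) (snd p)))) -` {..0})"
      by (simp only: Int_left_absorb)
    show "(0, b) \<notin> T \<inter> (\<lambda>p. det (MM (snd p) (q (fst p) (snd p)))) -` {..0}" for b
      using Q(1) by (auto simp: T_def q_def admd_def not_le)
  qed
  then obtain e1 where e1: "e1 > 0" "\<And>t b. \<bar>t\<bar> < e1 \<Longrightarrow> (t, b) \<notin> T \<inter> (\<lambda>p. det (MM (snd p) (q (fst p) (snd p)))) -` {..0}"
    by blast
  \<comment> \<open>An eigenvalue of modulus at least 1 is recorded by its inverse \<open>x\<close>
    in the closed unit disc, through \<open>x *s (AA y q *v v) = v\<close> with \<open>v\<close> of
    norm 1. This keeps the set of failures compact.\<close>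
  define S where "S = {-1..1::real} \<times> (P \<times> (sphere (0::complex^'n) 1 \<times> cball (0::complex) 1))"
  define F where "F p = (case p of (t, y, v, x) \<Rightarrow> x *s (AA y (q t y) *v v) - v)" for p :: "real \<times> (real^'n) \<times> (complex^'n) \<times> complex"
  have S: "compact S" "closed S"
    using compact_P by (auto simp: S_def intro!: compact_Times compact_imp_closed)
  have F_cont: "continuous_on S F"
  proof -
    have "continuous_on S (\<lambda>p. AA (fst (snd p)) (q (fst p) (fst (snd p))))"
      by (intro continuous_AA q_cont continuous_intros) (auto simp: S_def)
    then have "continuous_on S (\<lambda>p. snd (snd (snd p)) *s (AA (fst (snd p)) (q (fst p) (fst (snd p))) *v fst (snd (snd p))) - fst (snd (snd p)))"
      unfolding vector_scalar_mult_def matrix_vector_mult_def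
      by (intro continuous_intros) 
    then show ?thesis
      by (simp add: F_def case_prod_beta)
  qed
  have "\<exists>e>0. \<forall>t b. \<bar>t\<bar> < e \<longrightarrow> (t, b) \<notin> S \<inter> F -` {0}"
  proof (rule compact_fst_avoids_0)
    have "closed (S \<inter> F -` {0})"
      by (intro continuous_closed_preimage F_cont S) auto
    from compact_Int_closed[OF S(1) this] show "compact (S \<inter> F -` {0})"
      by (simp only: Int_left_absorb)
    show "(0, b) \<notin> S \<inter> F -` {0}" for b
    proof
      assume b: "(0, b) \<in> S \<inter> F -` {0}"
      obtain y v x where byvx: "b = (y, v, x)" by (cases b) auto
      have y: "y \<in> P" "norm v = 1" "cmod x \<le> 1" and v: "x *s (AA y (Q y) *v v) = v"
        using b by (auto simp: byvx S_def F_def q_def)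
      have "v \<noteq> 0" using y by auto
      then have "x \<noteq> 0" using v by auto
      have "inverse x *s (x *s (AA y (Q y) *v v)) = inverse x *s v"
        using v by simp
      then have "AA y (Q y) *v v = inverse x *s v"
        using \<open>x \<noteq> 0\<close> by (simp add: vector_smult_assoc)
      then have "eigenvalue (AA y (Q y)) (inverse x)"
        using \<open>v \<noteq> 0\<close> by (auto simp: eigenvalue_def)
      then have "cmod (inverse x) < 1"
        using Q(1) y(1) by (auto simp: admd_def)
      then show False
        using y(3) \<open>x \<noteq> 0\<close> by (simp add: norm_inverse inverse_less_1_iff)
    qed
  qed
  then obtain e2 where e2: "e2 > 0" "\<And>t b. \<bar>t\<bar> < e2 \<Longrightarrow> (t, b) \<notin> S \<inter> F -` {0}"
    by blast
  obtain b where b: "b > 0" "\<And>y v. y \<in> X \<Longrightarrow> b * (norm v)\<^sup>2 \<le> v \<bullet> ((G0 y + Q y) *v v)"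
    using posdef_lower_bound[OF Q(1,2)] by blast
  obtain B where B: "B > 0" "\<And>y. y \<in> P \<Longrightarrow> norm (Q' y) \<le> B"
    using bounded_on_P[OF Q'(1)] by blast
  obtain K where K: "K > 0" "\<And>(A::real^'n^'n) (x::real^'n). norm (A *v x) \<le> norm A * norm x * K"
    using bounded_bilinear.pos_bounded[OF bounded_bilinear_matrix_vector] by blast
  \<comment> \<open>The last entry keeps the perturbation of the quadratic form below half of its
    lower bound \<open>b\<close>.\<close>
  define e where "e = min (min e1 e2) (min 1 (b / (2 * B * K)))"
  have e: "e > 0" "e \<le> e1" "e \<le> e2" "e \<le> 1" "e * (B * K) < b"
  proof -
    have "e \<le> b / (2 * B * K)" by (simp add: e_def)
    then have "e * (B * K) \<le> b / (2 * B * K) * (B * K)"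
      using B K by (intro mult_right_mono) auto
    also have "\<dots> = b / 2" using B K by (simp add: field_simps)
    finally show "e * (B * K) < b" using b(1) by simp
  qed (use e1 e2 b B K in \<open>auto simp: e_def\<close>)
  have "admd (q t)" if t: "\<bar>t\<bar> < e" for t
    unfolding admd_def
  proof (intro conjI ballI allI impI)
    fix y assume y: "y \<in> P"
    have tT: "t \<in> {-1..1}" using t e by auto
    show "det (MM y (q t y)) > 0"
      using e1(2)[of t y] t e y tT by (auto simp: T_def not_le)
    fix x assume "eigenvalue (AA y (q t y)) x"
    then obtain v where v: "v \<noteq> 0" "AA y (q t y) *v v = x *s v"
      by (auto simp: eigenvalue_def)
    show "cmod x < 1"
    proof (rule ccontr)
      assume "\<not> cmod x < 1"
      then have x: "x \<noteq> 0" "cmod (inverse x) \<le> 1"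
        by (auto simp: norm_inverse inverse_le_1_iff)
      define w where "w = complex_of_real (1 / norm v) *s v"
      have w_eq: "w = (1 / norm v) *\<^sub>R v"
        by (simp add: w_def vec_eq_iff) (simp add: scaleR_conv_of_real)
      have "norm w = 1" using v(1) by (simp add: w_eq)
      moreover have "AA y (q t y) *v w = x *s w"
        by (simp add: w_def vector_scalar_commute v(2) vec_eq_iff mult_ac)
      then have "inverse x *s (AA y (q t y) *v w) = w"
        using x(1) by (simp add: vector_smult_assoc)
      ultimately have "(t, y, w, inverse x) \<in> S \<inter> F -` {0}"
        using y tT x(2) by (simp add: S_def F_def)
      then show False using e2(2) t e by auto
    qed
  next
    fix y assume y: "y \<in> X"
    show "real_posdef (G0 y + q t y)"
      unfolding real_posdef_def
    proof (intro conjI allI impI)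
      show "transpose (G0 y + q t y) = G0 y + q t y"
        using G0_posdef[OF y] Q(3) Q'(2) X_subset y
        by (auto simp: q_def transpose_add transpose_scaleR real_posdef_def)
      fix v :: "real^'n" assume v: "v \<noteq> 0"
      have "\<bar>v \<bullet> (Q' y *v v)\<bar> \<le> norm v * norm (Q' y *v v)"
        by (rule Cauchy_Schwarz_ineq2)
      also have "\<dots> \<le> norm v * (norm (Q' y) * norm v * K)"
        by (intro mult_left_mono K) auto
      also have "\<dots> \<le> norm v * (B * norm v * K)"
        using B K X_subset y by (intro mult_left_mono mult_right_mono) auto
      finally have 1: "\<bar>v \<bullet> (Q' y *v v)\<bar> \<le> (B * K) * (norm v)\<^sup>2"
        by (simp add: power2_eq_square mult_ac)
      have "\<bar>t * (v \<bullet> (Q' y *v v))\<bar> \<le> e * ((B * K) * (norm v)\<^sup>2)"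
        unfolding abs_mult using t 1 by (intro mult_mono) auto
      also have "\<dots> < b * (norm v)\<^sup>2"
        using e(5) v by (simp add: mult.assoc[symmetric])
      finally have "\<bar>t * (v \<bullet> (Q' y *v v))\<bar> < b * (norm v)\<^sup>2" .
      moreover have "v \<bullet> ((G0 y + q t y) *v v) = v \<bullet> ((G0 y + Q y) *v v) + t * (v \<bullet> (Q' y *v v))"
        by (simp add: q_def matrix_vector_mult_add_rdistrib scaleR_matrix_mult inner_add_right)
      ultimately show "v \<bullet> ((G0 y + q t y) *v v) > 0"
        using b(2)[OF y, of v] by linarith
    qed
  qed
  moreover have "q t = (\<lambda>y. Q y + t *\<^sub>R Q' y)" for t
    by (simp add: q_def fun_eq_iff)
  ultimately show ?thesis
    using e(1) by (intro exI[of _ e]) auto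
qed

section \<open>Boundary behaviour of the real coefficient matrix\<close>

definition Kt :: "(real^'n \<Rightarrow> real^'n^'n) \<Rightarrow> real^'n \<Rightarrow> real^'n^'n" where
  "Kt Q y = reM (Hm (G0 y + Q y) (\<xi> y))"

text \<open>\<open>om\<close> is the coefficient of \<open>\<ell>\<^sup>r\<close> in the expansion of \<open>\<nu>\<^sup>r \<sqdot> K \<nu>\<^sup>r\<close> at the facet \<open>\<ell>\<^sup>r = 0\<close>. It equals \<open>1\<close>
  there, which fixes the weight of the boundary integral.\<close>

definition om :: "(real^'n \<Rightarrow> real^'n^'n) \<Rightarrow> 'r \<Rightarrow> real^'n \<Rightarrow> real" where
  "om Q r y = \<nu> r \<bullet> (matrix_inv (MM y (Q y)) *v ww r y)"

lemma om_continuous: "admd Q \<Longrightarrow> continuous_on P Q \<Longrightarrow> continuous_on P (om Q r)"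
  unfolding om_def by (intro continuous_intros continuous_on_matrix_vector continuous_inv_MM ww)

text \<open>On the facet \<open>Gam\<close> annihilates \<open>\<nu> r\<close>, so after pairing
  with \<open>\<nu> r\<close> the matrix \<open>MM\<close> acts as the identity, and
  \<open>nu_ww\<close> gives the value.\<close>

lemma om_facet:
  assumes "admd Q" "y \<in> P" "L r y = 0"
  shows "om Q r y = 1"
proof -
  define z where "z = matrix_inv (MM y (Q y)) *v ww r y"
  have "MM y (Q y) *v z = ww r y"
    using admd_inverse(1)[OF assms(1,2)] by (simp add: z_def matrix_vector_mul_assoc invertible_inv_mult)
  then have "\<nu> r \<bullet> (z + Gam y *v (Q y *v z)) = 1"
    using nu_ww[OF assms(2,3)] by (simp add: MM_def matrix_vector_mult_add_rdistrib matrix_vector_mul_assoc)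
  moreover have "\<nu> r \<bullet> (Gam y *v w) = 0" for w
    using inner_matrix_transpose[of "Gam y" "\<nu> r" w] Gam_sym[OF assms(2)] Gam_nu[OF assms(2), of r] assms(3)
    by simp
  ultimately show ?thesis
    by (simp add: om_def inner_add_right flip: z_def)
qed

text \<open>The inverse Hessian on \<open>\<nu> r\<close> is exactly
  \<open>L r y * om Q r y\<close>. The correction \<open>\<xi> G cnj \<xi>\<close> has real part
  \<open>Gam y ** T y ** Gam y\<close> with \<open>T\<close> bounded, and
  \<open>Gam y *v \<nu> r\<close> carries a factor \<open>L r y\<close>; on \<open>\<nu> r\<close>
  the correction is therefore quadratic.\<close>

lemma Kt_bounds:
  assumes Q: "admd Q" "continuous_on P Q"
  obtains C where "C > 0" "\<And>y a. y \<in> X \<Longrightarrow> a \<bullet> (Kt Q y *v a) \<le> C * (norm a)\<^sup>2"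
    "\<And>y r. y \<in> X \<Longrightarrow> \<nu> r \<bullet> (Kt Q y *v \<nu> r) \<le> C * L r y"
    "\<And>y r. y \<in> X \<Longrightarrow> \<bar>\<nu> r \<bullet> (Kt Q y *v \<nu> r) - L r y * om Q r y\<bar> \<le> C * (L r y)\<^sup>2"
proof -
  obtain B where B: "B > 0" "\<And>y v. y \<in> X \<Longrightarrow> v \<bullet> (matrix_inv (G0 y + Q y) *v v) \<le> B * (norm v)\<^sup>2"
    using inverse_bounded[OF Q] by blast
  define T where "T y = reM (Th y ** complex_mat (MM y (Q y)) ** complex_mat (Gam y) ** map_matrix cnj (Th y))" for y
  have T_cont: "continuous_on P T"
    unfolding T_def by (intro bounded_linear.continuous_on[OF bounded_linear_reM]
      continuous_on_matrix_mult_complex continuous_on_complex_mat continuous_on_map_matrix_cnj Th Gam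
      continuous_MM continuous_on_id Q) auto
  define E where "E y = (\<Sum>r\<in>UNIV. \<bar>ww r y \<bullet> (T y *v ww r y)\<bar>)" for y
  have "continuous_on P E"
    unfolding E_def by (intro continuous_intros continuous_on_matrix_vector T_cont ww)
  then obtain C1 where C1: "C1 > 0" "\<And>y. y \<in> P \<Longrightarrow> norm (E y) \<le> C1"
    using bounded_on_P by blast
  have "continuous_on P (\<lambda>y. \<Sum>r\<in>UNIV. \<bar>om Q r y\<bar>)"
    by (intro continuous_intros om_continuous Q)
  then obtain C2 where C2: "C2 > 0" "\<And>y. y \<in> P \<Longrightarrow> norm (\<Sum>r\<in>UNIV. \<bar>om Q r y\<bar>) \<le> C2"
    using bounded_on_P by blast
  have main: "0 \<le> a \<bullet> (Kt Q y *v a)" "a \<bullet> (Kt Q y *v a) \<le> a \<bullet> (matrix_inv (G0 y + Q y) *v a)"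
    "a \<bullet> (matrix_inv (G0 y + Q y) *v a) - a \<bullet> (reM (\<xi> y ** complex_mat (G0 y + Q y) ** map_matrix cnj (\<xi> y)) *v a)
      \<le> a \<bullet> (Kt Q y *v a)" if y: "y \<in> X" for y a
  proof -
    obtain V \<sigma> where "hframe (G0 y + Q y) (\<xi> y) V \<sigma>"
      using good_hframe[OF admd_good[OF Q(1) y]] .
    then interpret hframe "G0 y + Q y" "\<xi> y" V \<sigma> .
    show "0 \<le> a \<bullet> (Kt Q y *v a)" "a \<bullet> (Kt Q y *v a) \<le> a \<bullet> (matrix_inv (G0 y + Q y) *v a)"
    "a \<bullet> (matrix_inv (G0 y + Q y) *v a) - a \<bullet> (reM (\<xi> y ** complex_mat (G0 y + Q y) ** map_matrix cnj (\<xi> y)) *v a)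
      \<le> a \<bullet> (Kt Q y *v a)"
      unfolding Kt_def by (rule reM_Hm_bounds)+
  qed
  have inv_nu: "\<nu> r \<bullet> (matrix_inv (G0 y + Q y) *v \<nu> r) = L r y * om Q r y" if y: "y \<in> X" for y r
    using Gam_nu[of y r] X_subset y
    by (auto simp: admd_inverse(2)[OF Q(1) y] om_def matrix_vector_mult_scaleR simp flip: matrix_vector_mul_assoc)
  have xi_nu: "\<nu> r \<bullet> (reM (\<xi> y ** complex_mat (G0 y + Q y) ** map_matrix cnj (\<xi> y)) *v \<nu> r) \<le> C1 * (L r y)\<^sup>2"
    if y: "y \<in> X" for y r
  proof -
    have yP: "y \<in> P" using y X_subset by blast
    have "map_matrix cnj (\<xi> y) = complex_mat (Gam y) ** map_matrix cnj (Th y) ** complex_mat (Gam y)"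
      by (subst xi_eq[OF y]) (simp add: map_matrix_cnj_mult)
    then have "\<xi> y ** complex_mat (G0 y + Q y) ** map_matrix cnj (\<xi> y) =
        complex_mat (Gam y) ** (Th y ** complex_mat (MM y (Q y)) ** complex_mat (Gam y) ** map_matrix cnj (Th y)) ** complex_mat (Gam y)"
      by (simp add: xi_G[OF y] matrix_mul_assoc)
    then have "reM (\<xi> y ** complex_mat (G0 y + Q y) ** map_matrix cnj (\<xi> y)) = Gam y ** T y ** Gam y"
      by (simp add: reM_sandwich T_def)
    then have "\<nu> r \<bullet> (reM (\<xi> y ** complex_mat (G0 y + Q y) ** map_matrix cnj (\<xi> y)) *v \<nu> r) =
        \<nu> r \<bullet> (Gam y *v (T y *v (Gam y *v \<nu> r)))"
      by (simp add: matrix_vector_mul_assoc matrix_mul_assoc)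
    also have "\<dots> = (Gam y *v \<nu> r) \<bullet> (T y *v (Gam y *v \<nu> r))"
      using inner_matrix_transpose[of "Gam y" "\<nu> r"] Gam_sym[OF yP] by simp
    also have "\<dots> = (L r y)\<^sup>2 * (ww r y \<bullet> (T y *v ww r y))"
      by (simp add: Gam_nu[OF yP] matrix_vector_mult_scaleR power2_eq_square)
    also have "\<dots> \<le> (L r y)\<^sup>2 * C1"
    proof (intro mult_left_mono)
      have "\<bar>ww r y \<bullet> (T y *v ww r y)\<bar> \<le> E y"
        unfolding E_def by (rule member_le_sum) auto
      then show "ww r y \<bullet> (T y *v ww r y) \<le> C1"
        using C1(2)[OF yP] by simp
    qed simp
    finally show ?thesis by (simp add: mult.commute)
  qed
  define C where "C = max B (max C1 C2)"
  show ?thesis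
  proof (rule that[of C])
    show "C > 0" using B(1) by (simp add: C_def)
    show "a \<bullet> (Kt Q y *v a) \<le> C * (norm a)\<^sup>2" if y: "y \<in> X" for y a
    proof -
      have "a \<bullet> (Kt Q y *v a) \<le> B * (norm a)\<^sup>2"
        using main(2)[OF y, of a] B(2)[OF y, of a] by simp
      also have "\<dots> \<le> C * (norm a)\<^sup>2"
        by (intro mult_right_mono) (auto simp: C_def)
      finally show ?thesis .
    qed
    fix y r assume y: "y \<in> X"
    have L: "L r y > 0" using y interior_iff by blast
    have yP: "y \<in> P" using y X_subset by blast
    have "\<bar>om Q r y\<bar> \<le> (\<Sum>r\<in>UNIV. \<bar>om Q r y\<bar>)"
      by (rule member_le_sum) auto
    then have "om Q r y \<le> C"
      using C2(2)[OF yP] by (simp add: C_def)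
    then have "L r y * om Q r y \<le> L r y * C"
      using L by (intro mult_left_mono) auto
    then show "\<nu> r \<bullet> (Kt Q y *v \<nu> r) \<le> C * L r y"
      using main(2)[OF y, of "\<nu> r"] inv_nu[OF y, of r] by (simp add: mult.commute)
    have "C1 * (L r y)\<^sup>2 \<le> C * (L r y)\<^sup>2"
      by (intro mult_right_mono) (auto simp: C_def)
    moreover have "0 \<le> C * (L r y)\<^sup>2"
      using B(1) by (simp add: C_def)
    ultimately show "\<bar>\<nu> r \<bullet> (Kt Q y *v \<nu> r) - L r y * om Q r y\<bar> \<le> C * (L r y)\<^sup>2"
      using main(2,3)[OF y, of "\<nu> r"] inv_nu[OF y, of r] xi_nu[OF y, of r] by linarith
  qed
qed

lemma Kt_psd:
  assumes *: "admd Q" "y \<in> X"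
  shows "transpose (Kt Q y) = Kt Q y" "0 \<le> a \<bullet> (Kt Q y *v a)"
proof -
  obtain V \<sigma> where "hframe (G0 y + Q y) (\<xi> y) V \<sigma>"
    using good_hframe[OF admd_good[OF *]] .
  then interpret hframe "G0 y + Q y" "\<xi> y" V \<sigma> .
  show "transpose (Kt Q y) = Kt Q y" "0 \<le> a \<bullet> (Kt Q y *v a)"
    unfolding Kt_def by (rule reM_Hm_sym reM_Hm_bounds)+
qed

end

subsection \<open>Integration by parts\<close>

lemma integrable_compact_support:
  fixes g :: "real^'n \<Rightarrow> real"
  assumes "compact S" "continuous_on S g" "\<And>y. y \<notin> S \<Longrightarrow> g y = 0"
  shows "integrable lborel g"
proof -
  have "g = (\<lambda>y. indicator S y *\<^sub>R g y)"
    using assms(3) by (auto simp: indicator_def fun_eq_iff)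
  with borel_integrable_compact[OF assms(1,2)] show ?thesis by simp
qed

lemma partial_support:
  assumes "closed S" "\<And>y. y \<notin> S \<Longrightarrow> w y = 0" "y \<notin> S"
  shows "partial i w y = 0"
  using partial_cong_open[of "- S" y w "\<lambda>_. 0" i] assms by auto

text \<open>Difference quotients have integral zero by translation invariance and converge
  dominatedly, since they are derivatives at intermediate points and have uniformly bounded
  support.\<close>

lemma integral_partial_zero:
  fixes w :: "real^'n \<Rightarrow> real"
  assumes w: "Ck_on 1 UNIV w" and S: "compact S" "\<And>y. y \<notin> S \<Longrightarrow> w y = 0"
  shows "integrable lborel (partial i w)" "(LINT y|lborel. partial i w y) = 0"
proof -
  define v :: "real^'n" where "v = axis i 1"
  have nv: "norm v = 1" by (simp add: v_def)
  have w': "\<And>y. w differentiable (at y)" "\<And>i. continuous_on UNIV (partial i w)"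
    using w by (auto simp: One_nat_def)
  have cw: "continuous_on UNIV w"
    using Ck_on_continuous[OF w] .
  have [measurable]: "w \<in> borel_measurable borel" "partial i w \<in> borel_measurable borel"
    using cw w'(2) by (auto intro: borel_measurable_continuous_onI)
  have p0: "partial i w y = 0" if "y \<notin> S" for y
    using partial_support[of S w y i] S that compact_imp_closed by blast
  show "integrable lborel (partial i w)"
    using integrable_compact_support[OF S(1) continuous_on_subset[OF w'(2)] p0] by simp
  obtain R where R: "\<And>y. y \<in> S \<Longrightarrow> norm y \<le> R"
    using compact_imp_bounded[OF S(1)] bounded_iff by blast
  obtain C where C: "C > 0" "\<And>y. y \<in> S \<Longrightarrow> norm (partial i w y) \<le> C"
    using compact_imp_bounded[OF compact_continuous_image[OF continuous_on_subset[OF w'(2)] S(1)], of i]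
    unfolding bounded_pos by auto
  have C': "\<bar>partial i w y\<bar> \<le> C" for y
    using C p0 by (cases "y \<in> S") auto
  define e :: "nat \<Rightarrow> real" where "e k = 1 / real (Suc k)" for k
  have e: "0 < e k" "e k \<le> 1" for k by (auto simp: e_def)
  define D where "D k y = (w (y + e k *\<^sub>R v) - w y) / e k" for k y
  have line: "((\<lambda>r. w (y + r *\<^sub>R v)) has_real_derivative partial i w (y + r *\<^sub>R v)) (at r)" for y r
    unfolding v_def by (rule line_derivative) (rule w')
  have bound: "\<bar>D k y\<bar> \<le> C * indicator (cball 0 (R + 1)) y" for k y
  proof (cases "y \<in> cball 0 (R + 1)")
    case True
    obtain r where r: "w (y + e k *\<^sub>R v) - w (y + 0 *\<^sub>R v) = (e k - 0) * partial i w (y + r *\<^sub>R v)"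
      using MVT2[of 0 "e k" "\<lambda>r. w (y + r *\<^sub>R v)" "\<lambda>r. partial i w (y + r *\<^sub>R v)"] line e by blast
    then have "D k y = partial i w (y + r *\<^sub>R v)"
      using e[of k] by (simp add: D_def field_simps)
    then show ?thesis using C' True by simp
  next
    case False
    then have n: "norm y > R + 1" by simp
    have "norm y \<le> norm (y + e k *\<^sub>R v) + norm (e k *\<^sub>R v)"
      using norm_triangle_ineq4[of "y + e k *\<^sub>R v" "e k *\<^sub>R v"] by simp
    then have "norm (y + e k *\<^sub>R v) > R"
      using n e[of k] nv by simp
    then have "w (y + e k *\<^sub>R v) = 0" "w y = 0"
      using R S(2) n by (force, force)
    then show ?thesis using C by (simp add: D_def)
  qed
  have lim: "(\<lambda>k. D k y) \<longlonglongrightarrow> partial i w y" for y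
  proof -
    have "((\<lambda>h. (w (y + h *\<^sub>R v) - w y) / h) \<longlongrightarrow> partial i w y) (at 0)"
      using line[of y 0] by (simp add: DERIV_def)
    moreover have "filterlim e (at 0) sequentially"
    proof -
      have "e \<longlonglongrightarrow> 0" unfolding e_def by (rule lim_1_over_n[THEN LIMSEQ_Suc])
      then show ?thesis
        unfolding filterlim_at using e by (auto intro!: always_eventually simp: less_imp_neq[symmetric])
    qed
    ultimately show ?thesis
      unfolding D_def by (rule filterlim_compose)
  qed
  have Dm[measurable]: "D k \<in> borel_measurable borel" for k
    unfolding D_def by measurable
  have 1: "(\<lambda>k. LINT y|lborel. D k y) \<longlonglongrightarrow> (LINT y|lborel. partial i w y)"
  proof (rule integral_dominated_convergence[where w="\<lambda>y. C * indicator (cball 0 (R + 1)) y"])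
    have "emeasure lborel (cball (0::real^'n) (R + 1)) < \<infinity>"
      by (rule emeasure_lborel_cball_finite)
    then show "integrable lborel (\<lambda>y::real^'n. C * indicator (cball 0 (R + 1)) y)"
      by (intro integrable_mult_right integrable_real_indicator) auto
  qed (use lim bound in auto)
  have iw: "integrable lborel w"
    using integrable_compact_support[OF S(1) continuous_on_subset[OF cw] S(2)] by simp
  have "(LINT y|lborel. D k y) = 0" for k
  proof -
    have "distr lborel borel ((+) (e k *\<^sub>R v)) = (lborel :: (real^'n) measure)"
      by (rule lborel_distr_plus)
    then have 1: "integrable lborel (\<lambda>y. w (e k *\<^sub>R v + y))" "(LINT y|lborel. w (e k *\<^sub>R v + y)) = (LINT y|lborel. w y)"
      using integrable_distr_eq[of "(+) (e k *\<^sub>R v)" lborel borel w] integral_distr[of "(+) (e k *\<^sub>R v)" lborel borel w] iw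
      by simp_all
    then show ?thesis
      using iw by (simp add: D_def add.commute)
  qed
  with 1 show "(LINT y|lborel. partial i w y) = 0"
    by (simp add: LIMSEQ_const_iff)
qed

lemma Ck_on_Un:
  assumes "open A" "open B" "Ck_on k A f" "Ck_on k B f"
  shows "Ck_on k (A \<union> B) f"
  using assms(3,4)
proof (induction k arbitrary: f)
  case 0
  then show ?case by (simp add: continuous_on_open_Un assms)
next
  case (Suc k)
  then show ?case by auto
qed

text \<open>\<open>X\<close> and the complement of \<open>S\<close> form an open cover, and
  \<open>w\<close> vanishes on the second set.\<close>

lemma Ck_on_zero_extension:
  assumes "open X" "closed S" "S \<subseteq> X" "Ck_on k X w" "\<And>y. y \<notin> S \<Longrightarrow> w y = 0"
  shows "Ck_on k UNIV w"
proof -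
  have "Ck_on k (- S) w"
    using Ck_on_cong[of "- S" "\<lambda>_. 0" w k] Ck_on_const assms by auto
  from Ck_on_Un[OF assms(1) _ assms(4) this] have "Ck_on k (X \<union> - S) w"
    using assms(2) by auto
  moreover have "X \<union> - S = UNIV" using assms(3) by auto
  ultimately show ?thesis by simp
qed

lemma integral_by_parts:
  fixes f :: "real^'n \<Rightarrow> real" and K :: "'n \<Rightarrow> 'n \<Rightarrow> real^'n \<Rightarrow> real"
  assumes X: "open X" and S: "compact S" "S \<subseteq> X" "\<And>y. y \<notin> S \<Longrightarrow> f y = 0"
    and f: "Ck_on 2 X f" and K: "\<And>a b. Ck_on 2 X (K a b)"
  shows "(LINT y|lborel. f y * (\<Sum>a\<in>UNIV. \<Sum>b\<in>UNIV. partial b (partial a (K a b)) y))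
    = (LINT y|lborel. (\<Sum>a\<in>UNIV. \<Sum>b\<in>UNIV. K a b y * partial a (partial b f) y))"
proof -
  have cS: "closed S" using S compact_imp_closed by blast
  have f1: "f differentiable (at y)" "partial a f differentiable (at y)" if "y \<in> X" for y a
    using f that by (auto simp: numeral_2_eq_2)
  have K1: "K a b differentiable (at y)" "partial i (K a b) differentiable (at y)" if "y \<in> X" for y a b i
    using K[of a b] that by (auto simp: numeral_2_eq_2)
  have f2: "Ck_on 1 X f" "Ck_on 1 X (partial a f)" "continuous_on X (partial b (partial a f))" for a b
    using f Ck_on_le[OF f, of 1] by (auto simp: numeral_2_eq_2)
  have K2: "Ck_on 1 X (K a b)" "Ck_on 1 X (partial i (K a b))" "continuous_on X (partial j (partial i (K a b)))" for a b i j
    using K[of a b] Ck_on_le[OF K, of 1] by (auto simp: numeral_2_eq_2)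
  have pf: "partial a f y = 0" if "y \<notin> S" for a y
    using partial_support[OF cS S(3) that] by simp
  have ppf: "partial a (partial b f) y = 0" if "y \<notin> S" for a b y
    using partial_support[OF cS pf that] by simp
  \<comment> \<open>The difference of the two integrands is \<open>partial b\<close> of
    \<open>w1\<close> minus \<open>partial a\<close> of \<open>w2\<close>; the mixed products of
    first derivatives cancel.\<close>
  define w1 w2 where "w1 a b y = f y * partial a (K a b) y" and "w2 a b y = partial b f y * K a b y" for a b y
  have w1: "Ck_on 1 UNIV (w1 a b)" and w2: "Ck_on 1 UNIV (w2 a b)" for a b
    unfolding w1_def w2_def
    by (rule Ck_on_zero_extension[OF X cS S(2)];
        use S(3) pf Ck_on_mult[OF X f2(1) K2(2)] Ck_on_mult[OF X f2(2) K2(1)] in \<open>simp\<close>)+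
  have w0: "w1 a b y = 0" "w2 a b y = 0" if "y \<notin> S" for a b y
    using that S(3) pf by (simp_all add: w1_def w2_def)
  have id: "f y * partial b (partial a (K a b)) y - K a b y * partial a (partial b f) y
    = partial b (w1 a b) y - partial a (w2 a b) y" for a b y
  proof (cases "y \<in> X")
    case True
    show ?thesis
      unfolding w1_def w2_def by (simp add: partial_mult[OF f1(1)[OF True] K1(2)[OF True]] partial_mult[OF f1(2)[OF True] K1(1)[OF True]])
  next
    case False
    then have "y \<notin> S" using S by auto
    then show ?thesis
      using S(3) ppf partial_support[OF cS w0(1)] partial_support[OF cS w0(2)] by simp
  qed
  have i0: "(LINT y|lborel. partial b (w1 a b) y - partial a (w2 a b) y) = 0"
    "integrable lborel (\<lambda>y. partial b (w1 a b) y - partial a (w2 a b) y)" for a b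
    using integral_partial_zero[OF w1 S(1) w0(1)] integral_partial_zero[OF w2 S(1) w0(2)] by simp_all
  have "(LINT y|lborel. (\<Sum>a\<in>UNIV. \<Sum>b\<in>UNIV. f y * partial b (partial a (K a b)) y - K a b y * partial a (partial b f) y)) = 0"
    unfolding id by (subst Bochner_Integration.integral_sum | simp add: i0)+
  moreover have "integrable lborel (\<lambda>y. f y * (\<Sum>a\<in>UNIV. \<Sum>b\<in>UNIV. partial b (partial a (K a b)) y))"
    by (rule integrable_compact_support[OF S(1)])
      (auto intro!: continuous_intros continuous_on_subset[OF _ S(2)] K2 Ck_on_continuous[OF f] simp: S(3))
  moreover have "integrable lborel (\<lambda>y. \<Sum>a\<in>UNIV. \<Sum>b\<in>UNIV. K a b y * partial a (partial b f) y)"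
    by (rule integrable_compact_support[OF S(1)])
      (auto intro!: continuous_intros continuous_on_subset[OF _ S(2)] f2 Ck_on_continuous[OF K] simp: ppf)
  ultimately show ?thesis
    by (simp add: sum_subtractf sum_distrib_left[symmetric])
qed

subsection \<open>Cutoff functions\<close>

lemma max_power_derivative:
  fixes x :: real
  assumes n: "n > 0"
  shows "((\<lambda>x. (max 0 x) ^ Suc n) has_real_derivative real (Suc n) * (max 0 x) ^ n) (at x)"
proof -
  consider "x > 0" | "x < 0" | "x = 0" by linarith
  then show ?thesis
  proof cases
    case 1
    have "((\<lambda>x. x ^ Suc n) has_real_derivative real (Suc n) * (max 0 x) ^ n) (at x)"
      using DERIV_pow[of "Suc n" x] 1 by simp
    then show ?thesis
      by (rule has_field_derivative_transform_within_open[where S="{0<..}"]) (use 1 in auto)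
  next
    case 2
    have "((\<lambda>x. 0) has_real_derivative real (Suc n) * (max 0 x) ^ n) (at x)" using 2 n by (simp add: max_absorb1 power_0_left)
    then show ?thesis
      by (rule has_field_derivative_transform_within_open[where S="{..<0}"]) (use 2 n in auto)
  next
    case 3
    have "((\<lambda>h. max 0 h ^ n) \<longlongrightarrow> max 0 0 ^ n) (at (0::real))"
      by (intro tendsto_intros)
    moreover have "max 0 0 ^ n = (0::real)" using n by simp
    ultimately have *: "((\<lambda>h. max 0 h ^ n) \<longlongrightarrow> 0) (at (0::real))" by (simp only:)
    have "((\<lambda>h. max 0 h ^ Suc n / h) \<longlongrightarrow> 0) (at (0::real))"
      by (rule Lim_null_comparison[OF always_eventually *]) (auto simp: max_def)
    then show ?thesis using n by (simp add: 3 DERIV_def power_0_left)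
  qed
qed

text \<open>A cubic B-spline rises from \<open>0\<close> to \<open>1\<close> on \<open>[1, 2]\<close>; \<open>spl 0\<close> is the resulting \<open>C\<^sup>2\<close> step and
  \<open>spl 1\<close>, \<open>spl 2\<close> its derivatives.\<close>

definition spl :: "nat \<Rightarrow> real \<Rightarrow> real" where
  "spl j x = 27 / (if j = 0 then 6 else if j = 1 then 2 else 1) *
     ((max 0 (x - 1)) ^ (3 - j) - 3 * (max 0 (x - 4/3)) ^ (3 - j) + 3 * (max 0 (x - 5/3)) ^ (3 - j) - (max 0 (x - 2)) ^ (3 - j))"

lemma spl_derivative:
  assumes "j < 2"
  shows "(spl j has_real_derivative spl (Suc j) x) (at x)"
proof -
  have *: "((\<lambda>x. (max 0 (x - c)) ^ Suc n) has_real_derivative real (Suc n) * (max 0 (x - c)) ^ n) (at x)"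
    if "n > 0" for c :: real and n
  proof -
    have "((\<lambda>x. x - c) has_real_derivative 1) (at x)"
      by (auto intro!: derivative_eq_intros)
    from DERIV_chain2[where f="\<lambda>x. (max 0 x) ^ Suc n" and g="\<lambda>x. x - c", OF max_power_derivative[OF that] this]
    show ?thesis by simp
  qed
  note ds = DERIV_cmult DERIV_add DERIV_diff
  consider "j = 0" | "j = 1" using assms by linarith
  then show ?thesis
  proof cases
    case 1
    have "((\<lambda>x. 27 / 6 * ((max 0 (x - 1)) ^ 3 - 3 * (max 0 (x - 4/3)) ^ 3 + 3 * (max 0 (x - 5/3)) ^ 3 - (max 0 (x - 2)) ^ 3))
      has_real_derivative 27 / 6 * (3 * (max 0 (x - 1))\<^sup>2 - 3 * (3 * (max 0 (x - 4/3))\<^sup>2) + 3 * (3 * (max 0 (x - 5/3))\<^sup>2) - 3 * (max 0 (x - 2))\<^sup>2)) (at x)"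
      using *[of 2] by (intro ds) (simp_all only: eval_nat_numeral of_nat_numeral, simp_all)
    then show ?thesis
      unfolding spl_def[abs_def] 1 by (simp add: field_simps)
  next
    case 2
    have "((\<lambda>x. 27 / 2 * ((max 0 (x - 1))\<^sup>2 - 3 * (max 0 (x - 4/3))\<^sup>2 + 3 * (max 0 (x - 5/3))\<^sup>2 - (max 0 (x - 2))\<^sup>2))
      has_real_derivative 27 / 2 * (2 * max 0 (x - 1) - 3 * (2 * max 0 (x - 4/3)) + 3 * (2 * max 0 (x - 5/3)) - 2 * max 0 (x - 2))) (at x)"
      using *[of 1] by (intro ds) (simp_all only: eval_nat_numeral of_nat_numeral, simp_all)
    also have "27 / 2 * (2 * max 0 (x - 1) - 3 * (2 * max 0 (x - 4/3)) + 3 * (2 * max 0 (x - 5/3)) - 2 * max 0 (x - 2)) = spl 2 x"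
      by (simp add: spl_def)
    finally show ?thesis
      unfolding spl_def[of 1, abs_def] 2 by (simp add: numeral_2_eq_2)
  qed
qed

lemma spl_low: "j \<le> 2 \<Longrightarrow> x \<le> 1 \<Longrightarrow> spl j x = 0"
  by (simp add: spl_def max_def)

lemma spl_high:
  assumes "x \<ge> 2"
  shows "spl 0 x = 1" "spl 1 x = 0" "spl 2 x = 0"
  using assms by (simp_all add: spl_def max_def) (simp_all add: power3_eq_cube power2_eq_square field_simps)

lemma spl_continuous: "continuous_on A (spl j)"
  unfolding spl_def by (intro continuous_intros)

lemma spl_bounded: "\<exists>C. \<forall>j\<le>2. \<forall>x. \<bar>spl j x\<bar> \<le> C"
proof -
  have "\<exists>C. \<forall>x\<in>{1..2}. \<bar>spl j x\<bar> \<le> C" for j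
    using compact_imp_bounded[OF compact_continuous_image[OF spl_continuous compact_Icc]]
    unfolding bounded_iff by (metis imageI real_norm_def)
  then obtain C where C: "\<And>j x. x \<in> {1..2} \<Longrightarrow> \<bar>spl j x\<bar> \<le> C j"
    by metis
  have b: "\<bar>spl j x\<bar> \<le> C 0 + C 1 + C 2 + 1" if "j \<le> 2" for j x
  proof -
    have "0 \<le> C j" for j using C[of 1 j] by (smt (verit) atLeastAtMost_iff)
    note C0 = this[of 0] this[of 1] this[of 2]
    have j: "j = 0 \<or> j = 1 \<or> j = 2" using that by linarith
    consider "x \<le> 1" | "x \<in> {1..2}" | "x \<ge> 2" by fastforce
    then show ?thesis
    proof cases
      case 1
      then show ?thesis using C0 spl_low[OF that, of x] by linarith
    next
      case 2
      then have "\<bar>spl j x\<bar> \<le> C j" by (rule C)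
      moreover have "C j \<le> C 0 + C 1 + C 2" using j C0 by auto
      ultimately show ?thesis by simp
    next
      case 3
      have "\<bar>spl j x\<bar> \<le> 1" using j spl_high[OF 3] by auto
      then show ?thesis using C0 by linarith
    qed
  qed
  then show ?thesis by blast
qed

lemma spl_nonzero: "j \<le> 2 \<Longrightarrow> j \<noteq> 0 \<Longrightarrow> spl j x \<noteq> 0 \<Longrightarrow> 1 \<le> x \<and> x \<le> 2"
proof -
  assume *: "j \<le> 2" "j \<noteq> 0" "spl j x \<noteq> 0"
  then have "j = 1 \<or> j = 2" by linarith
  then show ?thesis
    using * spl_low[of j x] spl_high(2,3)[of x] by (cases "x \<le> 1"; cases "x \<ge> 2"; fastforce)
qed

text \<open>An antiderivative is \<open>s * spl 1 s - spl 0 s\<close>, so the value is minus the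
  total rise of the step. This number fixes the weight and the sign of the boundary term.\<close>

lemma integral_spl: "integrable lborel (\<lambda>s. s * spl 2 s)" "(LINT s|lborel. s * spl 2 s) = - 1"
proof -
  have eq: "(\<lambda>s. indicator {1..2} s *\<^sub>R (s * spl 2 s)) = (\<lambda>s. s * spl 2 s)"
    using spl_nonzero[of 2] by (auto simp: indicator_def fun_eq_iff)
  have d: "((\<lambda>s. s * spl 1 s - spl 0 s) has_real_derivative s * spl 2 s) (at s)" for s
    by (rule derivative_eq_intros spl_derivative | simp add: numeral_2_eq_2)+
  have c: "continuous_on A (\<lambda>s. s * spl 2 s)" for A
    by (intro continuous_intros spl_continuous)
  have "integrable lborel (\<lambda>s. indicator {1..2} s *\<^sub>R (s * spl 2 s))"
    using c by (intro borel_integrable_compact) auto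
  then show "integrable lborel (\<lambda>s. s * spl 2 s)" unfolding eq .
  have "(LINT s|lborel. indicator {1..2} s *\<^sub>R (s * spl 2 s)) = (2 * spl 1 2 - spl 0 2) - (1 * spl 1 1 - spl 0 1)"
    by (rule integral_FTC_Icc) (use d c in \<open>auto intro: DERIV_subset simp flip: has_real_derivative_iff_has_vector_derivative\<close>)
  then show "(LINT s|lborel. s * spl 2 s) = - 1"
    unfolding eq using spl_high[of 2] by (simp add: spl_low)
qed

text \<open>The family \<open>exp (- inverse x) * inverse x ^ k\<close> is closed under
  differentiation up to linear combinations, which gives smoothness by induction; at 0 the
  exponential beats every power.\<close>

lemma exp_bump_derivative:
  fixes k :: nat and x :: real
  defines "b \<equiv> \<lambda>k x. if x > 0 then exp (- inverse x) * inverse x ^ k else (0::real)"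
  shows "(b k has_real_derivative b (k + 2) x - real k * b (Suc k) x) (at x)"
proof -
  consider "x > 0" | "x < 0" | "x = 0" by linarith
  then show ?thesis
  proof cases
    case 1
    have i: "(inverse has_real_derivative - (inverse x)\<^sup>2) (at x)"
      using DERIV_inverse[of x] 1 by (simp add: power2_eq_square)
    have e: "((\<lambda>x. exp (- inverse x)) has_real_derivative exp (- inverse x) * (inverse x)\<^sup>2) (at x)"
      using DERIV_chain2[OF DERIV_exp DERIV_minus[OF i]] by simp
    have "((\<lambda>x. exp (- inverse x) * inverse x ^ k) has_real_derivative
      exp (- inverse x) * (inverse x)\<^sup>2 * inverse x ^ k + real k * (inverse x ^ (k - Suc 0) * - (inverse x)\<^sup>2) * exp (- inverse x)) (at x)"
      using DERIV_mult[OF e DERIV_power[OF i, of k]] by (simp add: mult_ac)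
    also have "exp (- inverse x) * (inverse x)\<^sup>2 * inverse x ^ k + real k * (inverse x ^ (k - Suc 0) * - (inverse x)\<^sup>2) * exp (- inverse x)
      = b (k + 2) x - real k * b (Suc k) x"
      using 1 by (cases k) (simp_all add: b_def power2_eq_square mult_ac)
    finally have "((\<lambda>x. exp (- inverse x) * inverse x ^ k) has_real_derivative b (k + 2) x - real k * b (Suc k) x) (at x)" .
    then show ?thesis
      by (rule has_field_derivative_transform_within_open[where S="{0<..}"]) (use 1 in \<open>auto simp: b_def\<close>)
  next
    case 2
    have "((\<lambda>x. 0) has_real_derivative b (k + 2) x - real k * b (Suc k) x) (at x)" using 2 by (simp add: b_def)
    then show ?thesis
      by (rule has_field_derivative_transform_within_open[where S="{..<0}"]) (use 2 in \<open>auto simp: b_def\<close>)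
  next
    case 3
    have "((\<lambda>x::real. x ^ Suc k / exp x) \<longlongrightarrow> 0) at_top"
      by (rule tendsto_power_div_exp_0)
    then have "((\<lambda>h::real. inverse h ^ Suc k / exp (inverse h)) \<longlongrightarrow> 0) (at_right 0)"
      by (rule filterlim_compose[OF _ filterlim_inverse_at_top_right])
    then have r: "((\<lambda>h. b k h / h) \<longlongrightarrow> 0) (at_right 0)"
      by (rule Lim_transform_eventually)
        (auto simp: eventually_at_filter b_def exp_minus divide_simps intro!: always_eventually)
    have l: "((\<lambda>h. b k h / h) \<longlongrightarrow> 0) (at_left 0)"
      by (rule Lim_transform_eventually[OF tendsto_const])
        (auto simp: eventually_at_filter b_def intro!: always_eventually)
    have "((\<lambda>h. b k h / h) \<longlongrightarrow> 0) (at 0)"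
      using l r by (simp add: filterlim_split_at)
    then show ?thesis unfolding 3 DERIV_def add_0_left by (simp add: b_def)
  qed
qed

lemma partial_chain:
  fixes q :: "real^'n \<Rightarrow> real"
  assumes f: "(f has_real_derivative f') (at (q y))" and q: "q differentiable (at y)"
  shows "(\<lambda>y. f (q y)) differentiable (at y)" "partial i (\<lambda>y. f (q y)) y = f' * partial i q y"
proof -
  obtain q' where q': "(q has_derivative q') (at y)"
    using q by (auto simp: differentiable_def)
  have "((\<lambda>y. f (q y)) has_derivative (\<lambda>h. f' * q' h)) (at y)"
    using diff_chain_at[OF q' f[unfolded has_field_derivative_def]] by (simp add: comp_def)
  then show "(\<lambda>y. f (q y)) differentiable (at y)" "partial i (\<lambda>y. f (q y)) y = f' * partial i q y"
    using partial_has_derivative[OF q'] partial_has_derivative by (auto simp: differentiable_def)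
qed

lemma smooth_bump:
  fixes y0 :: "real^'n"
  assumes e: "e > 0"
  obtains f :: "real^'n \<Rightarrow> real" where "smooth_on UNIV f" "\<And>y. 0 \<le> f y" "f y0 > 0" "\<And>y. dist y y0 \<ge> e \<Longrightarrow> f y = 0"
proof -
  define b where "b k x = (if x > 0 then exp (- inverse x) * inverse x ^ k else (0::real))" for k :: nat and x
  have db: "(b k has_real_derivative b (k + 2) x - real k * b (Suc k) x) (at x)" for k x
    using exp_bump_derivative[of k x] unfolding b_def .
  define q where "q y = e\<^sup>2 - (y - y0) \<bullet> (y - y0)" for y
  have dq: "(q has_derivative (\<lambda>h. - 2 * ((y - y0) \<bullet> h))) (at y)" for y
    unfolding q_def by (auto intro!: derivative_eq_intros simp: inner_commute)
  have q: "q differentiable (at y)" "partial i q y = - 2 * (y $ i - y0 $ i)" for y i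
    using dq partial_has_derivative[OF dq] by (auto simp: differentiable_def inner_axis)
  have Cb: "Ck_on n UNIV (\<lambda>y. b k (q y))" for n k
  proof (induction n arbitrary: k)
    case 0
    have "continuous_on UNIV (\<lambda>y. b k (q y))"
      using partial_chain(1)[OF db q(1)] by (auto intro!: differentiable_imp_continuous_on simp: differentiable_on_def)
    then show ?case by simp
  next
    case (Suc n)
    have "partial i (\<lambda>y. b k (q y)) = (\<lambda>y. (b (k + 2) (q y) - real k * b (Suc k) (q y)) * (- 2 * (y $ i - y0 $ i)))" for i
      using partial_chain(2)[OF db q(1)] by (simp add: q(2) fun_eq_iff)
    moreover have "Ck_on n UNIV (\<lambda>y. (b (k + 2) (q y) - real k * b (Suc k) (q y)) * (- 2 * (y $ i - y0 $ i)))" for i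
      by (intro Ck_on_mult Ck_on_diff Ck_on_const Suc Ck_on_nth Ck_on_bounded_linear_id bounded_linear_ident) auto
    ultimately show ?case
      using partial_chain(1)[OF db q(1)] by simp
  qed
  show ?thesis
  proof
    show "smooth_on UNIV (\<lambda>y. b 0 (q y))" using Cb by (simp add: smooth_on_def)
    show "0 \<le> b 0 (q y)" for y by (simp add: b_def)
    show "b 0 (q y0) > 0" using e by (simp add: b_def q_def)
    show "b 0 (q y) = 0" if "dist y y0 \<ge> e" for y
    proof -
      have "e\<^sup>2 \<le> (dist y y0)\<^sup>2" using that e by (intro power_mono) auto
      then show ?thesis by (simp add: b_def q_def dist_norm power2_norm_eq_inner)
    qed
  qed
qed

subsection \<open>Integration by parts over the polytope\<close>

context delz
begin

text \<open>\<open>d r\<close> counts how often the factor belonging to the facet \<open>r\<close> has been differentiated.\<close>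

definition cut :: "real \<Rightarrow> ('r \<Rightarrow> nat) \<Rightarrow> real^'n \<Rightarrow> real" where
  "cut e d y = (\<Prod>r\<in>UNIV. spl (d r) (L r y / e))"

abbreviation one :: "'r \<Rightarrow> 'r \<Rightarrow> nat" where
  "one r \<equiv> (\<lambda>_. 0)(r := 1)"

abbreviation two :: "'r \<Rightarrow> 'r \<Rightarrow> 'r \<Rightarrow> nat" where
  "two r s \<equiv> (one r)(s := Suc (one r s))"

lemma cut_derivative:
  assumes d: "\<And>r. d r < 2"
  shows "cut e d differentiable (at y)"
    and "partial a (cut e d) y = (\<Sum>r\<in>UNIV. (\<nu> r $ a / e) * cut e (d(r := Suc (d r))) y)"
proof -
  have f: "((\<lambda>y. spl (d r) (L r y / e)) has_derivative (\<lambda>h. spl (Suc (d r)) (L r y / e) * ((\<nu> r \<bullet> h) / e))) (at y)" for r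
  proof -
    have "((\<lambda>y. L r y / e) has_derivative (\<lambda>h. (\<nu> r \<bullet> h) / e)) (at y)"
      unfolding ell_def divide_inverse by (auto intro!: derivative_eq_intros)
    from diff_chain_at[OF this spl_derivative[OF d, unfolded has_field_derivative_def]]
    show ?thesis by (simp add: comp_def)
  qed
  have *: "(cut e d has_derivative (\<lambda>h. \<Sum>r\<in>UNIV. (spl (Suc (d r)) (L r y / e) * ((\<nu> r \<bullet> h) / e)) * (\<Prod>s\<in>UNIV - {r}. spl (d s) (L s y / e)))) (at y)"
    unfolding cut_def[abs_def] by (rule has_derivative_prod) (rule f)
  then show "cut e d differentiable (at y)" by (auto simp: differentiable_def)
  have "cut e (d(r := Suc (d r))) y = spl (Suc (d r)) (L r y / e) * (\<Prod>s\<in>UNIV - {r}. spl (d s) (L s y / e))" for r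
    unfolding cut_def by (subst prod.remove[of UNIV r]) (auto intro: prod.cong)
  then show "partial a (cut e d) y = (\<Sum>r\<in>UNIV. (\<nu> r $ a / e) * cut e (d(r := Suc (d r))) y)"
    unfolding partial_has_derivative[OF *] by (simp add: inner_axis mult_ac)
qed

lemma cut_continuous: "continuous_on A (cut e d)"
proof -
  have "continuous_on A (\<lambda>y. spl (d r) (L r y / e))" for r
  proof -
    have "continuous_on A (\<lambda>y. L r y / e)"
      unfolding divide_inverse by (intro continuous_intros L_continuous)
    from continuous_on_compose2[OF spl_continuous[of UNIV] this] show ?thesis by simp
  qed
  then show ?thesis unfolding cut_def[abs_def] by (intro continuous_on_prod)
qed

lemma cut_second:
  shows "partial a (cut e (\<lambda>_. 0)) = (\<lambda>y. \<Sum>r\<in>UNIV. (\<nu> r $ a / e) * cut e (one r) y)"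
    and "partial a (cut e (\<lambda>_. 0)) differentiable (at y)"
    and "partial b (partial a (cut e (\<lambda>_. 0))) y = (\<Sum>r\<in>UNIV. (\<nu> r $ a / e) * (\<Sum>s\<in>UNIV. (\<nu> s $ b / e) * cut e (two r s) y))"
proof -
  show 1: "partial a (cut e (\<lambda>_. 0)) = (\<lambda>y. \<Sum>r\<in>UNIV. (\<nu> r $ a / e) * cut e (one r) y)"
    by (simp add: fun_eq_iff cut_derivative)
  have d: "cut e (one r) differentiable (at y)" for r
    by (rule cut_derivative) auto
  show "partial a (cut e (\<lambda>_. 0)) differentiable (at y)"
    unfolding 1 by (rule differentiable_sum) (simp, intro ballI differentiable_mult differentiable_const d)
  have "partial b (cut e (one r)) y = (\<Sum>s\<in>UNIV. (\<nu> s $ b / e) * cut e (two r s) y)" for r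
    by (rule cut_derivative(2)) auto
  then have "partial b (\<lambda>y. (\<nu> r $ a / e) * cut e (one r) y) y = (\<nu> r $ a / e) * (\<Sum>s\<in>UNIV. (\<nu> s $ b / e) * cut e (two r s) y)" for r
    by (subst partial_mult[OF differentiable_const d]) simp
  then show "partial b (partial a (cut e (\<lambda>_. 0))) y = (\<Sum>r\<in>UNIV. (\<nu> r $ a / e) * (\<Sum>s\<in>UNIV. (\<nu> s $ b / e) * cut e (two r s) y))"
    unfolding 1 by (subst partial_sum) (intro differentiable_mult differentiable_const d, simp only:)
qed

lemma cut_Ck: "Ck_on 2 UNIV (cut e (\<lambda>_. 0))"
proof -
  have "Ck_on 0 UNIV (partial b (partial a (cut e (\<lambda>_. 0))))" for a b
    unfolding cut_second(3)[abs_def] Ck_on.simps divide_inverse by (intro continuous_intros cut_continuous)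
  then show ?thesis
    using cut_derivative(1)[of "\<lambda>_. 0"] cut_second(2) by (simp add: numeral_2_eq_2)
qed

text \<open>Each factor vanishes for \<open>L r y \<le> e\<close>, and a differentiated factor also
  vanishes beyond \<open>2 * e\<close>: derivatives of the cutoff live in thin layers along the
  facets.\<close>

lemma cut_support:
  assumes "e > 0" "\<And>r. d r \<le> 2" "cut e d y \<noteq> 0"
  shows "\<And>r. e < L r y" "\<And>r. d r \<noteq> 0 \<Longrightarrow> L r y \<le> 2 * e"
proof -
  have nz: "spl (d r) (L r y / e) \<noteq> 0" for r using assms(3) by (simp add: cut_def)
  show "e < L r y" for r
    using nz[of r] spl_low[OF assms(2), of "L r y / e" r] assms(1) by (fastforce simp: field_simps)
  show "L r y \<le> 2 * e" if "d r \<noteq> 0" for r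
    using spl_nonzero[OF assms(2) that nz] assms(1) by (simp add: field_simps)
qed

lemma cut_bounded: "\<exists>C>0. \<forall>e d y. (\<forall>r. d r \<le> 2) \<longrightarrow> \<bar>cut e d y\<bar> \<le> C"
proof -
  obtain C where C: "\<And>j x. j \<le> 2 \<Longrightarrow> \<bar>spl j x\<bar> \<le> C" using spl_bounded by blast
  have "\<bar>cut e d y\<bar> \<le> C ^ CARD('r)" if "\<forall>r. d r \<le> 2" for e d y
  proof -
    have "\<bar>cut e d y\<bar> = (\<Prod>r\<in>UNIV. \<bar>spl (d r) (L r y / e)\<bar>)" by (simp add: cut_def abs_prod)
    also have "\<dots> \<le> (\<Prod>r\<in>(UNIV::'r set). C)" using C that by (intro prod_mono) auto
    finally show ?thesis by simp
  qed
  then show ?thesis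
    by (intro exI[of _ "\<bar>C ^ CARD('r)\<bar> + 1"] conjI allI impI) (simp, metis abs_ge_self add_increasing2 order_trans zero_le_one)
qed

text \<open>A compact subset of the interior that carries the cutoff and its derivatives.\<close>

definition core :: "real \<Rightarrow> (real^'n) set" where
  "core e = {y. \<forall>r. e \<le> L r y}"

lemma core:
  assumes "e > 0"
  shows "compact (core e)" "core e \<subseteq> X" "(\<And>r. d r \<le> 2) \<Longrightarrow> y \<notin> core e \<Longrightarrow> cut e d y = 0"
proof -
  show 1: "core e \<subseteq> X"
  proof
    fix y assume "y \<in> core e"
    then have "0 < L r y" for r using less_le_trans[OF assms] by (simp add: core_def)
    then show "y \<in> X" by (simp add: interior_iff)
  qed
  have "closed (core e)"
    unfolding core_def by (intro closed_Collect_all closed_Collect_le continuous_intros L_continuous)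
  then show "compact (core e)"
    using bounded_subset[OF bounded_P] 1 X_subset compact_eq_bounded_closed by blast
  show "(\<And>r. d r \<le> 2) \<Longrightarrow> y \<notin> core e \<Longrightarrow> cut e d y = 0"
    using cut_support(1)[OF assms, of d y] unfolding core_def by (auto intro: less_imp_le)
qed

lemma X_indicator_measurable: "continuous_on X f \<Longrightarrow> (\<lambda>y. indicator X y * f y :: real) \<in> borel_measurable borel"
  using borel_measurable_continuous_on_indicator[of X f] by simp

lemma two_le: "two r s t \<le> 2" "one r t \<le> 2" by auto

text \<open>Proportional defining functions would have the same zero set in \<open>P\<close>,
  against the injectivity of \<open>facet\<close>.\<close>

lemma different_hyperplanes:
  assumes "s \<noteq> r"
  shows "\<not> (\<exists>k. \<nu> s = k *\<^sub>R \<nu> r \<and> c s = k * c r)"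
proof
  assume "\<exists>k. \<nu> s = k *\<^sub>R \<nu> r \<and> c s = k * c r"
  then obtain k where k: "\<nu> s = k *\<^sub>R \<nu> r" "c s = k * c r" by blast
  then have "k \<noteq> 0" using nu_nonzero[of s] by auto
  moreover have "L s y = k * L r y" for y by (simp add: ell_def k algebra_simps)
  ultimately have "facet \<nu> c s = facet \<nu> c r" by (auto simp: facet_def)
  then show False using inj_facet assms by (auto dest: injD)
qed

end

lemma inner_matrix_sum: "u \<bullet> (K *v v) = (\<Sum>a\<in>UNIV. \<Sum>b\<in>UNIV. K $ a $ b * (u $ a * v $ b))" for K :: "real^'n^'n"
  by (simp add: inner_vec_def matrix_vector_mult_def sum_distrib_left mult_ac)

locale ibp = higgs \<nu> c \<xi> for \<nu> :: "'r::finite \<Rightarrow> real^'n" and c \<xi> +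
  fixes Q :: "real^'n \<Rightarrow> real^'n^'n" and U :: "(real^'n) set" and \<phi> :: "real^'n \<Rightarrow> real"
  assumes Q: "admd Q" "continuous_on P Q" and Q_Ck: "Ck_on 2 X Q"
    and U: "open U" "P \<subseteq> U" and phi: "Ck_on 2 U \<phi>"
begin

definition grad :: "real^'n \<Rightarrow> real^'n" where "grad y = (\<chi> a. partial a \<phi> y)"

definition contr :: "real^'n \<Rightarrow> real" where
  "contr y = (\<Sum>a\<in>UNIV. \<Sum>b\<in>UNIV. Kt Q y $ a $ b * partial a (partial b \<phi>) y)"

lemma G0_Ck: "Ck_on k X G0"
proof -
  have "Ck_on k X (\<lambda>y. inverse (L r y) *\<^sub>R outer (\<nu> r))" for r
  proof (intro Ck_on_scaleR Ck_on_const Ck_on_inverse)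
    have "L r = (\<lambda>y. \<nu> r \<bullet> y + c r)" by (simp add: fun_eq_iff ell_def)
    then show "Ck_on k X (L r)"
      by (simp) (intro Ck_on_add Ck_on_const Ck_on_bounded_linear_id bounded_linear_inner_right; simp)
    show "L r z \<noteq> 0" if "z \<in> X" for z
      using that unfolding interior_iff by (metis less_irrefl)
  qed auto
  then show ?thesis unfolding G0_def[abs_def] by (auto intro!: Ck_on_sum simp: inverse_eq_divide)
qed

lemma Kt_Ck: "Ck_on 2 X (\<lambda>y. Kt Q y $ a $ b)"
proof -
  have "Ck_on 2 X (\<lambda>y. Hm (G0 y + Q y) (\<xi> y))"
    using xi_smooth admd_good[OF Q(1)]
    by (intro Ck_on_Hm Ck_on_add G0_Ck Q_Ck) (auto simp: smooth_on_def)
  from Ck_on_bounded_linear[OF bounded_linear_reM _ this] show ?thesis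
    unfolding Kt_def by (intro Ck_on_nth) auto
qed

lemma Kt_continuous: "continuous_on X (\<lambda>y. Kt Q y $ a $ b)" "continuous_on X (Kt Q)"
proof -
  show 1: "continuous_on X (\<lambda>y. Kt Q y $ a $ b)" for a b using Ck_on_continuous[OF Kt_Ck] .
  have "continuous_on X (\<lambda>y. \<chi> a b. Kt Q y $ a $ b)" by (intro continuous_on_vec_lambda 1)
  then show "continuous_on X (Kt Q)" by simp
qed

lemma phi1: "y \<in> U \<Longrightarrow> \<phi> differentiable (at y)" "y \<in> U \<Longrightarrow> partial a \<phi> differentiable (at y)"
  and phi_cont: "continuous_on P \<phi>" "continuous_on P (partial a \<phi>)" "continuous_on P (partial b (partial a \<phi>))"
proof -
  have "Ck_on 1 U (partial a \<phi>)" for a using phi by (simp add: numeral_2_eq_2)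
  from Ck_on_continuous[OF this] have "continuous_on U (partial a \<phi>)" for a .
  then show "y \<in> U \<Longrightarrow> \<phi> differentiable (at y)" "y \<in> U \<Longrightarrow> partial a \<phi> differentiable (at y)"
    "continuous_on P \<phi>" "continuous_on P (partial a \<phi>)" "continuous_on P (partial b (partial a \<phi>))"
    using phi Ck_on_continuous[OF phi] by (auto simp: numeral_2_eq_2 intro!: continuous_on_subset[OF _ U(2)])
qed

lemma grad_cont: "continuous_on P grad"
  unfolding grad_def[abs_def] by (intro continuous_intros phi_cont)

lemma contr_cont: "continuous_on X contr"
  unfolding contr_def[abs_def] by (intro continuous_intros Kt_continuous continuous_on_subset[OF phi_cont(3) X_subset])

lemma K_sym: "y \<in> X \<Longrightarrow> u \<bullet> (Kt Q y *v v) = v \<bullet> (Kt Q y *v u)"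
  by (metis Kt_psd(1)[OF Q(1)] inner_matrix_transpose inner_commute)

text \<open>Cauchy-Schwarz for the semidefinite form \<open>Kt\<close> distributes the gain at the
  boundary: each normal in an argument contributes a factor \<open>sqrt (L r y)\<close>.\<close>

lemma K_est:
  obtains C where "C > 0" "\<And>y u v. y \<in> X \<Longrightarrow> \<bar>u \<bullet> (Kt Q y *v v)\<bar> \<le> C * norm u * norm v"
    "\<And>y r v. y \<in> X \<Longrightarrow> \<bar>\<nu> r \<bullet> (Kt Q y *v v)\<bar> \<le> C * sqrt (L r y) * norm v"
    "\<And>y r s. y \<in> X \<Longrightarrow> \<bar>\<nu> r \<bullet> (Kt Q y *v \<nu> s)\<bar> \<le> C * sqrt (L r y) * sqrt (L s y)"
    "\<And>y r. y \<in> X \<Longrightarrow> \<bar>\<nu> r \<bullet> (Kt Q y *v \<nu> r) - L r y * om Q r y\<bar> \<le> C * (L r y)\<^sup>2"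
proof -
  obtain C where C: "C > 0" "\<And>y a. y \<in> X \<Longrightarrow> a \<bullet> (Kt Q y *v a) \<le> C * (norm a)\<^sup>2"
    "\<And>y r. y \<in> X \<Longrightarrow> \<nu> r \<bullet> (Kt Q y *v \<nu> r) \<le> C * L r y"
    "\<And>y r. y \<in> X \<Longrightarrow> \<bar>\<nu> r \<bullet> (Kt Q y *v \<nu> r) - L r y * om Q r y\<bar> \<le> C * (L r y)\<^sup>2"
    using Kt_bounds[OF Q] by blast
  have cs: "\<bar>u \<bullet> (Kt Q y *v v)\<bar> \<le> C * p * q"
    if y: "y \<in> X" and u: "u \<bullet> (Kt Q y *v u) \<le> C * p\<^sup>2" and v: "v \<bullet> (Kt Q y *v v) \<le> C * q\<^sup>2" and pq: "p \<ge> 0" "q \<ge> 0" for y u v p q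
  proof (rule abs_le_square_iff[THEN iffD2, of _ "C * p * q", THEN order_trans])
    have "(u \<bullet> (Kt Q y *v v))\<^sup>2 \<le> (u \<bullet> (Kt Q y *v u)) * (v \<bullet> (Kt Q y *v v))"
      by (rule psd_cauchy_schwarz) (use Kt_psd[OF Q(1) y] in auto)
    also have "\<dots> \<le> (C * p\<^sup>2) * (C * q\<^sup>2)"
      using u v Kt_psd(2)[OF Q(1) y] C(1) by (intro mult_mono) auto
    also have "\<dots> = (C * p * q)\<^sup>2" by (simp add: power2_eq_square)
    finally show "(u \<bullet> (Kt Q y *v v))\<^sup>2 \<le> (C * p * q)\<^sup>2" .
    show "\<bar>C * p * q\<bar> \<le> C * p * q" using C(1) pq by simp
  qed
  have sq: "\<nu> r \<bullet> (Kt Q y *v \<nu> r) \<le> C * (sqrt (L r y))\<^sup>2" "sqrt (L r y) \<ge> 0" if "y \<in> X" for y r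
    using C(3)[OF that, of r] that interior_iff[of y] by (auto simp: less_imp_le)
  show ?thesis
  proof (rule that[OF C(1) _ _ _ C(4)])
    fix y u v r s assume y: "y \<in> X"
    show "\<bar>u \<bullet> (Kt Q y *v v)\<bar> \<le> C * norm u * norm v" by (rule cs[OF y C(2)[OF y] C(2)[OF y]]) auto
    show "\<bar>\<nu> r \<bullet> (Kt Q y *v v)\<bar> \<le> C * sqrt (L r y) * norm v" by (rule cs[OF y sq(1)[OF y] C(2)[OF y] sq(2)[OF y]]) auto
    show "\<bar>\<nu> r \<bullet> (Kt Q y *v \<nu> s)\<bar> \<le> C * sqrt (L r y) * sqrt (L s y)" by (rule cs[OF y sq(1)[OF y] sq(1)[OF y] sq(2)[OF y] sq(2)[OF y]])
  qed
qed

text \<open>In the second derivatives of cutoff times \<open>\<phi>\<close>, \<open>T1\<close>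
  collects one derivative on the cutoff and \<open>T2\<close> two. Of the factor
  \<open>1 / e\<^sup>2\<close> of the latter, \<open>1 / e\<close> is kept inside, because the
  pairing of two normals is of order \<open>e\<close> where the cutoff varies.\<close>

definition T1 :: "real \<Rightarrow> 'r \<Rightarrow> real^'n \<Rightarrow> real" where
  "T1 e r y = indicator X y * (cut e (one r) y * (\<nu> r \<bullet> (Kt Q y *v grad y)))"

definition T2 :: "real \<Rightarrow> 'r \<Rightarrow> 'r \<Rightarrow> real^'n \<Rightarrow> real" where
  "T2 e r s y = indicator X y * (cut e (two r s) y * \<phi> y * ((\<nu> s \<bullet> (Kt Q y *v \<nu> r)) / e))"

lemma T_cont: "continuous_on X (\<lambda>y. cut e (one r) y * (\<nu> r \<bullet> (Kt Q y *v grad y)))"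
    "continuous_on X (\<lambda>y. cut e (two r s) y * \<phi> y * ((\<nu> s \<bullet> (Kt Q y *v \<nu> r)) / e))"
  unfolding divide_inverse
  by (intro continuous_intros cut_continuous continuous_on_matrix_vector Kt_continuous continuous_on_subset[OF _ X_subset] grad_cont phi_cont)+

lemma T_measurable [measurable]: "T1 e r \<in> borel_measurable borel" "T2 e r s \<in> borel_measurable borel"
  unfolding T1_def[abs_def] T2_def[abs_def] by (intro X_indicator_measurable T_cont)+

lemma core_integrable:
  assumes "e > 0" "continuous_on X f" "\<And>y. y \<notin> core e \<Longrightarrow> f y = 0"
  shows "integrable lborel (\<lambda>y. indicator X y * f y :: real)"
proof (rule integrable_compact_support[OF core(1)[OF assms(1)]])
  show "continuous_on (core e) (\<lambda>y. indicator X y * f y)"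
    using core(2)[OF assms(1)] by (subst continuous_on_cong[OF refl, of _ _ f]) (auto intro: continuous_on_subset[OF assms(2)])
qed (use assms(3) in auto)

text \<open>Integration by parts against cutoff times \<open>\<phi>\<close>, which has compact
  support in the interior. The two mixed terms of the product rule agree because \<open>Kt\<close>
  is symmetric, hence the factor 2.\<close>

lemma cut_identity:
  assumes e: "e > 0"
  shows "(LINT y|lborel. indicator X y * (cut e (\<lambda>_. 0) y * (\<phi> y * (\<Sum>a\<in>UNIV. \<Sum>b\<in>UNIV. partial b (partial a (\<lambda>z. Kt Q z $ a $ b)) y))))
    = (LINT y|lborel. indicator X y * (cut e (\<lambda>_. 0) y * contr y)) + (\<Sum>r\<in>UNIV. (2 / e) * (LINT y|lborel. T1 e r y))
      + (\<Sum>r\<in>UNIV. \<Sum>s\<in>UNIV. (1 / e) * (LINT y|lborel. T2 e r s y))"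
proof -
  let ?\<eta> = "cut e (\<lambda>_. 0)"
  define f where "f y = indicator X y * (?\<eta> y * \<phi> y)" for y
  have fX: "f y = ?\<eta> y * \<phi> y" if "y \<in> X" for y using that by (simp add: f_def)
  have z: "?\<eta> y = 0" "cut e (one r) y = 0" "cut e (two r s) y = 0" if "y \<notin> core e" for y r s
    using that by (auto intro!: core(3)[OF e])
  have XU: "X \<subseteq> U" using X_subset U by auto
  have "Ck_on 2 X (\<lambda>y. ?\<eta> y * \<phi> y)"
    by (intro Ck_on_mult Ck_on_subset[OF cut_Ck] Ck_on_subset[OF phi XU]) auto
  then have fC: "Ck_on 2 X f" by (rule Ck_on_cong[rotated 2]) (auto simp: fX)
  have f0: "f y = 0" if "y \<notin> core e" for y using z[OF that] by (simp add: f_def)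
  have eqf: "(\<Sum>a\<in>UNIV. \<Sum>b\<in>UNIV. Kt Q y $ a $ b * partial a (partial b f) y)
    = indicator X y * (?\<eta> y * contr y) + (\<Sum>r\<in>UNIV. (2 / e) * T1 e r y) + (\<Sum>r\<in>UNIV. \<Sum>s\<in>UNIV. (1 / e) * T2 e r s y)" for y
  proof (cases "y \<in> X")
    case False
    then have y: "y \<notin> core e" using core(2)[OF e] by auto
    have "closed (core e)" using core(1)[OF e] compact_imp_closed by blast
    then have "partial a (partial b f) y = 0" for a b
      using partial_support[of "core e" "partial b f" y a] partial_support[of "core e" f] f0 y by auto
    then show ?thesis using False by (simp add: T1_def T2_def)
  next
    case y: True
    have yU: "z \<in> U" if "z \<in> X" for z using that XU by auto
    have d1: "?\<eta> differentiable (at z)" "partial a ?\<eta> differentiable (at z)" for z a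
      using cut_derivative(1)[of "\<lambda>_. 0"] cut_second(2) by auto
    have p1: "partial b f z = ?\<eta> z * partial b \<phi> z + partial b ?\<eta> z * \<phi> z" if "z \<in> X" for z b
    proof -
      have "partial b f z = partial b (\<lambda>y. ?\<eta> y * \<phi> y) z"
        by (rule partial_cong_open[of X]) (use that fX in auto)
      also have "\<dots> = ?\<eta> z * partial b \<phi> z + partial b ?\<eta> z * \<phi> z"
        by (rule partial_mult) (use d1 phi1 yU that in auto)
      finally show ?thesis .
    qed
    have p2: "partial a (partial b f) y = ?\<eta> y * partial a (partial b \<phi>) y + partial a ?\<eta> y * partial b \<phi> y
      + (partial b ?\<eta> y * partial a \<phi> y + partial a (partial b ?\<eta>) y * \<phi> y)" for a b
    proof -
      have "partial a (partial b f) y = partial a (\<lambda>z. ?\<eta> z * partial b \<phi> z + partial b ?\<eta> z * \<phi> z) y"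
        by (rule partial_cong_open[of X]) (use y p1 in auto)
      also have "\<dots> = ?\<eta> y * partial a (partial b \<phi>) y + partial a ?\<eta> y * partial b \<phi> y
      + (partial b ?\<eta> y * partial a \<phi> y + partial a (partial b ?\<eta>) y * \<phi> y)"
        using d1 phi1[OF yU[OF y]] by (simp add: partial_add partial_mult)
      finally show ?thesis .
    qed
    define g where "g = (\<Sum>r\<in>UNIV. (cut e (one r) y / e) *\<^sub>R \<nu> r)"
    have g: "partial a ?\<eta> y = g $ a" for a
      by (simp add: cut_second(1) g_def mult_ac)
    have gK: "g \<bullet> (Kt Q y *v grad y) = (\<Sum>r\<in>UNIV. (1 / e) * T1 e r y)"
      using y by (simp add: g_def inner_sum_left T1_def)
    have 1: "(\<Sum>a\<in>UNIV. \<Sum>b\<in>UNIV. Kt Q y $ a $ b * (partial a ?\<eta> y * partial b \<phi> y)) = (\<Sum>r\<in>UNIV. (1 / e) * T1 e r y)"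
      unfolding gK[symmetric] inner_matrix_sum by (simp add: g grad_def)
    have 2: "(\<Sum>a\<in>UNIV. \<Sum>b\<in>UNIV. Kt Q y $ a $ b * (partial b ?\<eta> y * partial a \<phi> y)) = (\<Sum>r\<in>UNIV. (1 / e) * T1 e r y)"
      unfolding gK[symmetric] unfolding K_sym[OF y, of g "grad y"] unfolding inner_matrix_sum by (simp add: g grad_def mult_ac)
    have 3: "(\<Sum>a\<in>UNIV. \<Sum>b\<in>UNIV. Kt Q y $ a $ b * (partial a (partial b ?\<eta>) y * \<phi> y)) = (\<Sum>r\<in>UNIV. \<Sum>s\<in>UNIV. (1 / e) * T2 e r s y)"
    proof -
      have "(\<Sum>a\<in>UNIV. \<Sum>b\<in>UNIV. Kt Q y $ a $ b * (partial a (partial b ?\<eta>) y * \<phi> y))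
        = (\<Sum>a\<in>UNIV. \<Sum>b\<in>UNIV. \<Sum>r\<in>UNIV. \<Sum>s\<in>UNIV. (cut e (two r s) y * \<phi> y / e\<^sup>2) * (Kt Q y $ a $ b * (\<nu> s $ a * \<nu> r $ b)))"
        by (simp add: cut_second(3) sum_distrib_left sum_distrib_right power2_eq_square mult_ac)
      also have "\<dots> = (\<Sum>r\<in>UNIV. \<Sum>s\<in>UNIV. \<Sum>a\<in>UNIV. \<Sum>b\<in>UNIV. (cut e (two r s) y * \<phi> y / e\<^sup>2) * (Kt Q y $ a $ b * (\<nu> s $ a * \<nu> r $ b)))"
        by (subst sum.swap[of _ _ "UNIV :: 'n set"], subst (2) sum.swap, subst (3) sum.swap, subst sum.swap[of _ "UNIV :: 'n set" "UNIV :: 'r set"], rule refl)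
      also have "\<dots> = (\<Sum>r\<in>UNIV. \<Sum>s\<in>UNIV. (1 / e) * T2 e r s y)"
      proof (intro sum.cong refl)
        fix r s
        have "(\<Sum>a\<in>UNIV. \<Sum>b\<in>UNIV. (cut e (two r s) y * \<phi> y / e\<^sup>2) * (Kt Q y $ a $ b * (\<nu> s $ a * \<nu> r $ b)))
          = (cut e (two r s) y * \<phi> y / e\<^sup>2) * (\<nu> s \<bullet> (Kt Q y *v \<nu> r))"
          by (simp only: inner_matrix_sum sum_distrib_left)
        then show "(\<Sum>a\<in>UNIV. \<Sum>b\<in>UNIV. (cut e (two r s) y * \<phi> y / e\<^sup>2) * (Kt Q y $ a $ b * (\<nu> s $ a * \<nu> r $ b))) = (1 / e) * T2 e r s y"
          using y by (simp add: T2_def power2_eq_square)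
      qed
      finally show ?thesis .
    qed
    have "(\<Sum>a\<in>UNIV. \<Sum>b\<in>UNIV. Kt Q y $ a $ b * partial a (partial b f) y)
      = (\<Sum>a\<in>UNIV. \<Sum>b\<in>UNIV. ?\<eta> y * (Kt Q y $ a $ b * partial a (partial b \<phi>) y))
       + (\<Sum>a\<in>UNIV. \<Sum>b\<in>UNIV. Kt Q y $ a $ b * (partial a ?\<eta> y * partial b \<phi> y))
       + (\<Sum>a\<in>UNIV. \<Sum>b\<in>UNIV. Kt Q y $ a $ b * (partial b ?\<eta> y * partial a \<phi> y))
       + (\<Sum>a\<in>UNIV. \<Sum>b\<in>UNIV. Kt Q y $ a $ b * (partial a (partial b ?\<eta>) y * \<phi> y))"
      unfolding p2 sum.distrib[symmetric] by (intro sum.cong refl) (simp add: algebra_simps)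
    also have "(\<Sum>a\<in>UNIV. \<Sum>b\<in>UNIV. ?\<eta> y * (Kt Q y $ a $ b * partial a (partial b \<phi>) y)) = ?\<eta> y * contr y"
      by (simp add: contr_def sum_distrib_left)
    finally show ?thesis
      unfolding 1 2 3 using y by (simp add: sum_distrib_left)
  qed
  have i0: "integrable lborel (\<lambda>y. indicator X y * (?\<eta> y * contr y))"
    by (rule core_integrable[OF e]) (use z in \<open>auto intro!: continuous_intros cut_continuous contr_cont\<close>)
  have i1: "integrable lborel (T1 e r)" for r
    unfolding T1_def[abs_def] by (rule core_integrable[OF e T_cont(1)]) (use z in auto)
  have i2: "integrable lborel (T2 e r s)" for r s
    unfolding T2_def[abs_def] by (rule core_integrable[OF e T_cont(2)]) (use z in auto)
  have "(LINT y|lborel. f y * (\<Sum>a\<in>UNIV. \<Sum>b\<in>UNIV. partial b (partial a (\<lambda>z. Kt Q z $ a $ b)) y))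
    = (LINT y|lborel. (\<Sum>a\<in>UNIV. \<Sum>b\<in>UNIV. Kt Q y $ a $ b * partial a (partial b f) y))"
    by (rule integral_by_parts[OF open_interior core(1,2)[OF e] f0 fC Kt_Ck])
  also have "\<dots> = (LINT y|lborel. indicator X y * (?\<eta> y * contr y)) + (\<Sum>r\<in>UNIV. (2 / e) * (LINT y|lborel. T1 e r y))
      + (\<Sum>r\<in>UNIV. \<Sum>s\<in>UNIV. (1 / e) * (LINT y|lborel. T2 e r s y))"
    unfolding eqf using i0 i1 i2 by simp
  finally show ?thesis by (simp add: f_def mult.assoc)
qed

end

section \<open>Limits of the cutoff identity\<close>

context delz
begin

lemma integrable_P_indicator: "integrable lborel (\<lambda>y. M * indicator P y :: real)"
  using compact_P by (intro integrable_mult_right integrable_real_indicator emeasure_bounded_finite compact_imp_bounded)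
    (auto simp: closed_P)

lemma X_integrable:
  fixes g :: "real^'n \<Rightarrow> real"
  assumes "continuous_on X g" "\<And>y. y \<in> X \<Longrightarrow> \<bar>g y\<bar> \<le> M"
  shows "integrable lborel (\<lambda>y. indicator X y * g y)"
proof (rule Bochner_Integration.integrable_bound[OF integrable_P_indicator[of M]])
  show "AE y in lborel. norm (indicator X y * g y) \<le> norm (M * indicator P y)"
    using assms(2) X_subset by (intro AE_I2) (fastforce simp: indicator_def)
qed (use X_indicator_measurable[OF assms(1)] in simp)

definition ek :: "nat \<Rightarrow> real" where "ek k = 1 / real (Suc k)"

lemma ek: "ek k > 0" "ek k \<le> 1" "ek \<longlonglongrightarrow> 0"
  by (auto simp: ek_def) (unfold ek_def[abs_def], rule lim_1_over_n[THEN LIMSEQ_Suc])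

text \<open>At an interior point every \<open>L r\<close> eventually exceeds
  \<open>2 * ek k\<close>, so the cutoff becomes 1 there.\<close>

lemma cut_limit:
  assumes g: "continuous_on X g" "\<And>y. y \<in> X \<Longrightarrow> \<bar>g y\<bar> \<le> M"
  shows "(\<lambda>k. LINT y|lborel. indicator X y * (cut (ek k) (\<lambda>_. 0) y * g y)) \<longlonglongrightarrow> (LINT y|lborel. indicator X y * g y)"
proof -
  obtain B where B: "B > 0" "\<And>e y. \<bar>cut e (\<lambda>_. 0) y\<bar> \<le> B" using cut_bounded by (metis zero_le)
  have gm: "(\<lambda>y. indicator X y * g y) \<in> borel_measurable lborel" "(\<lambda>y. indicator X y * (cut (ek k) (\<lambda>_. 0) y * g y)) \<in> borel_measurable lborel" for k
    using X_indicator_measurable[OF g(1)] X_indicator_measurable[OF continuous_on_mult[OF cut_continuous g(1)]] by simp_all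
  show ?thesis
  proof (rule integral_dominated_convergence[OF gm integrable_P_indicator[of "B * M"]])
    show "AE y in lborel. (\<lambda>k. indicator X y * (cut (ek k) (\<lambda>_. 0) y * g y)) \<longlonglongrightarrow> indicator X y * g y"
    proof (rule AE_I2)
      fix y
      show "(\<lambda>k. indicator X y * (cut (ek k) (\<lambda>_. 0) y * g y)) \<longlonglongrightarrow> indicator X y * g y"
      proof (cases "y \<in> X")
        case True
        have "\<forall>\<^sub>F k in sequentially. 2 * ek k < L r y" for r
        proof -
          have "(\<lambda>k. 2 * ek k) \<longlonglongrightarrow> 2 * 0" by (intro tendsto_intros ek)
          then show ?thesis using True by (intro order_tendstoD) (auto simp: interior_iff)
        qed
        then have "\<forall>\<^sub>F k in sequentially. \<forall>r\<in>UNIV. 2 * ek k < L r y"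
          by (intro eventually_ball_finite) auto
        then have "\<forall>\<^sub>F k in sequentially. indicator X y * g y = indicator X y * (cut (ek k) (\<lambda>_. 0) y * g y)"
        proof eventually_elim
          case (elim k)
          have "spl 0 (L r y / ek k) = 1" for r
            using elim ek(1)[of k] by (intro spl_high) (auto simp: field_simps intro: less_imp_le)
          then show ?case by (simp add: cut_def)
        qed
        then show ?thesis by (rule Lim_transform_eventually[OF tendsto_const])
      qed simp
    qed
    show "AE y in lborel. norm (indicator X y * (cut (ek k) (\<lambda>_. 0) y * g y)) \<le> B * M * indicator P y" for k
    proof (rule AE_I2)
      fix y
      show "norm (indicator X y * (cut (ek k) (\<lambda>_. 0) y * g y)) \<le> B * M * indicator P y"
      proof (cases "y \<in> X")
        case True
        have "\<bar>cut (ek k) (\<lambda>_. 0) y\<bar> * \<bar>g y\<bar> \<le> B * M"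
          using B g(2)[OF True] by (intro mult_mono) auto
        then show ?thesis using True X_subset by (auto simp: abs_mult)
      next
        case False
        have "0 \<le> B * M" using X_nonempty g(2) B(1) by (metis abs_ge_zero all_not_in_conv less_eq_real_def mult_nonneg_nonneg order_trans)
        then show ?thesis using False by simp
      qed
    qed
  qed
qed

end

context ibp
begin

lemma K_entry: "Kt Q y $ a $ b = axis a 1 \<bullet> (Kt Q y *v axis b 1)"
  by (simp add: inner_axis' matrix_vector_mult_basis column_def)

lemma contr_bounded: "\<exists>M. \<forall>y\<in>X. \<bar>contr y\<bar> \<le> M"
proof -
  obtain C where C: "C > 0" "\<And>y u v. y \<in> X \<Longrightarrow> \<bar>u \<bullet> (Kt Q y *v v)\<bar> \<le> C * norm u * norm v"
    using K_est by metis
  have "\<forall>a b. \<exists>M. \<forall>y\<in>P. \<bar>partial a (partial b \<phi>) y\<bar> \<le> M"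
    using bounded_on_P[OF phi_cont(3)] by (metis real_norm_def)
  then obtain M where M: "\<And>a b y. y \<in> P \<Longrightarrow> \<bar>partial a (partial b \<phi>) y\<bar> \<le> M a b" by metis
  have "\<bar>contr y\<bar> \<le> (\<Sum>a\<in>UNIV. \<Sum>b\<in>UNIV. C * M a b)" if y: "y \<in> X" for y
    unfolding contr_def
  proof (intro order_trans[OF sum_abs] sum_mono)
    fix a b
    show "\<bar>Kt Q y $ a $ b * partial a (partial b \<phi>) y\<bar> \<le> C * M a b"
      unfolding abs_mult using C(2)[OF y, of "axis a 1" "axis b 1"] M y X_subset C(1)
      by (intro mult_mono) (auto simp: K_entry)
  qed
  then show ?thesis by blast
qed

text \<open>The single normal makes the integrand of order \<open>sqrt e\<close> on a layer of
  volume of order \<open>e\<close>, so even the integral divided by \<open>e\<close> vanishes in the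
  limit.\<close>

lemma T1_limit: "(\<lambda>k. (1 / ek k) * (LINT y|lborel. T1 (ek k) r y)) \<longlonglongrightarrow> 0"
proof -
  interpret H: hyperplane "\<nu> r" "c r" by unfold_locales (rule nu_nonzero)
  obtain C where C: "C > 0" "\<And>y r v. y \<in> X \<Longrightarrow> \<bar>\<nu> r \<bullet> (Kt Q y *v v)\<bar> \<le> C * sqrt (L r y) * norm v"
    using K_est by metis
  obtain B where B: "B > 0" "\<And>e y d. \<forall>r. d r \<le> 2 \<Longrightarrow> \<bar>cut e d y\<bar> \<le> B" using cut_bounded by blast
  obtain M where M: "M > 0" "\<And>y. y \<in> P \<Longrightarrow> norm (grad y) \<le> M" using bounded_on_P[OF grad_cont] by blast
  obtain R where R: "\<And>y. y \<in> P \<Longrightarrow> norm y \<le> R" using bounded_P bounded_iff by blast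
  have supp: "y \<in> X \<and> L r y \<le> 2 * e" if "T1 e r y \<noteq> 0" "e > 0" for e y
    using that cut_support(2)[of e "one r" y r] by (auto simp: T1_def indicator_def split: if_splits)
  have est: "\<bar>T1 e r y\<bar> \<le> B * (C * sqrt (2 * e) * M)" if e: "e > 0" for e y
  proof (cases "T1 e r y = 0")
    case False
    note y = supp[OF False e]
    have "\<bar>\<nu> r \<bullet> (Kt Q y *v grad y)\<bar> \<le> C * sqrt (L r y) * norm (grad y)" using C(2) y by blast
    also have "\<dots> \<le> C * sqrt (2 * e) * M"
      using y C(1) M X_subset interior_iff[of y] e by (intro mult_mono) (auto simp: less_imp_le)
    finally have "\<bar>cut e (one r) y\<bar> * \<bar>\<nu> r \<bullet> (Kt Q y *v grad y)\<bar> \<le> B * (C * sqrt (2 * e) * M)"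
      using B by (intro mult_mono) auto
    then show ?thesis using y by (simp add: T1_def abs_mult)
  qed (use e B C M in simp)
  have "(\<lambda>k. (1 / ek k) * (LINT y|lborel. T1 (ek k) r y)) \<longlonglongrightarrow> 1 / norm (\<nu> r) * (LINT p|((lborel :: real measure) \<Otimes>\<^sub>M H.Q). 0)"
  proof (rule H.layer_limit[where C="B * (C * sqrt 2 * M)" and R=R])
    show "ek k > 0" for k by (rule ek)
    show "\<bar>T1 (ek k) r y\<bar> \<le> B * (C * sqrt 2 * M)" for k y
      using est[OF ek(1), of k y] ek(1,2)[of k] B C M
      by (elim order_trans) (intro mult_left_mono mult_right_mono; simp)
    show "norm y \<le> R \<and> 0 \<le> \<nu> r \<bullet> y + c r \<and> \<nu> r \<bullet> y + c r \<le> 2 * ek k" if "T1 (ek k) r y \<noteq> 0" for k y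
      using supp[OF that ek(1)] R X_subset interior_iff[of y] by (auto simp: ell_def less_imp_le)
    have l: "(\<lambda>k. B * (C * sqrt (2 * ek k) * M)) \<longlonglongrightarrow> B * (C * sqrt (2 * 0) * M)"
      by (intro tendsto_intros ek)
    have "(\<lambda>k. T1 (ek k) r (H.slice (ek k) p)) \<longlonglongrightarrow> 0" for p
      by (rule Lim_null_comparison[OF always_eventually]) (use est[OF ek(1)] l in auto)
    then show "AE p in lborel \<Otimes>\<^sub>M H.Q. (\<lambda>k. T1 (ek k) r (H.slice (ek k) p)) \<longlonglongrightarrow> 0" by simp
  qed measurable
  then show ?thesis by simp
qed

text \<open>The rescaled points approach a point of the hyperplane that lies on no other facet
  hyperplane. For \<open>r \<noteq> s\<close> the factor of \<open>s\<close> is no longer varying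
  there. For \<open>r = s\<close> the other cutoff factors are eventually 1, and the pairing of
  \<open>\<nu> r\<close> with itself, divided by \<open>ek k\<close>, tends to \<open>fst p\<close>
  by \<open>om_facet\<close>. Limits outside \<open>P\<close> and nonpositive \<open>fst p\<close>
  contribute nothing.\<close>

lemma T2_pointwise:
  fixes r s :: 'r and p :: "real \<times> (real^'n \<Rightarrow> real)"
  defines "pt \<equiv> hyperplane.pt (\<nu> r) (c r)" and "slice \<equiv> hyperplane.slice (\<nu> r) (c r)"
  assumes nz: "\<And>t. t \<noteq> r \<Longrightarrow> L t (pt (snd p)) \<noteq> 0"
  shows "(\<lambda>k. T2 (ek k) r s (slice (ek k) p)) \<longlonglongrightarrow>
    (if r = s then (fst p * spl 2 (fst p)) * (indicator P (pt (snd p)) * \<phi> (pt (snd p))) else 0)"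
proof -
  interpret H: hyperplane "\<nu> r" "c r" by unfold_locales (rule nu_nonzero)
  define z \<sigma> where "z = pt (snd p)" and "\<sigma> k = slice (ek k) p" for k
  have Lr: "L r z = 0" "L r (\<sigma> k) = ek k * fst p" for k
    unfolding z_def \<sigma>_def pt_def slice_def ell_def by (simp_all add: H.pt_ell H.slice_ell)
  have "(\<lambda>k. pt (snd p) + (ek k * fst p / (\<nu> r \<bullet> \<nu> r)) *\<^sub>R \<nu> r) \<longlonglongrightarrow> pt (snd p) + (0 * fst p / (\<nu> r \<bullet> \<nu> r)) *\<^sub>R \<nu> r"
    by (intro tendsto_intros ek) (use nu_nonzero in simp)
  then have \<sigma>: "\<sigma> \<longlonglongrightarrow> z"
    by (simp add: z_def \<sigma>_def[abs_def] slice_def H.slice_def pt_def)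
  have L\<sigma>: "(\<lambda>k. L t (\<sigma> k)) \<longlonglongrightarrow> L t z" for t
    unfolding ell_def by (intro tendsto_intros \<sigma>)
  have neg: "\<forall>\<^sub>F k in sequentially. T2 (ek k) r s (\<sigma> k) = 0" if "L t z < 0" for t
    using order_tendstoD(2)[OF L\<sigma> that]
  proof eventually_elim
    case (elim k)
    then have "\<sigma> k \<notin> X" unfolding interior_iff by (metis less_asym)
    then show ?case by (simp add: T2_def)
  qed
  have pos: "\<forall>\<^sub>F k in sequentially. 2 * ek k < L t (\<sigma> k)" if "L t z > 0" for t
  proof -
    have "(\<lambda>k. L t (\<sigma> k) - 2 * ek k) \<longlonglongrightarrow> L t z - 2 * 0"
      by (intro tendsto_intros L\<sigma> ek)
    then have "\<forall>\<^sub>F k in sequentially. 0 < L t (\<sigma> k) - 2 * ek k"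
      using that by (intro order_tendstoD) auto
    then show ?thesis by simp
  qed
  have zero: ?thesis if "\<forall>\<^sub>F k in sequentially. T2 (ek k) r s (\<sigma> k) = 0"
      "r = s \<Longrightarrow> (fst p * spl 2 (fst p)) * (indicator P z * \<phi> z) = 0"
    using tendsto_eventually[OF that(1)] that(2) unfolding z_def[symmetric] \<sigma>_def[symmetric] by (cases "r = s") auto
  show ?thesis
  proof (cases "r = s")
    case False
    show ?thesis
    proof (rule zero)
      have "L s z < 0 \<or> L s z > 0" using nz[of s] False by (auto simp: z_def)
      then show "\<forall>\<^sub>F k in sequentially. T2 (ek k) r s (\<sigma> k) = 0"
      proof
        assume "L s z > 0"
        from pos[OF this] show ?thesis
        proof eventually_elim
          case (elim k)
          have "cut (ek k) (two r s) (\<sigma> k) = 0"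
          proof (rule ccontr)
            assume "cut (ek k) (two r s) (\<sigma> k) \<noteq> 0"
            from cut_support(2)[OF ek(1) two_le(1) this, of s] elim show False by simp
          qed
          then show ?case by (simp add: T2_def)
        qed
      qed (rule neg)
    qed (use False in simp)
  next
    case s: True
    consider t where "L t z < 0" | "z \<in> P" "fst p \<le> 0" | "z \<in> P" "fst p > 0"
      by (auto simp: in_P not_le) (meson not_le)
    then show ?thesis
    proof cases
      case 1
      then have "z \<notin> P" by (auto simp: in_P not_le)
      then show ?thesis using neg[OF 1] by (intro zero) auto
    next
      case 2
      have "\<sigma> k \<notin> X" for k
      proof
        assume "\<sigma> k \<in> X"
        then have "0 < ek k * fst p" using Lr(2)[of k] by (metis interior_iff)
        then show False using 2(2) ek(1)[of k] by (simp add: zero_less_mult_iff)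
      qed
      then show ?thesis using spl_low[of 2 "fst p"] 2 by (intro zero) (auto simp: T2_def)
    next
      case 3
      obtain C where C: "C > 0" "\<And>y r. y \<in> X \<Longrightarrow> \<bar>\<nu> r \<bullet> (Kt Q y *v \<nu> r) - L r y * om Q r y\<bar> \<le> C * (L r y)\<^sup>2"
        using K_est by metis
      have "\<forall>\<^sub>F k in sequentially. \<forall>t\<in>UNIV - {r}. 2 * ek k < L t (\<sigma> k)"
        using nz 3(1) by (intro eventually_ball_finite ballI pos) (auto simp: z_def[symmetric] in_P order.strict_iff_order)
      then have ev: "\<forall>\<^sub>F k in sequentially. \<sigma> k \<in> X \<and> cut (ek k) (two r s) (\<sigma> k) = spl 2 (fst p)"
      proof eventually_elim
        case (elim k)
        have "L t (\<sigma> k) > 0" for t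
        proof (cases "t = r")
          case True
          then show ?thesis using Lr(2)[of k] 3(2) ek(1)[of k] by simp
        next
          case False
          then have "2 * ek k < L t (\<sigma> k)" using elim by auto
          then show ?thesis using ek(1)[of k] by linarith
        qed
        moreover have "spl (two r s t) (L t (\<sigma> k) / ek k) = 1" if "t \<noteq> r" for t
        proof -
          have "2 * ek k < L t (\<sigma> k)" using elim that by auto
          then have "2 \<le> L t (\<sigma> k) / ek k" using ek(1)[of k] by (simp add: field_simps)
          then show ?thesis using that s by (simp add: spl_high)
        qed
        then have "(\<Prod>t\<in>UNIV - {r}. spl (two r s t) (L t (\<sigma> k) / ek k)) = 1"
          by (intro prod.neutral) auto
        then have "cut (ek k) (two r s) (\<sigma> k) = spl 2 (L r (\<sigma> k) / ek k)"
          unfolding cut_def by (subst prod.remove[of UNIV r]) (simp_all add: s numeral_2_eq_2)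
        ultimately show ?case
          using ek(1)[of k] by (simp add: interior_iff Lr)
      qed
      have evP: "\<forall>\<^sub>F k in sequentially. \<sigma> k \<in> P"
        using ev by eventually_elim (use X_subset in auto)
      have om1: "(\<lambda>k. om Q r (\<sigma> k)) \<longlonglongrightarrow> 1"
        using continuous_on_tendsto_compose[OF om_continuous[OF Q, of r] \<sigma> 3(1) evP] om_facet[OF Q(1) 3(1) Lr(1)] by simp
      have phi1: "(\<lambda>k. \<phi> (\<sigma> k)) \<longlonglongrightarrow> \<phi> z"
        by (rule continuous_on_tendsto_compose[OF phi_cont(1) \<sigma> 3(1) evP])
      have d: "(\<lambda>k. (\<nu> r \<bullet> (Kt Q (\<sigma> k) *v \<nu> r)) / ek k - fst p * om Q r (\<sigma> k)) \<longlonglongrightarrow> 0"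
      proof (rule Lim_null_comparison)
        show "(\<lambda>k. C * (fst p)\<^sup>2 * ek k) \<longlonglongrightarrow> 0"
          using tendsto_mult_left[OF ek(3), of "C * (fst p)\<^sup>2"] by simp
        show "\<forall>\<^sub>F k in sequentially. norm ((\<nu> r \<bullet> (Kt Q (\<sigma> k) *v \<nu> r)) / ek k - fst p * om Q r (\<sigma> k)) \<le> C * (fst p)\<^sup>2 * ek k"
          using ev
        proof eventually_elim
          case (elim k)
          have "\<bar>\<nu> r \<bullet> (Kt Q (\<sigma> k) *v \<nu> r) - ek k * fst p * om Q r (\<sigma> k)\<bar> \<le> C * (ek k * fst p)\<^sup>2"
            using C(2)[of "\<sigma> k" r] elim by (simp add: Lr)
          moreover have "(\<nu> r \<bullet> (Kt Q (\<sigma> k) *v \<nu> r)) / ek k - fst p * om Q r (\<sigma> k)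
            = (\<nu> r \<bullet> (Kt Q (\<sigma> k) *v \<nu> r) - ek k * fst p * om Q r (\<sigma> k)) / ek k"
            using ek(1)[of k] by (simp add: field_simps)
          ultimately show ?case
            using ek(1)[of k] by (simp add: abs_divide divide_le_eq power2_eq_square mult_ac)
        qed
      qed
      have "(\<lambda>k. (\<nu> r \<bullet> (Kt Q (\<sigma> k) *v \<nu> r)) / ek k) \<longlonglongrightarrow> fst p"
        using tendsto_add[OF d tendsto_mult_left[OF om1, of "fst p"]] by simp
      then have "(\<lambda>k. spl 2 (fst p) * \<phi> (\<sigma> k) * ((\<nu> r \<bullet> (Kt Q (\<sigma> k) *v \<nu> r)) / ek k)) \<longlonglongrightarrow> spl 2 (fst p) * \<phi> z * fst p"
        by (intro tendsto_intros phi1)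
      moreover have "\<forall>\<^sub>F k in sequentially. spl 2 (fst p) * \<phi> (\<sigma> k) * ((\<nu> r \<bullet> (Kt Q (\<sigma> k) *v \<nu> r)) / ek k) = T2 (ek k) r s (\<sigma> k)"
        using ev by eventually_elim (simp add: T2_def s)
      ultimately have "(\<lambda>k. T2 (ek k) r s (\<sigma> k)) \<longlonglongrightarrow> spl 2 (fst p) * \<phi> z * fst p"
        by (rule Lim_transform_eventually)
      moreover have "spl 2 (fst p) * \<phi> z * fst p = (fst p * spl 2 (fst p)) * (indicator P z * \<phi> z)"
        using 3(1) by simp
      ultimately show ?thesis
        unfolding z_def[symmetric] \<sigma>_def[symmetric] by (simp only: if_P[OF s])
    qed
  qed
qed

text \<open>The limit integrand is a product of \<open>s * spl 2 s\<close> in the layer variable and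
  \<open>\<phi>\<close> on the facet. The first factor integrates to -1, and the Jacobian
  \<open>1 / norm (\<nu> r)\<close> turns the second into the integral against the boundary
  measure.\<close>

lemma T2_limit: "(\<lambda>k. (1 / ek k) * (LINT y|lborel. T2 (ek k) r s y)) \<longlonglongrightarrow>
    (if r = s then - ((LINT y:facet \<nu> c r|hyperplane_measure (\<nu> r) (c r). \<phi> y) / norm (\<nu> r)) else 0)"
proof -
  interpret H: hyperplane "\<nu> r" "c r" by unfold_locales (rule nu_nonzero)
  obtain C where C: "C > 0" "\<And>y r s. y \<in> X \<Longrightarrow> \<bar>\<nu> r \<bullet> (Kt Q y *v \<nu> s)\<bar> \<le> C * sqrt (L r y) * sqrt (L s y)"
    using K_est by metis
  obtain B where B: "B > 0" "\<And>e y d. \<forall>r. d r \<le> 2 \<Longrightarrow> \<bar>cut e d y\<bar> \<le> B" using cut_bounded by blast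
  obtain M where M: "M > 0" "\<And>y. y \<in> P \<Longrightarrow> \<bar>\<phi> y\<bar> \<le> M" using bounded_on_P[OF phi_cont(1)] by auto
  obtain R where R: "\<And>y. y \<in> P \<Longrightarrow> norm y \<le> R" using bounded_P bounded_iff by blast
  have supp: "y \<in> X \<and> L r y \<le> 2 * e \<and> L s y \<le> 2 * e" if "T2 e r s y \<noteq> 0" "e > 0" for e y
    using that cut_support(2)[of e "two r s" y r] cut_support(2)[of e "two r s" y s]
    by (auto simp: T2_def indicator_def split: if_splits)
  have est: "\<bar>T2 e r s y\<bar> \<le> B * M * (2 * C)" if e: "e > 0" for e y
  proof (cases "T2 e r s y = 0")
    case False
    note y = supp[OF False e]
    have Lp: "L t y \<ge> 0" for t using y interior_iff[of y] by (auto simp: less_imp_le)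
    have "\<bar>\<nu> s \<bullet> (Kt Q y *v \<nu> r)\<bar> \<le> C * sqrt (L s y) * sqrt (L r y)" using C(2) y by blast
    also have "\<dots> \<le> C * sqrt (2 * e) * sqrt (2 * e)"
      using y C(1) e Lp by (intro mult_mono) auto
    also have "\<dots> = 2 * C * e" using e by (simp add: mult.assoc)
    finally have "\<bar>(\<nu> s \<bullet> (Kt Q y *v \<nu> r)) / e\<bar> \<le> 2 * C" using e by (simp add: abs_divide divide_le_eq)
    moreover have "\<bar>cut e (two r s) y * \<phi> y\<bar> \<le> B * M"
      unfolding abs_mult using B M y X_subset by (intro mult_mono) auto
    ultimately have "\<bar>cut e (two r s) y * \<phi> y\<bar> * \<bar>(\<nu> s \<bullet> (Kt Q y *v \<nu> r)) / e\<bar> \<le> B * M * (2 * C)"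
      using B M by (intro mult_mono) auto
    then show ?thesis using y by (simp add: T2_def abs_mult)
  qed (use e B C M in simp)
  define k where "k x = indicator P (H.pt x) * \<phi> (H.pt x)" for x
  have Pm: "(\<lambda>y. indicator P y * \<phi> y) \<in> borel_measurable borel"
    using borel_measurable_continuous_on_indicator[of P \<phi>] phi_cont(1) closed_P by simp
  have km[measurable]: "k \<in> borel_measurable H.Q"
    unfolding k_def[abs_def] using measurable_compose[OF H.pt_measurable Pm] by simp
  have ki: "integrable H.Q k"
    unfolding k_def by (rule H.hyperplane_integrable(1)[OF Pm R M(2)])
  have kF: "(LINT y:facet \<nu> c r|hyperplane_measure (\<nu> r) (c r). \<phi> y) = (LINT x|H.Q. k x)"
  proof -
    have F: "facet \<nu> c r \<subseteq> P" by (auto simp: facet_def P_def)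
    have "closed (facet \<nu> c r)"
      unfolding facet_def P_def[symmetric] using closed_P
      by (simp add: Collect_conj_eq) (intro closed_Int closed_Collect_eq L_continuous continuous_on_const; simp)
    then have Fm: "(\<lambda>y. indicator (facet \<nu> c r) y * \<phi> y) \<in> borel_measurable borel"
      using borel_measurable_continuous_on_indicator[of "facet \<nu> c r" \<phi>] continuous_on_subset[OF phi_cont(1) F] by simp
    have "indicator (facet \<nu> c r) (H.pt x) = (indicator P (H.pt x) :: real)" for x
      using H.pt_ell[of x] by (simp add: indicator_def facet_def P_def ell_def)
    then show ?thesis
      using H.hyperplane_integrable(3)[OF Fm R M(2)] F by (auto simp: k_def[abs_def])
  qed
  define F0 where "F0 p = (if r = s then (fst p * spl 2 (fst p)) * k (snd p) else 0)" for p
  have "(\<lambda>k. (1 / ek k) * (LINT y|lborel. T2 (ek k) r s y)) \<longlonglongrightarrow> 1 / norm (\<nu> r) * (LINT p|(lborel \<Otimes>\<^sub>M H.Q). F0 p)"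
  proof (rule H.layer_limit[where C="B * M * (2 * C)" and R=R])
    show "ek k > 0" for k by (rule ek)
    show "\<bar>T2 (ek k) r s y\<bar> \<le> B * M * (2 * C)" for k y
      using est[OF ek(1)] .
    show "norm y \<le> R \<and> 0 \<le> \<nu> r \<bullet> y + c r \<and> \<nu> r \<bullet> y + c r \<le> 2 * ek k" if "T2 (ek k) r s y \<noteq> 0" for k y
      using supp[OF that ek(1)] R X_subset interior_iff[of y] by (auto simp: ell_def less_imp_le)
    have "AE p in (lborel :: real measure) \<Otimes>\<^sub>M H.Q. \<forall>t\<in>UNIV - {r}. L t (H.pt (snd p)) \<noteq> 0"
    proof (rule AE_finite_allI)
      fix t assume "t \<in> UNIV - {r}"
      then have "t \<noteq> r" by simp
      from H.AE_off_hyperplane[OF different_hyperplanes[OF this]]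
      show "AE p in (lborel :: real measure) \<Otimes>\<^sub>M H.Q. L t (H.pt (snd p)) \<noteq> 0"
        by (simp add: ell_def)
    qed simp
    then show "AE p in lborel \<Otimes>\<^sub>M H.Q. (\<lambda>k. T2 (ek k) r s (H.slice (ek k) p)) \<longlonglongrightarrow> F0 p"
    proof (rule AE_mp, intro AE_I2 impI)
      fix p :: "real \<times> (real^'n \<Rightarrow> real)"
      assume "\<forall>t\<in>UNIV - {r}. L t (H.pt (snd p)) \<noteq> 0"
      then show "(\<lambda>k. T2 (ek k) r s (H.slice (ek k) p)) \<longlonglongrightarrow> F0 p"
        unfolding F0_def k_def by (intro T2_pointwise) auto
    qed
    have [measurable]: "spl 2 \<in> borel_measurable borel"
      by (rule borel_measurable_continuous_onI[OF spl_continuous])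
    show "F0 \<in> borel_measurable (lborel \<Otimes>\<^sub>M H.Q)"
      unfolding F0_def by measurable
  qed measurable
  moreover have "(LINT p|(lborel \<Otimes>\<^sub>M H.Q). F0 p) = (if r = s then - (LINT x|H.Q. k x) else 0)"
  proof (cases "r = s")
    case True
    show ?thesis
      unfolding F0_def if_P[OF True] using H.product_integral(2)[OF integral_spl(1) ki] by (simp only: integral_spl(2))
  qed (simp add: F0_def)
  ultimately show ?thesis
    unfolding kF by (auto split: if_splits)
qed

text \<open>The assumed equation makes the left-hand integrand of \<open>cut_identity\<close>
  bounded, so that both sides have limits; among the terms with derivatives of the cutoff only the
  diagonal \<open>T2\<close> survive.\<close>

lemma integration_by_parts:
  assumes eq: "\<And>y. y \<in> X \<Longrightarrow> (\<Sum>a\<in>UNIV. \<Sum>b\<in>UNIV. partial b (partial a (\<lambda>z. Kt Q z $ a $ b)) y) = - K0"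
  shows "(LINT y|lborel. indicator X y * contr y) = boundary_integral \<nu> c \<phi> - K0 * (LINT y|lborel. indicator X y * \<phi> y)"
proof -
  obtain M1 where M1: "\<And>y. y \<in> X \<Longrightarrow> \<bar>contr y\<bar> \<le> M1" using contr_bounded by blast
  obtain M where M: "\<And>y. y \<in> P \<Longrightarrow> \<bar>\<phi> y\<bar> \<le> M" using bounded_on_P[OF phi_cont(1)] by auto
  let ?F = "\<lambda>r. (LINT y:facet \<nu> c r|hyperplane_measure (\<nu> r) (c r). \<phi> y) / norm (\<nu> r)"
  have "(\<lambda>k. (LINT y|lborel. indicator X y * (cut (ek k) (\<lambda>_. 0) y * contr y)) + (\<Sum>r\<in>UNIV. 2 * ((1 / ek k) * (LINT y|lborel. T1 (ek k) r y)))
      + (\<Sum>r\<in>UNIV. \<Sum>s\<in>UNIV. (1 / ek k) * (LINT y|lborel. T2 (ek k) r s y)))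
    \<longlonglongrightarrow> (LINT y|lborel. indicator X y * contr y) + (\<Sum>r\<in>(UNIV::'r set). 2 * 0) + (\<Sum>r\<in>UNIV. \<Sum>s\<in>UNIV. if r = s then - ?F r else 0)"
    by (intro tendsto_add tendsto_sum tendsto_mult_left T1_limit T2_limit cut_limit[OF contr_cont M1])
  moreover have "(\<Sum>r\<in>UNIV. \<Sum>s\<in>UNIV. if r = s then - ?F r else 0) = - boundary_integral \<nu> c \<phi>"
    by (simp add: boundary_integral_def sum_negf)
  ultimately have 1: "(\<lambda>k. (LINT y|lborel. indicator X y * (cut (ek k) (\<lambda>_. 0) y * (\<phi> y * (\<Sum>a\<in>UNIV. \<Sum>b\<in>UNIV. partial b (partial a (\<lambda>z. Kt Q z $ a $ b)) y)))))
    \<longlonglongrightarrow> (LINT y|lborel. indicator X y * contr y) - boundary_integral \<nu> c \<phi>"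
    unfolding cut_identity[OF ek(1)] by simp
  have e: "indicator X y * (cut (ek k) (\<lambda>_. 0) y * (\<phi> y * (\<Sum>a\<in>UNIV. \<Sum>b\<in>UNIV. partial b (partial a (\<lambda>z. Kt Q z $ a $ b)) y)))
    = indicator X y * (cut (ek k) (\<lambda>_. 0) y * (- K0 * \<phi> y))" for k y
    by (cases "y \<in> X") (simp_all add: eq)
  have "(\<lambda>k. (LINT y|lborel. indicator X y * (cut (ek k) (\<lambda>_. 0) y * (- K0 * \<phi> y)))) \<longlonglongrightarrow> (LINT y|lborel. indicator X y * (- K0 * \<phi> y))"
  proof (rule cut_limit[where M="\<bar>K0\<bar> * M"])
    show "continuous_on X (\<lambda>y. - K0 * \<phi> y)" by (intro continuous_intros continuous_on_subset[OF phi_cont(1) X_subset])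
    show "\<bar>- K0 * \<phi> y\<bar> \<le> \<bar>K0\<bar> * M" if "y \<in> X" for y
      using M[of y] that X_subset by (auto simp: abs_mult intro!: mult_left_mono)
  qed
  from LIMSEQ_unique[OF this 1[unfolded e]]
  have "(LINT y|lborel. - K0 * (indicator X y * \<phi> y)) = (LINT y|lborel. indicator X y * contr y) - boundary_integral \<nu> c \<phi>"
    by (simp only: mult_ac)
  then show ?thesis by simp
qed

end

subsection \<open>The moment map equation\<close>

context ibp
begin

abbreviation KK :: "real^'n \<Rightarrow> real" where
  "KK y \<equiv> (\<Sum>a\<in>UNIV. \<Sum>b\<in>UNIV. partial b (partial a (\<lambda>z. Kt Q z $ a $ b)) y)"

lemma KK_continuous: "continuous_on X KK"
proof -
  have "continuous_on X (partial b (partial a (\<lambda>z. Kt Q z $ a $ b)))" for a b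
    using Kt_Ck[of a b] by (simp add: numeral_2_eq_2)
  then show ?thesis by (intro continuous_intros)
qed

lemma partial2_bounded_linear:
  fixes h :: "real^'n \<Rightarrow> complex" and F :: "complex \<Rightarrow> real"
  assumes F: "bounded_linear F" and h: "Ck_on 2 X h" and y: "y \<in> X"
  shows "partial b (partial a (\<lambda>z. F (h z))) y = F (partial b (partial a h) y)"
proof -
  have d: "h differentiable (at z)" "partial a h differentiable (at z)" if "z \<in> X" for z
    using h that by (auto simp: numeral_2_eq_2)
  have "partial b (partial a (\<lambda>z. F (h z))) y = partial b (\<lambda>z. F (partial a h z)) y"
    by (rule partial_cong_open[of X]) (use y partial_bounded_linear[OF F d(1)] in auto)
  also have "\<dots> = F (partial b (partial a h) y)"
    by (rule partial_bounded_linear[OF F d(2)[OF y]])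
  finally show ?thesis .
qed

lemma moment_map_iff:
  assumes u: "\<And>y. y \<in> X \<Longrightarrow> hessian u y = G0 y + Q y"
  shows "moment_map_equation \<nu> c \<xi> u \<longleftrightarrow> (\<forall>y\<in>X. KK y = - C_const \<nu> c)"
proof -
  define h where "h a b z = Hm (G0 z + Q z) (\<xi> z) $ a $ b" for a b z
  have hC: "Ck_on 2 X (h a b)" for a b
    unfolding h_def using xi_smooth admd_good[OF Q(1)]
    by (intro Ck_on_nth Ck_on_Hm Ck_on_add G0_Ck Q_Ck) (auto simp: smooth_on_def)
  have IC: "Ck_on 2 X (\<lambda>z. Im (h a b z))" for a b
    by (rule Ck_on_bounded_linear[OF bounded_linear_Im _ hC]) simp
  have key: "(\<Sum>a\<in>UNIV. \<Sum>b\<in>UNIV. partial b (partial a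
           (\<lambda>z. (matrix_sqrt (mat 1 - higgs_mat \<xi> u z) ** complex_mat (matrix_inv (hessian u z))) $ a $ b)) y)
     = complex_of_real (KK y)" if y: "y \<in> X" for y
  proof -
    have 1: "partial b (partial a (\<lambda>z. (matrix_sqrt (mat 1 - higgs_mat \<xi> u z) ** complex_mat (matrix_inv (hessian u z))) $ a $ b)) y
      = partial b (partial a (h a b)) y" for a b
    proof (rule partial_cong_open[of X])
      fix z assume z: "z \<in> X"
      show "partial a (\<lambda>z. (matrix_sqrt (mat 1 - higgs_mat \<xi> u z) ** complex_mat (matrix_inv (hessian u z))) $ a $ b) z = partial a (h a b) z"
        by (rule partial_cong_open[of X]) (use z in \<open>auto simp: h_def Hm_def rt_def hm_def higgs_mat_def u\<close>)
    qed (use y in auto)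
    have re: "Re (partial b (partial a (h a b)) y) = partial b (partial a (\<lambda>z. Kt Q z $ a $ b)) y" for a b
      using partial2_bounded_linear[OF bounded_linear_Re hC y, of b a a b]
      by (simp add: Kt_def reM_def h_def)
    define I where "I a b = partial b (partial a (\<lambda>z. Im (h a b z))) y" for a b
    have im: "Im (partial b (partial a (h a b)) y) = I a b" for a b
      using partial2_bounded_linear[OF bounded_linear_Im hC y, of b a a b] by (simp add: I_def)
    have anti: "Im (h b a z) = - 1 * Im (h a b z)" if z: "z \<in> X" for a b z
    proof -
      obtain V \<sigma> where "hframe (G0 z + Q z) (\<xi> z) V \<sigma>"
        using good_hframe[OF admd_good[OF Q(1) z]] by blast
      then have "hconj (Hm (G0 z + Q z) (\<xi> z)) = Hm (G0 z + Q z) (\<xi> z)"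
        by (rule hframe.hconj_Hm)
      then have "hconj (Hm (G0 z + Q z) (\<xi> z)) $ b $ a = h b a z" by (simp only: h_def)
      moreover have "hconj M $ b $ a = cnj (M $ a $ b)" for M :: "complex^'n^'n"
        by (simp add: hconj_def transpose_def)
      ultimately have "h b a z = cnj (h a b z)" by (simp only: h_def)
      then show ?thesis by simp
    qed
    \<comment> \<open>Antisymmetry exchanges the matrix indices at the cost of a sign, and commuting
      the derivatives restores their order.\<close>
    have flip: "I b a = - I a b" for a b
    proof -
      have "partial b (\<lambda>z. Im (h b a z)) z = partial b (\<lambda>z. - 1 * Im (h a b z)) z" if z: "z \<in> X" for z
        by (rule partial_cong_open[OF open_interior z anti])
      then have "I b a = partial a (partial b (\<lambda>z. - 1 * Im (h a b z))) y"
        unfolding I_def by (rule partial_cong_open[OF open_interior y])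
      also have "\<dots> = partial b (partial a (\<lambda>z. - 1 * Im (h a b z))) y"
        by (rule partial_commute[OF open_interior y]) (intro Ck_on_mult Ck_on_const IC; simp)
      also have "\<dots> = - I a b"
        using partial2_bounded_linear[OF bounded_linear_compose[OF bounded_linear_mult_right[of "- 1"] bounded_linear_Im] hC y, of b a a b]
        by (simp add: comp_def im)
      finally show ?thesis .
    qed
    have "(\<Sum>a\<in>UNIV. \<Sum>b\<in>UNIV. I a b) = (\<Sum>a\<in>UNIV. \<Sum>b\<in>UNIV. I b a)"
      by (rule sum.swap)
    also have "\<dots> = - (\<Sum>a\<in>UNIV. \<Sum>b\<in>UNIV. I a b)"
      by (subst flip) (simp add: sum_negf)
    finally have "(\<Sum>a\<in>UNIV. \<Sum>b\<in>UNIV. I a b) = 0" by simp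
    then show ?thesis
      unfolding 1 by (simp add: complex_eq_iff re im)
  qed
  show ?thesis
    unfolding moment_map_equation_def P_def[symmetric] by (simp add: key del: of_real_sum flip: of_real_minus)
qed

text \<open>The fundamental lemma of the calculus of variations. A bump supported where
  \<open>K0 + KK\<close> keeps its sign sees no boundary, so compactly supported integration by
  parts moves all derivatives to \<open>Kt\<close>.\<close>

lemma weak_solution:
  assumes weak: "\<And>f U'. open U' \<Longrightarrow> P \<subseteq> U' \<Longrightarrow> smooth_on U' f \<Longrightarrow>
     boundary_integral \<nu> c f - K0 * (LINT y|lborel. indicator X y * f y) - (LINT y|lborel. indicator X y * ibp.contr \<nu> c \<xi> Q f y) = 0"
    and y0: "y0 \<in> X"
  shows "KK y0 = - K0"
proof (rule ccontr)
  define w where "w y = K0 + KK y" for y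
  assume "KK y0 \<noteq> - K0"
  then have w0: "w y0 \<noteq> 0" by (simp add: w_def)
  have wc: "continuous_on X w" unfolding w_def[abs_def] by (intro continuous_intros KK_continuous)
  have "continuous (at y0) (\<lambda>y. w y * w y0)"
    using continuous_on_interior[OF wc] y0 by (intro continuous_intros) simp
  then have "((\<lambda>y. w y * w y0) \<longlongrightarrow> w y0 * w y0) (nhds y0)"
    using tendsto_at_iff_tendsto_nhds[of "\<lambda>y. w y * w y0" y0] by (simp add: isCont_def)
  then have "\<forall>\<^sub>F y in nhds y0. w y * w y0 > 0"
    by (rule order_tendstoD) (use w0 in \<open>simp add: zero_less_mult_iff linorder_neq_iff disj_commute\<close>)
  moreover have "\<forall>\<^sub>F y in nhds y0. y \<in> X" using y0 by (intro eventually_nhds_in_open) auto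
  ultimately have "\<forall>\<^sub>F y in nhds y0. y \<in> X \<and> w y * w y0 > 0" by eventually_elim auto
  then obtain d where d: "d > 0" "\<And>y. dist y y0 < d \<Longrightarrow> y \<in> X \<and> w y * w y0 > 0"
    unfolding eventually_nhds_metric by blast
  define e where "e = d / 2"
  have e: "e > 0" "e < d" using d by (auto simp: e_def)
  obtain f :: "real^'n \<Rightarrow> real" where f: "smooth_on UNIV f" "\<And>y. 0 \<le> f y" "f y0 > 0" "\<And>y. dist y y0 \<ge> e \<Longrightarrow> f y = 0"
    using smooth_bump[OF e(1)] by blast
  define S where "S = cball y0 e"
  have S: "compact S" "S \<subseteq> X" "\<And>y. y \<notin> S \<Longrightarrow> f y = 0"
    using d(2) e f(4) by (auto simp: S_def dist_commute)
  have fX: "f y = 0" if "y \<notin> X" for y using S(2,3) that by blast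
  have fC: "Ck_on k A f" for k A using f(1) by (auto simp: smooth_on_def intro: Ck_on_subset)
  interpret I: ibp \<nu> c \<xi> Q UNIV f by unfold_locales (use Q Q_Ck fC in auto)
  have "(LINT y:facet \<nu> c r|hyperplane_measure (\<nu> r) (c r). f y) = 0" for r
  proof -
    have "y \<notin> X" if "y \<in> facet \<nu> c r" for y
      using that interior_iff[of y] by (auto simp: facet_def) (metis less_irrefl)
    then have "(\<lambda>y. indicator (facet \<nu> c r) y *\<^sub>R f y) = (\<lambda>_. 0)" using fX by (auto simp: indicator_def)
    then show ?thesis by (simp only: set_lebesgue_integral_def) simp
  qed
  then have b0: "boundary_integral \<nu> c f = 0" by (simp add: boundary_integral_def)
  have cS: "closed S" by (simp add: S_def)
  have "indicator X y * I.contr y = (\<Sum>a\<in>UNIV. \<Sum>b\<in>UNIV. Kt Q y $ a $ b * partial a (partial b f) y)" for y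
  proof (cases "y \<in> X")
    case False
    then have "y \<notin> S" using S by auto
    then have "partial a (partial b f) y = 0" for a b
      using partial_support[OF cS, of "partial b f" y a] partial_support[OF cS S(3)] by auto
    then show ?thesis using False by simp
  qed (simp add: I.contr_def)
  then have "(LINT y|lborel. indicator X y * I.contr y) = (LINT y|lborel. f y * KK y)"
    using integral_by_parts[OF open_interior S fC Kt_Ck] by simp
  moreover have "(LINT y|lborel. indicator X y * f y) = (LINT y|lborel. f y)"
    by (rule Bochner_Integration.integral_cong) (use fX in \<open>auto simp: indicator_def\<close>)
  ultimately have z: "K0 * (LINT y|lborel. f y) + (LINT y|lborel. f y * KK y) = 0"
    using weak[of UNIV f] f(1) b0 by simp
  have fc: "continuous_on A f" for A using Ck_on_continuous[OF fC[of 0]] .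
  have i1: "integrable lborel f" by (rule integrable_compact_support[OF S(1) fc S(3)])
  have i2: "integrable lborel (\<lambda>y. f y * KK y)"
    by (rule integrable_compact_support[OF S(1)])
      (use S(3) in \<open>auto intro!: continuous_on_mult fc continuous_on_subset[OF KK_continuous S(2)]\<close>)
  \<comment> \<open>The factor \<open>w y0\<close> makes the integrand nonnegative whichever sign
    \<open>w\<close> has near \<open>y0\<close>; its integral is zero, while it is positive on an
    open set containing \<open>y0\<close>.\<close>
  define v where "v y = (K0 * f y + f y * KK y) * w y0" for y
  have vi: "integrable lborel v" unfolding v_def using i1 i2 by simp
  have v0: "(LINT y|lborel. v y) = 0" unfolding v_def using i1 i2 z by simp
  have v_eq: "v y = f y * (w y * w y0)" for y by (simp add: v_def w_def algebra_simps)
  have vpos: "v y \<ge> 0" for y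
    using d(2)[of y] e f(2)[of y] f(4)[of y] by (cases "dist y y0 < d") (auto simp: v_eq)
  define N where "N = ball y0 e \<inter> f -` {0<..}"
  have "AE y in lborel. v y = 0"
    using integral_nonneg_eq_0_iff_AE[OF vi] vpos v0 by simp
  then have "AE y in lborel. y \<notin> N"
  proof (rule AE_mp, intro AE_I2 impI)
    fix y assume "v y = 0"
    then show "y \<notin> N" using d(2)[of y] e by (auto simp: N_def v_eq dist_commute)
  qed
  moreover have oN: "open N" unfolding N_def
    by (intro open_Int open_ball open_vimage) (use fc[of UNIV] in auto)
  ultimately have "N \<in> null_sets lborel" by (simp add: AE_iff_null_sets)
  then have "negligible N" by (simp add: negligible_iff_null_sets null_sets_completionI)
  moreover have "y0 \<in> N" using e f(3) by (simp add: N_def)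
  ultimately show False using open_not_negligible[OF oN] by blast
qed

end

subsection \<open>The energy along a linear path\<close>

context delz
begin

text \<open>The frontier of a convex set is null. The values of \<open>f\<close> on it are
  arbitrary, so measurability of \<open>f\<close> on \<open>P\<close> is obtained from the
  continuous representative on the interior.\<close>

lemma integral_P:
  fixes f g :: "real^'n \<Rightarrow> real"
  assumes fg: "\<And>y. y \<in> X \<Longrightarrow> f y = g y" and g: "continuous_on X g"
  shows "(LINT y:P|lebesgue. f y) = (LINT y|lborel. indicator X y * g y)"
proof -
  have m: "(\<lambda>y. indicator X y * g y) \<in> borel_measurable lborel" using X_indicator_measurable[OF g] by simp
  then have m': "(\<lambda>y. indicator X y * g y) \<in> borel_measurable lebesgue" by (rule measurable_completion)
  have "frontier P \<in> null_sets lebesgue"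
    using negligible_convex_frontier[OF convex_P] by (simp add: negligible_iff_null_sets)
  from AE_not_in[OF this] have ae: "AE y in lebesgue. indicator X y * g y = indicator P y *\<^sub>R f y"
  proof (rule AE_mp, intro AE_I2 impI)
    fix y assume "y \<notin> frontier P"
    then have "y \<in> X \<or> y \<notin> P" using closed_P by (auto simp: frontier_def)
    then show "indicator X y * g y = indicator P y *\<^sub>R f y"
      using fg X_subset by (auto simp: indicator_def)
  qed
  have "(LINT y:P|lebesgue. f y) = (LINT y|lebesgue. indicator X y * g y)"
    unfolding set_lebesgue_integral_def
    by (rule integral_cong_AE[OF borel_measurable_AE[OF m' ae] m']) (use ae in eventually_elim, simp)
  also have "\<dots> = (LINT y|lborel. indicator X y * g y)"
    by (rule integral_completion[OF m])
  finally show ?thesis .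
qed

lemma continuous_P_bounded: "continuous_on P (f :: real^'n \<Rightarrow> real) \<Longrightarrow> \<exists>M. \<forall>y\<in>P. \<bar>f y\<bar> \<le> M"
  using compact_imp_bounded[OF compact_continuous_image[OF _ compact_P], of f] unfolding bounded_iff by auto

lemma P_integrable: "continuous_on P f \<Longrightarrow> integrable lborel (\<lambda>y. indicator X y * f y :: real)"
  using continuous_P_bounded[of f] X_integrable[OF continuous_on_subset[OF _ X_subset], of f] X_subset by blast

lemma boundary_integral_linear:
  assumes f: "continuous_on P f" and g: "continuous_on P g"
  shows "boundary_integral \<nu> c (\<lambda>y. f y + t * g y) = boundary_integral \<nu> c f + t * boundary_integral \<nu> c g"
proof -
  obtain R where R: "\<And>y. y \<in> P \<Longrightarrow> norm y \<le> R" using bounded_P bounded_iff by blast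
  have "set_integrable (hyperplane_measure (\<nu> r) (c r)) (facet \<nu> c r) h" if h: "continuous_on P h" for h :: "real^'n \<Rightarrow> real" and r
  proof -
    interpret H: hyperplane "\<nu> r" "c r" by unfold_locales (rule nu_nonzero)
    obtain M where M: "\<And>y. y \<in> P \<Longrightarrow> \<bar>h y\<bar> \<le> M" using continuous_P_bounded[OF h] by blast
    have F: "facet \<nu> c r \<subseteq> P" by (auto simp: facet_def P_def)
    have "closed (facet \<nu> c r)"
      unfolding facet_def P_def[symmetric] using closed_P
      by (simp add: Collect_conj_eq) (intro closed_Int closed_Collect_eq L_continuous continuous_on_const; simp)
    then have "(\<lambda>y. indicator (facet \<nu> c r) y * h y) \<in> borel_measurable borel"
      using borel_measurable_continuous_on_indicator[of "facet \<nu> c r" h] continuous_on_subset[OF h F] by simp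
    from H.hyperplane_integrable(2)[OF this] show ?thesis using R M F by blast
  qed
  note i = this[OF f] this[OF g]
  have "(LINT y:facet \<nu> c r|hyperplane_measure (\<nu> r) (c r). f y + t * g y)
    = (LINT y:facet \<nu> c r|hyperplane_measure (\<nu> r) (c r). f y) + t * (LINT y:facet \<nu> c r|hyperplane_measure (\<nu> r) (c r). g y)" for r
    using set_integral_add(2)[OF i(1) set_integrable_mult_right[of t, OF i(2)]] by simp
  then show ?thesis
    by (simp add: boundary_integral_def add_divide_distrib sum.distrib sum_distrib_left)
qed

lemma guillemin_continuous: "continuous_on P (guillemin \<nu> c)"
proof -
  have "continuous_on P (\<lambda>y. L r y * ln (L r y))" for r
    by (rule continuous_on_compose2[OF continuous_on_x_ln_x L_continuous]) (auto simp: in_P)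
  then show ?thesis unfolding guillemin_def[abs_def] by (intro continuous_on_sum)
qed

end

context higgs
begin

lemma admd_cong: "(\<And>y. y \<in> P \<Longrightarrow> Q y = Q' y) \<Longrightarrow> admd Q \<longleftrightarrow> admd Q'"
  using X_subset by (auto simp: admd_def subset_iff)

text \<open>Through \<open>\<delta>\<close> the logarithm of the determinant splits into a function
  continuous on \<open>P\<close> and the logarithms of the \<open>L r\<close>, all integrable, while
  \<open>rho\<close> is bounded. Hence the two curvature integrals combine into one integral of
  \<open>phi\<close>.\<close>

lemma hk_energy_eq:
  assumes U: "open U" "P \<subseteq> U" "smooth_on U g" and u: "\<And>y. y \<in> P \<Longrightarrow> u y = guillemin \<nu> c y + g y"
    and adm: "u \<in> admissible \<nu> c \<xi>"
  shows "continuous_on P u"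
    and "integrable lborel (\<lambda>y. indicator X y * phi (G0 y + hessian g y) (\<xi> y))"
    and "hk_energy \<nu> c \<xi> u = boundary_integral \<nu> c u - C_const \<nu> c * (LINT y|lborel. indicator X y * u y)
      + (LINT y|lborel. indicator X y * phi (G0 y + hessian g y) (\<xi> y))"
proof -
  let ?G = "\<lambda>y. G0 y + hessian g y"
  have Q: "admd (hessian g)" using admissible_iff[OF U u] adm by blast
  have hes: "hessian u y = G0 y + hessian g y" if "y \<in> X" for y
    by (rule potential_hessian[OF U _ that]) (rule u)
  have "continuous_on P g" using Ck_on_continuous[OF smooth_on_imp_Ck[OF U(3)]] U(2) continuous_on_subset by blast
  then have "continuous_on P (\<lambda>y. guillemin \<nu> c y + g y)" by (intro continuous_intros guillemin_continuous)
  then show uc: "continuous_on P u" using u by (subst continuous_on_cong[OF refl, of _ _ "\<lambda>y. guillemin \<nu> c y + g y"]) auto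
  have Gc: "continuous_on X ?G"
    using G0_continuous smooth_hessian_P(1)[OF U] X_subset by (intro continuous_intros) (auto intro: continuous_on_subset)
  have phic: "continuous_on X (\<lambda>y. phi (?G y) (\<xi> y))"
    by (rule continuous_on_phi[OF open_interior Gc]) (use admd_good[OF Q] Ck_on_continuous[OF smooth_on_imp_Ck[OF xi_smooth]] in auto)
  have detp: "det (?G y) > 0" if "y \<in> X" for y
    using Q that det_posdef by (auto simp: admd_def)
  have lnc: "continuous_on X (\<lambda>y. ln (det (?G y)))"
    using detp by (intro continuous_on_ln continuous_on_det Gc) (auto simp: less_imp_neq[symmetric])
  obtain \<delta> where \<delta>: "continuous_on P \<delta>" "\<And>y. y \<in> P \<Longrightarrow> \<delta> y > 0"
      "\<And>y. y \<in> X \<Longrightarrow> det (hessian u y) = inverse (\<delta> y * (\<Prod>r\<in>UNIV. L r y))"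
    using adm unfolding admissible_def symplectic_potential_def Let_def P_def[symmetric] by auto
  have lnd: "indicator X y * ln (det (?G y)) = - (indicator X y * ln (\<delta> y)) - (\<Sum>r\<in>UNIV. indicator X y * ln (L r y))" for y
  proof (cases "y \<in> X")
    case True
    then have Lp: "L r y > 0" for r by (simp add: interior_iff)
    have dp: "\<delta> y > 0" using True X_subset \<delta>(2) by blast
    have ln_inv: "ln (inverse (a * b)) = - (ln a + ln b)" if "a > 0" "b > 0" for a b :: real
      using that by (simp add: ln_inverse ln_mult del: inverse_mult_distrib)
    have "ln (det (?G y)) = - (ln (\<delta> y) + ln (\<Prod>r\<in>UNIV. L r y))"
      unfolding hes[OF True, symmetric] \<delta>(3)[OF True] by (rule ln_inv[OF dp prod_L_pos[OF True]])
    also have "ln (\<Prod>r\<in>UNIV. L r y) = (\<Sum>r\<in>UNIV. ln (L r y))"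
      by (intro ln_prod) (auto simp: less_imp_neq[OF Lp, symmetric])
    finally show ?thesis using True by simp
  qed simp
  obtain R where R: "\<And>y. y \<in> P \<Longrightarrow> norm y \<le> R" using bounded_P bounded_iff by blast
  have iL: "integrable lborel (\<lambda>y. indicator X y * ln (L r y))" for r
  proof -
    interpret H: hyperplane "\<nu> r" "c r" by unfold_locales (rule nu_nonzero)
    show ?thesis unfolding ell_def
      by (rule H.integrable_ln_ell[where R=R]) (use R X_subset interior_iff in \<open>auto simp: ell_def\<close>)
  qed
  have id: "integrable lborel (\<lambda>y. indicator X y * ln (\<delta> y))"
    using \<delta>(1,2) by (intro P_integrable continuous_on_ln) (auto simp: less_imp_neq[symmetric])
  have lni: "integrable lborel (\<lambda>y. indicator X y * ln (det (?G y)))"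
    unfolding lnd
    by (intro Bochner_Integration.integrable_diff Bochner_Integration.integrable_minus Bochner_Integration.integrable_sum iL id)
  have rhoc: "continuous_on X (\<lambda>y. rho (hm (?G y) (\<xi> y)))"
    unfolding rho_eq_phi by (intro continuous_intros phic lnc)
  have rhoi: "integrable lborel (\<lambda>y. indicator X y * rho (hm (?G y) (\<xi> y)))"
  proof (rule X_integrable[OF rhoc])
    fix y assume "y \<in> X"
    then obtain V \<sigma> where "hframe (?G y) (\<xi> y) V \<sigma>"
      using good_hframe[OF admd_good[OF Q]] by blast
    then show "\<bar>rho (hm (?G y) (\<xi> y))\<bar> \<le> 2 * real CARD('n)" by (rule hframe.rho_bound)
  qed
  have ph: "indicator X y * phi (?G y) (\<xi> y) = - (indicator X y * ln (det (?G y))) + indicator X y * rho (hm (?G y) (\<xi> y))" for y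
    by (simp add: rho_eq_phi algebra_simps)
  show "integrable lborel (\<lambda>y. indicator X y * phi (?G y) (\<xi> y))"
    unfolding ph using lni rhoi by simp
  have "(LINT y:P|lebesgue. C_const \<nu> c * u y) = (LINT y|lborel. indicator X y * (C_const \<nu> c * u y))"
    by (rule integral_P[OF refl]) (intro continuous_intros continuous_on_subset[OF uc X_subset])
  also have "\<dots> = (LINT y|lborel. C_const \<nu> c * (indicator X y * u y))" by (simp only: mult_ac)
  finally have 1: "(LINT y:P|lebesgue. C_const \<nu> c * u y) = C_const \<nu> c * (LINT y|lborel. indicator X y * u y)" by simp
  have 2: "(LINT y:P|lebesgue. ln (det (hessian u y))) = (LINT y|lborel. indicator X y * ln (det (?G y)))"
    by (rule integral_P[OF _ lnc]) (simp add: hes)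
  have 3: "(LINT y:P|lebesgue. rho (higgs_mat \<xi> u y)) = (LINT y|lborel. indicator X y * rho (hm (?G y) (\<xi> y)))"
    by (rule integral_P[OF _ rhoc]) (simp add: hes higgs_mat_def hm_def)
  show "hk_energy \<nu> c \<xi> u = boundary_integral \<nu> c u - C_const \<nu> c * (LINT y|lborel. indicator X y * u y)
      + (LINT y|lborel. indicator X y * phi (?G y) (\<xi> y))"
    unfolding hk_energy_def P_def[symmetric] 1 2 3 ph using lni rhoi by simp
qed

end

text \<open>The smooth extensions \<open>g\<close> and \<open>g'\<close> share the neighbourhood
  \<open>U\<close>; \<open>u\<close> and \<open>\<phi>\<close> are tied to them on \<open>P\<close>
  only.\<close>

locale linear_path = higgs \<nu> c \<xi> for \<nu> :: "'r::finite \<Rightarrow> real^'n" and c \<xi> +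
  fixes U and g g' u \<phi> :: "real^'n \<Rightarrow> real"
  assumes U: "open U" "P \<subseteq> U" and g: "smooth_on U g" "smooth_on U g'"
    and u: "\<And>y. y \<in> P \<Longrightarrow> u y = guillemin \<nu> c y + g y" and \<phi>: "\<And>y. y \<in> P \<Longrightarrow> \<phi> y = g' y"
begin

abbreviation "Q \<equiv> hessian g"
abbreviation "Q' \<equiv> hessian g'"
abbreviation "ut t \<equiv> (\<lambda>y. u y + t * \<phi> y)"

definition h :: "real \<Rightarrow> real^'n \<Rightarrow> real" where
  "h t y = phi (G0 y + Q y + t *\<^sub>R Q' y) (\<xi> y)"

lemma path_smooth: "smooth_on U (\<lambda>y. g y + t * g' y)"
  by (intro smooth_on_add smooth_on_cmult U g)

lemma path_eq: "y \<in> P \<Longrightarrow> ut t y = guillemin \<nu> c y + (g y + t * g' y)"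
  by (simp add: u \<phi>)

lemma path_hessian: "y \<in> P \<Longrightarrow> hessian (\<lambda>y. g y + t * g' y) y = Q y + t *\<^sub>R Q' y"
  using hessian_add[OF U(1), of y g "\<lambda>y. t * g' y"] hessian_cmult[OF U(1) _ g(2), of y t]
    smooth_differentiable[OF g(1)] smooth_differentiable[OF smooth_on_cmult[OF U(1) g(2)]] U(2) by auto

lemma path_admissible: "ut t \<in> admissible \<nu> c \<xi> \<longleftrightarrow> admd (\<lambda>y. Q y + t *\<^sub>R Q' y)"
  using admissible_iff[OF U path_smooth[of t] path_eq[of _ t]] admd_cong[of "hessian (\<lambda>y. g y + t * g' y)", OF path_hessian]
  by blast

lemma phi_continuous: "continuous_on P \<phi>"
proof -
  have "continuous_on P g'" using Ck_on_continuous[OF smooth_on_imp_Ck[OF g(2)]] U(2) continuous_on_subset by blast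
  then show ?thesis using \<phi> by (subst continuous_on_cong[OF refl, of _ _ g']) auto
qed

lemma path_good:
  assumes "ut t \<in> admissible \<nu> c \<xi>" "y \<in> X"
  shows "good (G0 y + Q y + t *\<^sub>R Q' y) (\<xi> y)"
  using admd_good[OF path_admissible[THEN iffD1, OF assms(1)] assms(2)] by (simp add: add.assoc)

lemma path_energy:
  assumes 0: "u \<in> admissible \<nu> c \<xi>" and adm: "ut t \<in> admissible \<nu> c \<xi>"
  shows "integrable lborel (\<lambda>y. indicator X y * h t y)"
    and "hk_energy \<nu> c \<xi> (ut t) = (boundary_integral \<nu> c u - C_const \<nu> c * (LINT y|lborel. indicator X y * u y))
      + t * (boundary_integral \<nu> c \<phi> - C_const \<nu> c * (LINT y|lborel. indicator X y * \<phi> y))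
      + (LINT y|lborel. indicator X y * h t y)"
proof -
  have e: "indicator X y * phi (G0 y + hessian (\<lambda>y. g y + t * g' y) y) (\<xi> y) = indicator X y * h t y" for y
    using path_hessian[of y t] X_subset by (cases "y \<in> X") (auto simp: h_def add.assoc)
  note E = hk_energy_eq[OF U path_smooth[of t] _ adm, unfolded e]
  show "integrable lborel (\<lambda>y. indicator X y * h t y)" by (rule E(2)) (rule path_eq)
  have E3: "hk_energy \<nu> c \<xi> (ut t) = boundary_integral \<nu> c (ut t) - C_const \<nu> c * (LINT y|lborel. indicator X y * ut t y)
      + (LINT y|lborel. indicator X y * h t y)"
    by (rule E(3)) (rule path_eq)
  have uc: "continuous_on P u" by (rule hk_energy_eq(1)[OF U g(1) _ 0]) (rule u)
  have "(LINT y|lborel. indicator X y * (u y + t * \<phi> y)) = (LINT y|lborel. indicator X y * u y + t * (indicator X y * \<phi> y))"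
    by (simp add: algebra_simps)
  also have "\<dots> = (LINT y|lborel. indicator X y * u y) + t * (LINT y|lborel. indicator X y * \<phi> y)"
    using P_integrable[OF uc] P_integrable[OF phi_continuous] by simp
  finally show "hk_energy \<nu> c \<xi> (ut t) = (boundary_integral \<nu> c u - C_const \<nu> c * (LINT y|lborel. indicator X y * u y))
      + t * (boundary_integral \<nu> c \<phi> - C_const \<nu> c * (LINT y|lborel. indicator X y * \<phi> y))
      + (LINT y|lborel. indicator X y * h t y)"
    unfolding E3 boundary_integral_linear[OF uc phi_continuous] by (simp add: algebra_simps)
qed

text \<open>The boundary and linear terms are affine along the path, so convexity is inherited from
  the pointwise convexity of \<open>phi\<close> under the integral.\<close>

lemma path_convex:
  assumes adm: "\<And>t. t \<in> {0..1} \<Longrightarrow> ut t \<in> admissible \<nu> c \<xi>"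
  shows "convex_on {0..1} (\<lambda>t. hk_energy \<nu> c \<xi> (ut t))"
proof (rule convex_onI)
  have 0: "u \<in> admissible \<nu> c \<xi>" using adm[of 0] by simp
  note E = path_energy[OF 0 adm]
  fix s x y :: real assume s: "0 < s" "s < 1" and xy: "x \<in> {0..1}" "y \<in> {0..1}"
  define t where "t = (1 - s) *\<^sub>R x + s *\<^sub>R y"
  have t: "t \<in> {0..1}"
    using convexD[OF convex_real_interval(5)[of 0 1] xy, of "1 - s" s] s by (simp add: t_def)
  have "(LINT z|lborel. indicator X z * h t z) \<le> (LINT z|lborel. (1 - s) * (indicator X z * h x z) + s * (indicator X z * h y z))"
  proof (rule integral_mono)
    fix z
    show "indicator X z * h t z \<le> (1 - s) * (indicator X z * h x z) + s * (indicator X z * h y z)"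
    proof (cases "z \<in> X")
      case True
      have "convex_on {0..1} (\<lambda>t. phi (G0 z + Q z + t *\<^sub>R Q' z) (\<xi> z))"
        by (rule phi_convex) (rule path_good[OF adm True])
      from convex_onD[OF this, of s x y] s xy True show ?thesis
        by (simp add: h_def t_def)
    qed simp
  qed (use E(1) t xy in auto)
  also have "\<dots> = (1 - s) * (LINT z|lborel. indicator X z * h x z) + s * (LINT z|lborel. indicator X z * h y z)"
    using E(1) xy by simp
  finally show "hk_energy \<nu> c \<xi> (ut ((1 - s) *\<^sub>R x + s *\<^sub>R y)) \<le> (1 - s) * hk_energy \<nu> c \<xi> (ut x) + s * hk_energy \<nu> c \<xi> (ut y)"
    unfolding t_def[symmetric] E(2)[OF t] E(2)[OF xy(1)] E(2)[OF xy(2)]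
    by (simp add: t_def algebra_simps)
qed (rule convex_real_interval)

lemma path_eventually:
  assumes "u \<in> admissible \<nu> c \<xi>"
  obtains e where "e > 0" "\<And>t. \<bar>t\<bar> < e \<Longrightarrow> ut t \<in> admissible \<nu> c \<xi>"
proof -
  have "admd Q" using admissible_iff[OF U g(1) u] assms by blast
  from admd_perturb[OF this smooth_hessian_P[OF U g(1)] smooth_hessian_P[OF U g(2)]]
  show ?thesis using that path_admissible by blast
qed

lemma path_ibp: "u \<in> admissible \<nu> c \<xi> \<Longrightarrow> ibp \<nu> c \<xi> Q U g'"
  using admissible_iff[OF U g(1) u] smooth_hessian_P(1)[OF U g(1)] U Ck_on_subset[OF smooth_hessian[OF U(1) g(1)], of X 2] X_subset smooth_on_imp_Ck[OF g(2), of 2]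
  by unfold_locales auto

text \<open>Differentiation under the integral without any estimate of \<open>phi\<close> near the
  boundary: convexity bounds the increments from above by those at \<open>e\<close> and
  \<open>- e\<close>, the tangent inequality bounds them from below, and both bounds are
  integrable.\<close>

lemma path_derivative:
  assumes adm: "u \<in> admissible \<nu> c \<xi>"
  shows "((\<lambda>t. hk_energy \<nu> c \<xi> (ut t)) has_real_derivative
    boundary_integral \<nu> c \<phi> - C_const \<nu> c * (LINT y|lborel. indicator X y * \<phi> y)
      - (LINT y|lborel. indicator X y * ibp.contr \<nu> c \<xi> Q g' y)) (at 0)"
proof -
  interpret I: ibp \<nu> c \<xi> Q U g' by (rule path_ibp[OF adm])
  obtain e' where e': "e' > 0" "\<And>t. \<bar>t\<bar> < e' \<Longrightarrow> ut t \<in> admissible \<nu> c \<xi>"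
    using path_eventually[OF adm] by blast
  define e where "e = e' / 2"
  have e: "e > 0" "\<And>t. t \<in> {-e..e} \<Longrightarrow> ut t \<in> admissible \<nu> c \<xi>" using e' by (auto simp: e_def)
  note E = path_energy[OF adm e(2)]
  note good = path_good[OF e(2)]
  have tr: "Re (trace (Hm (G0 y + Q y) (\<xi> y) ** complex_mat (Q' y))) = I.contr y" for y
    by (simp add: trace_def matrix_matrix_mult_def I.contr_def Kt_def reM_def hessian_def)
  have der: "((\<lambda>t. h t y) has_real_derivative - I.contr y) (at 0 within {-e..e})" if "y \<in> X" for y
    using phi_has_derivative[of "{-e..e}" "G0 y + Q y" "Q' y" "\<xi> y" 0] good[OF _ that] e(1) by (simp add: h_def tr)
  have lower: "h t y \<ge> h 0 y - t * I.contr y" if "t \<in> {-e..e}" "y \<in> X" for t y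
    using phi_tangent[of "-e" e "G0 y + Q y" "Q' y" "\<xi> y" 0 t] good[OF _ that(2)] e(1) that(1) by (simp add: h_def tr)
  define W where "W y = indicator X y * \<bar>I.contr y\<bar> + indicator X y * \<bar>h e y - h 0 y\<bar> / e + indicator X y * \<bar>h (- e) y - h 0 y\<bar> / e" for y
  have quot: "\<bar>(h t y - h 0 y) / t\<bar> \<le> \<bar>I.contr y\<bar> + \<bar>h e y - h 0 y\<bar> / e + \<bar>h (- e) y - h 0 y\<bar> / e"
    if t: "t \<in> {-e..e}" "t \<noteq> 0" and y: "y \<in> X" for t y
  proof -
    have cv: "convex_on {-e..e} (\<lambda>t. h t y)"
      unfolding h_def by (rule phi_convex) (rule good[OF _ y])
    \<comment> \<open>The point \<open>\<tau> * e\<close> is a convex combination of 0 and the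
      endpoint on its own side, with weight the modulus of \<open>\<tau>\<close> on the
      endpoint.\<close>
    have up: "(h (\<tau> * e) y - h 0 y) \<le> \<bar>\<tau>\<bar> * \<bar>h (sgn \<tau> * e) y - h 0 y\<bar>" if \<tau>: "\<bar>\<tau>\<bar> \<le> 1" "\<tau> \<noteq> 0" for \<tau>
    proof -
      have "sgn \<tau> * e \<in> {-e..e}" "0 \<in> {-e..e}" using e(1) by (auto simp: sgn_if)
      note mem = this
      have eq: "(1 - \<bar>\<tau>\<bar>) *\<^sub>R 0 + \<bar>\<tau>\<bar> *\<^sub>R (sgn \<tau> * e) = \<tau> * e" by (simp add: sgn_if abs_if)
      define k where "k = h (sgn \<tau> * e) y"
      have "h (\<tau> * e) y \<le> (1 - \<bar>\<tau>\<bar>) * h 0 y + \<bar>\<tau>\<bar> * k"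
        using convex_onD[OF cv _ _ mem(2,1), of "\<bar>\<tau>\<bar>"] \<tau>(1) unfolding eq k_def by simp
      then have "h (\<tau> * e) y - h 0 y \<le> \<bar>\<tau>\<bar> * (k - h 0 y)" by (simp add: algebra_simps)
      then have "h (\<tau> * e) y - h 0 y \<le> \<bar>\<tau>\<bar> * (h (sgn \<tau> * e) y - h 0 y)" by (simp add: k_def)
      also have "\<dots> \<le> \<bar>\<tau>\<bar> * \<bar>h (sgn \<tau> * e) y - h 0 y\<bar>" by (intro mult_left_mono) auto
      finally show ?thesis .
    qed
    have "h t y - h 0 y \<le> \<bar>t\<bar> / e * \<bar>h (sgn t * e) y - h 0 y\<bar>"
      using up[of "t / e"] t e(1) by (simp add: abs_divide sgn_divide divide_le_eq abs_le_iff)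
    moreover have "\<bar>h (sgn t * e) y - h 0 y\<bar> \<le> \<bar>h e y - h 0 y\<bar> + \<bar>h (- e) y - h 0 y\<bar>"
      using t(2) by (auto simp: sgn_if)
    then have "\<bar>t\<bar> / e * \<bar>h (sgn t * e) y - h 0 y\<bar> \<le> \<bar>t\<bar> / e * (\<bar>h e y - h 0 y\<bar> + \<bar>h (- e) y - h 0 y\<bar>)"
      using e(1) by (intro mult_left_mono) auto
    moreover have "- (\<bar>t\<bar> * \<bar>I.contr y\<bar>) \<le> h t y - h 0 y"
      using lower[OF t(1) y] abs_ge_self[of "t * I.contr y"] by (simp add: abs_mult)
    moreover define A B where "A = \<bar>t\<bar> * \<bar>I.contr y\<bar>" and "B = \<bar>t\<bar> / e * (\<bar>h e y - h 0 y\<bar> + \<bar>h (- e) y - h 0 y\<bar>)"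
    moreover have "A \<ge> 0" "B \<ge> 0" using e(1) by (simp_all add: A_def B_def)
    ultimately have "\<bar>h t y - h 0 y\<bar> \<le> A + B" by linarith
    also have "\<dots> = \<bar>t\<bar> * (\<bar>I.contr y\<bar> + \<bar>h e y - h 0 y\<bar> / e + \<bar>h (- e) y - h 0 y\<bar> / e)"
      by (simp add: A_def B_def algebra_simps add_divide_distrib)
    finally show ?thesis using t(2) by (simp add: abs_divide divide_le_eq mult_ac)
  qed
  obtain M1 where M1: "\<And>y. y \<in> X \<Longrightarrow> \<bar>I.contr y\<bar> \<le> M1" using I.contr_bounded by blast
  have ci: "integrable lborel (\<lambda>y. indicator X y * I.contr y)"
    by (rule X_integrable[OF I.contr_cont M1])
  have hi: "integrable lborel (\<lambda>y. indicator X y * h t y)" if "t \<in> {-e..e}" for t by (rule E(1)[OF that])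
  have mem: "0 \<in> {-e..e}" "e \<in> {-e..e}" "- e \<in> {-e..e}" using e(1) by auto
  have ia: "integrable lborel (\<lambda>y. indicator X y * \<bar>f y\<bar>)" if "integrable lborel (\<lambda>y. indicator X y * f y)" for f :: "real^'n \<Rightarrow> real"
  proof -
    have "(\<lambda>y. indicator X y * \<bar>f y\<bar>) = (\<lambda>y. \<bar>indicator X y * f y\<bar>)" by (simp add: abs_mult fun_eq_iff)
    then show ?thesis using that by simp
  qed
  have di: "integrable lborel (\<lambda>y. indicator X y * (h t y - h 0 y))" if "t \<in> {-e..e}" for t
    using Bochner_Integration.integrable_diff[OF hi[OF that] hi[OF mem(1)]] by (simp add: algebra_simps)
  have Wi: "integrable lborel W"
    unfolding W_def[abs_def] by (intro Bochner_Integration.integrable_add integrable_divide_zero ia ci di mem; simp)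
  have lim: "((\<lambda>t. (LINT y|lborel. indicator X y * ((h t y - h 0 y) / t))) \<longlongrightarrow> (LINT y|lborel. indicator X y * - I.contr y)) (at 0 within {-e..e})"
    unfolding tendsto_at_iff_sequentially comp_def
  proof (intro allI impI)
    fix s :: "nat \<Rightarrow> real" assume s: "\<forall>i. s i \<in> {-e..e} - {0}" "s \<longlonglongrightarrow> 0"
    have sd: "s i \<in> {-e..e}" "s i \<noteq> 0" for i using s(1) by auto
    have qi: "integrable lborel (\<lambda>y. indicator X y * ((h (s i) y - h 0 y) / s i))" for i
      using integrable_divide_zero[of "s i", OF di[OF sd(1)[of i]]] by simp
    show "(\<lambda>i. LINT y|lborel. indicator X y * ((h (s i) y - h 0 y) / s i)) \<longlonglongrightarrow> (LINT y|lborel. indicator X y * - I.contr y)"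
    proof (rule integral_dominated_convergence[OF _ _ Wi])
      show "(\<lambda>y. indicator X y * - I.contr y) \<in> borel_measurable lborel"
        using borel_measurable_integrable[OF ci] by simp
      show "(\<lambda>y. indicator X y * ((h (s i) y - h 0 y) / s i)) \<in> borel_measurable lborel" for i
        using qi by (rule borel_measurable_integrable)
      show "AE y in lborel. (\<lambda>i. indicator X y * ((h (s i) y - h 0 y) / s i)) \<longlonglongrightarrow> indicator X y * - I.contr y"
      proof (rule AE_I2)
        fix y
        show "(\<lambda>i. indicator X y * ((h (s i) y - h 0 y) / s i)) \<longlonglongrightarrow> indicator X y * - I.contr y"
        proof (cases "y \<in> X")
          case True
          have "((\<lambda>t. (h t y - h 0 y) / (t - 0)) \<longlongrightarrow> - I.contr y) (at 0 within {-e..e})"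
            using der[OF True] unfolding has_field_derivative_iff .
          then have "(\<lambda>i. (h (s i) y - h 0 y) / s i) \<longlonglongrightarrow> - I.contr y"
            unfolding tendsto_at_iff_sequentially comp_def using s by simp
          then show ?thesis using True by simp
        qed simp
      qed
      show "AE y in lborel. norm (indicator X y * ((h (s i) y - h 0 y) / s i)) \<le> W y" for i
      proof (rule AE_I2)
        fix y show "norm (indicator X y * ((h (s i) y - h 0 y) / s i)) \<le> W y"
          using quot[OF sd(1)[of i] sd(2)[of i], of y] by (cases "y \<in> X") (simp_all add: W_def)
      qed
    qed
  qed
  have at0: "at 0 within {-e..e} = at (0::real)"
    using e(1) by (intro at_within_interior) (simp add: interior_atLeastAtMost_real)
  let ?\<beta> = "boundary_integral \<nu> c \<phi> - C_const \<nu> c * (LINT y|lborel. indicator X y * \<phi> y)"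
  have "\<forall>\<^sub>F t in at 0 within {-e..e}. ?\<beta> + (LINT y|lborel. indicator X y * ((h t y - h 0 y) / t))
    = (hk_energy \<nu> c \<xi> (ut t) - hk_energy \<nu> c \<xi> (ut 0)) / (t - 0)"
    unfolding eventually_at_filter
  proof (intro always_eventually allI impI)
    fix t assume t: "t \<noteq> 0" "t \<in> {-e..e}"
    have "(LINT y|lborel. indicator X y * ((h t y - h 0 y) / t)) = (LINT y|lborel. (indicator X y * h t y - indicator X y * h 0 y) / t)"
      by (simp add: algebra_simps diff_divide_distrib)
    also have "\<dots> = ((LINT y|lborel. indicator X y * h t y) - (LINT y|lborel. indicator X y * h 0 y)) / t"
      using hi[OF t(2)] hi[OF mem(1)] by simp
    finally show "?\<beta> + (LINT y|lborel. indicator X y * ((h t y - h 0 y) / t))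
      = (hk_energy \<nu> c \<xi> (ut t) - hk_energy \<nu> c \<xi> (ut 0)) / (t - 0)"
      unfolding E(2)[OF t(2)] E(2)[OF mem(1)] using t(1) by (simp add: field_simps)
  qed
  then have "((\<lambda>t. (hk_energy \<nu> c \<xi> (ut t) - hk_energy \<nu> c \<xi> (ut 0)) / (t - 0)) \<longlongrightarrow> ?\<beta> + (LINT y|lborel. indicator X y * - I.contr y)) (at 0 within {-e..e})"
    by (rule Lim_transform_eventually[OF tendsto_add[OF tendsto_const lim]])
  then show ?thesis
    unfolding at0 has_field_derivative_iff by (simp only: mult_minus_right integral_minus add_uminus_conv_diff)
qed

end

section \<open>The Euler-Lagrange equation\<close>

context higgs
begin

lemma extends_path:
  assumes u: "u \<in> admissible \<nu> c \<xi>" and \<phi>: "extends_smoothly P P \<phi>"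
  obtains U g g' where "linear_path \<nu> c \<xi> U g g' u \<phi>"
proof -
  obtain U g where g: "open U" "P \<subseteq> U" "smooth_on U g" "\<And>y. y \<in> P \<Longrightarrow> u y = guillemin \<nu> c y + g y"
    using admissible_potential[OF u] by metis
  obtain U' g' where g': "open U'" "P \<subseteq> U'" "smooth_on U' g'" "\<And>y. y \<in> P \<Longrightarrow> \<phi> y = g' y"
    using \<phi> unfolding extends_smoothly_def by metis
  have "linear_path \<nu> c \<xi> (U \<inter> U') g g' u \<phi>"
    by unfold_locales (use g g' smooth_on_subset[OF g(3)] smooth_on_subset[OF g'(3)] in auto)
  then show ?thesis by (rule that)
qed

text \<open>\<open>path_derivative\<close> expresses the derivative through the weak form of the
  equation. A solution makes it vanish by integration by parts over \<open>P\<close>; conversely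
  vanishing for all smooth test functions gives the equation at each interior point. A variation may
  be replaced by its smooth extension, since only its values on \<open>P\<close> enter.\<close>

lemma first_variation:
  assumes u: "u \<in> admissible \<nu> c \<xi>"
  shows "moment_map_equation \<nu> c \<xi> u \<longleftrightarrow> (\<forall>\<phi>. extends_smoothly P P \<phi> \<longrightarrow>
    ((\<lambda>t. hk_energy \<nu> c \<xi> (\<lambda>y. u y + t * \<phi> y)) has_real_derivative 0) (at 0))"
proof -
  obtain U g where g: "open U" "P \<subseteq> U" "smooth_on U g" "\<And>y. y \<in> P \<Longrightarrow> u y = guillemin \<nu> c y + g y"
    using admissible_potential[OF u] by metis
  have path: "linear_path \<nu> c \<xi> (U \<inter> U') g f u \<phi>" if "open U'" "P \<subseteq> U'" "smooth_on U' f" "\<And>y. y \<in> P \<Longrightarrow> \<phi> y = f y" for U' f \<phi>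
    by unfold_locales (use g that smooth_on_subset[OF g(3)] smooth_on_subset[OF that(3)] in auto)
  have "linear_path \<nu> c \<xi> U g g u g" by unfold_locales (use g in auto)
  from linear_path.path_ibp[OF this u] interpret I: ibp \<nu> c \<xi> "hessian g" U g .
  have hes: "hessian u y = G0 y + hessian g y" if "y \<in> X" for y
    using potential_hessian[OF g that] .
  have mm: "moment_map_equation \<nu> c \<xi> u \<longleftrightarrow> (\<forall>y\<in>X. I.KK y = - C_const \<nu> c)"
    by (rule I.moment_map_iff) (rule hes)
  have XP: "(LINT y|lborel. indicator X y * f y) = (LINT y|lborel. indicator X y * k y)" if "\<And>y. y \<in> P \<Longrightarrow> f y = (k y::real)" for f k
    by (rule Bochner_Integration.integral_cong) (use that X_subset in \<open>auto simp: indicator_def\<close>)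
  have bP: "boundary_integral \<nu> c f = boundary_integral \<nu> c k" if "\<And>y. y \<in> P \<Longrightarrow> f y = k y" for f k
  proof -
    have "(\<lambda>y. indicator (facet \<nu> c r) y *\<^sub>R f y) = (\<lambda>y. indicator (facet \<nu> c r) y *\<^sub>R k y)" for r
      using that by (auto simp: indicator_def facet_def P_def)
    then show ?thesis unfolding boundary_integral_def set_lebesgue_integral_def by (simp only:)
  qed
  show ?thesis
  proof (intro iffI allI impI)
    fix \<phi> :: "real^'n \<Rightarrow> real" assume eq: "moment_map_equation \<nu> c \<xi> u" and "extends_smoothly P P \<phi>"
    then obtain U' f where f: "open U'" "P \<subseteq> U'" "smooth_on U' f" "\<And>y. y \<in> P \<Longrightarrow> \<phi> y = f y"
      unfolding extends_smoothly_def by metis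
    note lp = path[OF f]
    interpret J: ibp \<nu> c \<xi> "hessian g" "U \<inter> U'" f by (rule linear_path.path_ibp[OF lp u])
    have "(LINT y|lborel. indicator X y * J.contr y) = boundary_integral \<nu> c f - C_const \<nu> c * (LINT y|lborel. indicator X y * f y)"
      by (rule J.integration_by_parts) (use eq mm in blast)
    then show "((\<lambda>t. hk_energy \<nu> c \<xi> (\<lambda>y. u y + t * \<phi> y)) has_real_derivative 0) (at 0)"
      using linear_path.path_derivative[OF lp u] XP[of \<phi> f] bP[of \<phi> f] f(4) by simp
  next
    assume weak: "\<forall>\<phi>. extends_smoothly P P \<phi> \<longrightarrow> ((\<lambda>t. hk_energy \<nu> c \<xi> (\<lambda>y. u y + t * \<phi> y)) has_real_derivative 0) (at 0)"
    show "moment_map_equation \<nu> c \<xi> u"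
      unfolding mm
    proof
      fix y assume y: "y \<in> X"
      show "I.KK y = - C_const \<nu> c"
      proof (rule I.weak_solution[OF _ y])
        fix f :: "real^'n \<Rightarrow> real" and U' assume f: "open U'" "P \<subseteq> U'" "smooth_on U' f"
        have "extends_smoothly P P f" unfolding extends_smoothly_def using f by blast
        with weak have "((\<lambda>t. hk_energy \<nu> c \<xi> (\<lambda>y. u y + t * f y)) has_real_derivative 0) (at 0)" by blast
        from DERIV_unique[OF linear_path.path_derivative[OF path[OF f refl] u] this]
        show "boundary_integral \<nu> c f - C_const \<nu> c * (LINT y|lborel. indicator X y * f y) - (LINT y|lborel. indicator X y * ibp.contr \<nu> c \<xi> (hessian g) f y) = 0" .
      qed
    qed
  qed
qed

end

theorem theorem1p15:
  fixes \<nu> :: "'r::finite \<Rightarrow> real^'n" and c :: "'r \<Rightarrow> real"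
    and \<xi> :: "real^'n \<Rightarrow> complex^'n^'n"
  assumes "delzant \<nu> c" and "higgs_tensor \<nu> c \<xi>"
  shows "(\<forall>u \<in> admissible \<nu> c \<xi>.
            (\<forall>\<phi>. extends_smoothly (poly_set \<nu> c) (poly_set \<nu> c) \<phi> \<longrightarrow>
               (\<forall>\<^sub>F t in at 0. (\<lambda>y. u y + t * \<phi> y) \<in> admissible \<nu> c \<xi>) \<and>
               (\<lambda>t::real. hk_energy \<nu> c \<xi> (\<lambda>y. u y + t * \<phi> y)) differentiable (at 0)) \<and>
            (moment_map_equation \<nu> c \<xi> u \<longleftrightarrow>
               (\<forall>\<phi>. extends_smoothly (poly_set \<nu> c) (poly_set \<nu> c) \<phi> \<longrightarrow>
                  ((\<lambda>t. hk_energy \<nu> c \<xi> (\<lambda>y. u y + t * \<phi> y)) has_real_derivative 0) (at 0))))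
       \<and> (\<forall>u\<^sub>0 u\<^sub>1.
            (\<forall>t\<in>{0..1}. (\<lambda>y. (1 - t) * u\<^sub>0 y + t * u\<^sub>1 y) \<in> admissible \<nu> c \<xi>) \<longrightarrow>
            convex_on {0..1} (\<lambda>t. hk_energy \<nu> c \<xi> (\<lambda>y. (1 - t) * u\<^sub>0 y + t * u\<^sub>1 y)))"
proof -
  interpret higgs \<nu> c \<xi> by unfold_locales (use assms in auto)
  show ?thesis
    unfolding P_def[symmetric]
  proof (intro conjI ballI allI impI)
    fix u \<phi> :: "real^'n \<Rightarrow> real" assume u: "u \<in> admissible \<nu> c \<xi>" and \<phi>: "extends_smoothly P P \<phi>"
    obtain U g g' where lp: "linear_path \<nu> c \<xi> U g g' u \<phi>" using extends_path[OF u \<phi>] .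
    obtain e where e: "e > 0" "\<And>t. \<bar>t\<bar> < e \<Longrightarrow> (\<lambda>y. u y + t * \<phi> y) \<in> admissible \<nu> c \<xi>"
      using linear_path.path_eventually[OF lp u] by blast
    show "\<forall>\<^sub>F t in at 0. (\<lambda>y. u y + t * \<phi> y) \<in> admissible \<nu> c \<xi>"
      unfolding eventually_at using e by (intro exI[of _ e]) auto
    show "(\<lambda>t::real. hk_energy \<nu> c \<xi> (\<lambda>y. u y + t * \<phi> y)) differentiable (at 0)"
      using linear_path.path_derivative[OF lp u] by (auto simp: real_differentiable_def)
  next
    fix u assume "u \<in> admissible \<nu> c \<xi>"
    then show "moment_map_equation \<nu> c \<xi> u \<longleftrightarrow> (\<forall>\<phi>. extends_smoothly P P \<phi> \<longrightarrow>
        ((\<lambda>t. hk_energy \<nu> c \<xi> (\<lambda>y. u y + t * \<phi> y)) has_real_derivative 0) (at 0))"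
      by (rule first_variation)
  next
    fix u0 u1 assume adm: "\<forall>t\<in>{0..1}. (\<lambda>y. (1 - t) * u0 y + t * u1 y) \<in> admissible \<nu> c \<xi>"
    have eq: "(\<lambda>y. (1 - t) * u0 y + t * u1 y) = (\<lambda>y. u0 y + t * (u1 y - u0 y))" for t :: real
      by (simp add: algebra_simps)
    have u0: "u0 \<in> admissible \<nu> c \<xi>" and u1: "u1 \<in> admissible \<nu> c \<xi>"
      using adm[THEN bspec, of 0] adm[THEN bspec, of 1] by simp_all
    obtain U g where g: "open U" "P \<subseteq> U" "smooth_on U g" "\<And>y. y \<in> P \<Longrightarrow> u0 y = guillemin \<nu> c y + g y"
      using admissible_potential[OF u0] by metis
    obtain U' g' where g': "open U'" "P \<subseteq> U'" "smooth_on U' g'" "\<And>y. y \<in> P \<Longrightarrow> u1 y = guillemin \<nu> c y + g' y"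
      using admissible_potential[OF u1] by metis
    \<comment> \<open>The Guillemin parts of the endpoints cancel in \<open>u1 - u0\<close>, leaving
      a difference that is smooth up to the boundary; the path thus fits
      \<open>linear_path\<close>.\<close>
    have "smooth_on (U \<inter> U') (\<lambda>y. g' y + (- 1) * g y)"
      by (intro smooth_on_add smooth_on_cmult smooth_on_subset[OF g(3)] smooth_on_subset[OF g'(3)]) (use g g' in auto)
    then have "linear_path \<nu> c \<xi> (U \<inter> U') g (\<lambda>y. g' y + (- 1) * g y) u0 (\<lambda>y. u1 y - u0 y)"
      by unfold_locales (use g g' smooth_on_subset[OF g(3)] in auto)
    from linear_path.path_convex[OF this] show "convex_on {0..1} (\<lambda>t. hk_energy \<nu> c \<xi> (\<lambda>y. (1 - t) * u0 y + t * u1 y))"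
      using adm unfolding eq by blast
  qed
qed

end
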